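(* Let $E$ be a complex Banach space and let $T\in N_k(E)$ be a current of bidimension $(p,q)$ ($p+q=k$) with $\overline\partial T=0$, such that $\mathrm{supp}\,T$ is bounded and at positive distance from $0$. Then there exists a quasi-local metric current $U$ of bidimension $(p,q+1)$ such that $\overline\partial U=T$.
   Context: Metric currents (Ambrosio–Kirchheim) on $E$: with $\mathscr E^k(E)=\mathrm{Lip}_b(E)\times[\mathrm{Lip}(E)]^k$ (complex-valued), a $k$-dimensional metric current is a multilinear $T:\mathscr E^k(E)\to\mathbb C$, continuous under pointwise convergence with uniformly bounded Lipschitz constants, local ($T(f,\pi)=0$ if some $\pi_j$ is constant near $\mathrm{supp} f$), of finite mass (finite Radon $\mu$ with $|T(f,\pi)|\le\prod_j\mathrm{Lip}(\pi_j)\int|f|d\mu$). Boundary $dT(f,\pi)=T(1,f,\pi)$; $N_k(E)$: currents with boundary of finite mass. Quasi-local currents: $\mathscr E_{\mathrm{q\text{-}loc}}(E)$ = Lipschitz functions with bounded support; $\mathrm{Lip}_{\mathrm{q\text{-}loc}}(E)$ = continuous functions Lipschitz on every ball $B(0,R)$; $\mathscr E^k_{\mathrm{q\text{-}loc}}(E)=\mathscr E_{\mathrm{q\text{-}loc}}(E)\times[\mathrm{Lip}_{\mathrm{q\text{-}loc}}(E)]^k$, with convergence meaning pointwise convergence, first entries supported in a common ball with uniformly bounded Lipschitz constants, other entries with uniformly bounded Lipschitz constants on each fixed ball. A quasi-local $k$-dimensional metric current is a multilinear $T:\mathscr E^k_{\mathrm{q\text{-}loc}}(E)\to\mathbb C$,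 continuous for this convergence, local, and such that for each $R>0$ there is a finite Radon $\mu_R$ with $|T(f,\pi)|\le\prod_j\mathrm{Lip}(\pi_j|_{B(0,R)})\int_{B(0,R)}|f|d\mu_R$ whenever $\mathrm{supp} f\subset B(0,R)$; boundary $dT(f,\pi)=T(\sigma,f,\pi)$ with $\sigma\in\mathscr E_{\mathrm{q\text{-}loc}}(E)$, $\sigma=1$ near $\mathrm{supp} f$. Bidimension $(p,q)$, $p+q=k$: vanishing on $(f,\pi)$ whenever $p+1$ of the $\pi_j$, or $q+1$ of the $\overline{\pi_j}$, are holomorphic on an open set containing $\mathrm{supp} f$. For $T$ of bidimension $(p,q)$ whose boundary admits a (unique) decomposition into currents of fixed bidimension, that decomposition is $(dT)_{p,q-1}+(dT)_{p-1,q}$; $\overline\partial T:=(dT)_{p,q-1}$, $\partial T:=(dT)_{p-1,q}$; "$\overline\partial T=0$" means this is defined and vanishes. *)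

theory Defs
  imports "HOL-Analysis.Analysis"
begin

class complex_vector = real_vector +
  fixes scaleC :: "complex \<Rightarrow> 'a \<Rightarrow> 'a"
  assumes scaleC_add_right: "scaleC a (x + y) = scaleC a x + scaleC a y"
    and scaleC_add_left: "scaleC (a + b) x = scaleC a x + scaleC b x"
    and scaleC_scaleC: "scaleC a (scaleC b x) = scaleC (a * b) x"
    and scaleC_one: "scaleC 1 x = x"
    and scaleR_scaleC: "scaleR r x = scaleC (complex_of_real r) x"

class complex_normed_vector = complex_vector + real_normed_vector +
  assumes norm_scaleC: "norm (scaleC a x) = cmod a * norm x"

class complex_banach = complex_normed_vector + complete_space

definition fsupp :: "('a::topological_space \<Rightarrow> complex) \<Rightarrow> 'a set" where
  "fsupp f = closure {x. f x \<noteq> 0}"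

definition lipc :: "'a::metric_space set \<Rightarrow> ('a \<Rightarrow> complex) \<Rightarrow> real" where
  "lipc U f = Inf {C. C-lipschitz_on U f}"

definition is_lip :: "('a::metric_space \<Rightarrow> complex) \<Rightarrow> bool" where
  "is_lip f \<longleftrightarrow> (\<exists>C. C-lipschitz_on UNIV f)"

definition is_lipb :: "('a::metric_space \<Rightarrow> complex) \<Rightarrow> bool" where
  "is_lipb f \<longleftrightarrow> is_lip f \<and> bounded (range f)"

definition is_qtest :: "('a::real_normed_vector \<Rightarrow> complex) \<Rightarrow> bool" where
  "is_qtest f \<longleftrightarrow> is_lip f \<and> bounded (fsupp f)"

definition is_qlip :: "('a::real_normed_vector \<Rightarrow> complex) \<Rightarrow> bool" where
  "is_qlip f \<longleftrightarrow> continuous_on UNIV f \<and> (\<forall>R. \<exists>C. C-lipschitz_on (ball 0 R) f)"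

definition holo_on :: "'a::complex_normed_vector set \<Rightarrow> ('a \<Rightarrow> complex) \<Rightarrow> bool" where
  "holo_on V g \<longleftrightarrow> (\<forall>x\<in>V. \<exists>L. bounded_linear L \<and> (\<forall>c v. L (scaleC c v) = c * L v)
      \<and> (g has_derivative L) (at x))"

definition finite_radon :: "'a::metric_space measure \<Rightarrow> bool" where
  "finite_radon \<mu> \<longleftrightarrow> sets \<mu> = sets borel \<and> emeasure \<mu> (space \<mu>) < \<infinity> \<and>
     (\<forall>B\<in>sets borel. emeasure \<mu> B = (SUP K\<in>{K. compact K \<and> K \<subseteq> B}. emeasure \<mu> K))"

text \<open>A \<open>k\<close>-dimensional current is represented as a function \<open>T f \<pi>s\<close> where
  \<open>\<pi>s\<close> is the list \<open>[\<pi>\<^sub>1,...,\<pi>\<^sub>k]\<close>; only the values on the domain matter.\<close>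

definition mdom :: "nat \<Rightarrow> ('a::metric_space \<Rightarrow> complex) \<Rightarrow> ('a \<Rightarrow> complex) list \<Rightarrow> bool" where
  "mdom k f \<pi>s \<longleftrightarrow> is_lipb f \<and> length \<pi>s = k \<and> (\<forall>\<pi>\<in>set \<pi>s. is_lip \<pi>)"

definition qdom :: "nat \<Rightarrow> ('a::real_normed_vector \<Rightarrow> complex) \<Rightarrow> ('a \<Rightarrow> complex) list \<Rightarrow> bool" where
  "qdom k f \<pi>s \<longleftrightarrow> is_qtest f \<and> length \<pi>s = k \<and> (\<forall>\<pi>\<in>set \<pi>s. is_qlip \<pi>)"

definition multilinear_on ::
  "(('a \<Rightarrow> complex) \<Rightarrow> ('a \<Rightarrow> complex) list \<Rightarrow> bool) \<Rightarrow> nat \<Rightarrow>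
   (('a \<Rightarrow> complex) \<Rightarrow> ('a \<Rightarrow> complex) list \<Rightarrow> complex) \<Rightarrow> bool" where
  "multilinear_on D k T \<longleftrightarrow>
    (\<forall>f g \<pi>s a b. D f \<pi>s \<and> D g \<pi>s \<longrightarrow>
        T (\<lambda>x. a * f x + b * g x) \<pi>s = a * T f \<pi>s + b * T g \<pi>s) \<and>
    (\<forall>f \<pi>s j u v a b. j < k \<and> D f (\<pi>s[j := u]) \<and> D f (\<pi>s[j := v]) \<longrightarrow>
        T f (\<pi>s[j := (\<lambda>x. a * u x + b * v x)]) = a * T f (\<pi>s[j := u]) + b * T f (\<pi>s[j := v]))"

definition local_on ::
  "(('a::topological_space \<Rightarrow> complex) \<Rightarrow> ('a \<Rightarrow> complex) list \<Rightarrow> bool) \<Rightarrow> nat \<Rightarrow>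
   (('a \<Rightarrow> complex) \<Rightarrow> ('a \<Rightarrow> complex) list \<Rightarrow> complex) \<Rightarrow> bool" where
  "local_on D k T \<longleftrightarrow>
    (\<forall>f \<pi>s. D f \<pi>s \<and> (\<exists>j<k. \<exists>V c. open V \<and> fsupp f \<subseteq> V \<and> (\<forall>x\<in>V. (\<pi>s ! j) x = c))
        \<longrightarrow> T f \<pi>s = 0)"

definition mass_bound :: "nat \<Rightarrow> (('a::metric_space \<Rightarrow> complex) \<Rightarrow> ('a \<Rightarrow> complex) list \<Rightarrow> complex)
    \<Rightarrow> 'a measure \<Rightarrow> bool" where
  "mass_bound k T \<mu> \<longleftrightarrow> finite_radon \<mu> \<and>
     (\<forall>f \<pi>s. mdom k f \<pi>s \<longrightarrow>
        cmod (T f \<pi>s) \<le> prod_list (map (lipc UNIV) \<pi>s) * (\<integral>x. cmod (f x) \<partial>\<mu>))"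

definition mcurrent :: "nat \<Rightarrow> (('a::metric_space \<Rightarrow> complex) \<Rightarrow> ('a \<Rightarrow> complex) list \<Rightarrow> complex) \<Rightarrow> bool" where
  "mcurrent k T \<longleftrightarrow>
    multilinear_on (mdom k) k T \<and>
    (\<forall>F P f \<pi>s. (\<forall>n. mdom k (F n) (P n)) \<and> mdom k f \<pi>s \<and>
        (\<forall>x. (\<lambda>n. F n x) \<longlonglongrightarrow> f x) \<and> (\<forall>j<k. \<forall>x. (\<lambda>n. (P n ! j) x) \<longlonglongrightarrow> (\<pi>s ! j) x) \<and>
        (\<exists>C. \<forall>n. (\<forall>x. cmod (F n x) \<le> C) \<and> lipc UNIV (F n) \<le> C \<and> (\<forall>j<k. lipc UNIV (P n ! j) \<le> C))
      \<longrightarrow> (\<lambda>n. T (F n) (P n)) \<longlonglongrightarrow> T f \<pi>s) \<and>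
    local_on (mdom k) k T \<and>
    (\<exists>\<mu>. mass_bound k T \<mu>)"

definition mbdry :: "(('a \<Rightarrow> complex) \<Rightarrow> ('a \<Rightarrow> complex) list \<Rightarrow> complex) \<Rightarrow>
    ('a \<Rightarrow> complex) \<Rightarrow> ('a \<Rightarrow> complex) list \<Rightarrow> complex" where
  "mbdry T f \<pi>s = T (\<lambda>_. 1) (f # \<pi>s)"

text \<open>Normal currents \<open>N_k(E)\<close> (for \<open>k = 0\<close> the boundary is zero by convention).\<close>
definition normal_current :: "nat \<Rightarrow> (('a::metric_space \<Rightarrow> complex) \<Rightarrow> ('a \<Rightarrow> complex) list \<Rightarrow> complex) \<Rightarrow> bool" where
  "normal_current k T \<longleftrightarrow> mcurrent k T \<and> (k = 0 \<or> mcurrent (k - 1) (mbdry T))"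

text \<open>Support of a current = support of its mass measure \<open>\<parallel>T\<parallel>\<close> (the least admissible
  measure): \<open>x\<close> is in the support iff every ball around \<open>x\<close> has positive
  \<open>\<parallel>T\<parallel>\<close>-measure, i.e. positive measure for every admissible \<open>\<mu>\<close>.\<close>
definition current_supp :: "nat \<Rightarrow> (('a::metric_space \<Rightarrow> complex) \<Rightarrow> ('a \<Rightarrow> complex) list \<Rightarrow> complex) \<Rightarrow> 'a set" where
  "current_supp k T = {x. \<forall>r>0. \<forall>\<mu>. mass_bound k T \<mu> \<longrightarrow> emeasure \<mu> (ball x r) > 0}"

definition qcurrent :: "nat \<Rightarrow> (('a::real_normed_vector \<Rightarrow> complex) \<Rightarrow> ('a \<Rightarrow> complex) list \<Rightarrow> complex) \<Rightarrow> bool" where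
  "qcurrent k T \<longleftrightarrow>
    multilinear_on (qdom k) k T \<and>
    (\<forall>F P f \<pi>s. (\<forall>n. qdom k (F n) (P n)) \<and> qdom k f \<pi>s \<and>
        (\<forall>x. (\<lambda>n. F n x) \<longlonglongrightarrow> f x) \<and> (\<forall>j<k. \<forall>x. (\<lambda>n. (P n ! j) x) \<longlonglongrightarrow> (\<pi>s ! j) x) \<and>
        (\<exists>R C. \<forall>n. fsupp (F n) \<subseteq> ball 0 R \<and> lipc UNIV (F n) \<le> C) \<and>
        (\<forall>R. \<exists>C. \<forall>n. \<forall>j<k. lipc (ball 0 R) (P n ! j) \<le> C)
      \<longrightarrow> (\<lambda>n. T (F n) (P n)) \<longlonglongrightarrow> T f \<pi>s) \<and>
    local_on (qdom k) k T \<and>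
    (\<forall>R>0. \<exists>\<mu>. finite_radon \<mu> \<and>
       (\<forall>f \<pi>s. qdom k f \<pi>s \<and> fsupp f \<subseteq> ball 0 R \<longrightarrow>
          cmod (T f \<pi>s) \<le> prod_list (map (lipc (ball 0 R)) \<pi>s) *
             (\<integral>x. indicator (ball 0 R) x * cmod (f x) \<partial>\<mu>)))"

text \<open>Vanishing on \<open>(f,\<pi>)\<close> whenever \<open>p+1\<close> of the \<open>\<pi>\<^sub>j\<close>, or \<open>q+1\<close> of the \<open>conj \<pi>\<^sub>j\<close>,
  are holomorphic on an open set containing \<open>supp f\<close>.  Integer \<open>p, q\<close> are allowed,
  so that bidimension \<open>(-1,q)\<close> means the zero current.\<close>
definition bidim_on ::
  "(('a::complex_normed_vector \<Rightarrow> complex) \<Rightarrow> ('a \<Rightarrow> complex) list \<Rightarrow> bool) \<Rightarrow> nat \<Rightarrow> int \<Rightarrow> int \<Rightarrow>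
   (('a \<Rightarrow> complex) \<Rightarrow> ('a \<Rightarrow> complex) list \<Rightarrow> complex) \<Rightarrow> bool" where
  "bidim_on D k p q T \<longleftrightarrow>
    (\<forall>f \<pi>s. D f \<pi>s \<and>
       (\<exists>V. open V \<and> fsupp f \<subseteq> V \<and>
          ((\<exists>J\<subseteq>{..<k}. int (card J) = p + 1 \<and> (\<forall>j\<in>J. holo_on V (\<pi>s ! j))) \<or>
           (\<exists>J\<subseteq>{..<k}. int (card J) = q + 1 \<and> (\<forall>j\<in>J. holo_on V (\<lambda>x. cnj ((\<pi>s ! j) x))))))
     \<longrightarrow> T f \<pi>s = 0)"

abbreviation mbidim where "mbidim k \<equiv> bidim_on (mdom k) k"
abbreviation qbidim where "qbidim k \<equiv> bidim_on (qdom k) k"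

text \<open>\<open>\<partial>-bar T = S\<close> for a normal current \<open>T\<close> of bidimension \<open>(p,q)\<close>, \<open>k = p+q \<ge> 1\<close>:
  \<open>dT = S + B\<close> with \<open>S\<close> of bidimension \<open>(p,q-1)\<close>, \<open>B\<close> of bidimension \<open>(p-1,q)\<close>.\<close>
definition dbar_is :: "nat \<Rightarrow> nat \<Rightarrow> nat \<Rightarrow>
    (('a::complex_normed_vector \<Rightarrow> complex) \<Rightarrow> ('a \<Rightarrow> complex) list \<Rightarrow> complex) \<Rightarrow>
    (('a \<Rightarrow> complex) \<Rightarrow> ('a \<Rightarrow> complex) list \<Rightarrow> complex) \<Rightarrow> bool" where
  "dbar_is k p q T S \<longleftrightarrow> (\<exists>B. mcurrent (k - 1) S \<and> mcurrent (k - 1) B \<and>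
      mbidim (k - 1) (int p) (int q - 1) S \<and> mbidim (k - 1) (int p - 1) (int q) B \<and>
      (\<forall>f \<pi>s. mdom (k - 1) f \<pi>s \<longrightarrow> mbdry T f \<pi>s = S f \<pi>s + B f \<pi>s))"

text \<open>\<open>\<partial>-bar T = 0\<close> (for \<open>k = 0\<close>, \<open>dT = 0\<close> by convention, so this holds trivially).\<close>
definition dbar_zero :: "nat \<Rightarrow> nat \<Rightarrow> nat \<Rightarrow>
    (('a::complex_normed_vector \<Rightarrow> complex) \<Rightarrow> ('a \<Rightarrow> complex) list \<Rightarrow> complex) \<Rightarrow> bool" where
  "dbar_zero k p q T \<longleftrightarrow> k = 0 \<or> dbar_is k p q T (\<lambda>_ _. 0)"

text \<open>For a quasi-local \<open>U\<close> of dimension \<open>k+1\<close> and bidimension \<open>(p,q+1)\<close> and a metric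
  current \<open>T\<close> of dimension \<open>k\<close>: \<open>\<partial>-bar U = T\<close>, i.e. \<open>dU = S + B\<close> with \<open>S\<close>, \<open>B\<close>
  quasi-local of bidimensions \<open>(p,q)\<close>, \<open>(p-1,q+1)\<close>, where \<open>dU(f,\<pi>) = U(\<sigma>,f,\<pi>)\<close>
  for any quasi-local test function \<open>\<sigma>\<close> equal to 1 near \<open>supp f\<close>, and \<open>S\<close> coincides
  with \<open>T\<close> on their common domain (bounded-support Lipschitz \<open>f\<close>, Lipschitz \<open>\<pi>\<^sub>j\<close>).\<close>
definition qdbar_is :: "nat \<Rightarrow> nat \<Rightarrow> nat \<Rightarrow>
    (('a::complex_normed_vector \<Rightarrow> complex) \<Rightarrow> ('a \<Rightarrow> complex) list \<Rightarrow> complex) \<Rightarrow>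
    (('a \<Rightarrow> complex) \<Rightarrow> ('a \<Rightarrow> complex) list \<Rightarrow> complex) \<Rightarrow> bool" where
  "qdbar_is k p q U T \<longleftrightarrow> (\<exists>S B. qcurrent k S \<and> qcurrent k B \<and>
      qbidim k (int p) (int q) S \<and> qbidim k (int p - 1) (int q + 1) B \<and>
      (\<forall>\<sigma> f \<pi>s. qdom k f \<pi>s \<and> is_qtest \<sigma> \<and>
          (\<exists>V. open V \<and> fsupp f \<subseteq> V \<and> (\<forall>x\<in>V. \<sigma> x = 1)) \<longrightarrow>
          U \<sigma> (f # \<pi>s) = S f \<pi>s + B f \<pi>s) \<and>
      (\<forall>f \<pi>s. is_qtest f \<and> length \<pi>s = k \<and> (\<forall>\<pi>\<in>set \<pi>s. is_lip \<pi>) \<longrightarrow> S f \<pi>s = T f \<pi>s))"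

end

theory Submission
  imports Defs
begin

text \<open>Because \<open>T\<close> lives in a spherical shell, composing with a radial retraction extends it to functions that
  are only Lipschitz on bounded sets. Contract \<open>T\<close> with the antiholomorphic part of the Euler
  vector field and integrate the pullbacks under \<open>x \<mapsto> e\<^sup>\<zeta> x\<close> over the cylinder \<open>\<complex>/2\<pi>i\<int>\<close> against the Cauchy
  kernel \<open>1/(1 - e\<^sup>-\<^sup>\<zeta>)\<close>. This is a cone operator \<open>U\<close>: Cartan's formula and the Cauchy-Pompeiu formula on
  the cylinder give \<open>d(U T) + U(dT) = T\<close>. The kernel decays exponentially as \<open>Re \<zeta>\<close> tends to minus infinity, and for
  large \<open>Re \<zeta>\<close> the pullback of a function with bounded support vanishes on the shell, so \<open>U\<close> is quasi-local.
  The contraction fills one slot and only sees its antiholomorphic derivative, so \<open>U\<close> maps bidimension \<open>(p,q)\<close> to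
  \<open>(p,q+1)\<close>; as \<open>dT\<close> has bidimension \<open>(p-1,q)\<close>, the part of \<open>d(U T)\<close> of bidimension \<open>(p,q)\<close> is \<open>T\<close>.

  The contraction needs derivatives along the flow. Integration by parts, using that \<open>T\<close> is normal, bounds
  \<open>U T\<close> by the supremum norm of any single slot, so \<open>U T\<close> extends from functions that are differentiable along the
  flow to Lipschitz ones by averaging along the flow.\<close>

text \<open>The sup-norm bound rests on f dg = d(fg) - g df. The cone formula evaluates the exact
  term through T and the cone of dT, so g survives only in coefficients, and normality gives the
  cone of dT finite mass. The same construction applied to dT, whose boundary is zero, produces a
  current U(dT); its negative is the part of d(U T) of bidimension (p-1,q+1).

  Averaging moves points, and this decides its form. Radially it goes inward, so that balls are
  preserved and Lipschitz constants do not grow; the mass bound on a ball then survives the limit.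
  Locality and holomorphy on an open set are inherited only on a smaller one. The room is made by
  soft thresholding of the coefficient, since a superlevel set of a Lipschitz function keeps a
  definite distance from the complement of a lower one.

  The space may be nonseparable: the complement of a support need not be covered by countably many
  null balls, and the Borel algebra of a product may exceed the product algebra. Tightness of Radon
  measures leaves finite covers in the first case; in the second it is enough that the parameter
  plane has a countable base.\<close>

type_synonym 'a functional = "('a \<Rightarrow> complex) \<Rightarrow> ('a \<Rightarrow> complex) list \<Rightarrow> complex"

section \<open>Locally Lipschitz functions\<close>

abbreviation qlips :: "('a::real_normed_vector \<Rightarrow> complex) list \<Rightarrow> bool" where
  "qlips \<pi>s \<equiv> \<forall>\<pi>\<in>set \<pi>s. is_qlip \<pi>"

abbreviation lprod :: "real \<Rightarrow> ('a::real_normed_vector \<Rightarrow> complex) list \<Rightarrow> real" where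
  "lprod R \<pi>s \<equiv> prod_list (map (lipc (ball 0 R)) \<pi>s)"

abbreviation L1norm :: "'a measure \<Rightarrow> ('a \<Rightarrow> complex) \<Rightarrow> real" where
  "L1norm \<mu> f \<equiv> \<integral>x. cmod (f x) \<partial>\<mu>"

abbreviation flow :: "complex \<Rightarrow> real \<Rightarrow> 'a::complex_vector \<Rightarrow> 'a" where
  "flow a t x \<equiv> scaleC (exp (complex_of_real t * a)) x"

text \<open>For a fixed pair of points the Lipschitz inequality is a closed condition on the
  constant, so the infimum is itself admissible. The hypothesis keeps the infimum from being taken
  over the empty set.\<close>

lemma lipc_lipschitz:
  assumes "C-lipschitz_on U f"
  shows "(lipc U f)-lipschitz_on U f"
proof (rule lipschitz_onI)
  let ?S = "{C. C-lipschitz_on U f}"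
  have ne: "?S \<noteq> {}" using assms by auto
  show "0 \<le> lipc U f"
    unfolding lipc_def by (rule cInf_greatest[OF ne]) (auto dest: lipschitz_on_nonneg)
  fix x y assume xy: "x \<in> U" "y \<in> U"
  show "dist (f x) (f y) \<le> lipc U f * dist x y"
  proof (cases "x = y")
    case False
    then have d: "dist x y > 0" by simp
    have "dist (f x) (f y) / dist x y \<le> lipc U f"
      unfolding lipc_def
    proof (rule cInf_greatest[OF ne])
      fix C assume "C \<in> ?S"
      then show "dist (f x) (f y) / dist x y \<le> C"
        using lipschitz_onD[of C U f x y] xy d by (simp add: divide_le_eq)
    qed
    then show ?thesis using d by (simp add: divide_le_eq)
  qed simp
qed

lemma lipc_le: "C-lipschitz_on U f \<Longrightarrow> lipc U f \<le> C"
  unfolding lipc_def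
  by (rule cInf_lower) (auto intro: bdd_belowI[of _ 0] dest: lipschitz_on_nonneg)

lemma is_qlip_iff: "is_qlip f \<longleftrightarrow> (\<forall>R. \<exists>C. C-lipschitz_on (ball 0 R) f)"
proof
  assume L: "\<forall>R. \<exists>C. C-lipschitz_on (ball 0 R) f"
  have "isCont f x" for x
  proof -
    obtain C where "C-lipschitz_on (ball 0 (norm x + 1)) f" using L by blast
    then have "continuous_on (ball 0 (norm x + 1)) f" by (rule lipschitz_on_continuous_on)
    then show ?thesis by (rule continuous_on_interior) simp
  qed
  then have "continuous_on UNIV f" by (simp add: continuous_on_eq_continuous_at)
  then show "is_qlip f" using L by (simp add: is_qlip_def)
qed (simp add: is_qlip_def)

lemma is_qlipI: "(\<And>R. R > 0 \<Longrightarrow> \<exists>C. C-lipschitz_on (ball 0 R) f) \<Longrightarrow> is_qlip f"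
  unfolding is_qlip_iff
proof
  fix R assume *: "\<And>R. R > 0 \<Longrightarrow> \<exists>C. C-lipschitz_on (ball 0 R) f"
  show "\<exists>C. C-lipschitz_on (ball 0 R) f"
  proof (cases "R > 0")
    case False
    then have e: "ball (0::'a) R = {}" by simp
    show ?thesis unfolding e by (intro exI[of _ 0]) (simp add: lipschitz_on_def)
  qed (use * in auto)
qed

lemma is_qlip_lipc: "is_qlip f \<Longrightarrow> (lipc (ball 0 R) f)-lipschitz_on (ball 0 R) f"
  using lipc_lipschitz unfolding is_qlip_iff by blast

lemma lipc_nonneg: "is_qlip f \<Longrightarrow> 0 \<le> lipc (ball 0 R) f"
  using is_qlip_lipc lipschitz_on_nonneg by blast

lemma lipc_mono: "is_qlip f \<Longrightarrow> R \<le> R' \<Longrightarrow> lipc (ball 0 R) f \<le> lipc (ball 0 R') f"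
  by (rule lipc_le, rule lipschitz_on_subset[OF is_qlip_lipc]) auto

lemma is_qlip_continuous: "is_qlip f \<Longrightarrow> continuous_on UNIV f"
  by (simp add: is_qlip_def)

lemma lip_is_qlip: "C-lipschitz_on UNIV f \<Longrightarrow> is_qlip f"
  unfolding is_qlip_iff using lipschitz_on_subset by blast

lemma is_lip_qlip: "is_lip f \<Longrightarrow> is_qlip f"
  unfolding is_lip_def using lip_is_qlip by blast

lemma lipschitz_bounded_ball:
  fixes f :: "'a::real_normed_vector \<Rightarrow> complex"
  assumes "C-lipschitz_on (ball 0 R) f" "x \<in> ball 0 R"
  shows "cmod (f x) \<le> cmod (f 0) + C * R"
proof -
  have R: "R > 0" "norm x < R" using assms(2) by (auto intro: le_less_trans[OF norm_ge_zero])
  have "dist (f x) (f 0) \<le> C * dist x 0"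
    using lipschitz_onD[OF assms(1), of x 0] assms(2) R by simp
  also have "\<dots> \<le> C * R" using R lipschitz_on_nonneg[OF assms(1)] by (intro mult_left_mono) auto
  finally have "cmod (f x - f 0) \<le> C * R" by (simp add: dist_norm)
  then show ?thesis using norm_triangle_ineq2[of "f x" "f 0"] by linarith
qed

lemma is_qlip_bounded: 
  assumes "is_qlip f" obtains B where "B > 0" "\<And>x. x \<in> ball 0 R \<Longrightarrow> cmod (f x) \<le> B"
proof -
  have "cmod (f x) \<le> \<bar>cmod (f 0) + lipc (ball 0 R) f * R\<bar> + 1" if "x \<in> ball 0 R" for x
    using lipschitz_bounded_ball[OF is_qlip_lipc[OF assms] that] by linarith
  then show ?thesis by (intro that[of "\<bar>cmod (f 0) + lipc (ball 0 R) f * R\<bar> + 1"]) auto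
qed

lemma lipschitz_on_mult:
  fixes f g :: "'a::metric_space \<Rightarrow> complex"
  assumes "C-lipschitz_on U f" "D-lipschitz_on U g"
    and "\<And>x. x \<in> U \<Longrightarrow> cmod (f x) \<le> A" "\<And>x. x \<in> U \<Longrightarrow> cmod (g x) \<le> B" "0 \<le> A" "0 \<le> B"
  shows "(A * D + B * C)-lipschitz_on U (\<lambda>x. f x * g x)"
proof (rule lipschitz_onI)
  have CD: "0 \<le> C" "0 \<le> D" using assms lipschitz_on_nonneg by blast+
  then show "0 \<le> A * D + B * C" using assms by simp
  fix x y assume xy: "x \<in> U" "y \<in> U"
  have "f x * g x - f y * g y = f x * (g x - g y) + (f x - f y) * g y" by (simp add: algebra_simps)
  then have "cmod (f x * g x - f y * g y) \<le> cmod (f x) * cmod (g x - g y) + cmod (f x - f y) * cmod (g y)"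
    by (metis norm_mult norm_triangle_ineq)
  also have "\<dots> \<le> A * (D * dist x y) + (C * dist x y) * B"
    using lipschitz_onD[OF assms(1) xy] lipschitz_onD[OF assms(2) xy] assms(3)[OF xy(1)] assms(4)[OF xy(2)] assms CD
    by (intro add_mono mult_mono) (auto simp: dist_norm)
  finally show "dist (f x * g x) (f y * g y) \<le> (A * D + B * C) * dist x y"
    by (simp add: dist_norm algebra_simps)
qed

lemma lipschitz_on_cmul:
  fixes f :: "'a::metric_space \<Rightarrow> complex"
  assumes "C-lipschitz_on U f"
  shows "(cmod a * C)-lipschitz_on U (\<lambda>x. a * f x)"
proof (rule lipschitz_onI)
  show "0 \<le> cmod a * C" using lipschitz_on_nonneg[OF assms] by simp
  fix x y assume "x \<in> U" "y \<in> U"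
  from lipschitz_onD[OF assms this] show "dist (a * f x) (a * f y) \<le> cmod a * C * dist x y"
    by (simp add: dist_norm norm_mult mult.assoc mult_left_mono flip: right_diff_distrib)
qed

section \<open>Slotwise convergence with Lipschitz bounds uniform on balls\<close>

definition eqlip :: "(nat \<Rightarrow> 'a::real_normed_vector \<Rightarrow> complex) \<Rightarrow> bool" where
  "eqlip F \<longleftrightarrow> (\<forall>R. \<exists>C. \<forall>n. C-lipschitz_on (ball 0 R) (F n))"

text \<open>Convergence is formulated for a single entry, so that it passes separately through
  products, dilations and averages. It says nothing about supports, because a current carried by a
  shell is continuous for coefficients of any support; common supports are added where
  quasi-locality asks for them.\<close>

definition qconv :: "(nat \<Rightarrow> 'a::real_normed_vector \<Rightarrow> complex) \<Rightarrow> ('a \<Rightarrow> complex) \<Rightarrow> bool" where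
  "qconv F f \<longleftrightarrow> eqlip F \<and> (\<forall>x. (\<lambda>n. F n x) \<longlonglongrightarrow> f x)"

lemma eqlipI: "(\<And>R. R > 0 \<Longrightarrow> \<exists>C. \<forall>n. C-lipschitz_on (ball 0 R) (F n)) \<Longrightarrow> eqlip F"
  unfolding eqlip_def
proof
  fix R assume *: "\<And>R. R > 0 \<Longrightarrow> \<exists>C. \<forall>n. C-lipschitz_on (ball 0 R) (F n)"
  show "\<exists>C. \<forall>n. C-lipschitz_on (ball 0 R) (F n)"
  proof (cases "R > 0")
    case False
    then have e: "ball (0::'a) R = {}" by simp
    show ?thesis unfolding e by (intro exI[of _ 0]) (simp add: lipschitz_on_def)
  qed (use * in auto)
qed

lemma eqlip_qlip: "eqlip F \<Longrightarrow> is_qlip (F n)"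
  unfolding is_qlip_iff eqlip_def by blast

lemma qconv_qlip: "qconv F f \<Longrightarrow> is_qlip (F n)"
  unfolding qconv_def using eqlip_qlip by blast

lemma qconv_tendsto: "qconv F f \<Longrightarrow> (\<lambda>n. F n x) \<longlonglongrightarrow> f x"
  by (simp add: qconv_def)

lemma lipschitz_on_limit:
  assumes "\<And>n. C-lipschitz_on U (F n)" "\<And>x. (\<lambda>n. F n x) \<longlonglongrightarrow> f x"
  shows "C-lipschitz_on U f"
proof (rule lipschitz_onI)
  show "0 \<le> C" using assms(1) lipschitz_on_nonneg by blast
  fix x y assume xy: "x \<in> U" "y \<in> U"
  have "(\<lambda>n. dist (F n x) (F n y)) \<longlonglongrightarrow> dist (f x) (f y)"
    by (intro tendsto_dist assms)
  then show "dist (f x) (f y) \<le> C * dist x y"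
    by (rule LIMSEQ_le_const2) (use lipschitz_onD[OF assms(1) xy] in auto)
qed

lemma qconv_qlip_lim: "qconv F f \<Longrightarrow> is_qlip f"
  unfolding qconv_def eqlip_def is_qlip_iff using lipschitz_on_limit by metis

lemma qconv_const: "is_qlip f \<Longrightarrow> qconv (\<lambda>n. f) f"
  unfolding qconv_def eqlip_def is_qlip_iff by auto

lemma qconv_bounded:
  assumes "qconv F f"
  obtains B where "B > 0" "\<And>n x. x \<in> ball 0 R \<Longrightarrow> cmod (F n x) \<le> B"
proof -
  obtain C where C: "\<And>n. C-lipschitz_on (ball 0 R) (F n)"
    using assms unfolding qconv_def eqlip_def by blast
  have "convergent (\<lambda>n. F n 0)" using assms unfolding qconv_def convergent_def by blast
  then have "Bseq (\<lambda>n. F n 0)" by (rule convergent_imp_Bseq)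
  then obtain D where D: "\<And>n. cmod (F n 0) \<le> D" unfolding Bseq_def by blast
  have "cmod (F n x) \<le> \<bar>D + C * R\<bar> + 1" if "x \<in> ball 0 R" for n x
    using lipschitz_bounded_ball[OF C that, of n] D[of n] by linarith
  then show ?thesis by (intro that[of "\<bar>D + C * R\<bar> + 1"]) auto
qed

lemma qconv_mult:
  assumes "qconv F f" "qconv G g"
  shows "qconv (\<lambda>n x. F n x * G n x) (\<lambda>x. f x * g x)"
  unfolding qconv_def
proof (intro conjI allI)
  show "(\<lambda>n. F n x * G n x) \<longlonglongrightarrow> f x * g x" for x
    using assms by (intro tendsto_mult qconv_tendsto)
  show "eqlip (\<lambda>n x. F n x * G n x)"
  proof (rule eqlipI)
    fix R :: real
    obtain C where C: "\<And>n. C-lipschitz_on (ball 0 R) (F n)"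
      using assms unfolding qconv_def eqlip_def by blast
    obtain D where D: "\<And>n. D-lipschitz_on (ball 0 R) (G n)"
      using assms unfolding qconv_def eqlip_def by blast
    obtain A where A: "A > 0" "\<And>n x. x \<in> ball 0 R \<Longrightarrow> cmod (F n x) \<le> A"
      using qconv_bounded[OF assms(1)] by metis
    obtain B where B: "B > 0" "\<And>n x. x \<in> ball 0 R \<Longrightarrow> cmod (G n x) \<le> B"
      using qconv_bounded[OF assms(2)] by metis
    show "\<exists>C. \<forall>n. C-lipschitz_on (ball 0 R) (\<lambda>x. F n x * G n x)"
      using lipschitz_on_mult[OF C D A(2) B(2)] A B by (intro exI[of _ "A * D + B * C"]) auto
  qed
qed

lemma qconv_lincomb:
  assumes "qconv F f" "qconv G g"
  shows "qconv (\<lambda>n x. a * F n x + b * G n x) (\<lambda>x. a * f x + b * g x)"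
  unfolding qconv_def
proof (intro conjI allI)
  show "(\<lambda>n. a * F n x + b * G n x) \<longlonglongrightarrow> a * f x + b * g x" for x
    using assms by (intro tendsto_intros qconv_tendsto)
  show "eqlip (\<lambda>n x. a * F n x + b * G n x)"
    unfolding eqlip_def
  proof
    fix R
    obtain C where C: "\<And>n. C-lipschitz_on (ball 0 R) (F n)"
      using assms unfolding qconv_def eqlip_def by blast
    obtain D where D: "\<And>n. D-lipschitz_on (ball 0 R) (G n)"
      using assms unfolding qconv_def eqlip_def by blast
    have "(norm a * C + norm b * D)-lipschitz_on (ball 0 R) (\<lambda>x. a * F n x + b * G n x)" for n
      by (intro lipschitz_on_add lipschitz_on_cmul C D)
    then show "\<exists>C. \<forall>n. C-lipschitz_on (ball 0 R) (\<lambda>x. a * F n x + b * G n x)" by blast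
  qed
qed

lemma is_qlip_mult [simp, intro]: "is_qlip f \<Longrightarrow> is_qlip g \<Longrightarrow> is_qlip (\<lambda>x. f x * g x)"
  by (rule qconv_qlip[OF qconv_mult[OF qconv_const qconv_const]])

lemma is_qlip_lincomb: "is_qlip f \<Longrightarrow> is_qlip g \<Longrightarrow> is_qlip (\<lambda>x. a * f x + b * g x)"
  by (rule qconv_qlip[OF qconv_lincomb[OF qconv_const qconv_const]])

lemma is_qlip_const [simp, intro]: "is_qlip (\<lambda>x. c)"
  by (rule lip_is_qlip[of 0]) (simp add: lipschitz_on_def)

lemma is_qlip_add [simp, intro]: "is_qlip f \<Longrightarrow> is_qlip g \<Longrightarrow> is_qlip (\<lambda>x. f x + g x)"
  using is_qlip_lincomb[of f g 1 1] by simp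

lemma is_qlip_diff [simp, intro]: "is_qlip f \<Longrightarrow> is_qlip g \<Longrightarrow> is_qlip (\<lambda>x. f x - g x)"
  using is_qlip_lincomb[of f g 1 "-1"] by simp

lemma is_qlip_sum: "(\<And>i. i \<in> I \<Longrightarrow> is_qlip (f i)) \<Longrightarrow> is_qlip (\<lambda>x. \<Sum>i\<in>I. f i x)"
  by (induction I rule: infinite_finite_induct) auto

lemma is_qlip_comp:
  assumes f: "is_qlip f" and F: "\<And>N. \<exists>D. D-lipschitz_on (cball 0 N) F"
  shows "is_qlip (\<lambda>x. F (f x))"
proof (rule is_qlipI)
  fix R :: real
  obtain B where B: "\<And>x. x \<in> ball 0 R \<Longrightarrow> cmod (f x) \<le> B" using is_qlip_bounded[OF f] by metis
  obtain D where D: "D-lipschitz_on (cball 0 B) F" using F by blast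
  have "D-lipschitz_on (f ` ball 0 R) F" by (rule lipschitz_on_subset[OF D]) (use B in auto)
  from lipschitz_on_compose2[OF is_qlip_lipc[OF f] this]
  show "\<exists>C. C-lipschitz_on (ball 0 R) (\<lambda>x. F (f x))" by auto
qed

lemma is_qlip_comp_lip: "is_qlip f \<Longrightarrow> D-lipschitz_on UNIV F \<Longrightarrow> is_qlip (\<lambda>x. F (f x))"
  by (rule is_qlip_comp, assumption, rule exI[of _ D], erule lipschitz_on_subset, simp)

lemma is_qlip_Re: "is_qlip f \<Longrightarrow> is_qlip (\<lambda>x. complex_of_real (Re (f x)))"
  by (rule is_qlip_comp_lip[where D=1 and F="\<lambda>z. complex_of_real (Re z)"])
     (auto simp: lipschitz_on_def dist_norm abs_Re_le_cmod simp flip: of_real_diff minus_complex.sel)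

lemma is_qlip_Im: "is_qlip f \<Longrightarrow> is_qlip (\<lambda>x. complex_of_real (Im (f x)))"
  by (rule is_qlip_comp_lip[where D=1 and F="\<lambda>z. complex_of_real (Im z)"])
     (auto simp: lipschitz_on_def dist_norm abs_Im_le_cmod simp flip: of_real_diff minus_complex.sel)

lemma is_qlip_cnj: "is_qlip f \<Longrightarrow> is_qlip (\<lambda>x. cnj (f x))"
  by (rule is_qlip_comp_lip[where D=1 and F=cnj])
     (auto simp: lipschitz_on_def dist_norm simp flip: complex_cnj_diff)

lemma is_qlip_of_real_comp:
  fixes \<gamma> :: "'a::real_normed_vector \<Rightarrow> real" and F :: "real \<Rightarrow> complex"
  assumes g: "is_qlip (\<lambda>x. complex_of_real (\<gamma> x))" and F: "\<And>N. \<exists>D. D-lipschitz_on {-N..N} F"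
  shows "is_qlip (\<lambda>x. F (\<gamma> x))"
proof -
  have "\<exists>D. D-lipschitz_on (cball 0 N) (\<lambda>z. F (Re z))" for N
  proof -
    obtain D where D: "D-lipschitz_on {-N..N} F" using F by blast
    have "1-lipschitz_on (cball 0 N) Re"
      by (auto simp: lipschitz_on_def dist_norm abs_Re_le_cmod simp flip: minus_complex.sel)
    moreover have "D-lipschitz_on (Re ` cball 0 N) F"
    proof (rule lipschitz_on_subset[OF D], safe)
      fix z assume "z \<in> cball (0::complex) N"
      then have "\<bar>Re z\<bar> \<le> N" using abs_Re_le_cmod[of z] by simp
      then show "Re z \<in> {-N..N}" by auto
    qed
    ultimately show ?thesis using lipschitz_on_compose2 by blast
  qed
  from is_qlip_comp[OF g this] show ?thesis by simp
qed

text \<open>Polarizing \<open>u + v\<close> gives antisymmetry for real functions, and complex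
  bilinearity extends it through real and imaginary parts. The diagonal is tested on real functions
  only, because the chain rule below is stated for real inner functions.\<close>

lemma polarization:
  fixes \<Lambda> :: "('a::real_normed_vector \<Rightarrow> complex) \<Rightarrow> ('a \<Rightarrow> complex) \<Rightarrow> complex"
  assumes l1: "\<And>u v w a b. is_qlip u \<Longrightarrow> is_qlip v \<Longrightarrow> is_qlip w \<Longrightarrow>
      \<Lambda> (\<lambda>x. a * u x + b * v x) w = a * \<Lambda> u w + b * \<Lambda> v w"
    and l2: "\<And>u v w a b. is_qlip u \<Longrightarrow> is_qlip v \<Longrightarrow> is_qlip w \<Longrightarrow>
      \<Lambda> w (\<lambda>x. a * u x + b * v x) = a * \<Lambda> w u + b * \<Lambda> w v"
    and z: "\<And>\<gamma>. is_qlip (\<lambda>x. complex_of_real (\<gamma> x)) \<Longrightarrow>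
      \<Lambda> (\<lambda>x. complex_of_real (\<gamma> x)) (\<lambda>x. complex_of_real (\<gamma> x)) = 0"
    and f: "is_qlip f" and g: "is_qlip g"
  shows "\<Lambda> f g = - \<Lambda> g f"
proof -
  have real: "\<Lambda> (\<lambda>x. of_real (u x)) (\<lambda>x. of_real (v x)) = - \<Lambda> (\<lambda>x. of_real (v x)) (\<lambda>x. of_real (u x))"
    if u: "is_qlip (\<lambda>x. complex_of_real (u x))" and v: "is_qlip (\<lambda>x. complex_of_real (v x))" for u v :: "'a \<Rightarrow> real"
  proof -
    let ?u = "\<lambda>x. complex_of_real (u x)" and ?v = "\<lambda>x. complex_of_real (v x)"
    have s: "is_qlip (\<lambda>x. 1 * ?u x + 1 * ?v x)" by (rule is_qlip_lincomb[OF u v])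
    have "0 = \<Lambda> (\<lambda>x. 1 * ?u x + 1 * ?v x) (\<lambda>x. 1 * ?u x + 1 * ?v x)"
      using z[of "\<lambda>x. u x + v x"] s by simp
    also have "\<dots> = \<Lambda> ?u ?u + \<Lambda> ?u ?v + (\<Lambda> ?v ?u + \<Lambda> ?v ?v)"
      by (subst l1[OF u v s], subst l2[OF u v u], subst l2[OF u v v]) simp
    also have "\<dots> = \<Lambda> ?u ?v + \<Lambda> ?v ?u" using z[OF u] z[OF v] by simp
    finally show ?thesis by (simp add: eq_neg_iff_add_eq_0)
  qed
  let ?fr = "\<lambda>x. complex_of_real (Re (f x))" and ?fi = "\<lambda>x. complex_of_real (Im (f x))"
  let ?gr = "\<lambda>x. complex_of_real (Re (g x))" and ?gi = "\<lambda>x. complex_of_real (Im (g x))"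
  have f': "f = (\<lambda>x. 1 * ?fr x + \<i> * ?fi x)" and g': "g = (\<lambda>x. 1 * ?gr x + \<i> * ?gi x)"
    by (auto simp: complex_eq_iff)
  note q = is_qlip_Re[OF f] is_qlip_Im[OF f] is_qlip_Re[OF g] is_qlip_Im[OF g]
  have 1: "\<Lambda> f g = \<Lambda> ?fr ?gr + \<i> * \<Lambda> ?fr ?gi + \<i> * (\<Lambda> ?fi ?gr + \<i> * \<Lambda> ?fi ?gi)"
    by (subst f', subst l1[OF q(1,2) g], subst (1 2) g', subst l2[OF q(3,4,1)], subst l2[OF q(3,4,2)]) simp
  have 2: "\<Lambda> g f = \<Lambda> ?gr ?fr + \<i> * \<Lambda> ?gr ?fi + \<i> * (\<Lambda> ?gi ?fr + \<i> * \<Lambda> ?gi ?fi)"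
    by (subst g', subst l1[OF q(3,4) f], subst (1 2) f', subst l2[OF q(1,2,3)], subst l2[OF q(1,2,4)]) simp
  show ?thesis
    unfolding 1 2 using real[OF q(1) q(3)] real[OF q(1) q(4)] real[OF q(2) q(3)] real[OF q(2) q(4)]
    by (simp add: algebra_simps)
qed

section \<open>Currents carried by a spherical shell\<close>

declare ball_Un [simp]

text \<open>Only the hats centred at the floor of \<open>s\<close> and at the next integer can be
  nonzero at \<open>s\<close>, and their values add up to 1. The range ends at \<open>m + 1\<close>
  because for \<open>s = m\<close> the second centre is \<open>m + 1\<close>.\<close>

lemma hat_sum:
  fixes s :: real and m :: int
  assumes "- of_int m \<le> s" "s \<le> of_int m"
  shows "(\<Sum>i\<in>{-m..m+1}. max 0 (1 - \<bar>s - of_int i\<bar>)) = 1"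
proof -
  define n where "n = \<lfloor>s\<rfloor>"
  have n: "of_int n \<le> s" "s < of_int n + 1" unfolding n_def by linarith+
  have mn: "-m \<le> n" "n \<le> m" using n assms by linarith+
  have "(\<Sum>i\<in>{-m..m+1}. max 0 (1 - \<bar>s - of_int i\<bar>)) = (\<Sum>i\<in>{n,n+1}. max 0 (1 - \<bar>s - of_int i\<bar>))"
  proof (rule sum.mono_neutral_right)
    show "\<forall>i\<in>{-m..m+1} - {n,n+1}. max 0 (1 - \<bar>s - of_int i\<bar>) = 0"
    proof
      fix i assume "i \<in> {-m..m+1} - {n,n+1}"
      then have "i \<le> n - 1 \<or> n + 2 \<le> i" by auto
      then have "real_of_int i \<le> of_int n - 1 \<or> of_int n + 2 \<le> real_of_int i" by linarith
      then show "max 0 (1 - \<bar>s - of_int i\<bar>) = 0" using n by auto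
    qed
  qed (use mn in auto)
  also have "\<dots> = 1" using n by simp
  finally show ?thesis .
qed

lemma has_vderiv_lipschitz:
  fixes f :: "real \<Rightarrow> complex"
  assumes "convex S" "\<And>s. s \<in> S \<Longrightarrow> (f has_vector_derivative f' s) (at s within S)"
    "\<And>s. s \<in> S \<Longrightarrow> norm (f' s) \<le> C" "0 \<le> C"
  shows "C-lipschitz_on S f"
proof (rule lipschitz_onI)
  fix x y assume xy: "x \<in> S" "y \<in> S"
  have "norm (f x - f y) \<le> C * norm (x - y)"
  proof (rule differentiable_bound[OF assms(1) _ _ xy])
    show "(f has_derivative (\<lambda>h. h *\<^sub>R f' s)) (at s within S)" if "s \<in> S" for s
      using assms(2)[OF that] by (simp add: has_vector_derivative_def)
    show "onorm (\<lambda>h. h *\<^sub>R f' s) \<le> C" if "s \<in> S" for s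
      using assms(3)[OF that] by (intro onorm_le) (simp add: mult.commute[of "\<bar>_\<bar>"] mult_right_mono)
  qed
  then show "dist (f x) (f y) \<le> C * dist x y" by (simp add: dist_norm)
qed (rule assms(4))

lemma cmod_eq_zero_if_small:
  assumes "\<And>e. e > 0 \<Longrightarrow> cmod d \<le> K * e"
  shows "d = 0"
proof (rule ccontr)
  assume "d \<noteq> 0"
  then have d: "cmod d > 0" by simp
  have K: "0 \<le> K" using assms[of 1] order_trans[OF norm_ge_zero, of d K] by simp
  have "cmod d \<le> K * (cmod d / (2 * (K + 1)))" by (rule assms) (use d K in simp)
  also have "\<dots> < cmod d" using d K by (simp add: field_simps add_strict_increasing)
  finally show False by simp
qed

lemma lipschitz_clamp: "1-lipschitz_on UNIV (\<lambda>s::real. max a (min b s))"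
  by (auto simp: lipschitz_on_def dist_real_def)

lemma cis_vector_derivative:
  "((\<lambda>s. cis (c * s)) has_vector_derivative (of_real c * (\<i> * cis (c * s)))) (at s)"
proof -
  have "((\<lambda>z. exp (\<i> * (of_real c * z))) has_field_derivative (of_real c * (\<i> * cis (c * s)))) (at (of_real s))"
    unfolding cis_conv_exp by (auto intro!: derivative_eq_intros)
  from has_vector_derivative_real_field[OF this] show ?thesis by (simp add: cis_conv_exp)
qed

text \<open>What the construction uses of a current whose mass lies in a shell, once its entries may
  be any locally Lipschitz functions. The coefficient is asked to vanish off an open set, or beyond
  radius \<open>R\<close> inside the shell, rather than to have its support there: dilated and
  truncated coefficients satisfy this form directly. \<open>bound\<close> measures the slots on the
  ball of radius \<open>R\<close> only, which may be smaller than the shell; this becomes the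
  quasi-local mass bound after dilation. The locale is instantiated by \<open>T\<close> and by its
  boundary alike.\<close>

locale shell_current =
  fixes k :: nat
    and T :: "'a::complex_normed_vector functional"
    and \<delta> M :: real and \<nu> :: "'a measure"
  assumes delta_pos: "0 < \<delta>" and delta_le: "\<delta> \<le> M"
    and radon: "finite_radon \<nu>"
    and conc: "AE x in \<nu>. \<delta> \<le> norm x \<and> norm x \<le> M"
    and lin_coeff: "\<lbrakk>is_qlip f; is_qlip g; length \<pi>s = k; qlips \<pi>s\<rbrakk> \<Longrightarrow>
          T (\<lambda>x. a * f x + b * g x) \<pi>s = a * T f \<pi>s + b * T g \<pi>s"
    and lin_slot: "\<lbrakk>is_qlip f; is_qlip u; is_qlip v; Suc (length us + length vs) = k;
          qlips us; qlips vs\<rbrakk> \<Longrightarrow>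
          T f (us @ (\<lambda>x. a * u x + b * v x) # vs) = a * T f (us @ u # vs) + b * T f (us @ v # vs)"
    and local: "\<lbrakk>open V; is_qlip f; \<And>x. x \<notin> V \<Longrightarrow> f x = 0; is_qlip u; Suc (length us + length vs) = k;
          qlips us; qlips vs; \<And>x. x \<in> V \<Longrightarrow> u x = c\<rbrakk> \<Longrightarrow> T f (us @ u # vs) = 0"
    and bound: "\<lbrakk>R > 0; is_qlip f; length \<pi>s = k; qlips \<pi>s;
          \<And>x. \<delta> \<le> norm x \<Longrightarrow> norm x \<le> M \<Longrightarrow> R \<le> norm x \<Longrightarrow> f x = 0\<rbrakk> \<Longrightarrow>
          cmod (T f \<pi>s) \<le> lprod R \<pi>s * L1norm \<nu> f"
    and cont: "\<lbrakk>qconv F f; \<And>n. length (P n) = k; length \<pi>s = k;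
          \<And>j. j < k \<Longrightarrow> qconv (\<lambda>n. P n ! j) (\<pi>s ! j)\<rbrakk> \<Longrightarrow> (\<lambda>n. T (F n) (P n)) \<longlonglongrightarrow> T f \<pi>s"

lemma finite_radon_finite_measure: "finite_radon \<mu> \<Longrightarrow> finite_measure \<mu>"
  unfolding finite_radon_def by (intro finite_measureI) (auto simp: top.not_eq_extremum)

lemma qlip_borel_measurable:
  fixes f :: "'a::real_normed_vector \<Rightarrow> complex"
  assumes "is_qlip f" "sets \<mu> = sets borel"
  shows "f \<in> borel_measurable \<mu>"
  by (subst measurable_cong_sets[OF assms(2) refl])
     (rule borel_measurable_continuous_onI[OF is_qlip_continuous[OF assms(1)]])

lemma prod_list_lipc_nonneg: "qlips \<pi>s \<Longrightarrow> 0 \<le> lprod R \<pi>s"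
  by (induction \<pi>s) (auto simp: lipc_nonneg)

lemma list_all2_qconv_const: "qlips \<rho> \<Longrightarrow> list_all2 qconv (map (\<lambda>p n. p) \<rho>) \<rho>"
  by (induction \<rho>) (auto intro: qconv_const)

context shell_current
begin

lemma sets_nu [simp, measurable_cong]: "sets \<nu> = sets borel"
  using radon by (simp add: finite_radon_def)

sublocale nu: finite_measure \<nu>
  by (rule finite_radon_finite_measure[OF radon])

lemma qlip_measurable: "is_qlip f \<Longrightarrow> f \<in> borel_measurable \<nu>"
  by (rule qlip_borel_measurable) auto

lemma qlip_AE_bounded:
  assumes "is_qlip f" obtains B where "B > 0" "AE x in \<nu>. cmod (f x) \<le> B"
proof -
  obtain B where B: "B > 0" "\<And>x. x \<in> ball 0 (M+1) \<Longrightarrow> cmod (f x) \<le> B"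
    using is_qlip_bounded[OF assms] by metis
  have "AE x in \<nu>. cmod (f x) \<le> B"
    using conc by eventually_elim (use B in auto)
  with B that show ?thesis by blast
qed

lemma qlip_integrable: "is_qlip f \<Longrightarrow> integrable \<nu> f"
  using qlip_AE_bounded[of f] nu.integrable_const_bound[of f] qlip_measurable[of f] by metis

lemma T_zero: "length \<pi>s = k \<Longrightarrow> qlips \<pi>s \<Longrightarrow> T (\<lambda>x. 0) \<pi>s = 0"
  using lin_coeff[of "\<lambda>x. 0" "\<lambda>x. 0" \<pi>s 0 0] by simp

lemma T_add: "\<lbrakk>is_qlip f; is_qlip g; length \<pi>s = k; qlips \<pi>s\<rbrakk> \<Longrightarrow>
  T (\<lambda>x. f x + g x) \<pi>s = T f \<pi>s + T g \<pi>s"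
  using lin_coeff[of f g \<pi>s 1 1] by simp

lemma T_diff: "\<lbrakk>is_qlip f; is_qlip g; length \<pi>s = k; qlips \<pi>s\<rbrakk> \<Longrightarrow>
  T (\<lambda>x. f x - g x) \<pi>s = T f \<pi>s - T g \<pi>s"
  using lin_coeff[of f g \<pi>s 1 "-1"] by simp

lemma T_cmult: "\<lbrakk>is_qlip f; length \<pi>s = k; qlips \<pi>s\<rbrakk> \<Longrightarrow> T (\<lambda>x. a * f x) \<pi>s = a * T f \<pi>s"
  using lin_coeff[of f f \<pi>s a 0] by simp

lemma T_sum: "\<lbrakk>\<And>i. i \<in> I \<Longrightarrow> is_qlip (f i); length \<pi>s = k; qlips \<pi>s\<rbrakk> \<Longrightarrow>
  T (\<lambda>x. \<Sum>i\<in>I. f i x) \<pi>s = (\<Sum>i\<in>I. T (f i) \<pi>s)"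
proof (induction I rule: infinite_finite_induct)
  case (insert i I)
  then show ?case
    using T_add[of "f i" "\<lambda>x. \<Sum>i\<in>I. f i x" \<pi>s] is_qlip_sum[of I f] by simp
qed (simp_all add: T_zero)

lemma T_slot_diff: "\<lbrakk>is_qlip f; is_qlip u; is_qlip v; Suc (length us + length vs) = k;
    qlips us; qlips vs\<rbrakk> \<Longrightarrow>
    T f (us @ (\<lambda>x. u x - v x) # vs) = T f (us @ u # vs) - T f (us @ v # vs)"
  using lin_slot[of f u v us vs 1 "-1"] by simp

text \<open>The radius \<open>M + 1\<close> exceeds every norm in the shell, so every coefficient
  qualifies for \<open>bound\<close>.\<close>

lemma bound_M:
  assumes "is_qlip f" "length \<pi>s = k" "qlips \<pi>s"
  shows "cmod (T f \<pi>s) \<le> lprod (M+1) \<pi>s * L1norm \<nu> f"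
  by (rule bound) (use assms delta_pos delta_le in auto)

lemma T_cong_shell:
  assumes "is_qlip f" "is_qlip g" "length \<pi>s = k" "qlips \<pi>s"
    and eq: "\<And>x. \<delta> \<le> norm x \<Longrightarrow> norm x \<le> M \<Longrightarrow> f x = g x"
  shows "T f \<pi>s = T g \<pi>s"
proof -
  have "(\<integral>x. cmod (f x - g x) \<partial>\<nu>) = 0"
    by (rule integral_eq_zero_AE) (use conc eq in auto)
  then have "cmod (T (\<lambda>x. f x - g x) \<pi>s) \<le> 0"
    using bound_M[of "\<lambda>x. f x - g x" \<pi>s] assms by simp
  then show ?thesis using T_diff[OF assms(1-4)] by simp
qed

text \<open>On the set where a hat function of width \<open>\<epsilon>\<close> composed with \<open>\<gamma>\<close> is nonzero, \<open>F \<circ> \<gamma>\<close> differs from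
  an affine function of \<open>\<gamma>\<close> by a function with Lipschitz constant \<open>O(\<epsilon>)\<close>; the mass bound
  controls the sum of these errors.\<close>

lemma chain_rule:
  fixes \<gamma> :: "'a \<Rightarrow> real" and F F' :: "real \<Rightarrow> complex"
  assumes a: "is_qlip a" and g: "is_qlip (\<lambda>x. complex_of_real (\<gamma> x))"
    and len: "Suc (length us + length vs) = k"
    and q1: "qlips us" and q2: "qlips vs"
    and dF: "\<And>s. (F has_vector_derivative F' s) (at s)"
    and B: "\<And>s t. cmod (F' s - F' t) \<le> B * \<bar>s - t\<bar>"
  shows "T a (us @ (\<lambda>x. F (\<gamma> x)) # vs) = T (\<lambda>x. a x * F' (\<gamma> x)) (us @ (\<lambda>x. complex_of_real (\<gamma> x)) # vs)"
proof -
  let ?\<gamma> = "\<lambda>x. complex_of_real (\<gamma> x)"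
  have B0: "0 \<le> B" using order_trans[OF norm_ge_zero B[of 0 1]] by simp
  have qF: "is_qlip (\<lambda>x. F (\<gamma> x))"
  proof (rule is_qlip_of_real_comp[OF g])
    fix N :: real
    have "(cmod (F' 0) + B * \<bar>N\<bar>)-lipschitz_on {-N..N} F"
    proof (rule has_vderiv_lipschitz)
      fix s assume s: "s \<in> {-N..N}"
      show "(F has_vector_derivative F' s) (at s within {-N..N})"
        using dF by (rule has_vector_derivative_at_within)
      have "cmod (F' s) \<le> cmod (F' 0) + cmod (F' s - F' 0)"
        by (metis add_diff_cancel_left' diff_add_cancel norm_triangle_sub)
      also have "\<dots> \<le> cmod (F' 0) + B * \<bar>s - 0\<bar>" using B[of s 0] by simp
      also have "\<dots> \<le> cmod (F' 0) + B * \<bar>N\<bar>" using s B0 by (intro add_left_mono mult_left_mono) auto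
      finally show "cmod (F' s) \<le> cmod (F' 0) + B * \<bar>N\<bar>" .
    qed (use B0 in auto)
    then show "\<exists>D. D-lipschitz_on {-N..N} F" by blast
  qed
  have qF': "is_qlip (\<lambda>x. F' (\<gamma> x))"
  proof (rule is_qlip_of_real_comp[OF g])
    fix N :: real
    have "B-lipschitz_on {-N..N} F'" using B B0 by (auto simp: lipschitz_on_def dist_norm)
    then show "\<exists>D. D-lipschitz_on {-N..N} F'" by blast
  qed
  define L where "L = lipc (ball 0 (M+1)) ?\<gamma>"
  define P where "P = lprod (M+1) us * lprod (M+1) vs"
  have L0: "0 \<le> L" unfolding L_def by (rule lipc_nonneg[OF g])
  have P0: "0 \<le> P" unfolding P_def using q1 q2 by (simp add: prod_list_lipc_nonneg)
  have bd: "cmod (T f (us @ u # vs)) \<le> P * lipc (ball 0 (M+1)) u * L1norm \<nu> f"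
    if "is_qlip f" "is_qlip u" for f u
  proof -
    have e: "lprod (M+1) (us @ u # vs) = P * lipc (ball 0 (M+1)) u"
      by (simp add: P_def)
    show ?thesis
      unfolding e[symmetric] by (rule bound_M[OF that(1)]) (use that(2) len q1 q2 in auto)
  qed
  obtain N where N: "\<And>x. x \<in> ball 0 (M+1) \<Longrightarrow> cmod (?\<gamma> x) \<le> N" using is_qlip_bounded[OF g] by metis
  define D where "D b = T b (us @ (\<lambda>x. F (\<gamma> x)) # vs) - T (\<lambda>x. b x * F' (\<gamma> x)) (us @ ?\<gamma> # vs)" for b
  note lq = len q1 q2
  have "cmod (D a) \<le> (2 * P * L * B * L1norm \<nu> a) * e" if e: "e > 0" for e
  proof -
    define H where "H i x = complex_of_real (max 0 (1 - \<bar>\<gamma> x / e - of_int i\<bar>))" for i :: int and x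
    have qH: "is_qlip (H i)" for i
      unfolding H_def
    proof (rule is_qlip_of_real_comp[OF g])
      fix N :: real
      have "(1/e)-lipschitz_on {-N..N} (\<lambda>s. complex_of_real (max 0 (1 - \<bar>s / e - of_int i\<bar>)))"
      proof (rule lipschitz_onI)
        fix s t :: real
        have "\<bar>max 0 (1 - \<bar>s / e - of_int i\<bar>) - max 0 (1 - \<bar>t / e - of_int i\<bar>)\<bar> \<le> \<bar>s / e - t / e\<bar>"
          by linarith
        also have "\<dots> = 1 / e * \<bar>s - t\<bar>" using e by (simp add: field_simps flip: abs_mult diff_divide_distrib)
        finally show "dist (complex_of_real (max 0 (1 - \<bar>s / e - of_int i\<bar>))) (complex_of_real (max 0 (1 - \<bar>t / e - of_int i\<bar>)))
            \<le> 1 / e * dist s t"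
          by (simp add: dist_norm dist_real_def flip: of_real_diff)
      qed (use e in simp)
      then show "\<exists>D. D-lipschitz_on {-N..N} (\<lambda>s. complex_of_real (max 0 (1 - \<bar>s / e - of_int i\<bar>)))" by blast
    qed
    define m :: int where "m = \<lceil>N / e\<rceil>"
    define I where "I = {-m..m+1}"
    have Hsum: "(\<Sum>i\<in>I. H i x) = 1" if "norm x \<le> M" for x
    proof -
      have "\<bar>\<gamma> x\<bar> \<le> N" using N[of x] that by simp
      then have "\<bar>\<gamma> x / e\<bar> \<le> N / e" using e by (simp add: divide_right_mono)
      also have "\<dots> \<le> of_int m" unfolding m_def by linarith
      finally have "- of_int m \<le> \<gamma> x / e" "\<gamma> x / e \<le> of_int m" by linarith+
      then show ?thesis
        using hat_sum[of m "\<gamma> x / e"] unfolding I_def H_def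
        by (simp flip: of_real_sum)
    qed
    have Di: "cmod (D (\<lambda>x. a x * H i x)) \<le> 2 * P * L * B * e * (\<integral>x. cmod (a x * H i x) \<partial>\<nu>)" for i
    proof -
      define c where "c = of_int i * e"
      let ?b = "\<lambda>x. a x * H i x"
      have qb: "is_qlip ?b" using a qH by auto
      define V where "V = {x. cmod (?\<gamma> x - of_real c) < e}"
      have V: "open V" unfolding V_def
        by (intro open_Collect_less continuous_intros is_qlip_continuous[OF g])
      have bV: "?b x = 0" if "x \<notin> V" for x
      proof -
        have "\<bar>\<gamma> x - c\<bar> \<ge> e" using that unfolding V_def by (simp flip: of_real_diff)
        then have "\<bar>\<gamma> x / e - of_int i\<bar> \<ge> 1"
          using e unfolding c_def by (simp add: field_simps abs_if split: if_splits)
        then show ?thesis by (simp add: H_def)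
      qed
      \<comment> \<open>The remainder after subtracting the linear function with slope
        \<open>F' c\<close> has derivative \<open>F' s - F' c\<close>, of size at most
        \<open>B * e\<close> on the interval. The clamp \<open>cl\<close> extends this small
        Lipschitz constant to the whole line, and locality allows the exchange because the
        coefficient lives on \<open>V\<close>.\<close>
      define \<phi> where "\<phi> s = F s - F' c * of_real s" for s
      define cl where "cl s = max (c - e) (min (c + e) s)" for s
      have phi_lip: "(B * e)-lipschitz_on {c-e..c+e} \<phi>"
      proof (rule has_vderiv_lipschitz)
        fix s assume s: "s \<in> {c-e..c+e}"
        have "((\<lambda>s. F s - F' c * of_real s) has_vector_derivative (F' s - F' c * of_real 1)) (at s)"
          by (rule has_vector_derivative_diff[OF dF has_vector_derivative_mult_right[OF
              has_vector_derivative_of_real[OF DERIV_ident]]])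
        from has_vector_derivative_at_within[OF this]
        show "(\<phi> has_vector_derivative (F' s - F' c)) (at s within {c-e..c+e})"
          unfolding \<phi>_def by simp
        have "cmod (F' s - F' c) \<le> B * \<bar>s - c\<bar>" by (rule B)
        also have "\<dots> \<le> B * e" using s B0 by (intro mult_left_mono) auto
        finally show "cmod (F' s - F' c) \<le> B * e" .
      qed (use B0 e in auto)
      have cl_lip: "1-lipschitz_on UNIV cl" unfolding cl_def by (rule lipschitz_clamp)
      have pc: "(B * e)-lipschitz_on UNIV (\<lambda>s. \<phi> (cl s))"
      proof -
        have "range cl \<subseteq> {c-e..c+e}" using e by (auto simp: cl_def)
        from lipschitz_on_compose2[OF cl_lip lipschitz_on_subset[OF phi_lip this]] show ?thesis by simp
      qed
      let ?\<Phi> = "\<lambda>x. 1 * F (\<gamma> x) + (- F' c) * ?\<gamma> x" and ?\<Phi>' = "\<lambda>x. \<phi> (cl (\<gamma> x))"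
      have q\<Phi>: "is_qlip ?\<Phi>" by (rule is_qlip_lincomb[OF qF g])
      have q\<Phi>': "is_qlip ?\<Phi>'"
        by (rule is_qlip_of_real_comp[OF g, of "\<lambda>s. \<phi> (cl s)"]) (use lipschitz_on_subset[OF pc] in blast)
      have "T ?b (us @ (\<lambda>x. ?\<Phi> x - ?\<Phi>' x) # vs) = 0"
      proof (rule local[OF V qb bV, where c = 0])
        show "?\<Phi> x - ?\<Phi>' x = 0" if "x \<in> V" for x
        proof -
          have "\<bar>\<gamma> x - c\<bar> < e" using that unfolding V_def by (simp flip: of_real_diff)
          then have "cl (\<gamma> x) = \<gamma> x" unfolding cl_def by auto
          then show ?thesis by (simp add: \<phi>_def)
        qed
      qed (use lq q\<Phi> q\<Phi>' in auto)
      then have eq: "T ?b (us @ ?\<Phi> # vs) = T ?b (us @ ?\<Phi>' # vs)"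
        using T_slot_diff[OF qb q\<Phi> q\<Phi>' lq] by simp
      have e1: "T ?b (us @ ?\<Phi> # vs) = T ?b (us @ (\<lambda>x. F (\<gamma> x)) # vs) - F' c * T ?b (us @ ?\<gamma> # vs)"
        using lin_slot[OF qb qF g lq, of 1 "- F' c"] by simp
      let ?d = "\<lambda>x. ?b x * (F' (\<gamma> x) - F' c)"
      have qd: "is_qlip ?d" by (intro is_qlip_mult qb is_qlip_diff qF' is_qlip_const)
      have "?d = (\<lambda>x. 1 * (?b x * F' (\<gamma> x)) + (- F' c) * ?b x)" by (auto simp: algebra_simps)
      then have e2: "T ?d (us @ ?\<gamma> # vs) = T (\<lambda>x. ?b x * F' (\<gamma> x)) (us @ ?\<gamma> # vs) - F' c * T ?b (us @ ?\<gamma> # vs)"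
        using lin_coeff[of "\<lambda>x. ?b x * F' (\<gamma> x)" ?b "us @ ?\<gamma> # vs" 1 "- F' c"] qb qF' lq g by (simp add: is_qlip_mult)
      have DD: "D ?b = T ?b (us @ ?\<Phi>' # vs) - T ?d (us @ ?\<gamma> # vs)"
        unfolding D_def eq[symmetric] e1 e2 by simp
      have Ib: "0 \<le> (\<integral>x. cmod (?b x) \<partial>\<nu>)" by simp
      have "lipc (ball 0 (M+1)) ?\<Phi>' \<le> B * e * L"
      proof (rule lipc_le, rule lipschitz_onI)
        fix x y :: 'a assume xy: "x \<in> ball 0 (M+1)" "y \<in> ball 0 (M+1)"
        have "dist (?\<Phi>' x) (?\<Phi>' y) \<le> B * e * dist (\<gamma> x) (\<gamma> y)" by (rule lipschitz_onD[OF pc]) auto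
        also have "dist (\<gamma> x) (\<gamma> y) = dist (?\<gamma> x) (?\<gamma> y)" by (simp add: dist_norm dist_real_def flip: of_real_diff)
        also have "B * e * dist (?\<gamma> x) (?\<gamma> y) \<le> B * e * (L * dist x y)"
          using lipschitz_onD[OF is_qlip_lipc[OF g] xy] B0 e unfolding L_def by (intro mult_left_mono) auto
        finally show "dist (?\<Phi>' x) (?\<Phi>' y) \<le> B * e * L * dist x y" by simp
      qed (use B0 e L0 in auto)
      then have "P * lipc (ball 0 (M+1)) ?\<Phi>' * (\<integral>x. cmod (?b x) \<partial>\<nu>) \<le> P * (B * e * L) * (\<integral>x. cmod (?b x) \<partial>\<nu>)"
        using P0 Ib by (intro mult_right_mono mult_left_mono)
      with bd[OF qb q\<Phi>'] have b1: "cmod (T ?b (us @ ?\<Phi>' # vs)) \<le> P * (B * e * L) * (\<integral>x. cmod (?b x) \<partial>\<nu>)"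
        by linarith
      have "(\<integral>x. cmod (?d x) \<partial>\<nu>) \<le> (\<integral>x. B * e * cmod (?b x) \<partial>\<nu>)"
      proof (rule integral_mono)
        show "integrable \<nu> (\<lambda>x. cmod (?d x))" using qlip_integrable[OF qd] by simp
        show "integrable \<nu> (\<lambda>x. B * e * cmod (?b x))" using qlip_integrable[OF qb] by simp
        fix x
        show "cmod (?d x) \<le> B * e * cmod (?b x)"
        proof (cases "x \<in> V")
          case True
          then have "\<bar>\<gamma> x - c\<bar> \<le> e" unfolding V_def by (simp flip: of_real_diff)
          then have "cmod (F' (\<gamma> x) - F' c) \<le> B * e"
            using B[of "\<gamma> x" c] B0 mult_left_mono[of "\<bar>\<gamma> x - c\<bar>" e B] by linarith
          then show ?thesis by (simp only: norm_mult mult.commute[of "B * e"]) (intro mult_left_mono, auto)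
        next
          case False
          show ?thesis using bV[OF False] by (simp only: bV[OF False]) simp
        qed
      qed
      then have I2: "(\<integral>x. cmod (?d x) \<partial>\<nu>) \<le> B * e * (\<integral>x. cmod (?b x) \<partial>\<nu>)" by simp
      have "P * L * (\<integral>x. cmod (?d x) \<partial>\<nu>) \<le> P * L * (B * e * (\<integral>x. cmod (?b x) \<partial>\<nu>))"
        using P0 L0 I2 by (intro mult_left_mono) auto
      with bd[OF qd g] have b2: "cmod (T ?d (us @ ?\<gamma> # vs)) \<le> P * (B * e * L) * (\<integral>x. cmod (?b x) \<partial>\<nu>)"
        unfolding L_def[symmetric] by (simp add: mult_ac)
      have "cmod (D ?b) \<le> cmod (T ?b (us @ ?\<Phi>' # vs)) + cmod (T ?d (us @ ?\<gamma> # vs))"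
        unfolding DD by (rule norm_triangle_ineq4)
      with b1 b2 show ?thesis by (simp add: mult_ac)
    qed
    have qs: "is_qlip (\<lambda>x. \<Sum>i\<in>I. a x * H i x)" by (intro is_qlip_sum is_qlip_mult a qH)
    have as: "a x = (\<Sum>i\<in>I. a x * H i x)" if "norm x \<le> M" for x
      using Hsum[OF that] by (simp flip: sum_distrib_left)
    have "T a (us @ (\<lambda>x. F (\<gamma> x)) # vs) = T (\<lambda>x. \<Sum>i\<in>I. a x * H i x) (us @ (\<lambda>x. F (\<gamma> x)) # vs)"
      by (rule T_cong_shell) (use a qs qF lq as in auto)
    also have "\<dots> = (\<Sum>i\<in>I. T (\<lambda>x. a x * H i x) (us @ (\<lambda>x. F (\<gamma> x)) # vs))"
      by (rule T_sum) (use a qH qF lq in auto)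
    finally have s1: "T a (us @ (\<lambda>x. F (\<gamma> x)) # vs) = \<dots>" .
    have "T (\<lambda>x. a x * F' (\<gamma> x)) (us @ ?\<gamma> # vs) = T (\<lambda>x. \<Sum>i\<in>I. a x * H i x * F' (\<gamma> x)) (us @ ?\<gamma> # vs)"
    proof (rule T_cong_shell)
      show "is_qlip (\<lambda>x. \<Sum>i\<in>I. a x * H i x * F' (\<gamma> x))" by (intro is_qlip_sum is_qlip_mult a qH qF')
      show "a x * F' (\<gamma> x) = (\<Sum>i\<in>I. a x * H i x * F' (\<gamma> x))" if "norm x \<le> M" for x
        using as[OF that] by (simp flip: sum_distrib_right)
    qed (use a qF' g lq in auto)
    also have "\<dots> = (\<Sum>i\<in>I. T (\<lambda>x. a x * H i x * F' (\<gamma> x)) (us @ ?\<gamma> # vs))"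
      by (rule T_sum) (use a qH qF' g lq in auto)
    finally have "D a = (\<Sum>i\<in>I. D (\<lambda>x. a x * H i x))"
      unfolding D_def s1 by (simp add: sum_subtractf)
    then have "cmod (D a) \<le> (\<Sum>i\<in>I. cmod (D (\<lambda>x. a x * H i x)))" by (simp add: norm_sum)
    also have "\<dots> \<le> (\<Sum>i\<in>I. 2 * P * L * B * e * (\<integral>x. cmod (a x * H i x) \<partial>\<nu>))"
      by (rule sum_mono) (rule Di)
    also have "\<dots> = 2 * P * L * B * e * (\<Sum>i\<in>I. \<integral>x. cmod (a x * H i x) \<partial>\<nu>)" by (simp add: sum_distrib_left)
    \<comment> \<open>The hats are nonnegative and sum to 1 on the shell, so the
      \<open>L1norm\<close> of the pieces adds up to that of \<open>a\<close>. The total error is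
      therefore of order \<open>e\<close>, whatever the number of hats.\<close>
    also have "(\<Sum>i\<in>I. \<integral>x. cmod (a x * H i x) \<partial>\<nu>) = (\<integral>x. (\<Sum>i\<in>I. cmod (a x * H i x)) \<partial>\<nu>)"
      by (rule Bochner_Integration.integral_sum[symmetric]) (intro integrable_norm qlip_integrable is_qlip_mult a qH)
    also have "\<dots> = L1norm \<nu> a"
    proof (rule integral_cong_AE)
      have m: "a \<in> borel_measurable \<nu>" "H i \<in> borel_measurable \<nu>" for i using a qH qlip_measurable by blast+
      show "(\<lambda>x. \<Sum>i\<in>I. cmod (a x * H i x)) \<in> borel_measurable \<nu>" using m by measurable
      show "(\<lambda>x. cmod (a x)) \<in> borel_measurable \<nu>" using m by measurable
      show "AE x in \<nu>. (\<Sum>i\<in>I. cmod (a x * H i x)) = cmod (a x)"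
        using conc
      proof eventually_elim
        case (elim x)
        have "(\<Sum>i\<in>I. cmod (H i x)) = Re (\<Sum>i\<in>I. H i x)"
          unfolding Re_sum by (intro sum.cong refl) (simp add: H_def)
        then have "(\<Sum>i\<in>I. cmod (H i x)) = 1" using Hsum[of x] elim by simp
        then show ?case by (simp add: norm_mult flip: sum_distrib_left)
      qed
    qed
    finally show ?thesis by (simp add: mult_ac)
  qed
  then have "D a = 0" by (rule cmod_eq_zero_if_small)
  then show ?thesis by (simp add: D_def)
qed

text \<open>The defect \<open>\<Lambda>\<close> of the product rule is bilinear and symmetric, and
  the chain rule for the square kills it on real diagonals. Polarization makes it antisymmetric as
  well, hence zero.\<close>

lemma leibniz:
  assumes a: "is_qlip a" and f: "is_qlip f" and g: "is_qlip g"
    and lq: "Suc (length us + length vs) = k" "qlips us" "qlips vs"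
  shows "T a (us @ (\<lambda>x. f x * g x) # vs) =
    T (\<lambda>x. a x * f x) (us @ g # vs) + T (\<lambda>x. a x * g x) (us @ f # vs)"
proof -
  define \<Lambda> where "\<Lambda> f g = T a (us @ (\<lambda>x. f x * g x) # vs)
      - T (\<lambda>x. a x * f x) (us @ g # vs) - T (\<lambda>x. a x * g x) (us @ f # vs)" for f g
  have sym: "\<Lambda> f g = \<Lambda> g f" for f g
    unfolding \<Lambda>_def by (simp add: mult.commute[of "f _"])
  have l1: "\<Lambda> (\<lambda>x. c * u x + d * v x) w = c * \<Lambda> u w + d * \<Lambda> v w"
    if q: "is_qlip u" "is_qlip v" "is_qlip w" for u v w c d
  proof -
    have e1: "(\<lambda>x. (c * u x + d * v x) * w x) = (\<lambda>x. c * (u x * w x) + d * (v x * w x))"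
      and e2: "(\<lambda>x. a x * (c * u x + d * v x)) = (\<lambda>x. c * (a x * u x) + d * (a x * v x))"
      by (auto simp: algebra_simps)
    have "T a (us @ (\<lambda>x. c * (u x * w x) + d * (v x * w x)) # vs)
        = c * T a (us @ (\<lambda>x. u x * w x) # vs) + d * T a (us @ (\<lambda>x. v x * w x) # vs)"
      by (rule lin_slot) (use a q lq in auto)
    moreover have "T (\<lambda>x. c * (a x * u x) + d * (a x * v x)) (us @ w # vs)
        = c * T (\<lambda>x. a x * u x) (us @ w # vs) + d * T (\<lambda>x. a x * v x) (us @ w # vs)"
      by (rule lin_coeff) (use a q lq in auto)
    moreover have "T (\<lambda>x. a x * w x) (us @ (\<lambda>x. c * u x + d * v x) # vs)
        = c * T (\<lambda>x. a x * w x) (us @ u # vs) + d * T (\<lambda>x. a x * w x) (us @ v # vs)"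
      by (rule lin_slot) (use a q lq in auto)
    ultimately show ?thesis unfolding \<Lambda>_def e1 e2 by (simp add: algebra_simps)
  qed
  have "\<Lambda> f g = - \<Lambda> g f"
  proof (rule polarization[OF l1 _ _ f g])
    show "\<Lambda> w (\<lambda>x. a * u x + b * v x) = a * \<Lambda> w u + b * \<Lambda> w v"
      if q: "is_qlip u" "is_qlip v" "is_qlip w" for u v w a b
      using l1[OF q, of a b] sym by metis
  next
    fix \<gamma> :: "'a \<Rightarrow> real" assume g: "is_qlip (\<lambda>x. complex_of_real (\<gamma> x))"
    have "T a (us @ (\<lambda>x. complex_of_real (\<gamma> x) * complex_of_real (\<gamma> x)) # vs)
       = T (\<lambda>x. a x * (2 * complex_of_real (\<gamma> x))) (us @ (\<lambda>x. complex_of_real (\<gamma> x)) # vs)"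
    proof (rule chain_rule[OF a g lq, where F = "\<lambda>s. complex_of_real s * complex_of_real s" and F' = "\<lambda>s. 2 * complex_of_real s" and B = 2])
      fix s t :: real
      show "((\<lambda>s. complex_of_real s * complex_of_real s) has_vector_derivative 2 * complex_of_real s) (at s)"
        by (auto intro!: derivative_eq_intros simp: has_vector_derivative_def scaleR_conv_of_real)
      show "cmod (2 * complex_of_real s - 2 * complex_of_real t) \<le> 2 * \<bar>s - t\<bar>"
        by (simp add: norm_mult flip: of_real_diff right_diff_distrib)
    qed
    also have "\<dots> = 2 * T (\<lambda>x. a x * complex_of_real (\<gamma> x)) (us @ (\<lambda>x. complex_of_real (\<gamma> x)) # vs)"
    proof (subst T_cmult[symmetric])
      show "qlips (us @ (\<lambda>x. complex_of_real (\<gamma> x)) # vs)" using g lq by auto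
    qed (use a g lq in \<open>auto simp: mult.left_commute\<close>)
    finally show "\<Lambda> (\<lambda>x. complex_of_real (\<gamma> x)) (\<lambda>x. complex_of_real (\<gamma> x)) = 0"
      unfolding \<Lambda>_def by simp
  qed
  then have "\<Lambda> f g = 0" using sym[of f g] by simp
  then show ?thesis unfolding \<Lambda>_def by (simp add: algebra_simps)
qed

text \<open>A list of sequences takes the place of a sequence of lists, so that convergence of the
  slots can be assembled by list operations and \<open>list_all2\<close>.\<close>

lemma cont_lists:
  assumes F: "qconv F f" and P: "list_all2 qconv Ps \<pi>s" and k: "length \<pi>s = k"
  shows "(\<lambda>n. T (F n) (map (\<lambda>p. p n) Ps)) \<longlonglongrightarrow> T f \<pi>s"
proof (rule cont[OF F])
  show "length (map (\<lambda>p. p n) Ps) = k" for n using list_all2_lengthD[OF P] k by simp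
  show "qconv (\<lambda>n. map (\<lambda>p. p n) Ps ! j) (\<pi>s ! j)" if "j < k" for j
    using list_all2_nthD2[OF P, of j] list_all2_lengthD[OF P] that k by simp
qed (rule k)

lemma chain_exp:
  fixes \<gamma> :: "'a \<Rightarrow> real" and c :: real
  assumes "is_qlip a" "is_qlip (\<lambda>x. complex_of_real (\<gamma> x))" "c \<noteq> 0"
    "Suc (length us + length vs) = k" "qlips us" "qlips vs"
  shows "T a (us @ (\<lambda>x. cis (c * \<gamma> x) / of_real c) # vs) = T (\<lambda>x. a x * (\<i> * cis (c * \<gamma> x))) (us @ (\<lambda>x. complex_of_real (\<gamma> x)) # vs)"
proof (rule chain_rule[OF assms(1,2,4-6), where F = "\<lambda>s. cis (c * s) / of_real c" and F' = "\<lambda>s. \<i> * cis (c * s)" and B = "\<bar>c\<bar>"])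
  note d = cis_vector_derivative[of c]
  fix s t :: real
  show "((\<lambda>s. cis (c * s) / of_real c) has_vector_derivative \<i> * cis (c * s)) (at s)"
    using has_vector_derivative_mult_right[OF d, of "1 / of_real c" s] assms(3) by simp
  have "\<bar>c\<bar>-lipschitz_on UNIV (\<lambda>s. cis (c * s))"
    by (rule has_vderiv_lipschitz[OF _ d]) (auto simp: norm_mult)
  from lipschitz_onD[OF this, of s t]
  show "cmod (\<i> * cis (c * s) - \<i> * cis (c * t)) \<le> \<bar>c\<bar> * \<bar>s - t\<bar>"
    by (simp add: dist_norm dist_real_def norm_mult flip: right_diff_distrib)
qed

text \<open>The chain rule gives \<open>T(f; \<gamma>, \<gamma>) = T(f; e\<^sup>i\<^sup>n\<^sup>\<gamma>/n, -e\<^sup>-\<^sup>i\<^sup>n\<^sup>\<gamma>/n)\<close>,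
  and the right-hand side tends to zero by continuity.\<close>

lemma alternating_real:
  fixes \<gamma> :: "'a \<Rightarrow> real"
  assumes f: "is_qlip f" and g: "is_qlip (\<lambda>x. complex_of_real (\<gamma> x))"
    and lq: "Suc (Suc (length us + length vs)) = k" "qlips us" "qlips vs"
  shows "T f (us @ (\<lambda>x. complex_of_real (\<gamma> x)) # (\<lambda>x. complex_of_real (\<gamma> x)) # vs) = 0"
proof -
  let ?\<gamma> = "\<lambda>x. complex_of_real (\<gamma> x)"
  define E where "E c x = cis (c * \<gamma> x) / of_real c" for c x
  have lipE: "1-lipschitz_on UNIV (\<lambda>s. cis (c * s) / of_real c)" if "c \<noteq> 0" for c
  proof (rule has_vderiv_lipschitz)
    note d = cis_vector_derivative[of c]
    show "((\<lambda>s. cis (c * s) / of_real c) has_vector_derivative \<i> * cis (c * s)) (at s)" for s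
      using has_vector_derivative_mult_right[OF d, of "1 / of_real c" s] that by simp
  qed (auto simp: norm_mult)
  have lipE': "C-lipschitz_on (ball 0 R) (E c)" if "c \<noteq> 0" "C-lipschitz_on (ball 0 R) ?\<gamma>" for c C R
  proof (rule lipschitz_onI)
    fix x y :: 'a assume "x \<in> ball 0 R" "y \<in> ball 0 R"
    from lipschitz_onD[OF that(2) this] have "dist (\<gamma> x) (\<gamma> y) \<le> C * dist x y"
      by (simp add: dist_norm dist_real_def flip: of_real_diff)
    then show "dist (E c x) (E c y) \<le> C * dist x y"
      using lipschitz_onD[OF lipE[OF that(1)], of "\<gamma> x" "\<gamma> y"] unfolding E_def by simp
  qed (use lipschitz_on_nonneg[OF that(2)] in simp)
  have qE: "is_qlip (E c)" if "c \<noteq> 0" for c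
    unfolding is_qlip_iff using lipE'[OF that is_qlip_lipc[OF g]] by blast
  have conv: "qconv (\<lambda>n. E (s * real (Suc n))) (\<lambda>x. 0)" if s: "s = 1 \<or> s = -1" for s
    unfolding qconv_def eqlip_def
  proof (intro conjI allI)
    fix R
    have "(lipc (ball 0 R) ?\<gamma>)-lipschitz_on (ball 0 R) (E (s * real (Suc n)))" for n
      by (rule lipE'[OF _ is_qlip_lipc[OF g]]) (use s in auto)
    then show "\<exists>C. \<forall>n. C-lipschitz_on (ball 0 R) (E (s * real (Suc n)))" by blast
  next
    fix x
    have "cmod (E (s * real (Suc n)) x) = inverse (real (Suc n))" for n
      using s by (auto simp: E_def norm_divide norm_mult norm_inverse divide_inverse norm_of_nat simp del: of_nat_Suc)
    then have "(\<lambda>n. cmod (E (s * real (Suc n)) x)) \<longlonglongrightarrow> 0"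
      by (simp only: LIMSEQ_inverse_real_of_nat)
    then show "(\<lambda>n. E (s * real (Suc n)) x) \<longlonglongrightarrow> 0" by (rule tendsto_norm_zero_cancel)
  qed
  \<comment> \<open>The two chain rules produce the factors
    \<open>\<i> * cis (c * \<gamma> x)\<close> and \<open>\<i> * cis (-c * \<gamma> x)\<close>,
    whose product is -1. The value is therefore independent of \<open>n\<close>, while
    \<open>conv\<close> sends both slots to 0.\<close>
  have eq: "T f (us @ E (1 * real (Suc n)) # E (-1 * real (Suc n)) # vs) = T (\<lambda>x. - f x) (us @ ?\<gamma> # ?\<gamma> # vs)" for n
  proof -
    define c where "c = real (Suc n)"
    have c: "c \<noteq> 0" "-c \<noteq> 0" unfolding c_def by auto
    have ci: "is_qlip (\<lambda>x. \<i> * cis (c * \<gamma> x))"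
    proof -
      have "(\<lambda>x. \<i> * cis (c * \<gamma> x)) = (\<lambda>x. (\<i> * of_real c) * E c x)" using c by (auto simp: E_def)
      then show ?thesis using qE[OF c(1)] by simp
    qed
    have "T f (us @ E c # E (-c) # vs) = T (\<lambda>x. f x * (\<i> * cis (c * \<gamma> x))) (us @ ?\<gamma> # E (-c) # vs)"
      unfolding E_def[of c, abs_def] by (rule chain_exp) (use f g c lq qE[OF c(2)] in auto)
    also have "\<dots> = T (\<lambda>x. f x * (\<i> * cis (c * \<gamma> x)) * (\<i> * cis (-c * \<gamma> x))) ((us @ [?\<gamma>]) @ ?\<gamma> # vs)"
      using chain_exp[of "\<lambda>x. f x * (\<i> * cis (c * \<gamma> x))" \<gamma> "-c" "us @ [?\<gamma>]" vs] f g c lq ci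
      unfolding E_def[of "-c", abs_def] by simp
    also have "(\<lambda>x. f x * (\<i> * cis (c * \<gamma> x)) * (\<i> * cis (-c * \<gamma> x))) = (\<lambda>x. - f x)"
    proof
      fix x
      have "cis (c * \<gamma> x) * cis (-c * \<gamma> x) = 1" by (simp add: cis_mult)
      then have "f x * (\<i> * cis (c * \<gamma> x)) * (\<i> * cis (-c * \<gamma> x)) = f x * (\<i> * \<i>) * 1"
        by (metis (no_types, lifting) mult.assoc mult.left_commute)
      then show "f x * (\<i> * cis (c * \<gamma> x)) * (\<i> * cis (-c * \<gamma> x)) = - f x" by simp
    qed
    finally show ?thesis by (simp add: c_def)
  qed
  have "(\<lambda>n. T f (us @ E (1 * real (Suc n)) # E (-1 * real (Suc n)) # vs)) \<longlonglongrightarrow> T f (us @ (\<lambda>x. 0) # (\<lambda>x. 0) # vs)"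
    using cont_lists[OF qconv_const[OF f], of "map (\<lambda>p n. p) us @ (\<lambda>n. E (1 * real (Suc n))) # (\<lambda>n. E (-1 * real (Suc n))) # map (\<lambda>p n. p) vs"
        "us @ (\<lambda>x. 0) # (\<lambda>x. 0) # vs"] conv[of 1] conv[of "-1"] lq
    by (simp add: list_all2_append list_all2_qconv_const o_def del: of_nat_Suc)
  moreover have "T f (us @ (\<lambda>x. 0) # (\<lambda>x. 0) # vs) = 0"
    by (rule local[where V = UNIV and c = 0]) (use f lq in auto)
  ultimately have "T (\<lambda>x. - f x) (us @ ?\<gamma> # ?\<gamma> # vs) = 0"
    unfolding eq by (simp add: LIMSEQ_const_iff)
  then show ?thesis using T_cmult[of f "us @ ?\<gamma> # ?\<gamma> # vs" "-1"] f g lq by simp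
qed

text \<open>Polarization of \<open>alternating_real\<close> in two adjacent slots; the
  rearrangements used later are chains of such exchanges.\<close>

lemma swap:
  assumes f: "is_qlip f" and uv: "is_qlip u" "is_qlip v"
    and lq: "Suc (Suc (length us + length vs)) = k" "qlips us" "qlips vs"
  shows "T f (us @ u # v # vs) = - T f (us @ v # u # vs)"
proof (rule polarization[where \<Lambda> = "\<lambda>u v. T f (us @ u # v # vs)", OF _ _ _ uv])
  show "T f (us @ (\<lambda>x. a * u x + b * v x) # w # vs) = a * T f (us @ u # w # vs) + b * T f (us @ v # w # vs)"
    if "is_qlip u" "is_qlip v" "is_qlip w" for u v w a b
    by (rule lin_slot) (use that f lq in auto)
  show "T f (us @ w # (\<lambda>x. a * u x + b * v x) # vs) = a * T f (us @ w # u # vs) + b * T f (us @ w # v # vs)"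
    if "is_qlip u" "is_qlip v" "is_qlip w" for u v w a b
    using lin_slot[of f u v "us @ [w]" vs a b] that f lq by simp
qed (use alternating_real[OF f _ lq] in simp)

end

section \<open>The multiplicative flow and averages along it\<close>

lemma scaleC_diff_left: "scaleC (a - b) (x::'a::complex_vector) = scaleC a x - scaleC b x"
  using scaleC_add_left[of "a - b" b x] by (simp add: algebra_simps)

lemma scaleC_diff_right: "scaleC a (x - y :: 'a::complex_vector) = scaleC a x - scaleC a y"
  using scaleC_add_right[of a "x - y" y] by (simp add: algebra_simps)

lemma scaleC_zero_right [simp]: "scaleC a (0::'a::complex_vector) = 0"
  using scaleC_diff_right[of a 0 0] by simp

lemma dist_scaleC: "dist (scaleC a x) (scaleC a (y::'a::complex_normed_vector)) = cmod a * dist x y"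
  by (simp add: dist_norm norm_scaleC flip: scaleC_diff_right)

lemma dist_scaleC_left: "dist (scaleC a x) (scaleC b (x::'a::complex_normed_vector)) = cmod (a - b) * norm x"
  by (simp add: dist_norm norm_scaleC flip: scaleC_diff_left)

lemma tendsto_scaleC:
  fixes g :: "'b \<Rightarrow> 'a::complex_normed_vector"
  assumes "(f \<longlongrightarrow> a) F" "(g \<longlongrightarrow> x) F"
  shows "((\<lambda>t. scaleC (f t) (g t)) \<longlongrightarrow> scaleC a x) F"
proof -
  have "((\<lambda>t. cmod (f t) * norm (g t - x) + cmod (f t - a) * norm x) \<longlongrightarrow> cmod a * norm (x - x) + cmod (a - a) * norm x) F"
    by (intro tendsto_intros assms)
  then have *: "((\<lambda>t. cmod (f t) * norm (g t - x) + cmod (f t - a) * norm x) \<longlongrightarrow> 0) F" by simp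
  have "norm (scaleC (f t) (g t) - scaleC a x) \<le> cmod (f t) * norm (g t - x) + cmod (f t - a) * norm x" for t
  proof -
    have "scaleC (f t) (g t) - scaleC a x = scaleC (f t) (g t - x) + scaleC (f t - a) x"
      by (simp add: scaleC_diff_left scaleC_diff_right)
    then show ?thesis by (metis norm_scaleC norm_triangle_ineq)
  qed
  then have "((\<lambda>t. scaleC (f t) (g t) - scaleC a x) \<longlongrightarrow> 0) F"
    by - (rule Lim_null_comparison[OF _ *], auto)
  then show ?thesis by (rule LIM_zero_cancel)
qed

lemma continuous_on_scaleC [continuous_intros]:
  fixes g :: "'b::topological_space \<Rightarrow> 'a::complex_normed_vector"
  shows "continuous_on S f \<Longrightarrow> continuous_on S g \<Longrightarrow> continuous_on S (\<lambda>t. scaleC (f t) (g t))"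
  unfolding continuous_on_def by (auto intro: tendsto_scaleC)

text \<open>On the left half-plane, which is convex, the derivative of the exponential has modulus
  at most 1. Inward motion with parameter \<open>w\<close> therefore displaces a point by at most
  \<open>cmod w\<close> times its norm.\<close>

lemma norm_exp_minus_one_le:
  assumes "Re w \<le> 0" shows "cmod (exp w - 1) \<le> cmod w"
proof -
  have "norm (exp w - exp 0) \<le> 1 * norm (w - 0)"
  proof (rule field_differentiable_bound[where S = "{z. Re z \<le> 0}" and f' = exp])
    show "convex {z. Re z \<le> 0}" by (rule convex_halfspace_Re_le)
    show "(exp has_field_derivative exp z) (at z within {z. Re z \<le> 0})" for z
      by (rule DERIV_exp[THEN has_field_derivative_at_within])
  qed (use assms in auto)
  then show ?thesis by simp
qed

lemma vderiv_seq:
  fixes g :: "real \<Rightarrow> complex"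
  assumes "(g has_vector_derivative d) (at 0)" "t \<longlonglongrightarrow> 0" "\<And>n. t n \<noteq> 0"
  shows "(\<lambda>n. (g (t n) - g 0) / of_real (t n)) \<longlonglongrightarrow> d"
proof -
  have "((\<lambda>h. norm (g (0 + h) - g 0 - h *\<^sub>R d) / norm h) \<longlongrightarrow> 0) (at 0)"
    using assms(1) unfolding has_vector_derivative_def has_derivative_at by blast
  moreover have "filterlim t (at 0) sequentially"
    using assms by (simp add: filterlim_at)
  ultimately have "(\<lambda>n. norm (g (0 + t n) - g 0 - t n *\<^sub>R d) / norm (t n)) \<longlonglongrightarrow> 0"
    by (rule filterlim_compose)
  moreover have "norm (g (0 + t n) - g 0 - t n *\<^sub>R d) / norm (t n) = cmod ((g (t n) - g 0) / of_real (t n) - d)" for n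
  proof -
    have "(g (t n) - g 0) / of_real (t n) - d = (g (t n) - g 0 - of_real (t n) * d) / of_real (t n)"
      using assms(3)[of n] by (simp add: field_simps)
    then show ?thesis by (simp add: norm_divide scaleR_conv_of_real)
  qed
  ultimately have "(\<lambda>n. cmod ((g (t n) - g 0) / of_real (t n) - d)) \<longlonglongrightarrow> 0" by simp
  then have "(\<lambda>n. (g (t n) - g 0) / of_real (t n) - d) \<longlonglongrightarrow> 0" by (rule tendsto_norm_zero_cancel)
  then show ?thesis by (rule LIM_zero_cancel)
qed

definition dil :: "complex \<Rightarrow> ('a::complex_normed_vector \<Rightarrow> complex) \<Rightarrow> 'a \<Rightarrow> complex" where
  "dil \<zeta> f = (\<lambda>x. f (scaleC (exp \<zeta>) x))"

lemma dil_dil: "dil a (dil b f) = dil (a + b) f"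
  by (auto simp: dil_def scaleC_scaleC exp_add mult.commute)

lemma dil_0 [simp]: "dil 0 f = f"
  by (simp add: dil_def scaleC_one)

lemma dil_lipschitz:
  assumes "C-lipschitz_on (ball 0 R) f" "exp (Re \<zeta>) * r \<le> R"
  shows "(exp (Re \<zeta>) * C)-lipschitz_on (ball 0 r) (dil \<zeta> f)"
proof (rule lipschitz_onI)
  show "0 \<le> exp (Re \<zeta>) * C" using lipschitz_on_nonneg[OF assms(1)] by simp
  fix x y :: 'a assume "x \<in> ball 0 r" "y \<in> ball 0 r"
  then have "norm x < r" "norm y < r" by auto
  then have "exp (Re \<zeta>) * norm x < exp (Re \<zeta>) * r" "exp (Re \<zeta>) * norm y < exp (Re \<zeta>) * r" by auto
  then have "exp (Re \<zeta>) * norm x < R" "exp (Re \<zeta>) * norm y < R" using assms(2) by linarith+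
  then have "scaleC (exp \<zeta>) x \<in> ball 0 R" "scaleC (exp \<zeta>) y \<in> ball 0 R"
    by (simp_all add: norm_scaleC)
  from lipschitz_onD[OF assms(1) this]
  show "dist (dil \<zeta> f x) (dil \<zeta> f y) \<le> exp (Re \<zeta>) * C * dist x y"
    by (simp add: dil_def dist_scaleC mult_ac)
qed

lemma is_qlip_dil [simp, intro]: "is_qlip f \<Longrightarrow> is_qlip (dil \<zeta> f)"
  unfolding is_qlip_iff using dil_lipschitz[OF is_qlip_lipc order_refl, unfolded is_qlip_iff]
  by (metis dil_lipschitz order_refl)

lemma lipc_dil:
  assumes "is_qlip f" "exp (Re \<zeta>) * r \<le> R"
  shows "lipc (ball 0 r) (dil \<zeta> f) \<le> exp (Re \<zeta>) * lipc (ball 0 R) f"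
  by (rule lipc_le[OF dil_lipschitz[OF is_qlip_lipc[OF assms(1)] assms(2)]])

text \<open>Parameter and function vary together. All moved points lie in one ball, on which the
  functions are equi-Lipschitz, so convergence at the limit point alone controls the values.\<close>

lemma qconv_dil_seq:
  assumes "qconv F f" "z \<longlonglongrightarrow> \<zeta>"
  shows "qconv (\<lambda>n. dil (z n) (F n)) (dil \<zeta> f)"
proof -
  have "Bseq z" using assms(2) convergent_imp_Bseq convergent_def by blast
  then obtain b where b: "\<And>n. cmod (z n) \<le> b" unfolding Bseq_def by blast
  have Re: "Re (z n) \<le> b" for n using b[of n] complex_Re_le_cmod[of "z n"] by linarith
  show ?thesis
    unfolding qconv_def
  proof (intro conjI allI)
    show "eqlip (\<lambda>n. dil (z n) (F n))"
    proof (rule eqlipI)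
      fix R :: real assume R: "R > 0"
      obtain C where C: "\<And>n. C-lipschitz_on (ball 0 (exp b * R)) (F n)"
        using assms(1) unfolding qconv_def eqlip_def by blast
      have "(exp b * C)-lipschitz_on (ball 0 R) (dil (z n) (F n))" for n
      proof -
        have "exp (Re (z n)) * R \<le> exp b * R" using Re R by simp
        from dil_lipschitz[OF C this] have "(exp (Re (z n)) * C)-lipschitz_on (ball 0 R) (dil (z n) (F n))" .
        then show ?thesis
          by (rule lipschitz_on_le) (use Re lipschitz_on_nonneg[OF C] in \<open>simp add: mult_right_mono\<close>)
      qed
      then show "\<exists>C. \<forall>n. C-lipschitz_on (ball 0 R) (dil (z n) (F n))" by blast
    qed
    fix x :: 'a
    define y where "y n = scaleC (exp (z n)) x" for n
    have y: "y \<longlonglongrightarrow> scaleC (exp \<zeta>) x" unfolding y_def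
      by (intro tendsto_scaleC tendsto_intros assms(2))
    obtain C where C: "\<And>n. C-lipschitz_on (ball 0 (exp b * norm x + norm (scaleC (exp \<zeta>) x) + 1)) (F n)"
      using assms(1) unfolding qconv_def eqlip_def by blast
    have "dist (F n (y n)) (F n (scaleC (exp \<zeta>) x)) \<le> C * dist (y n) (scaleC (exp \<zeta>) x)" for n
    proof (rule lipschitz_onD[OF C])
      have "norm (y n) \<le> exp b * norm x" unfolding y_def by (simp add: norm_scaleC Re mult_right_mono)
      then show "y n \<in> ball 0 (exp b * norm x + norm (scaleC (exp \<zeta>) x) + 1)"
        by (simp add: add.commute add_strict_increasing)
           (smt (verit) norm_ge_zero)
    qed (simp add: add_nonneg_pos add_pos_nonneg)
    moreover have "(\<lambda>n. C * dist (y n) (scaleC (exp \<zeta>) x)) \<longlonglongrightarrow> C * 0"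
      by (intro tendsto_intros y[unfolded tendsto_dist_iff[of y]])
    ultimately have "(\<lambda>n. F n (y n) - F n (scaleC (exp \<zeta>) x)) \<longlonglongrightarrow> 0"
      by - (rule Lim_null_comparison[where g = "\<lambda>n. C * dist (y n) (scaleC (exp \<zeta>) x)"], auto simp: dist_norm)
    from tendsto_add[OF this qconv_tendsto[OF assms(1), of "scaleC (exp \<zeta>) x"]]
    show "(\<lambda>n. dil (z n) (F n) x) \<longlonglongrightarrow> dil \<zeta> f x" by (simp add: dil_def y_def)
  qed
qed

lemma qconv_dil: "qconv F f \<Longrightarrow> qconv (\<lambda>n. dil \<zeta> (F n)) (dil \<zeta> f)"
  by (rule qconv_dil_seq) auto

lemma qlip_orbit_continuous:
  fixes f :: "'a::complex_normed_vector \<Rightarrow> complex"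
  assumes "is_qlip f" "continuous_on S g"
  shows "continuous_on S (\<lambda>t. f (scaleC (exp (g t)) x))"
proof -
  have "continuous_on S (\<lambda>t. exp (g t))" by (intro continuous_on_exp assms(2))
  then have "continuous_on S (\<lambda>t. scaleC (exp (g t)) x)" by (rule continuous_on_scaleC) (rule continuous_on_const)
  then show ?thesis by (rule continuous_on_compose2[OF is_qlip_continuous[OF assms(1)]]) simp
qed

text \<open>Length and direction of the averaging path are both carried by \<open>a\<close>, over a
  fixed time interval: there is no normalizing factor, and \<open>a = 0\<close> gives the
  identity.\<close>

definition Av :: "complex \<Rightarrow> ('a::complex_normed_vector \<Rightarrow> complex) \<Rightarrow> 'a \<Rightarrow> complex" where
  "Av a f x = integral {0..1} (\<lambda>u. f (flow a u x))"

lemma Av_continuous: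
  fixes f :: "'a::complex_normed_vector \<Rightarrow> complex"
  shows "is_qlip f \<Longrightarrow> continuous_on S (\<lambda>u. f (flow a u x))"
  by (rule qlip_orbit_continuous) (auto intro!: continuous_intros)

lemma Av_integrable:
  fixes f :: "'a::complex_normed_vector \<Rightarrow> complex"
  shows "is_qlip f \<Longrightarrow> (\<lambda>u. f (flow a u x)) integrable_on {0..1::real}"
  by (intro integrable_continuous_real Av_continuous)

lemma integral_01_bound:
  fixes g :: "real \<Rightarrow> complex"
  assumes "continuous_on {0..1} g" "\<And>u. u \<in> {0..1} \<Longrightarrow> cmod (g u) \<le> B"
  shows "cmod (integral {0..1} g) \<le> B"
  using integral_bound[of 0 1 g B] assms by simp

lemma Av_lipschitz_gen:
  assumes f: "is_qlip f" and "C-lipschitz_on (ball 0 (exp b * R)) f" and b: "0 \<le> b" "Re a \<le> b" and R: "R > 0"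
  shows "(exp b * C)-lipschitz_on (ball 0 R) (Av a f)"
proof (rule lipschitz_onI)
  have C0: "0 \<le> C" using lipschitz_on_nonneg[OF assms(2)] .
  then show "0 \<le> exp b * C" by simp
  fix x y :: 'a assume xy: "x \<in> ball 0 R" "y \<in> ball 0 R"
  have "Av a f x - Av a f y = integral {0..1} (\<lambda>u. f (flow a u x) - f (flow a u y))"
    unfolding Av_def by (rule integral_diff[symmetric]) (intro Av_integrable f)+
  also have "cmod \<dots> \<le> exp b * C * dist x y"
  proof (rule integral_01_bound)
    show "continuous_on {0..1} (\<lambda>u. f (flow a u x) - f (flow a u y))"
      by (intro continuous_intros Av_continuous f)
    fix u :: real assume u: "u \<in> {0..1}"
    have "u * Re a \<le> u * b" using u b by (intro mult_left_mono) auto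
    also have "\<dots> \<le> 1 * b" using u b by (intro mult_right_mono) auto
    finally have ub: "Re (of_real u * a) \<le> b" by simp
    then have "exp (Re (of_real u * a)) * R \<le> exp b * R" using R by simp
    from lipschitz_onD[OF dil_lipschitz[OF assms(2) this] xy]
    have "cmod (f (flow a u x) - f (flow a u y)) \<le> exp (Re (of_real u * a)) * C * dist x y"
      by (simp add: dil_def dist_norm)
    also have "\<dots> \<le> exp b * C * dist x y" using ub C0 by (intro mult_right_mono) auto
    finally show "cmod (f (flow a u x) - f (flow a u y)) \<le> exp b * C * dist x y" .
  qed
  finally show "dist (Av a f x) (Av a f y) \<le> exp b * C * dist x y" by (simp add: dist_norm)
qed

lemma is_qlip_Av [simp, intro]: "is_qlip f \<Longrightarrow> is_qlip (Av a f)"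
  by (rule is_qlipI, rule exI, rule Av_lipschitz_gen[where b = "\<bar>Re a\<bar>", OF _ is_qlip_lipc]) auto

text \<open>For \<open>Re a \<le> 0\<close> the path runs inward or along a sphere, so neither the
  ball nor the Lipschitz constant has to grow. The mass bounds for the extended cone rely on this
  exact constant.\<close>

lemma Av_lipschitz:
  assumes "is_qlip f" "C-lipschitz_on (ball 0 R) f" "Re a \<le> 0" "R > 0"
  shows "C-lipschitz_on (ball 0 R) (Av a f)"
  using Av_lipschitz_gen[of f C 0 R a] assms by simp

lemma qconv_Av:
  assumes "qconv F f"
  shows "qconv (\<lambda>n. Av a (F n)) (Av a f)"
  unfolding qconv_def
proof (intro conjI allI)
  show "eqlip (\<lambda>n. Av a (F n))"
  proof (rule eqlipI)
    fix R :: real assume R: "R > 0"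
    obtain C where C: "\<And>n. C-lipschitz_on (ball 0 (exp \<bar>Re a\<bar> * R)) (F n)"
      using assms(1) unfolding qconv_def eqlip_def by blast
    have "(exp \<bar>Re a\<bar> * C)-lipschitz_on (ball 0 R) (Av a (F n))" for n
      by (rule Av_lipschitz_gen[OF qconv_qlip[OF assms] C]) (use R in auto)
    then show "\<exists>C. \<forall>n. C-lipschitz_on (ball 0 R) (Av a (F n))" by blast
  qed
  fix x :: 'a
  obtain B where B: "\<And>n y. y \<in> ball 0 (exp \<bar>Re a\<bar> * norm x + 1) \<Longrightarrow> cmod (F n y) \<le> B"
    using qconv_bounded[OF assms] by metis
  show "(\<lambda>n. Av a (F n) x) \<longlonglongrightarrow> Av a f x"
    unfolding Av_def
  proof (rule dominated_convergence(2)[where h = "\<lambda>_. B"])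
    show "(\<lambda>u. F n (flow a u x)) integrable_on {0..1}" for n
      by (rule Av_integrable[OF qconv_qlip[OF assms]])
    show "(\<lambda>n. F n (flow a u x)) \<longlonglongrightarrow> f (flow a u x)" for u
      by (rule qconv_tendsto[OF assms])
    fix n and u :: real assume u: "u \<in> {0..1}"
    have "u * Re a \<le> u * \<bar>Re a\<bar>" using u by (intro mult_left_mono) auto
    also have "\<dots> \<le> 1 * \<bar>Re a\<bar>" using u by (intro mult_right_mono) auto
    finally have "exp (Re (of_real u * a)) * norm x \<le> exp \<bar>Re a\<bar> * norm x"
      by (intro mult_right_mono) auto
    then show "cmod (F n (flow a u x)) \<le> B"
      by (intro B) (simp add: norm_scaleC)
  qed (simp add: integrable_const_ivl)
qed

lemma Av_close:
  assumes f: "is_qlip f" and C: "C-lipschitz_on (ball 0 R) f" and a: "Re a \<le> 0" and x: "norm x < R"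
  shows "cmod (Av a f x - f x) \<le> C * R * cmod a"
proof -
  have C0: "0 \<le> C" using lipschitz_on_nonneg[OF C] .
  have R: "R > 0" using x by (meson norm_ge_zero le_less_trans)
  have "Av a f x - f x = integral {0..1} (\<lambda>u. f (flow a u x) - f x)"
    unfolding Av_def by (subst integral_diff) (auto intro!: Av_integrable f)
  also have "cmod \<dots> \<le> C * R * cmod a"
  proof (rule integral_01_bound)
    show "continuous_on {0..1} (\<lambda>u. f (flow a u x) - f x)"
      by (intro continuous_intros Av_continuous f)
    fix u :: real assume u: "u \<in> {0..1}"
    have Re: "Re (of_real u * a) \<le> 0" using u a by (simp add: mult_nonneg_nonpos)
    have "exp (Re (of_real u * a)) * norm x \<le> 1 * norm x" using Re by (intro mult_right_mono) auto
    then have "flow a u x \<in> ball 0 R" using x by (simp add: norm_scaleC)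
    from lipschitz_onD[OF C this, of x] x
    have "dist (f (flow a u x)) (f x) \<le> C * dist (flow a u x) x" by simp
    also have "dist (flow a u x) x = cmod (exp (of_real u * a) - 1) * norm x"
      using dist_scaleC_left[of _ x 1] by (simp add: scaleC_one)
    also have "C * (cmod (exp (of_real u * a) - 1) * norm x) \<le> C * (cmod a * R)"
    proof (intro mult_left_mono mult_mono C0)
      have "cmod (exp (of_real u * a) - 1) \<le> cmod (of_real u * a)" by (rule norm_exp_minus_one_le[OF Re])
      also have "\<dots> \<le> 1 * cmod a" using u by (simp add: norm_mult mult_left_le_one_le)
      finally show "cmod (exp (of_real u * a) - 1) \<le> cmod a" by simp
    qed (use x in auto)
    finally show "cmod (f (flow a u x) - f x) \<le> C * R * cmod a"
      by (simp add: dist_norm mult_ac)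
  qed
  finally show ?thesis .
qed

text \<open>Dilations commute, so this is an exchange of two integrals over the unit square. It
  allows the average in the direction of differentiation to be made the outer one.\<close>

lemma Av_swap:
  assumes "is_qlip f" shows "Av a (Av b f) = Av b (Av a f)"
proof
  fix x :: 'a
  have c: "continuous_on (cbox (0,0) (1,1)) (\<lambda>(u, v). f (scaleC (exp (complex_of_real u * a + of_real v * b)) x))"
    unfolding case_prod_beta by (intro qlip_orbit_continuous assms continuous_intros)
  have "Av a (Av b f) x = integral {0..1} (\<lambda>u. integral {0..1} (\<lambda>v. f (scaleC (exp (of_real u * a + of_real v * b)) x)))"
    unfolding Av_def by (simp add: scaleC_scaleC exp_add mult.commute)
  also have "\<dots> = integral {0..1} (\<lambda>v. integral {0..1} (\<lambda>u. f (scaleC (exp (of_real u * a + of_real v * b)) x)))"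
    using integral_swap_continuous[OF c] by simp
  also have "\<dots> = Av b (Av a f) x"
    unfolding Av_def by (simp add: scaleC_scaleC exp_add mult.commute)
  finally show "Av a (Av b f) x = Av b (Av a f) x" .
qed

text \<open>Along the orbit the average is the integral of a continuous function over a sliding
  window of length 1, so its derivative is the difference of the values at the two ends.\<close>

lemma Av_has_derivative:
  assumes f: "is_qlip f"
  shows "((\<lambda>t. Av a f (flow a t x)) has_vector_derivative (f (scaleC (exp a) x) - f x)) (at 0)"
proof -
  define \<phi> where "\<phi> u = f (flow a u x)" for u
  have c: "continuous_on S \<phi>" for S unfolding \<phi>_def by (rule Av_continuous[OF f])
  \<comment> \<open>The base point -2 only keeps the times 0 and 1, and all windows for
    \<open>t\<close> between -1 and 1, inside an interval on which the primitive is
    differentiable.\<close>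
  define \<Psi> where "\<Psi> t = integral {-2..t} \<phi>" for t
  have d: "(\<Psi> has_vector_derivative \<phi> t) (at t)" if "t \<in> {-2<..<3}" for t
  proof -
    have "(\<Psi> has_vector_derivative \<phi> t) (at t within {-2..3})"
      unfolding \<Psi>_def by (rule integral_has_vector_derivative) (use c that in auto)
    then show ?thesis using that by (metis at_within_interior interior_atLeastAtMost_real)
  qed
  have eq: "Av a f (flow a t x) = \<Psi> (1 + t) - \<Psi> t" if "t \<in> {-1<..<1}" for t
  proof -
    have "Av a f (flow a t x) = integral {0..1} (\<phi> \<circ> ((+) t))"
      unfolding Av_def \<phi>_def by (simp add: scaleC_scaleC exp_add[symmetric] algebra_simps o_def)
    also have "\<dots> = integral {0+t..1+t} \<phi>" by (rule integral_shift_Icc_real)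
    also have "\<dots> = \<Psi> (1 + t) - \<Psi> t"
    proof -
      have "integral {-2..t} \<phi> + integral {t..1+t} \<phi> = integral {-2..1+t} \<phi>"
        by (rule Henstock_Kurzweil_Integration.integral_combine) (use that c in \<open>auto intro: integrable_continuous_real\<close>)
      then show ?thesis unfolding \<Psi>_def by (simp add: algebra_simps)
    qed
    finally show ?thesis .
  qed
  have "((\<lambda>t. \<Psi> (1 + t) - \<Psi> t) has_vector_derivative (\<phi> 1 - \<phi> 0)) (at 0)"
  proof (rule has_vector_derivative_diff)
    have "((\<lambda>t. 1 + t) has_vector_derivative 1) (at (0::real))"
      by (auto intro!: derivative_eq_intros simp: has_vector_derivative_def)
    from vector_diff_chain_at[OF this, of \<Psi> "\<phi> 1"] d[of 1]
    show "((\<lambda>t. \<Psi> (1 + t)) has_vector_derivative \<phi> 1) (at 0)" by (simp add: o_def)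
    show "(\<Psi> has_vector_derivative \<phi> 0) (at 0)" by (rule d) simp
  qed
  then have "((\<lambda>t. Av a f (flow a t x)) has_vector_derivative (\<phi> 1 - \<phi> 0)) (at 0)"
    by (rule has_vector_derivative_transform_within_open[where S = "{-1<..<1}"]) (auto simp: eq)
  then show ?thesis by (simp add: \<phi>_def scaleC_one)
qed

subsection \<open>Functions differentiable along the flow\<close>

definition ddir :: "complex \<Rightarrow> ('a::complex_normed_vector \<Rightarrow> complex) \<Rightarrow> 'a \<Rightarrow> complex" where
  "ddir a f x = vector_derivative (\<lambda>t. f (flow a t x)) (at 0)"

text \<open>Differentiability is asked along orbits only, in the radial and the rotational
  direction, which is all that contraction with the Euler field sees. The derivatives must be
  locally Lipschitz because they become coefficients and slots of \<open>T\<close>.\<close>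

definition smooth :: "('a::complex_normed_vector \<Rightarrow> complex) \<Rightarrow> bool" where
  "smooth f \<longleftrightarrow> is_qlip f \<and> (\<forall>a\<in>{1,\<i>}. is_qlip (ddir a f) \<and>
     (\<forall>x. ((\<lambda>t. f (flow a t x)) has_vector_derivative ddir a f x) (at 0)))"

abbreviation smooths :: "('a::complex_normed_vector \<Rightarrow> complex) list \<Rightarrow> bool" where
  "smooths \<pi>s \<equiv> \<forall>\<pi>\<in>set \<pi>s. smooth \<pi>"

text \<open>With \<open>z = e\<^sup>\<zeta>\<close>, \<open>dba f\<close> is twice the \<open>\<zeta>\<close>-antiholomorphic derivative of \<open>f(e\<^sup>\<zeta> x)\<close> at \<open>\<zeta> = 0\<close>.\<close>

definition dba :: "('a::complex_normed_vector \<Rightarrow> complex) \<Rightarrow> 'a \<Rightarrow> complex" where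
  "dba f x = ddir 1 f x + \<i> * ddir \<i> f x"

lemma ddir_eqI:
  "((\<lambda>t. f (flow a t x)) has_vector_derivative d) (at 0) \<Longrightarrow> ddir a f x = d"
  unfolding ddir_def by (rule vector_derivative_at)

lemma smooth_qlip: "smooth f \<Longrightarrow> is_qlip f" by (simp add: smooth_def)

lemma smooth_deriv: "smooth f \<Longrightarrow> a \<in> {1,\<i>} \<Longrightarrow>
    ((\<lambda>t. f (flow a t x)) has_vector_derivative ddir a f x) (at 0)"
  by (auto simp: smooth_def)

lemma smooth_ddir_qlip: "smooth f \<Longrightarrow> a \<in> {1,\<i>} \<Longrightarrow> is_qlip (ddir a f)"
  by (auto simp: smooth_def)

lemma smooth_dba_qlip: "smooth f \<Longrightarrow> is_qlip (dba f)"
  unfolding dba_def[abs_def] by (intro is_qlip_add is_qlip_mult is_qlip_const smooth_ddir_qlip) auto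

lemma smoothI:
  assumes "is_qlip f"
    and "\<And>a. a \<in> {1,\<i>} \<Longrightarrow> is_qlip (g a)"
    and "\<And>a x. a \<in> {1,\<i>} \<Longrightarrow> ((\<lambda>t. f (flow a t x)) has_vector_derivative g a x) (at 0)"
  shows "smooth f" and "\<And>a. a \<in> {1,\<i>} \<Longrightarrow> ddir a f = g a"
proof -
  show e: "ddir a f = g a" if "a \<in> {1,\<i>}" for a using ddir_eqI[OF assms(3)[OF that]] by auto
  show "smooth f" unfolding smooth_def using assms e by auto
qed

lemma smooth_lincomb:
  assumes f: "smooth f" and g: "smooth g"
  shows "smooth (\<lambda>x. c * f x + d * g x)" "dba (\<lambda>x. c * f x + d * g x) = (\<lambda>x. c * dba f x + d * dba g x)"
proof -
  note s = smoothI[of "\<lambda>x. c * f x + d * g x" "\<lambda>a x. c * ddir a f x + d * ddir a g x"]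
  have 1: "is_qlip (\<lambda>x. c * f x + d * g x)" by (intro is_qlip_lincomb smooth_qlip f g)
  have 2: "is_qlip (\<lambda>x. c * ddir a f x + d * ddir a g x)" if "a \<in> {1,\<i>}" for a
    by (intro is_qlip_lincomb smooth_ddir_qlip f g that)
  have 3: "((\<lambda>t. c * f (flow a t x) + d * g (flow a t x))
      has_vector_derivative (c * ddir a f x + d * ddir a g x)) (at 0)" if "a \<in> {1,\<i>}" for a x
    by (intro has_vector_derivative_add has_vector_derivative_mult_right smooth_deriv f g that)
  show "smooth (\<lambda>x. c * f x + d * g x)" by (rule s(1)[OF 1 2 3])
  show "dba (\<lambda>x. c * f x + d * g x) = (\<lambda>x. c * dba f x + d * dba g x)"
    unfolding dba_def using s(2)[OF 1 2 3] by (auto simp: algebra_simps)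
qed

lemma smooth_mult:
  assumes f: "smooth f" and g: "smooth g"
  shows "smooth (\<lambda>x. f x * g x)" "dba (\<lambda>x. f x * g x) = (\<lambda>x. f x * dba g x + g x * dba f x)"
proof -
  note s = smoothI[of "\<lambda>x. f x * g x" "\<lambda>a x. f x * ddir a g x + ddir a f x * g x"]
  have 1: "is_qlip (\<lambda>x. f x * g x)" by (intro is_qlip_mult smooth_qlip f g)
  have 2: "is_qlip (\<lambda>x. f x * ddir a g x + ddir a f x * g x)" if "a \<in> {1,\<i>}" for a
    by (intro is_qlip_add is_qlip_mult smooth_qlip smooth_ddir_qlip f g that)
  have 3: "((\<lambda>t. f (flow a t x) * g (flow a t x))
      has_vector_derivative (f x * ddir a g x + ddir a f x * g x)) (at 0)" if "a \<in> {1,\<i>}" for a x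
    using has_vector_derivative_mult[OF smooth_deriv[OF f that, of x] smooth_deriv[OF g that, of x]]
    by (simp add: scaleC_one)
  show "smooth (\<lambda>x. f x * g x)" by (rule s(1)[OF 1 2 3])
  show "dba (\<lambda>x. f x * g x) = (\<lambda>x. f x * dba g x + g x * dba f x)"
    unfolding dba_def using s(2)[OF 1 2 3] by (auto simp: algebra_simps)
qed

lemma smooth_dil:
  assumes f: "smooth f"
  shows "smooth (dil \<zeta> f)" "\<And>a. a \<in> {1,\<i>} \<Longrightarrow> ddir a (dil \<zeta> f) = dil \<zeta> (ddir a f)" "dba (dil \<zeta> f) = dil \<zeta> (dba f)"
proof -
  note s = smoothI[of "dil \<zeta> f" "\<lambda>a. dil \<zeta> (ddir a f)"]
  have 1: "is_qlip (dil \<zeta> f)" by (intro is_qlip_dil smooth_qlip f)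
  have 2: "is_qlip (dil \<zeta> (ddir a f))" if "a \<in> {1,\<i>}" for a
    by (intro is_qlip_dil smooth_ddir_qlip f that)
  have 3: "((\<lambda>t. dil \<zeta> f (flow a t x))
      has_vector_derivative dil \<zeta> (ddir a f) x) (at 0)" if "a \<in> {1,\<i>}" for a x
    using smooth_deriv[OF f that, of "scaleC (exp \<zeta>) x"] by (simp add: dil_def scaleC_scaleC mult.commute)
  show "smooth (dil \<zeta> f)" by (rule s(1)[OF 1 2 3])
  show e: "ddir a (dil \<zeta> f) = dil \<zeta> (ddir a f)" if "a \<in> {1,\<i>}" for a by (rule s(2)[OF 1 2 3 that])
  show "dba (dil \<zeta> f) = dil \<zeta> (dba f)"
    unfolding dba_def using e by (auto simp: dil_def)
qed

lemma smooth_const [simp]: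
  "smooth (\<lambda>x::'a::complex_normed_vector. c)" "dba (\<lambda>x::'a::complex_normed_vector. c) = (\<lambda>x. 0)"
proof -
  note s = smoothI[of "\<lambda>x::'a. c" "\<lambda>a x. 0"]
  show "smooth (\<lambda>x::'a. c)" by (rule s(1)) auto
  have "ddir a (\<lambda>x::'a. c) = (\<lambda>x. 0)" if "a \<in> {1,\<i>}" for a
    by (rule s(2)[OF _ _ _ that]) auto
  then show "dba (\<lambda>x::'a. c) = (\<lambda>x. 0)" unfolding dba_def by simp
qed

lemma dba_bound:
  assumes f: "smooth f" and C: "C-lipschitz_on (ball 0 R) f" and x: "norm x < R"
  shows "cmod (dba f x) \<le> 2 * (C * norm x)"
proof -
  have C0: "0 \<le> C" using lipschitz_on_nonneg[OF C] .
  have "cmod (ddir a f x) \<le> C * norm x" if a: "a \<in> {1,\<i>}" for a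
  proof -
    let ?g = "\<lambda>t. f (flow a t x)"
    \<comment> \<open>Negative times: for \<open>a = 1\<close> they move \<open>x\<close> inward, so
      the points of the difference quotients stay in the ball where \<open>C\<close> is
      valid.\<close>
    define t where "t n = - inverse (real (Suc n))" for n
    have t0: "t n \<noteq> 0" and tneg: "t n < 0" for n unfolding t_def by auto
    have "t \<longlonglongrightarrow> 0" unfolding t_def using tendsto_minus[OF LIMSEQ_inverse_real_of_nat] by simp
    from vderiv_seq[OF smooth_deriv[OF f a] this t0]
    have lim: "(\<lambda>n. (?g (t n) - ?g 0) / of_real (t n)) \<longlonglongrightarrow> ddir a f x" by simp
    have le: "cmod ((?g (t n) - ?g 0) / of_real (t n)) \<le> C * norm x" for n
    proof -
      have Re: "Re (of_real (t n) * a) \<le> 0" using a tneg[of n] by auto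
      have na: "cmod (of_real (t n) * a) = \<bar>t n\<bar>" using a by (auto simp: norm_mult)
      have "exp (Re (of_real (t n) * a)) * norm x \<le> 1 * norm x" using Re by (intro mult_right_mono) auto
      then have "scaleC (exp (of_real (t n) * a)) x \<in> ball 0 R" using x by (simp add: norm_scaleC)
      from lipschitz_onD[OF C this, of x] x
      have "dist (?g (t n)) (f x) \<le> C * dist (scaleC (exp (of_real (t n) * a)) x) x" by simp
      also have "dist (scaleC (exp (of_real (t n) * a)) x) x = cmod (exp (of_real (t n) * a) - 1) * norm x"
        using dist_scaleC_left[of _ x 1] by (simp add: scaleC_one)
      also have "C * (cmod (exp (of_real (t n) * a) - 1) * norm x) \<le> C * (\<bar>t n\<bar> * norm x)"
        using norm_exp_minus_one_le[OF Re] na by (intro mult_left_mono mult_right_mono C0) auto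
      finally have "cmod (?g (t n) - ?g 0) \<le> (C * norm x) * \<bar>t n\<bar>"
        by (simp add: dist_norm mult_ac scaleC_one)
      then show ?thesis using t0[of n] by (simp add: norm_divide divide_le_eq)
    qed
    show ?thesis by (rule LIMSEQ_le_const2[OF tendsto_norm[OF lim]]) (use le in auto)
  qed
  from this[of 1] this[of \<i>] show ?thesis
    unfolding dba_def using norm_triangle_ineq[of "ddir 1 f x" "\<i> * ddir \<i> f x"] by (simp add: norm_mult)
qed

subsection \<open>Mollification\<close>

text \<open>An average over a small sector: rotation by angles up to \<open>h\<close> and radial
  shrinking. Both directions are needed for \<open>smooth\<close>, and the radial one points inward
  so that balls and Lipschitz constants are preserved.\<close>

definition mol :: "real \<Rightarrow> ('a::complex_normed_vector \<Rightarrow> complex) \<Rightarrow> 'a \<Rightarrow> complex" where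
  "mol h f = Av (of_real (- h)) (Av (\<i> * of_real h) f)"

lemma is_qlip_mol [simp, intro]: "is_qlip f \<Longrightarrow> is_qlip (mol h f)"
  by (simp add: mol_def is_qlip_Av)

lemma mol_lipschitz:
  assumes "is_qlip f" "C-lipschitz_on (ball 0 R) f" "0 \<le> h" "R > 0"
  shows "C-lipschitz_on (ball 0 R) (mol h f)"
  unfolding mol_def by (intro Av_lipschitz is_qlip_Av assms) (use assms in auto)

lemma lipc_mol: "is_qlip f \<Longrightarrow> 0 \<le> h \<Longrightarrow> R > 0 \<Longrightarrow> lipc (ball 0 R) (mol h f) \<le> lipc (ball 0 R) f"
  by (intro lipc_le mol_lipschitz is_qlip_lipc)

lemma mol_close:
  assumes f: "is_qlip f" and C: "C-lipschitz_on (ball 0 R) f" and h: "0 \<le> h" and x: "norm x < R"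
  shows "cmod (mol h f x - f x) \<le> 2 * C * R * h"
proof -
  have R: "R > 0" using x by (meson norm_ge_zero le_less_trans)
  have "cmod (mol h f x - Av (\<i> * of_real h) f x) \<le> C * R * cmod (of_real (- h))"
    unfolding mol_def by (rule Av_close[OF is_qlip_Av[OF f] Av_lipschitz[OF f C _ R] _ x]) (use h in auto)
  moreover have "cmod (Av (\<i> * of_real h) f x - f x) \<le> C * R * cmod (\<i> * of_real h)"
    by (rule Av_close[OF f C _ x]) simp
  ultimately show ?thesis
    using norm_triangle_ineq[of "mol h f x - Av (\<i> * of_real h) f x" "Av (\<i> * of_real h) f x - f x"] h
    by (simp add: norm_mult)
qed

lemma Av_deriv_scaled:
  assumes f: "is_qlip f" and c: "c \<noteq> 0"
  shows "((\<lambda>t. Av (of_real c * b) f (flow b t x)) has_vector_derivative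
     ((f (flow b c x) - f x) / of_real c)) (at 0)"
proof -
  have d: "((\<lambda>t. t / c) has_vector_derivative (1 / c)) (at (0::real))"
    using c by (auto intro!: derivative_eq_intros simp flip: has_real_derivative_iff_has_vector_derivative)
  have "((\<lambda>t. Av (of_real c * b) f (flow (of_real c * b) t x)) has_vector_derivative
     (f (flow b c x) - f x)) (at (0 / c))"
    using Av_has_derivative[OF f] by simp
  from vector_diff_chain_at[OF d this] show ?thesis
    using c by (simp add: o_def scaleR_conv_of_real field_simps)
qed

text \<open>The derivative of the mollification in direction \<open>a\<close>: differentiating an
  average along its own direction gives a difference quotient of the other average. For fixed
  \<open>h\<close> it is locally Lipschitz and depends continuously on \<open>f\<close>, without any
  differentiability of \<open>f\<close>.\<close>

definition molX :: "real \<Rightarrow> complex \<Rightarrow> ('a::complex_normed_vector \<Rightarrow> complex) \<Rightarrow> 'a \<Rightarrow> complex" where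
  "molX h a f = (if a = 1
     then (\<lambda>x. (1 / of_real h) * Av (\<i> * of_real h) f x + (- 1 / of_real h) * dil (of_real (- h)) (Av (\<i> * of_real h) f) x)
     else (\<lambda>x. (1 / of_real h) * dil (\<i> * of_real h) (Av (of_real (- h)) f) x + (- 1 / of_real h) * Av (of_real (- h)) f x))"

lemma smooth_mol:
  assumes f: "is_qlip f" and h: "h > 0"
  shows "smooth (mol h f)" "dba (mol h f) = (\<lambda>x. 1 * molX h 1 f x + \<i> * molX h \<i> f x)"
proof -
  note s = smoothI[of "mol h f" "\<lambda>a. molX h a f"]
  have 1: "is_qlip (mol h f)" using f by simp
  have 2: "is_qlip (molX h a f)" for a
    unfolding molX_def by (simp only: if_split) (intro conjI impI is_qlip_lincomb is_qlip_Av is_qlip_dil f)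
  have 3: "((\<lambda>t. mol h f (flow a t x)) has_vector_derivative molX h a f x) (at 0)"
    if "a \<in> {1,\<i>}" for a x
  proof (cases "a = 1")
    case True
    show ?thesis
      using Av_deriv_scaled[OF is_qlip_Av[OF f], of "-h" 1 "\<i> * of_real h" x] h
      by (simp add: True mol_def molX_def dil_def diff_divide_distrib)
  next
    case False
    then have a: "a = \<i>" using that by simp
    have "mol h f = Av (of_real h * \<i>) (Av (of_real (- h)) f)"
      unfolding mol_def by (simp add: Av_swap[OF f] mult.commute)
    then show ?thesis
      using Av_deriv_scaled[OF is_qlip_Av[OF f], of h \<i> "of_real (-h)" x] h
      by (simp add: a molX_def dil_def diff_divide_distrib mult.commute)
  qed
  show "smooth (mol h f)" by (rule s(1)[OF 1 2 3])
  show "dba (mol h f) = (\<lambda>x. 1 * molX h 1 f x + \<i> * molX h \<i> f x)"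
    unfolding dba_def using s(2)[OF 1 2 3] by auto
qed

lemma qconv_mol: "qconv F f \<Longrightarrow> qconv (\<lambda>n. mol h (F n)) (mol h f)"
  unfolding mol_def by (intro qconv_Av)

lemma qconv_dba_mol:
  assumes "qconv F f" "h > 0"
  shows "qconv (\<lambda>n. dba (mol h (F n))) (dba (mol h f))"
proof -
  have "qconv (\<lambda>n. molX h a (F n)) (molX h a f)" for a
  proof (cases "a = 1")
    case True
    show ?thesis unfolding molX_def if_P[OF True] by (intro qconv_lincomb qconv_Av qconv_dil assms)
  next
    case False
    show ?thesis unfolding molX_def if_not_P[OF False] by (intro qconv_lincomb qconv_Av qconv_dil assms)
  qed
  then have "qconv (\<lambda>n x. 1 * molX h 1 (F n) x + \<i> * molX h \<i> (F n) x) (\<lambda>x. 1 * molX h 1 f x + \<i> * molX h \<i> f x)"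
    by (intro qconv_lincomb)
  then show ?thesis
    using smooth_mol(2)[OF qconv_qlip[OF assms(1)] assms(2)] smooth_mol(2)[OF qconv_qlip_lim[OF assms(1)] assms(2)] by simp
qed

lemma qconv_mol_approx:
  assumes f: "is_qlip f" and h: "\<And>n. 0 \<le> h n" "h \<longlonglongrightarrow> 0"
  shows "qconv (\<lambda>n. mol (h n) f) f"
  unfolding qconv_def
proof (intro conjI allI)
  show "eqlip (\<lambda>n. mol (h n) f)"
  proof (rule eqlipI)
    fix R :: real assume "R > 0"
    then show "\<exists>C. \<forall>n. C-lipschitz_on (ball 0 R) (mol (h n) f)"
      using mol_lipschitz[OF f is_qlip_lipc[OF f] h(1)] by blast
  qed
  fix x :: 'a
  let ?C = "lipc (ball 0 (norm x + 1)) f"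
  have "cmod (mol (h n) f x - f x) \<le> 2 * ?C * (norm x + 1) * h n" for n
    by (rule mol_close[OF f is_qlip_lipc[OF f] h(1)]) simp
  moreover have "(\<lambda>n. 2 * ?C * (norm x + 1) * h n) \<longlonglongrightarrow> 2 * ?C * (norm x + 1) * 0"
    by (intro tendsto_intros h)
  ultimately have "(\<lambda>n. mol (h n) f x - f x) \<longlonglongrightarrow> 0"
    by - (rule Lim_null_comparison[where g = "\<lambda>n. 2 * ?C * (norm x + 1) * h n"], auto)
  then show "(\<lambda>n. mol (h n) f x) \<longlonglongrightarrow> f x" by (rule LIM_zero_cancel)
qed

section \<open>Contraction with the flow\<close>

lemma vderivI_seq:
  fixes g :: "real \<Rightarrow> complex"
  assumes "\<And>t. t \<longlonglongrightarrow> 0 \<Longrightarrow> (\<And>n. t n \<noteq> 0) \<Longrightarrow> (\<lambda>n. (g (t n) - g 0) / of_real (t n)) \<longlonglongrightarrow> d"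
  shows "(g has_vector_derivative d) (at 0)"
proof -
  have "((\<lambda>h. norm (g (0 + h) - g 0 - h *\<^sub>R d) / norm h) \<longlongrightarrow> 0) (at 0)"
    unfolding tendsto_at_iff_sequentially
  proof (intro allI impI)
    fix t :: "nat \<Rightarrow> real" assume t: "\<forall>i. t i \<in> UNIV - {0}" "t \<longlonglongrightarrow> 0"
    have "(\<lambda>n. (g (t n) - g 0) / of_real (t n) - d) \<longlonglongrightarrow> 0"
      using LIM_zero[OF assms[OF t(2)]] t(1) by auto
    from tendsto_norm_zero[OF this]
    show "((\<lambda>h. norm (g (0 + h) - g 0 - h *\<^sub>R d) / norm h) \<circ> t) \<longlonglongrightarrow> 0"
    proof (rule Lim_transform_eventually)
      show "\<forall>\<^sub>F n in sequentially. norm ((g (t n) - g 0) / of_real (t n) - d) = ((\<lambda>h. norm (g (0 + h) - g 0 - h *\<^sub>R d) / norm h) \<circ> t) n"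
      proof (intro always_eventually allI)
        fix n
        have "(g (t n) - g 0) / of_real (t n) - d = (g (t n) - g 0 - of_real (t n) * d) / of_real (t n)"
          using t(1) by (simp add: field_simps)
        then show "norm ((g (t n) - g 0) / of_real (t n) - d) = ((\<lambda>h. norm (g (0 + h) - g 0 - h *\<^sub>R d) / norm h) \<circ> t) n"
          by (simp add: norm_divide scaleR_conv_of_real)
      qed
    qed
  qed
  then show ?thesis unfolding has_vector_derivative_def has_derivative_at
    by (simp add: bounded_linear_scaleR_left)
qed

text \<open>The two lists are joined by hybrids that take their first \<open>j\<close> entries from
  one and the rest from the other; consecutive hybrids differ in one slot. \<open>P\<close> will be
  \<open>is_qlip\<close> or \<open>smooth\<close>.\<close>

lemma list_telescope:
  fixes \<Phi> :: "('a \<Rightarrow> complex) list \<Rightarrow> complex"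
  assumes add: "\<And>us u v vs. \<lbrakk>\<forall>\<pi>\<in>set us. P \<pi>; P u; P v; \<forall>\<pi>\<in>set vs. P \<pi>; Suc (length us + length vs) = n\<rbrakk> \<Longrightarrow>
      \<Phi> (us @ (\<lambda>x. u x - v x) # vs) = \<Phi> (us @ u # vs) - \<Phi> (us @ v # vs)"
    and l: "length \<pi>s = n" "length \<pi>s' = n" and P: "\<forall>\<pi>\<in>set \<pi>s. P \<pi>" "\<forall>\<pi>\<in>set \<pi>s'. P \<pi>"
  shows "\<Phi> \<pi>s - \<Phi> \<pi>s' = (\<Sum>j<n. \<Phi> (take j \<pi>s' @ (\<lambda>x. (\<pi>s ! j) x - (\<pi>s' ! j) x) # drop (Suc j) \<pi>s))"
proof -
  define \<Psi> where "\<Psi> j = \<Phi> (take j \<pi>s' @ drop j \<pi>s)" for j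
  have "\<Phi> (take j \<pi>s' @ (\<lambda>x. (\<pi>s ! j) x - (\<pi>s' ! j) x) # drop (Suc j) \<pi>s) = \<Psi> j - \<Psi> (Suc j)" if j: "j < n" for j
  proof -
    have "\<Phi> (take j \<pi>s' @ (\<lambda>x. (\<pi>s ! j) x - (\<pi>s' ! j) x) # drop (Suc j) \<pi>s)
        = \<Phi> (take j \<pi>s' @ \<pi>s ! j # drop (Suc j) \<pi>s) - \<Phi> (take j \<pi>s' @ \<pi>s' ! j # drop (Suc j) \<pi>s)"
      by (rule add) (use P l j in \<open>auto dest: in_set_takeD in_set_dropD\<close>)
    then show ?thesis using j l unfolding \<Psi>_def
      by (simp add: Cons_nth_drop_Suc take_Suc_conv_app_nth)
  qed
  then have "(\<Sum>j<n. \<Phi> (take j \<pi>s' @ (\<lambda>x. (\<pi>s ! j) x - (\<pi>s' ! j) x) # drop (Suc j) \<pi>s)) = (\<Sum>j<n. \<Psi> j - \<Psi> (Suc j))"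
    by simp
  also have "\<dots> = \<Psi> 0 - \<Psi> n" by (rule sum_lessThan_telescope')
  also have "\<dots> = \<Phi> \<pi>s - \<Phi> \<pi>s'" using l by (simp add: \<Psi>_def)
  finally show ?thesis by simp
qed

text \<open>The predicate \<open>P\<close> is abstract so that the lemma serves both
  \<open>T\<close> and its contraction, which alternate on different classes of slots.\<close>

lemma move_front:
  fixes \<Phi> :: "('a \<Rightarrow> complex) list \<Rightarrow> complex"
  assumes swp: "\<And>us u v vs. \<lbrakk>\<forall>\<pi>\<in>set us. P \<pi>; P u; P v; \<forall>\<pi>\<in>set vs. P \<pi>; Suc (Suc (length us + length vs)) = n\<rbrakk> \<Longrightarrow>
      \<Phi> (us @ u # v # vs) = - \<Phi> (us @ v # u # vs)"
    and "\<forall>\<pi>\<in>set us. P \<pi>" "P g" "\<forall>\<pi>\<in>set vs. P \<pi>" "Suc (length us + length vs) = n"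
  shows "\<Phi> (us @ g # vs) = (-1) ^ length us * \<Phi> (g # us @ vs)"
  using assms(2-)
proof (induction us arbitrary: vs rule: rev_induct)
  case (snoc c \<rho>)
  have "\<Phi> ((\<rho> @ [c]) @ g # vs) = - \<Phi> (\<rho> @ g # c # vs)"
    using swp[of \<rho> c g vs] snoc.prems by simp
  also have "\<Phi> (\<rho> @ g # c # vs) = (-1) ^ length \<rho> * \<Phi> (g # \<rho> @ c # vs)"
    using snoc.IH[of "c # vs"] snoc.prems by simp
  finally show ?case by simp
qed simp

definition rem :: "nat \<Rightarrow> 'b list \<Rightarrow> 'b list" where
  "rem j xs = take j xs @ drop (Suc j) xs"

lemma length_rem: "j < length xs \<Longrightarrow> length (rem j xs) = length xs - 1"
  by (simp add: rem_def)

lemma set_rem: "set (rem j xs) \<subseteq> set xs"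
  by (auto simp: rem_def dest: in_set_takeD in_set_dropD)

lemma rem_Cons_0 [simp]: "rem 0 (x # xs) = xs"
  and rem_Cons_Suc [simp]: "rem (Suc j) (x # xs) = x # rem j xs"
  by (simp_all add: rem_def)

lemma map_rem: "map f (rem j xs) = rem j (map f xs)"
  by (simp add: rem_def take_map drop_map)

text \<open>\<open>Om T\<close> is the contraction of \<open>T\<close> with the antiholomorphic part of the Euler vector field.\<close>

definition Om :: "('a::complex_normed_vector functional) \<Rightarrow>
    ('a \<Rightarrow> complex) \<Rightarrow> ('a \<Rightarrow> complex) list \<Rightarrow> complex" where
  "Om T f \<pi>s = (\<Sum>j<length \<pi>s. (-1) ^ j * T (\<lambda>x. f x * dba (\<pi>s ! j) x) (rem j \<pi>s))"

lemma Om_Nil [simp]: "Om T f [] = 0"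
  by (simp add: Om_def)

text \<open>The antiderivation rule of the interior product. Freezing the first slot gives a
  functional with one slot less, so inductions over slots change the functional; this is why the
  auxiliary lemmas below take an arbitrary \<open>T\<close> with just the property at hand.\<close>

lemma Om_Cons: "Om T f (\<pi> # \<rho>) = T (\<lambda>x. f x * dba \<pi> x) \<rho> - Om (\<lambda>g \<rho>. T g (\<pi> # \<rho>)) f \<rho>"
  unfolding Om_def by (simp add: sum.lessThan_Suc_shift sum_negf del: sum.lessThan_Suc)

lemma Om_lincomb_T:
  assumes "\<And>g \<rho>'. is_qlip g \<Longrightarrow> smooths \<rho>' \<Longrightarrow> Suc (length \<rho>') = length \<rho> \<Longrightarrow> T g \<rho>' = a * T\<^sub>1 g \<rho>' + b * T\<^sub>2 g \<rho>'"
    and "is_qlip f" "smooths \<rho>"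
  shows "Om T f \<rho> = a * Om T\<^sub>1 f \<rho> + b * Om T\<^sub>2 f \<rho>"
proof -
  have "T (\<lambda>x. f x * dba (\<rho> ! j) x) (rem j \<rho>)
     = a * T\<^sub>1 (\<lambda>x. f x * dba (\<rho> ! j) x) (rem j \<rho>) + b * T\<^sub>2 (\<lambda>x. f x * dba (\<rho> ! j) x) (rem j \<rho>)" if "j < length \<rho>" for j
  proof (rule assms(1))
    show "is_qlip (\<lambda>x. f x * dba (\<rho> ! j) x)"
      using assms(2,3) that by (intro is_qlip_mult smooth_dba_qlip) auto
    show "smooths (rem j \<rho>)" using set_rem[of j \<rho>] assms(3) by blast
    show "Suc (length (rem j \<rho>)) = length \<rho>" using that by (simp add: length_rem)
  qed
  then show ?thesis unfolding Om_def by (simp add: sum_distrib_left sum.distrib[symmetric] algebra_simps)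
qed

text \<open>Slots in front of the pair are frozen by induction. For the pair itself, expanding twice
  gives two terms that trade places with opposite signs; the remaining terms inherit the
  antisymmetry of \<open>T\<close>.\<close>

lemma Om_swap_aux:
  assumes "\<And>f us u v vs. \<lbrakk>is_qlip f; qlips us; is_qlip u; is_qlip v; qlips vs;
        Suc (Suc (length us + length vs)) = m\<rbrakk> \<Longrightarrow> T f (us @ u # v # vs) = - T f (us @ v # u # vs)"
    and "is_qlip f" "smooths us" "smooth a" "smooth b" "smooths vs"
    and "Suc (length us + length vs) = m"
  shows "Om T f (us @ a # b # vs) = - Om T f (us @ b # a # vs)"
  using assms
proof (induction us arbitrary: T m)
  case Nil
  have "Om (\<lambda>g \<rho>. T g (a # b # \<rho>)) f vs = (-1) * Om (\<lambda>g \<rho>. T g (b # a # \<rho>)) f vs + 0 * Om T f vs"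
  proof (rule Om_lincomb_T)
    fix g :: "'a \<Rightarrow> complex" and \<rho>' :: "('a \<Rightarrow> complex) list" assume "is_qlip g" "smooths \<rho>'" "Suc (length \<rho>') = length vs"
    then show "T g (a # b # \<rho>') = (-1) * T g (b # a # \<rho>') + 0 * T g \<rho>'"
      using Nil.prems(1)[of g "[]" a b \<rho>'] Nil.prems by (simp add: smooth_qlip)
  qed (use Nil.prems in auto)
  then show ?case by (simp add: Om_Cons)
next
  case (Cons c \<rho>)
  have m: "m = Suc (Suc (length \<rho> + length vs))" using Cons.prems by simp
  have c: "is_qlip c" "is_qlip (dba c)" using Cons.prems by (auto simp: smooth_qlip smooth_dba_qlip)
  have "T (\<lambda>x. f x * dba c x) (\<rho> @ a # b # vs) = - T (\<lambda>x. f x * dba c x) (\<rho> @ b # a # vs)"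
    by (rule Cons.prems(1)) (use Cons.prems c m in \<open>auto simp: smooth_qlip\<close>)
  moreover have "Om (\<lambda>g \<rho>. T g (c # \<rho>)) f (\<rho> @ a # b # vs) = - Om (\<lambda>g \<rho>. T g (c # \<rho>)) f (\<rho> @ b # a # vs)"
  proof (rule Cons.IH[where m = "Suc (length \<rho> + length vs)"])
    fix f u v :: "'a \<Rightarrow> complex" and us vs' :: "('a \<Rightarrow> complex) list"
    assume "is_qlip f" "qlips us" "is_qlip u" "is_qlip v" "qlips vs'"
      "Suc (Suc (length us + length vs')) = Suc (length \<rho> + length vs)"
    then show "T f (c # us @ u # v # vs') = - T f (c # us @ v # u # vs')"
      using Cons.prems(1)[of f "c # us" u v vs'] c m by simp
  qed (use Cons.prems in auto)
  ultimately show ?case by (simp add: Om_Cons)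
qed

lemma Om_lin_slot_aux:
  assumes "\<And>f us u v vs. \<lbrakk>is_qlip f; qlips us; is_qlip u; is_qlip v; qlips vs;
        Suc (length us + length vs) = m\<rbrakk> \<Longrightarrow>
        T f (us @ (\<lambda>x. c * u x + d * v x) # vs) = c * T f (us @ u # vs) + d * T f (us @ v # vs)"
    and "\<And>f g \<rho>. \<lbrakk>is_qlip f; is_qlip g; qlips \<rho>; length \<rho> = m\<rbrakk> \<Longrightarrow>
        T (\<lambda>x. c * f x + d * g x) \<rho> = c * T f \<rho> + d * T g \<rho>"
    and "is_qlip f" "smooths us" "smooth u" "smooth v" "smooths vs"
    and "length us + length vs = m"
  shows "Om T f (us @ (\<lambda>x. c * u x + d * v x) # vs) = c * Om T f (us @ u # vs) + d * Om T f (us @ v # vs)"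
  using assms
proof (induction us arbitrary: T m)
  case Nil
  have "Om (\<lambda>g \<rho>. T g ((\<lambda>x. c * u x + d * v x) # \<rho>)) f vs
      = c * Om (\<lambda>g \<rho>. T g (u # \<rho>)) f vs + d * Om (\<lambda>g \<rho>. T g (v # \<rho>)) f vs"
  proof (rule Om_lincomb_T)
    fix g :: "'a \<Rightarrow> complex" and \<rho>' :: "('a \<Rightarrow> complex) list" assume "is_qlip g" "smooths \<rho>'" "Suc (length \<rho>') = length vs"
    then show "T g ((\<lambda>x. c * u x + d * v x) # \<rho>') = c * T g (u # \<rho>') + d * T g (v # \<rho>')"
      using Nil.prems(1)[of g "[]" u v \<rho>'] Nil.prems(5-) by (simp add: smooth_qlip)
  qed (use Nil.prems in auto)
  moreover have "(\<lambda>x. f x * dba (\<lambda>x. c * u x + d * v x) x) = (\<lambda>x. c * (f x * dba u x) + d * (f x * dba v x))"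
    using Nil.prems by (simp add: smooth_lincomb(2) algebra_simps)
  moreover have "T (\<lambda>x. c * (f x * dba u x) + d * (f x * dba v x)) vs
      = c * T (\<lambda>x. f x * dba u x) vs + d * T (\<lambda>x. f x * dba v x) vs"
    by (rule Nil.prems(2)) (use Nil.prems in \<open>auto simp: smooth_qlip smooth_dba_qlip\<close>)
  ultimately show ?case by (simp add: Om_Cons algebra_simps)
next
  case (Cons e \<rho>)
  have m: "m = Suc (length \<rho> + length vs)" using Cons.prems by simp
  have e: "is_qlip e" "is_qlip (dba e)" using Cons.prems by (auto simp: smooth_qlip smooth_dba_qlip)
  have "T (\<lambda>x. f x * dba e x) (\<rho> @ (\<lambda>x. c * u x + d * v x) # vs)
      = c * T (\<lambda>x. f x * dba e x) (\<rho> @ u # vs) + d * T (\<lambda>x. f x * dba e x) (\<rho> @ v # vs)"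
    by (rule Cons.prems(1)) (use Cons.prems(3-) e m in \<open>auto simp: smooth_qlip\<close>)
  moreover have "Om (\<lambda>g \<rho>. T g (e # \<rho>)) f (\<rho> @ (\<lambda>x. c * u x + d * v x) # vs)
      = c * Om (\<lambda>g \<rho>. T g (e # \<rho>)) f (\<rho> @ u # vs) + d * Om (\<lambda>g \<rho>. T g (e # \<rho>)) f (\<rho> @ v # vs)"
  proof (rule Cons.IH[where m = "length \<rho> + length vs"])
    fix f u v :: "'a \<Rightarrow> complex" and us vs' :: "('a \<Rightarrow> complex) list"
    assume "is_qlip f" "qlips us" "is_qlip u" "is_qlip v" "qlips vs'"
      "Suc (length us + length vs') = length \<rho> + length vs"
    then show "T f (e # us @ (\<lambda>x. c * u x + d * v x) # vs') = c * T f (e # us @ u # vs') + d * T f (e # us @ v # vs')"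
      using Cons.prems(1)[of f "e # us" u v vs'] e m by simp
  next
    fix f g :: "'a \<Rightarrow> complex" and \<rho>' :: "('a \<Rightarrow> complex) list" assume "is_qlip f" "is_qlip g" "qlips \<rho>'" "length \<rho>' = length \<rho> + length vs"
    then show "T (\<lambda>x. c * f x + d * g x) (e # \<rho>') = c * T f (e # \<rho>') + d * T g (e # \<rho>')"
      using Cons.prems(2)[of f g "e # \<rho>'"] e m by simp
  qed (use Cons.prems in auto)
  ultimately show ?case by (simp add: Om_Cons algebra_simps)
qed

text \<open>\<open>P\<close> stands for constant, holomorphic or antiholomorphic; in the first two cases \<open>dba\<close> annihilates it.\<close>

lemma Om_vanish:
  assumes "\<And>g \<rho>'. \<lbrakk>is_qlip g; \<And>x. x \<notin> V \<Longrightarrow> g x = 0; qlips \<rho>'; length \<rho>' = m; n \<le> length (filter P \<rho>')\<rbrakk>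
        \<Longrightarrow> T g \<rho>' = 0"
    and zero: "\<And>\<rho>'. \<lbrakk>qlips \<rho>'; length \<rho>' = m\<rbrakk> \<Longrightarrow> T (\<lambda>x. 0) \<rho>' = 0"
    and "is_qlip f" "\<And>x. x \<notin> V \<Longrightarrow> f x = 0" "smooths \<rho>" "length \<rho> = Suc m"
    and "n \<le> length (filter P \<rho>) \<and> (\<forall>\<pi>\<in>set \<rho>. P \<pi> \<longrightarrow> (\<forall>x\<in>V. dba \<pi> x = 0)) \<or> Suc n \<le> length (filter P \<rho>)"
  shows "Om T f \<rho> = 0"
  unfolding Om_def
proof (rule sum.neutral, rule ballI)
  fix j assume "j \<in> {..<length \<rho>}"
  then have j: "j < length \<rho>" by simp
  let ?g = "\<lambda>x. f x * dba (\<rho> ! j) x"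
  have qg: "is_qlip ?g" using assms(3,5) j by (intro is_qlip_mult smooth_dba_qlip) auto
  have r: "qlips (rem j \<rho>)" using set_rem[of j \<rho>] assms(5) smooth_qlip by blast
  have lr: "length (rem j \<rho>) = m" using assms(6) j by (simp add: length_rem)
  have split: "\<rho> = take j \<rho> @ \<rho> ! j # drop (Suc j) \<rho>" using j by (rule id_take_nth_drop)
  have fl: "length (filter P \<rho>) = length (filter P (rem j \<rho>)) + (if P (\<rho> ! j) then 1 else 0)"
    unfolding rem_def by (subst split) (simp only: filter_append filter.simps length_append list.size if_split, auto)
  have "T ?g (rem j \<rho>) = 0"
  proof (cases "n \<le> length (filter P (rem j \<rho>))")
    case True
    then show ?thesis using assms(1)[OF qg _ r lr] assms(4) by auto
  next
    case False
    \<comment> \<open>The count falls below \<open>n\<close> only if exactly \<open>n\<close> slots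
      had \<open>P\<close> and the deleted one was among them. Then the first alternative holds:
      \<open>dba\<close> of that slot vanishes on \<open>V\<close>, and \<open>f\<close> vanishes
      off \<open>V\<close>.\<close>
    then have Pj: "P (\<rho> ! j)" and "\<not> Suc n \<le> length (filter P \<rho>)" using assms(7) fl by (auto split: if_splits)
    then have z: "?g x = 0" for x using assms(4,7) j by (cases "x \<in> V") auto
    have e: "?g = (\<lambda>x. 0)" by (rule ext) (rule z)
    show ?thesis unfolding e by (rule zero[OF r lr])
  qed
  then show "(-1) ^ j * T ?g (rem j \<rho>) = 0" by simp
qed


lemma map_dil_0 [simp]: "map (dil 0) \<rho> = \<rho>"
  by (rule map_idI) simp

lemma list_all2_qconv_dil:
  assumes "qlips \<rho>" "z \<longlonglongrightarrow> \<zeta>"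
  shows "list_all2 qconv (map (\<lambda>p n. dil (z n) p) \<rho>) (map (dil \<zeta>) \<rho>)"
  using assms(1) by (induction \<rho>) (auto intro: qconv_dil_seq[OF qconv_const assms(2)])

lemma prod_list_mono:
  fixes f g :: "'b \<Rightarrow> real"
  assumes "\<And>x. x \<in> set xs \<Longrightarrow> 0 \<le> f x" "\<And>x. x \<in> set xs \<Longrightarrow> f x \<le> g x"
  shows "0 \<le> prod_list (map f xs) \<and> prod_list (map f xs) \<le> prod_list (map g xs)"
  using assms
proof (induction xs)
  case (Cons x xs)
  then have "0 \<le> prod_list (map f xs) \<and> prod_list (map f xs) \<le> prod_list (map g xs)" "0 \<le> f x" "f x \<le> g x" by auto
  then show ?case by (auto intro: mult_mono)
qed simp

lemma smooth_deriv_at: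
  assumes "smooth f" "a \<in> {1,\<i>}"
  shows "((\<lambda>t. f (flow a t x)) has_vector_derivative ddir a f (scaleC (exp (of_real \<tau> * a)) x)) (at \<tau>)"
proof -
  have d: "((\<lambda>t. t - \<tau>) has_vector_derivative 1) (at \<tau>)"
    by (auto intro!: derivative_eq_intros simp flip: has_real_derivative_iff_has_vector_derivative)
  have "((\<lambda>t. f (flow a t (scaleC (exp (of_real \<tau> * a)) x))) has_vector_derivative
      ddir a f (scaleC (exp (of_real \<tau> * a)) x)) (at (\<tau> - \<tau>))"
    using smooth_deriv[OF assms] by simp
  from vector_diff_chain_at[OF d this] show ?thesis
    by (simp add: o_def scaleC_scaleC algebra_simps flip: exp_add)
qed

text \<open>Uniform Lipschitz bounds for the quotients come from the derivative: the difference of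
  \<open>f\<close> along the orbits of two points has a derivative controlled by the Lipschitz
  constant of \<open>ddir a f\<close>, and the mean value inequality passes this on to all
  quotients.\<close>

lemma qconv_diffquot:
  assumes f: "smooth f" and a: "a \<in> {1,\<i>}" and t: "t \<longlonglongrightarrow> 0" "\<And>n. t n \<noteq> 0"
  shows "qconv (\<lambda>n x. (1 / of_real (t n)) * dil (of_real (t n) * a) f x + (- 1 / of_real (t n)) * f x) (ddir a f)"
  unfolding qconv_def
proof (intro conjI allI)
  fix x :: 'a
  show "(\<lambda>n. (1 / of_real (t n)) * dil (of_real (t n) * a) f x + (- 1 / of_real (t n)) * f x) \<longlonglongrightarrow> ddir a f x"
    using vderiv_seq[OF smooth_deriv[OF f a] t, of x] by (simp add: dil_def diff_divide_distrib scaleC_one)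
next
  have "Bseq t" using t(1) convergent_imp_Bseq convergent_def by blast
  then obtain b where b: "b > 0" "\<And>n. \<bar>t n\<bar> \<le> b" unfolding Bseq_def by auto
  show "eqlip (\<lambda>n x. (1 / of_real (t n)) * dil (of_real (t n) * a) f x + (- 1 / of_real (t n)) * f x)"
  proof (rule eqlipI)
    fix R :: real assume R: "R > 0"
    define C where "C = exp b * lipc (ball 0 (exp b * R)) (ddir a f)"
    have C0: "0 \<le> C" unfolding C_def using lipc_nonneg[OF smooth_ddir_qlip[OF f a]] by simp
    have "C-lipschitz_on (ball 0 R) (\<lambda>x. (1 / of_real (t n)) * dil (of_real (t n) * a) f x + (- 1 / of_real (t n)) * f x)" for n
    proof (rule lipschitz_onI[OF _ C0])
      fix x y :: 'a assume xy: "x \<in> ball 0 R" "y \<in> ball 0 R"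
      define \<phi> where "\<phi> s = f (flow a s x) - f (flow a s y)" for s
      have "(C * dist x y)-lipschitz_on {-b..b} \<phi>"
      proof (rule has_vderiv_lipschitz)
        fix s assume s: "s \<in> {-b..b}"
        show "(\<phi> has_vector_derivative (ddir a f (flow a s x) - ddir a f (flow a s y))) (at s within {-b..b})"
          unfolding \<phi>_def by (rule has_vector_derivative_at_within, rule has_vector_derivative_diff) (rule smooth_deriv_at[OF f a])+
        have Re: "Re (of_real s * a) \<le> b" using s a b by auto
        then have "exp (Re (of_real s * a)) * R \<le> exp b * R" using R by simp
        from lipschitz_onD[OF dil_lipschitz[OF is_qlip_lipc[OF smooth_ddir_qlip[OF f a]] this] xy]
        have "cmod (ddir a f (flow a s x) - ddir a f (flow a s y))
           \<le> exp (Re (of_real s * a)) * lipc (ball 0 (exp b * R)) (ddir a f) * dist x y"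
          by (simp add: dil_def dist_norm)
        also have "\<dots> \<le> C * dist x y"
          unfolding C_def using Re lipc_nonneg[OF smooth_ddir_qlip[OF f a]] by (intro mult_right_mono) auto
        finally show "cmod (ddir a f (flow a s x) - ddir a f (flow a s y)) \<le> C * dist x y" .
      qed (use C0 in auto)
      from lipschitz_onD[OF this, of "t n" 0] b
      have le: "cmod (\<phi> (t n) - \<phi> 0) \<le> C * dist x y * \<bar>t n\<bar>"
        by (auto simp: dist_norm abs_le_iff dest: minus_le_iff[THEN iffD1])
      have "(1 / of_real (t n)) * dil (of_real (t n) * a) f x + (- 1 / of_real (t n)) * f x
         - ((1 / of_real (t n)) * dil (of_real (t n) * a) f y + (- 1 / of_real (t n)) * f y) = (\<phi> (t n) - \<phi> 0) / of_real (t n)"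
        using t(2)[of n] by (simp add: \<phi>_def dil_def scaleC_one field_simps)
      then show "dist ((1 / of_real (t n)) * dil (of_real (t n) * a) f x + (- 1 / of_real (t n)) * f x)
         ((1 / of_real (t n)) * dil (of_real (t n) * a) f y + (- 1 / of_real (t n)) * f y) \<le> C * dist x y"
        unfolding dist_norm[of "(1 / of_real (t n)) * _ + _"] using le t(2)[of n] by (simp add: norm_divide divide_le_eq)
    qed
    then show "\<exists>C. \<forall>n. C-lipschitz_on (ball 0 R) (\<lambda>x. (1 / of_real (t n)) * dil (of_real (t n) * a) f x + (- 1 / of_real (t n)) * f x)"
      by blast
  qed
qed

context shell_current
begin

lemma T_move:
  assumes "is_qlip f" "qlips us" "is_qlip g" "qlips vs" "Suc (length us + length vs) = k"
  shows "T f (us @ g # vs) = (-1) ^ length us * T f (g # us @ vs)"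
  by (rule move_front[where P = is_qlip and n = k and \<Phi> = "T f"], rule swap) (use assms in auto)

lemma Om_swap:
  assumes "is_qlip f" "smooths us" "smooth a" "smooth b" "smooths vs"
    "Suc (length us + length vs) = k"
  shows "Om T f (us @ a # b # vs) = - Om T f (us @ b # a # vs)"
  by (rule Om_swap_aux[OF _ assms]) (rule swap; assumption)

lemma Om_move:
  assumes "is_qlip f" "smooths us" "smooth g" "smooths vs" "length us + length vs = k"
  shows "Om T f (us @ g # vs) = (-1) ^ length us * Om T f (g # us @ vs)"
  by (rule move_front[where P = smooth and n = "Suc k" and \<Phi> = "Om T f"], rule Om_swap) (use assms in auto)

lemma Om_lin_slot:
  assumes "is_qlip f" "smooths us" "smooth u" "smooth v" "smooths vs"
    "length us + length vs = k"
  shows "Om T f (us @ (\<lambda>x. c * u x + d * v x) # vs) = c * Om T f (us @ u # vs) + d * Om T f (us @ v # vs)"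
  by (rule Om_lin_slot_aux[OF _ _ assms]) (rule lin_slot lin_coeff; assumption)+

lemma smooth_rem:
  assumes "smooths \<pi>s" shows "qlips (rem j \<pi>s)"
  using set_rem[of j \<pi>s] assms smooth_qlip by blast

lemma Om_coeff:
  assumes "is_qlip f" "is_qlip g" "smooths \<pi>s" "length \<pi>s = Suc k"
  shows "Om T (\<lambda>x. a * f x + b * g x) \<pi>s = a * Om T f \<pi>s + b * Om T g \<pi>s"
proof -
  have "T (\<lambda>x. (a * f x + b * g x) * dba (\<pi>s ! j) x) (rem j \<pi>s)
     = a * T (\<lambda>x. f x * dba (\<pi>s ! j) x) (rem j \<pi>s) + b * T (\<lambda>x. g x * dba (\<pi>s ! j) x) (rem j \<pi>s)" if "j < length \<pi>s" for j
  proof -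
    have "is_qlip (dba (\<pi>s ! j))" using assms(3) that by (auto intro: smooth_dba_qlip)
    then show ?thesis
      using lin_coeff[of "\<lambda>x. f x * dba (\<pi>s ! j) x" "\<lambda>x. g x * dba (\<pi>s ! j) x" "rem j \<pi>s" a b]
        assms smooth_rem[OF assms(3)] that by (simp add: algebra_simps length_rem)
  qed
  then show ?thesis unfolding Om_def by (simp add: sum_distrib_left sum.distrib[symmetric] algebra_simps)
qed

text \<open>Contraction respects f dg + g df = d(fg). The terms that contract a slot of
  \<open>\<rho>\<close> use the Leibniz rule of \<open>T\<close>, the term that contracts the first
  slot uses the product rule of \<open>dba\<close>. This identity is what later moves a derivative
  off a slot.\<close>

lemma Om_leibniz:
  assumes f: "smooth f" and g: "smooth g" and r: "smooths \<rho>" "length \<rho> = k"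
  shows "Om T f (g # \<rho>) + Om T g (f # \<rho>) = Om T (\<lambda>_. 1) ((\<lambda>x. f x * g x) # \<rho>)"
proof -
  note qf = smooth_qlip[OF f] smooth_dba_qlip[OF f] and qg = smooth_qlip[OF g] smooth_dba_qlip[OF g]
  have qr: "qlips \<rho>" using r(1) smooth_qlip by blast
  have "T (\<lambda>x. dba (\<rho> ! j) x) ((\<lambda>x. f x * g x) # rem j \<rho>)
     = T (\<lambda>x. f x * dba (\<rho> ! j) x) (g # rem j \<rho>) + T (\<lambda>x. g x * dba (\<rho> ! j) x) (f # rem j \<rho>)" if "j < length \<rho>" for j
  proof -
    have "is_qlip (dba (\<rho> ! j))" using r that by (auto intro: smooth_dba_qlip)
    then show ?thesis
      using leibniz[of "dba (\<rho> ! j)" f g "[]" "rem j \<rho>"] qf qg smooth_rem[OF r(1)] that r(2)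
      by (simp add: length_rem mult.commute)
  qed
  then have 1: "Om (\<lambda>h \<rho>. T h ((\<lambda>x. f x * g x) # \<rho>)) (\<lambda>_. 1) \<rho> =
      Om (\<lambda>h \<rho>. T h (g # \<rho>)) f \<rho> + Om (\<lambda>h \<rho>. T h (f # \<rho>)) g \<rho>"
    unfolding Om_def by (simp add: sum.distrib[symmetric] algebra_simps)
  have "T (\<lambda>x. f x * dba g x + g x * dba f x) \<rho> = T (\<lambda>x. f x * dba g x) \<rho> + T (\<lambda>x. g x * dba f x) \<rho>"
    by (rule T_add) (use qf qg r qr in auto)
  with 1 show ?thesis by (simp add: Om_Cons smooth_mult(2)[OF f g])
qed

text \<open>The Lie derivative along the antiholomorphic Euler field, written on the test entries:
  the derivative falls on each entry in turn.\<close>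

definition Lie :: "'a functional" where
  "Lie f \<pi>s = T (dba f) \<pi>s + (\<Sum>j<k. T f (take j \<pi>s @ dba (\<pi>s ! j) # drop (Suc j) \<pi>s))"

text \<open>Cartan's formula, with the boundary of the contraction and the contraction of the
  boundary on the left. \<open>leibniz\<close> splits each slot \<open>f * dba (\<pi>s ! j)\<close>;
  the part in which \<open>f\<close> stays a slot cancels against the tail from
  \<open>Om_Cons\<close>, and the other part belongs to the Lie derivative.\<close>

lemma Om_Cartan:
  assumes f: "smooth f" and r: "smooths \<pi>s" "length \<pi>s = k"
  shows "Om T (\<lambda>_. 1) (f # \<pi>s) + Om (\<lambda>g \<rho>. T (\<lambda>_. 1) (g # \<rho>)) f \<pi>s = Lie f \<pi>s"
proof -
  note qf = smooth_qlip[OF f] smooth_dba_qlip[OF f]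
  have "(-1) ^ j * T (\<lambda>_. 1) ((\<lambda>x. f x * dba (\<pi>s ! j) x) # rem j \<pi>s)
     = (-1) ^ j * T (\<lambda>x. dba (\<pi>s ! j) x) (f # rem j \<pi>s) + T f (take j \<pi>s @ dba (\<pi>s ! j) # drop (Suc j) \<pi>s)" if j: "j < k" for j
  proof -
    have q: "is_qlip (dba (\<pi>s ! j))" using r that by (auto intro: smooth_dba_qlip)
    have td: "qlips (take j \<pi>s)" "qlips (drop (Suc j) \<pi>s)"
      using r(1) by (auto dest!: in_set_takeD in_set_dropD intro: smooth_qlip)
    have 1: "T (\<lambda>_. 1) ((\<lambda>x. f x * dba (\<pi>s ! j) x) # rem j \<pi>s)
       = T f (dba (\<pi>s ! j) # rem j \<pi>s) + T (\<lambda>x. dba (\<pi>s ! j) x) (f # rem j \<pi>s)"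
      using leibniz[of "\<lambda>_. 1" f "dba (\<pi>s ! j)" "[]" "rem j \<pi>s"] q qf smooth_rem[OF r(1)] j r(2)
      by (simp add: length_rem)
    have 2: "T f (take j \<pi>s @ dba (\<pi>s ! j) # drop (Suc j) \<pi>s) = (-1) ^ j * T f (dba (\<pi>s ! j) # rem j \<pi>s)"
      using T_move[of f "take j \<pi>s" "dba (\<pi>s ! j)" "drop (Suc j) \<pi>s"] q qf td j r(2) by (simp add: rem_def)
    show ?thesis unfolding 1 2 by (simp add: algebra_simps)
  qed
  then have "Om (\<lambda>g \<rho>. T (\<lambda>_. 1) (g # \<rho>)) f \<pi>s = Om (\<lambda>g \<rho>. T g (f # \<rho>)) (\<lambda>_. 1) \<pi>s
     + (\<Sum>j<k. T f (take j \<pi>s @ dba (\<pi>s ! j) # drop (Suc j) \<pi>s))"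
    unfolding Om_def r(2) by (simp add: sum.distrib[symmetric])
  then show ?thesis by (simp add: Om_Cons Lie_def)
qed

definition Ld :: "complex \<Rightarrow> ('a \<Rightarrow> complex) \<Rightarrow> ('a \<Rightarrow> complex) list \<Rightarrow> complex" where
  "Ld a f \<pi>s = T (ddir a f) \<pi>s + (\<Sum>j<k. T f (take j \<pi>s @ ddir a (\<pi>s ! j) # drop (Suc j) \<pi>s))"

lemma Lie_Ld:
  assumes f: "smooth f" and r: "smooths \<pi>s" "length \<pi>s = k"
  shows "Lie f \<pi>s = Ld 1 f \<pi>s + \<i> * Ld \<i> f \<pi>s"
proof -
  have qr: "qlips \<pi>s" using r(1) smooth_qlip by blast
  have 1: "T (dba f) \<pi>s = T (ddir 1 f) \<pi>s + \<i> * T (ddir \<i> f) \<pi>s"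
    using lin_coeff[of "ddir 1 f" "ddir \<i> f" \<pi>s 1 \<i>] smooth_ddir_qlip[OF f] qr r(2) by (simp add: dba_def[abs_def])
  have "T f (take j \<pi>s @ dba (\<pi>s ! j) # drop (Suc j) \<pi>s)
    = T f (take j \<pi>s @ ddir 1 (\<pi>s ! j) # drop (Suc j) \<pi>s) + \<i> * T f (take j \<pi>s @ ddir \<i> (\<pi>s ! j) # drop (Suc j) \<pi>s)"
    if j: "j < k" for j
  proof -
    have s: "smooth (\<pi>s ! j)" using r j by auto
    have td: "qlips (take j \<pi>s)" "qlips (drop (Suc j) \<pi>s)"
      using qr by (auto dest!: in_set_takeD in_set_dropD)
    show ?thesis
      using lin_slot[of f "ddir 1 (\<pi>s ! j)" "ddir \<i> (\<pi>s ! j)" "take j \<pi>s" "drop (Suc j) \<pi>s" 1 \<i>]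
        smooth_qlip[OF f] smooth_ddir_qlip[OF s] td j r(2) by (simp add: dba_def[abs_def])
  qed
  then show ?thesis unfolding Lie_def Ld_def 1 by (simp add: sum.distrib sum_distrib_left algebra_simps)
qed

text \<open>By multilinearity the difference quotient of the value is a sum of values with one entry
  replaced by its own difference quotient \<open>Q\<close>. These converge by
  \<open>qconv_diffquot\<close> and the joint continuity of \<open>T\<close>.\<close>

lemma T_flow_deriv:
  assumes f: "smooth f" and r: "smooths \<pi>s" "length \<pi>s = k" and a: "a \<in> {1,\<i>}"
  shows "((\<lambda>t. T (dil (of_real t * a) f) (map (dil (of_real t * a)) \<pi>s)) has_vector_derivative Ld a f \<pi>s) (at 0)"
proof (rule vderivI_seq)
  fix t :: "nat \<Rightarrow> real" assume t: "t \<longlonglongrightarrow> 0" "\<And>n. t n \<noteq> 0"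
  have qr: "qlips \<pi>s" using r(1) smooth_qlip by blast
  note qf = smooth_qlip[OF f]
  define z where "z n = of_real (t n) * a" for n
  have "(\<lambda>n. of_real (t n) * a) \<longlonglongrightarrow> of_real 0 * a" by (intro tendsto_intros t)
  then have z: "z \<longlonglongrightarrow> 0" unfolding z_def by simp
  define Q where "Q g n x = (1 / of_real (t n)) * dil (z n) g x + (- 1 / of_real (t n)) * g x" for g :: "'a \<Rightarrow> complex" and n x
  have Qc: "qconv (Q g) (ddir a g)" if "smooth g" for g
    using qconv_diffquot[OF that a t] unfolding Q_def z_def .
  have step: "(T (dil (z n) f) (map (dil (z n)) \<pi>s) - T f \<pi>s) / of_real (t n)
     = T (Q f n) (map (dil (z n)) \<pi>s) + (\<Sum>j<k. T f (take j \<pi>s @ Q (\<pi>s ! j) n # drop (Suc j) (map (dil (z n)) \<pi>s)))" for n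
  proof -
    have qm: "qlips (map (dil (z n)) \<pi>s)" using qr by auto
    have 1: "T (Q f n) (map (dil (z n)) \<pi>s) = (T (dil (z n) f) (map (dil (z n)) \<pi>s) - T f (map (dil (z n)) \<pi>s)) / of_real (t n)"
      using lin_coeff[of "dil (z n) f" f "map (dil (z n)) \<pi>s" "1 / of_real (t n)" "- 1 / of_real (t n)"] qf qm r(2)
      unfolding Q_def[abs_def] by (simp add: diff_divide_distrib)
    have "T f (map (dil (z n)) \<pi>s) - T f \<pi>s
       = (\<Sum>j<k. T f (take j \<pi>s @ (\<lambda>x. (map (dil (z n)) \<pi>s ! j) x - (\<pi>s ! j) x) # drop (Suc j) (map (dil (z n)) \<pi>s)))"
      by (rule list_telescope[where P = is_qlip and \<Phi> = "T f"], rule T_slot_diff) (use qf r qr qm in auto)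
    moreover have "T f (take j \<pi>s @ (\<lambda>x. (map (dil (z n)) \<pi>s ! j) x - (\<pi>s ! j) x) # drop (Suc j) (map (dil (z n)) \<pi>s)) / of_real (t n)
        = T f (take j \<pi>s @ Q (\<pi>s ! j) n # drop (Suc j) (map (dil (z n)) \<pi>s))" if j: "j < k" for j
    proof -
      have s: "is_qlip (\<pi>s ! j)" using qr j r by auto
      have td: "qlips (take j \<pi>s)" "\<forall>\<pi>\<in>set (drop (Suc j) (map (dil (z n)) \<pi>s)). is_qlip \<pi>"
        using qr qm by (auto dest!: in_set_takeD in_set_dropD)
      have l: "Suc (length (take j \<pi>s) + length (drop (Suc j) (map (dil (z n)) \<pi>s))) = k" using j r by simp
      show ?thesis
        using T_slot_diff[OF qf is_qlip_dil[OF s] s l td, of "z n"] j r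
          lin_slot[OF qf is_qlip_dil[OF s] s l td, of "1 / of_real (t n)" "z n" "- 1 / of_real (t n)"]
        unfolding Q_def[abs_def] by (simp add: diff_divide_distrib)
    qed
    ultimately have "(T f (map (dil (z n)) \<pi>s) - T f \<pi>s) / of_real (t n)
       = (\<Sum>j<k. T f (take j \<pi>s @ Q (\<pi>s ! j) n # drop (Suc j) (map (dil (z n)) \<pi>s)))"
      by (simp add: sum_divide_distrib)
    from this[symmetric] show ?thesis unfolding 1 by (simp add: diff_divide_distrib)
  qed
  have "(\<lambda>n. T (Q f n) (map (dil (z n)) \<pi>s)) \<longlonglongrightarrow> T (ddir a f) \<pi>s"
    using cont_lists[OF Qc[OF f] list_all2_qconv_dil[OF qr z]] r(2) by (simp add: o_def)
  moreover have "(\<lambda>n. T f (take j \<pi>s @ Q (\<pi>s ! j) n # drop (Suc j) (map (dil (z n)) \<pi>s)))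
      \<longlonglongrightarrow> T f (take j \<pi>s @ ddir a (\<pi>s ! j) # drop (Suc j) \<pi>s)" if j: "j < k" for j
  proof -
    have s: "smooth (\<pi>s ! j)" using r j by auto
    have td: "qlips (take j \<pi>s)" "qlips (drop (Suc j) \<pi>s)"
      using qr by (auto dest!: in_set_takeD in_set_dropD)
    have "list_all2 qconv (map (\<lambda>p n. p) (take j \<pi>s) @ Q (\<pi>s ! j) # map (\<lambda>p n. dil (z n) p) (drop (Suc j) \<pi>s))
       (take j \<pi>s @ ddir a (\<pi>s ! j) # map (dil 0) (drop (Suc j) \<pi>s))"
      using list_all2_qconv_const[OF td(1)] Qc[OF s] list_all2_qconv_dil[OF td(2) z] by (intro list_all2_appendI) auto
    from cont_lists[OF qconv_const[OF qf] this] show ?thesis using j r(2)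
      by (simp add: o_def drop_map)
  qed
  ultimately show "(\<lambda>n. (T (dil (of_real (t n) * a) f) (map (dil (of_real (t n) * a)) \<pi>s)
      - T (dil (of_real 0 * a) f) (map (dil (of_real 0 * a)) \<pi>s)) / of_real (t n)) \<longlonglongrightarrow> Ld a f \<pi>s"
    unfolding Ld_def using step by (simp add: z_def[symmetric] del: drop_map) (intro tendsto_add tendsto_sum, auto)
qed

lemma T_dil_continuous:
  assumes "is_qlip u" "qlips \<rho>" "length \<rho> = k"
  shows "continuous_on UNIV (\<lambda>\<zeta>. T (dil \<zeta> u) (map (dil \<zeta>) \<rho>))"
  unfolding continuous_on_sequentially
proof (intro allI ballI impI, elim conjE)
  fix z \<zeta> assume "z \<longlonglongrightarrow> (\<zeta>::complex)"
  from cont_lists[OF qconv_dil_seq[OF qconv_const[OF assms(1)] this] list_all2_qconv_dil[OF assms(2) this]] assms(3)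
  show "((\<lambda>\<zeta>. T (dil \<zeta> u) (map (dil \<zeta>) \<rho>)) \<circ> z) \<longlonglongrightarrow> T (dil \<zeta> u) (map (dil \<zeta>) \<rho>)"
    by (simp add: o_def)
qed

text \<open>For \<open>Re \<zeta> \<le> s\<close> the dilated shell stays in the ball of radius
  \<open>exp s * (M + 1)\<close>, on which the data have fixed bounds.\<close>

lemma T_dil_bounded:
  assumes "is_qlip u" "qlips \<rho>" "length \<rho> = k"
  shows "\<exists>B. \<forall>\<zeta>. Re \<zeta> \<le> s \<longrightarrow> cmod (T (dil \<zeta> u) (map (dil \<zeta>) \<rho>)) \<le> B"
proof -
  define R where "R = exp s * (M + 1)"
  obtain b where b: "b > 0" "\<And>x. x \<in> ball 0 R \<Longrightarrow> cmod (u x) \<le> b" using is_qlip_bounded[OF assms(1)] by metis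
  define B where "B = prod_list (map (\<lambda>\<pi>. exp s * lipc (ball 0 R) \<pi>) \<rho>) * (\<integral>x. b \<partial>\<nu>)"
  have "cmod (T (dil \<zeta> u) (map (dil \<zeta>) \<rho>)) \<le> B" if s: "Re \<zeta> \<le> s" for \<zeta>
  proof -
    have M: "0 < M + 1" using delta_pos delta_le by simp
    have eR: "exp (Re \<zeta>) * (M + 1) \<le> R" unfolding R_def using s M by simp
    have p: "0 \<le> prod_list (map (\<lambda>\<pi>. lipc (ball 0 (M+1)) (dil \<zeta> \<pi>)) \<rho>) \<and>
       prod_list (map (\<lambda>\<pi>. lipc (ball 0 (M+1)) (dil \<zeta> \<pi>)) \<rho>) \<le> prod_list (map (\<lambda>\<pi>. exp s * lipc (ball 0 R) \<pi>) \<rho>)"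
    proof (rule prod_list_mono)
      fix \<pi> assume "\<pi> \<in> set \<rho>"
      then have q: "is_qlip \<pi>" using assms(2) by blast
      show "0 \<le> lipc (ball 0 (M+1)) (dil \<zeta> \<pi>)" by (intro lipc_nonneg is_qlip_dil q)
      have "lipc (ball 0 (M+1)) (dil \<zeta> \<pi>) \<le> exp (Re \<zeta>) * lipc (ball 0 R) \<pi>" by (rule lipc_dil[OF q eR])
      also have "\<dots> \<le> exp s * lipc (ball 0 R) \<pi>" using s lipc_nonneg[OF q] by (intro mult_right_mono) auto
      finally show "lipc (ball 0 (M+1)) (dil \<zeta> \<pi>) \<le> exp s * lipc (ball 0 R) \<pi>" .
    qed
    have "(\<integral>x. cmod (dil \<zeta> u x) \<partial>\<nu>) \<le> (\<integral>x. b \<partial>\<nu>)"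
    proof (rule integral_mono_AE)
      show "integrable \<nu> (\<lambda>x. cmod (dil \<zeta> u x))" by (intro integrable_norm qlip_integrable is_qlip_dil assms)
      show "AE x in \<nu>. cmod (dil \<zeta> u x) \<le> b"
        using conc
      proof eventually_elim
        case (elim x)
        then have "exp (Re \<zeta>) * norm x < exp (Re \<zeta>) * (M + 1)" by simp
        from this eR have "exp (Re \<zeta>) * norm x < R" by (rule less_le_trans)
        then have "scaleC (exp \<zeta>) x \<in> ball 0 R" by (simp add: norm_scaleC)
        then show ?case unfolding dil_def by (rule b(2))
      qed
    qed simp
    moreover have "0 \<le> (\<integral>x. cmod (dil \<zeta> u x) \<partial>\<nu>)" by simp
    moreover have "cmod (T (dil \<zeta> u) (map (dil \<zeta>) \<rho>)) \<le> prod_list (map (\<lambda>\<pi>. lipc (ball 0 (M+1)) (dil \<zeta> \<pi>)) \<rho>) * (\<integral>x. cmod (dil \<zeta> u x) \<partial>\<nu>)"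
      using bound_M[of "dil \<zeta> u" "map (dil \<zeta>) \<rho>"] assms by (simp add: o_def)
    ultimately show ?thesis unfolding B_def using p by (meson mult_mono order_trans)
  qed
  then show ?thesis by blast
qed

lemma T_dil_zero:
  assumes "is_qlip u" "qlips \<rho>" "length \<rho> = k"
    and z: "\<And>x. R \<le> norm x \<Longrightarrow> u x = 0" and \<zeta>: "R \<le> exp (Re \<zeta>) * \<delta>"
  shows "T (dil \<zeta> u) \<rho> = 0"
proof -
  have "T (dil \<zeta> u) \<rho> = T (\<lambda>x. 0) \<rho>"
  proof (rule T_cong_shell)
    fix x :: 'a assume "\<delta> \<le> norm x"
    then have "exp (Re \<zeta>) * \<delta> \<le> exp (Re \<zeta>) * norm x" by simp
    with \<zeta> have "R \<le> exp (Re \<zeta>) * norm x" by (rule order_trans)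
    then have "R \<le> norm (scaleC (exp \<zeta>) x)" by (simp add: norm_scaleC)
    then show "dil \<zeta> u x = 0" unfolding dil_def by (rule z)
  qed (use assms in auto)
  then show ?thesis using T_zero assms by simp
qed

end

section \<open>The Cauchy kernel on the cylinder\<close>

text \<open>In the coordinate \<open>z = e\<^sup>\<zeta>\<close> the form \<open>dz/(z-1)\<close> becomes \<open>d\<zeta>/(1-e\<^sup>-\<^sup>\<zeta>)\<close>. The two coordinate
  axes are removed for convenience; they form a null set.\<close>

definition ck :: "complex \<Rightarrow> complex" where
  "ck \<zeta> = 1 / (1 - exp (- \<zeta>))"

definition cker :: "real \<times> real \<Rightarrow> complex" where
  "cker p = (if fst p \<noteq> 0 \<and> snd p \<noteq> 0 \<and> \<bar>snd p\<bar> \<le> pi then ck (Complex (fst p) (snd p)) else 0)"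

section \<open>Size and integrability of the kernel\<close>

lemma exp_minus_eq_1_strip:
  assumes "exp (- \<zeta>) = 1" "\<bar>Im \<zeta>\<bar> \<le> pi" shows "\<zeta> = 0"
proof -
  obtain n :: int where n: "Re (- \<zeta>) = 0" "Im (- \<zeta>) = of_int (2 * n) * pi"
    using assms(1) by (auto simp: exp_eq_1)
  have "n = 0"
  proof (rule ccontr)
    assume "n \<noteq> 0"
    then have "1 \<le> \<bar>of_int n :: real\<bar>" by linarith
    then have "2 * pi * 1 \<le> 2 * pi * \<bar>of_int n\<bar>" by (intro mult_left_mono) auto
    also have "\<dots> = \<bar>Im \<zeta>\<bar>"
    proof -
      have "Im \<zeta> = - (of_int (2 * n) * pi)" using n(2) by simp
      then show ?thesis by (simp add: abs_mult)
    qed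
    finally show False using assms(2) pi_gt_zero by linarith
  qed
  then show ?thesis using n by (simp add: complex_eq_iff)
qed

text \<open>The quotient \<open>(1 - exp (- \<zeta>)) / \<zeta>\<close>, completed by 1 at 0, is
  continuous and has no zero on a compact piece of the strip, so its modulus has a positive minimum
  there. At 0 both sides are 0 by the convention for division by zero.\<close>

lemma ck_near_bound:
  obtains C where "C > 0" "\<And>\<zeta>. -1 \<le> Re \<zeta> \<Longrightarrow> Re \<zeta> \<le> s \<Longrightarrow> \<bar>Im \<zeta>\<bar> \<le> pi \<Longrightarrow> cmod (ck \<zeta>) \<le> C / cmod \<zeta>"
proof -
  define E where "E \<zeta> = (if \<zeta> = 0 then 1 else (1 - exp (- \<zeta>)) / \<zeta>)" for \<zeta> :: complex
  have "((\<lambda>\<zeta>. 1 - exp (- \<zeta>)) has_field_derivative 1) (at (0::complex))"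
    by (auto intro!: derivative_eq_intros)
  then have "((\<lambda>\<zeta>::complex. (1 - exp (- \<zeta>)) / \<zeta>) \<longlongrightarrow> 1) (at 0)"
    by (simp add: has_field_derivative_iff)
  then have "(E \<longlongrightarrow> 1) (at 0)"
    by (rule Lim_transform_eventually) (auto simp: E_def eventually_at_filter)
  then have c0: "isCont E 0" unfolding isCont_def by (simp add: E_def)
  have cE: "isCont E \<zeta>" for \<zeta>
  proof (cases "\<zeta> = 0")
    case False
    have "isCont (\<lambda>\<zeta>. (1 - exp (- \<zeta>)) / \<zeta>) \<zeta>" using False by (intro continuous_intros)
    moreover have "\<forall>\<^sub>F z in nhds \<zeta>. E z = (1 - exp (- z)) / z"
      using t1_space_nhds[OF False] by eventually_elim (simp add: E_def)
    ultimately show ?thesis by (simp only: isCont_cong)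
  qed (use c0 in simp)
  define Q where "Q = cbox (Complex (-1) (-pi)) (Complex (max s 0) pi)"
  have Q: "compact Q" "Q \<noteq> {}" unfolding Q_def by (auto simp: box_ne_empty Basis_complex_def inner_complex_def)
  have "continuous_on Q (\<lambda>\<zeta>. cmod (E \<zeta>))"
    using cE by (intro continuous_on_norm continuous_at_imp_continuous_on) auto
  from continuous_attains_inf[OF Q this] obtain w where w: "w \<in> Q" "\<And>\<zeta>. \<zeta> \<in> Q \<Longrightarrow> cmod (E w) \<le> cmod (E \<zeta>)" by blast
  have inQ: "\<zeta> \<in> Q \<longleftrightarrow> -1 \<le> Re \<zeta> \<and> Re \<zeta> \<le> max s 0 \<and> \<bar>Im \<zeta>\<bar> \<le> pi" for \<zeta>
    unfolding Q_def by (auto simp: in_cbox_complex_iff)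
  have "E w \<noteq> 0"
  proof (cases "w = 0")
    case False
    then have "exp (- w) \<noteq> 1" using exp_minus_eq_1_strip[of w] w(1) inQ by blast
    then show ?thesis using False by (simp add: E_def)
  qed (simp add: E_def)
  then have pos: "cmod (E w) > 0" by simp
  show ?thesis
  proof (rule that[of "1 / cmod (E w)"])
    fix \<zeta> assume z: "-1 \<le> Re \<zeta>" "Re \<zeta> \<le> s" "\<bar>Im \<zeta>\<bar> \<le> pi"
    show "cmod (ck \<zeta>) \<le> 1 / cmod (E w) / cmod \<zeta>"
    proof (cases "\<zeta> = 0")
      case False
      have "\<zeta> \<in> Q" using z inQ by auto
      from w(2)[OF this] have "cmod (E w) * cmod \<zeta> \<le> cmod (1 - exp (- \<zeta>))"
        using False by (simp add: E_def norm_divide le_divide_eq)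
      then show ?thesis using pos False unfolding ck_def
        by (simp add: norm_divide) (smt (verit) frac_le mult_pos_pos norm_le_zero_iff divide_divide_eq_left)
    qed (simp add: ck_def)
  qed (use pos in simp)
qed

text \<open>For \<open>Re \<zeta> \<le> -1\<close> the modulus of \<open>exp (- \<zeta>)\<close> is
  at least 2, so subtracting it from 1 loses at most half of it. This decay makes integration down
  to minus infinity possible.\<close>

lemma ck_far_bound:
  assumes "Re \<zeta> \<le> -1" shows "cmod (ck \<zeta>) \<le> 2 * exp (Re \<zeta>)"
proof -
  have e: "exp (- Re \<zeta>) \<ge> 2"
  proof -
    have "1 + 1 \<le> 1 + (- Re \<zeta>)" using assms by simp
    also have "\<dots> \<le> exp (- Re \<zeta>)" by (rule exp_ge_add_one_self)
    finally show ?thesis by simp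
  qed
  have "exp (- Re \<zeta>) - 1 \<le> cmod (1 - exp (- \<zeta>))"
    using norm_triangle_ineq2[of "exp (- \<zeta>)" 1] by (simp add: norm_minus_commute)
  then have "exp (- Re \<zeta>) / 2 \<le> cmod (1 - exp (- \<zeta>))" using e by simp
  then have "cmod (ck \<zeta>) \<le> 1 / (exp (- Re \<zeta>) / 2)"
    unfolding ck_def norm_divide norm_one by (intro divide_left_mono) (auto intro!: mult_pos_pos simp: zero_less_mult_iff)
  also have "\<dots> = 2 * exp (Re \<zeta>)" by (simp add: exp_minus field_simps)
  finally show ?thesis .
qed

lemma cker_measurable [measurable]: "cker \<in> borel_measurable borel"
proof -
  have "(\<lambda>p::real \<times> real. complex_of_real (fst p) + \<i> * complex_of_real (snd p)) \<in> borel_measurable borel"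
    by (intro borel_measurable_continuous_onI continuous_intros)
  moreover have "ck \<in> borel_measurable borel" unfolding ck_def[abs_def] by measurable
  ultimately have "(\<lambda>p. ck (complex_of_real (fst p) + \<i> * complex_of_real (snd p))) \<in> borel_measurable borel"
    by measurable
  moreover have "Measurable.pred borel (\<lambda>p::real \<times> real. fst p \<noteq> 0 \<and> snd p \<noteq> 0 \<and> \<bar>snd p\<bar> \<le> pi)"
    unfolding borel_prod[symmetric] by measurable
  ultimately show ?thesis unfolding cker_def[abs_def] Complex_eq by measurable
qed

lemma nn_integral_product_finite:
  fixes u v :: "real \<Rightarrow> ennreal"
  assumes [measurable]: "u \<in> borel_measurable borel" "v \<in> borel_measurable borel"
    and "(\<integral>\<^sup>+x. u x \<partial>lborel) < \<infinity>" "(\<integral>\<^sup>+x. v x \<partial>lborel) < \<infinity>"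
  shows "(\<integral>\<^sup>+p. u (fst p) * v (snd p) \<partial>(lborel :: (real \<times> real) measure)) < \<infinity>"
proof -
  have "(\<integral>\<^sup>+p. u (fst p) * v (snd p) \<partial>(lborel :: (real \<times> real) measure))
      = (\<integral>\<^sup>+x. \<integral>\<^sup>+y. u x * v y \<partial>lborel \<partial>lborel)"
    unfolding lborel_prod[symmetric] by (subst lborel.nn_integral_fst[symmetric]) (auto simp: case_prod_beta)
  also have "\<dots> = (\<integral>\<^sup>+x. u x \<partial>lborel) * (\<integral>\<^sup>+x. v x \<partial>lborel)"
    by (simp add: nn_integral_cmult nn_integral_multc)
  also have "\<dots> < \<infinity>" using assms by (simp add: ennreal_mult_less_top)
  finally show ?thesis .
qed

text \<open>The even function |x| to the power -1/2 on the interval from \<open>-a\<close> to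
  \<open>a\<close>, with value 0 at 0; it is written as two reflected halves so that one integral
  starting at 0 suffices.\<close>

definition invsqrt :: "real \<Rightarrow> real \<Rightarrow> real" where
  "invsqrt a x = indicator {0..a} x * x powr (-1/2) + indicator {0..a} (-x) * (-x) powr (-1/2)"

lemma invsqrt_nonneg: "0 \<le> invsqrt a x" by (simp add: invsqrt_def)

lemma invsqrt_measurable [measurable]: "invsqrt a \<in> borel_measurable borel"
  unfolding invsqrt_def[abs_def] by measurable

lemma invsqrt_eq: "x \<noteq> 0 \<Longrightarrow> \<bar>x\<bar> \<le> a \<Longrightarrow> invsqrt a x = \<bar>x\<bar> powr (-1/2)"
  by (auto simp: invsqrt_def indicator_def abs_if split: if_splits)

lemma nn_integral_reflect:
  fixes f :: "real \<Rightarrow> ennreal"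
  assumes "f \<in> borel_measurable borel"
  shows "(\<integral>\<^sup>+x. f (- x) \<partial>lborel) = (\<integral>\<^sup>+x. f x \<partial>lborel)"
  using nn_integral_real_affine[OF assms, of "-1" 0] by simp

lemma invsqrt_finite:
  assumes "0 \<le> a" shows "(\<integral>\<^sup>+x. ennreal (invsqrt a x) \<partial>lborel) < \<infinity>"
proof -
  define j where "j x = indicator {0..a} x * x powr (-1/2)" for x :: real
  have [measurable]: "j \<in> borel_measurable borel" unfolding j_def by measurable
  have j0: "0 \<le> j x" for x by (simp add: j_def)
  have "(\<integral>\<^sup>+x. ennreal (j x) \<partial>lborel) = ennreal (a powr (-1/2+1) / (-1/2+1))"
    using nn_integral_has_integral_lebesgue[OF _ has_integral_powr_from_0[of "-1/2" a]] assms unfolding j_def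
    by (simp add: ennreal_mult' ennreal_indicator)
  then have 1: "(\<integral>\<^sup>+x. ennreal (j x) \<partial>lborel) < \<infinity>" by simp
  have "(\<integral>\<^sup>+x. ennreal (invsqrt a x) \<partial>lborel) = (\<integral>\<^sup>+x. ennreal (j x) + ennreal (j (-x)) \<partial>lborel)"
    using j0 by (intro nn_integral_cong) (simp add: invsqrt_def j_def flip: ennreal_plus)
  also have "\<dots> = (\<integral>\<^sup>+x. ennreal (j x) \<partial>lborel) + (\<integral>\<^sup>+x. ennreal (j (-x)) \<partial>lborel)"
    by (intro nn_integral_add) measurable
  also have "(\<integral>\<^sup>+x. ennreal (j (-x)) \<partial>lborel) = (\<integral>\<^sup>+x. ennreal (j x) \<partial>lborel)"
    by (rule nn_integral_reflect[of "\<lambda>x. ennreal (j x)"]) measurable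
  finally show ?thesis using 1 by simp
qed

text \<open>From 2|xy| \<le> x^2 + y^2. The planar singularity is dominated by a product of two
  integrable one-dimensional ones, so Tonelli settles integrability near 0. The right side is 0 on
  the coordinate axes, which is why \<open>cker\<close> omits them.\<close>

lemma inverse_norm_le:
  assumes "x \<noteq> 0" "y \<noteq> 0"
  shows "1 / cmod (Complex x y) \<le> \<bar>x\<bar> powr (-1/2) * \<bar>y\<bar> powr (-1/2)"
proof -
  have pos: "0 < \<bar>x\<bar> * \<bar>y\<bar>" using assms by simp
  have "0 \<le> (\<bar>x\<bar> - \<bar>y\<bar>)\<^sup>2" by simp
  then have "2 * (\<bar>x\<bar> * \<bar>y\<bar>) \<le> x\<^sup>2 + y\<^sup>2" by (simp add: power2_diff)
  then have "\<bar>x\<bar> * \<bar>y\<bar> \<le> x\<^sup>2 + y\<^sup>2" using pos by linarith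
  then have le: "sqrt (\<bar>x\<bar> * \<bar>y\<bar>) \<le> cmod (Complex x y)" unfolding complex_norm by (intro real_sqrt_le_mono)
  have "1 / cmod (Complex x y) \<le> 1 / sqrt (\<bar>x\<bar> * \<bar>y\<bar>)"
    by (rule frac_le) (use le pos in auto)
  also have "\<dots> = (\<bar>x\<bar> * \<bar>y\<bar>) powr (-1/2)"
    using pos by (simp add: powr_minus_divide powr_half_sqrt)
  also have "\<dots> = \<bar>x\<bar> powr (-1/2) * \<bar>y\<bar> powr (-1/2)" by (rule powr_mult)
  finally show ?thesis .
qed

lemma cker_integrable: "integrable lborel (\<lambda>p. indicator {p. fst p \<le> s} p *\<^sub>R cker p)"
proof -
  obtain C where C: "C > 0" "\<And>\<zeta>. -1 \<le> Re \<zeta> \<Longrightarrow> Re \<zeta> \<le> s \<Longrightarrow> \<bar>Im \<zeta>\<bar> \<le> pi \<Longrightarrow> cmod (ck \<zeta>) \<le> C / cmod \<zeta>"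
    using ck_near_bound by blast
  define a where "a = max 1 s"
  define e :: "real \<Rightarrow> real" where "e x = indicator {0..} (-x) * exp (- 1 * (- x))" for x
  \<comment> \<open>The product \<open>u x * v y\<close> dominates two products at once: the
    exponential tail times the strip, used for \<open>x \<le> -1\<close>, and the two inverse square
    roots, used for larger \<open>x\<close>. The mixed terms only enlarge it.\<close>
  define u where "u x = 2 * ennreal (e x) + ennreal C * ennreal (invsqrt a x)" for x
  define v where "v y = indicator {-pi..pi} y + ennreal (invsqrt pi y)" for y :: real
  have [measurable]: "e \<in> borel_measurable borel" unfolding e_def by measurable
  have e0: "0 \<le> e x" for x by (simp add: e_def)
  have um: "u \<in> borel_measurable borel" unfolding u_def[abs_def] by measurable
  have vm: "v \<in> borel_measurable borel" unfolding v_def[abs_def] by measurable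
  have fe: "(\<integral>\<^sup>+x. ennreal (e x) \<partial>lborel) < \<infinity>"
  proof -
    have m: "(\<lambda>x::real. ennreal (indicator {0..} x * exp (- 1 * x))) \<in> borel_measurable borel" by measurable
    have "(\<integral>\<^sup>+x. ennreal (e x) \<partial>lborel) = (\<integral>\<^sup>+x. ennreal (indicator {0..} x * exp (- 1 * x)) \<partial>lborel)"
      unfolding e_def using nn_integral_reflect[OF m] by simp
    also have "\<dots> = ennreal (exp (-1*0)/1)"
      using nn_integral_has_integral_lebesgue[OF _ has_integral_exp_minus_to_infinity[of 1 0]]
      by (simp add: ennreal_mult' ennreal_indicator)
    finally show ?thesis by simp
  qed
  have uf: "(\<integral>\<^sup>+x. u x \<partial>lborel) < \<infinity>"
    unfolding u_def using fe invsqrt_finite[of a]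
    by (subst nn_integral_add) (auto simp: nn_integral_cmult a_def ennreal_mult_less_top)
  have vf: "(\<integral>\<^sup>+x. v x \<partial>lborel) < \<infinity>"
    unfolding v_def using invsqrt_finite[of pi]
    by (subst nn_integral_add) (auto simp: emeasure_lborel_Icc_eq)
  have le: "ennreal (norm (indicator {p. fst p \<le> s} p *\<^sub>R cker p)) \<le> u (fst p) * v (snd p)" for p :: "real \<times> real"
  proof (cases "fst p \<le> s \<and> fst p \<noteq> 0 \<and> snd p \<noteq> 0 \<and> \<bar>snd p\<bar> \<le> pi")
    case False
    then show ?thesis by (auto simp: cker_def indicator_def)
  next
    case True
    define x y where "x = fst p" and "y = snd p"
    have xy: "x \<le> s" "x \<noteq> 0" "y \<noteq> 0" "\<bar>y\<bar> \<le> pi" using True by (auto simp: x_def y_def)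
    have n: "norm (indicator {p. fst p \<le> s} p *\<^sub>R cker p) = cmod (ck (Complex x y))"
      using True by (simp add: cker_def x_def y_def)
    show ?thesis
    proof (cases "x \<le> -1")
      case True
      have "cmod (ck (Complex x y)) \<le> 2 * e x" using ck_far_bound[of "Complex x y"] True by (simp add: e_def)
      then have "ennreal (cmod (ck (Complex x y))) \<le> ennreal (2 * e x)" by (rule ennreal_leI)
      also have "\<dots> = 2 * ennreal (e x) * 1" by (simp add: ennreal_mult' e0)
      also have "\<dots> \<le> u x * v y"
      proof (rule mult_mono)
        show "2 * ennreal (e x) \<le> u x" unfolding u_def by simp
        show "1 \<le> v y" unfolding v_def using xy by (simp add: abs_le_iff)
      qed auto
      finally show ?thesis unfolding n x_def y_def .
    next
      case False
      have "cmod (ck (Complex x y)) \<le> C / cmod (Complex x y)" using C(2)[of "Complex x y"] False xy by simp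
      also have "\<dots> = C * (1 / cmod (Complex x y))" by simp
      also have "\<dots> \<le> C * (\<bar>x\<bar> powr (-1/2) * \<bar>y\<bar> powr (-1/2))"
        using C(1) by (intro mult_left_mono inverse_norm_le xy) auto
      also have "\<dots> = C * invsqrt a x * invsqrt pi y"
        using xy False by (simp add: invsqrt_eq a_def)
      finally have "ennreal (cmod (ck (Complex x y))) \<le> ennreal (C * invsqrt a x * invsqrt pi y)" by (rule ennreal_leI)
      also have "\<dots> = ennreal C * ennreal (invsqrt a x) * ennreal (invsqrt pi y)"
        using C(1) by (simp add: ennreal_mult invsqrt_nonneg)
      also have "\<dots> \<le> u x * v y" by (rule mult_mono) (auto simp: u_def v_def)
      finally show ?thesis unfolding n x_def y_def .
    qed
  qed
  show ?thesis
  proof (rule integrableI_bounded)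
    have "Measurable.pred borel (\<lambda>p::real \<times> real. fst p \<le> s)" unfolding borel_prod[symmetric] by measurable
    then have "{p::real \<times> real. fst p \<le> s} \<in> sets borel" by (simp add: pred_def)
    then show "(\<lambda>p. indicator {p. fst p \<le> s} p *\<^sub>R cker p) \<in> borel_measurable lborel" by measurable
    have "(\<integral>\<^sup>+p. ennreal (norm (indicator {p. fst p \<le> s} p *\<^sub>R cker p)) \<partial>lborel) \<le> (\<integral>\<^sup>+p. u (fst p) * v (snd p) \<partial>lborel)"
      by (intro nn_integral_mono le)
    also have "\<dots> < \<infinity>" by (rule nn_integral_product_finite[OF um vm uf vf])
    finally show "(\<integral>\<^sup>+p. ennreal (norm (indicator {p. fst p \<le> s} p *\<^sub>R cker p)) \<partial>lborel) < \<infinity>" .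
  qed
qed

lemma cker_mult_integrable:
  assumes m: "\<Phi> \<in> borel_measurable borel" and B: "\<And>p. fst p \<le> s \<Longrightarrow> cmod (\<Phi> p) \<le> B" and z: "\<And>p. s < fst p \<Longrightarrow> \<Phi> p = 0"
  shows "integrable lborel (\<lambda>p. cker p * \<Phi> p)"
proof (rule Bochner_Integration.integrable_bound)
  show "integrable lborel (\<lambda>p. \<bar>B\<bar> * norm (indicator {p. fst p \<le> s} p *\<^sub>R cker p))"
    by (intro integrable_mult_right integrable_norm cker_integrable)
  show "(\<lambda>p. cker p * \<Phi> p) \<in> borel_measurable lborel" using m by measurable
  show "AE p in lborel. norm (cker p * \<Phi> p) \<le> norm (\<bar>B\<bar> * norm (indicator {p. fst p \<le> s} p *\<^sub>R cker p))"
  proof (rule AE_I2)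
    fix p :: "real \<times> real"
    show "norm (cker p * \<Phi> p) \<le> norm (\<bar>B\<bar> * norm (indicator {p. fst p \<le> s} p *\<^sub>R cker p))"
    proof (cases "fst p \<le> s")
      case True
      have "cmod (cker p) * cmod (\<Phi> p) \<le> cmod (cker p) * \<bar>B\<bar>" using B[OF True] by (intro mult_left_mono) auto
      then show ?thesis using True by (simp add: norm_mult mult.commute)
    qed (use z in auto)
  qed
qed


section \<open>Contour integrals of the kernel and the Cauchy-Pompeiu formula\<close>

lemma ck_period: "ck (Complex s pi) = ck (Complex s (- pi))"
proof -
  have "exp (- Complex s pi) = exp (- Complex s (- pi))"
    by (simp add: complex_eq_iff Re_exp Im_exp)
  then show ?thesis by (simp add: ck_def)
qed

lemma Complex_path_derivs:
  "((\<lambda>s. Complex s t) has_vector_derivative 1) (at s)"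
  "((\<lambda>t. Complex s t) has_vector_derivative \<i>) (at t)"
proof -
  have "((\<lambda>s. of_real s + \<i> * of_real t) has_vector_derivative (of_real 1 + 0)) (at s)"
    by (intro has_vector_derivative_add has_vector_derivative_of_real DERIV_ident has_vector_derivative_const)
  then show "((\<lambda>s. Complex s t) has_vector_derivative 1) (at s)" by (simp add: Complex_eq)
  have "((\<lambda>t. of_real s + \<i> * of_real t) has_vector_derivative (0 + \<i> * of_real 1)) (at t)"
    by (intro has_vector_derivative_add has_vector_derivative_mult_right has_vector_derivative_of_real DERIV_ident has_vector_derivative_const)
  then show "((\<lambda>t. Complex s t) has_vector_derivative \<i>) (at t)" by (simp add: Complex_eq)
qed

lemma exp_minus_neq_1: "Re \<zeta> \<noteq> 0 \<Longrightarrow> exp (- \<zeta>) \<noteq> 1"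
  by (auto simp: exp_eq_1)

lemma ck_derivative:
  assumes "Re \<zeta> \<noteq> 0"
  shows "(ck has_field_derivative (- exp (- \<zeta>) / (1 - exp (- \<zeta>))\<^sup>2)) (at \<zeta>)"
  unfolding ck_def[abs_def] using exp_minus_neq_1[OF assms]
  by (auto intro!: derivative_eq_intros simp: power2_eq_square field_simps)

lemma ck_continuous_on: "(\<And>\<zeta>. \<zeta> \<in> S \<Longrightarrow> exp (- \<zeta>) \<noteq> 1) \<Longrightarrow> continuous_on S ck"
  unfolding ck_def[abs_def] by (intro continuous_intros) auto

lemma continuous_on_Complex: "continuous_on S (\<lambda>p. Complex (fst p) (snd p))"
  unfolding Complex_eq by (intro continuous_intros)

text \<open>The residue at z = 1: the circle of radius \<open>exp s\<close> encloses that point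
  exactly when \<open>s > 0\<close>. On either side a logarithm gives, up to a constant factor, a
  periodic primitive in \<open>t\<close>, of \<open>ck - 1\<close> for \<open>s > 0\<close> and of
  \<open>ck\<close> for \<open>s < 0\<close>. Its argument is 1 minus a number of modulus below 1,
  hence off the branch cut.\<close>

lemma ck_integral:
  assumes "s \<noteq> 0"
  shows "integral {-pi..pi} (\<lambda>t. ck (Complex s t)) = (if s > 0 then 2 * of_real pi else 0)"
proof (cases "s > 0")
  case True
  define F where "F t = Ln (1 - exp (- Complex s t))" for t
  have "((\<lambda>t. \<i> * (ck (Complex s t) - 1)) has_integral (F pi - F (-pi))) {-pi..pi}"
  proof (rule fundamental_theorem_of_calculus)
    fix t :: real
    have ne: "exp (- Complex s t) \<noteq> 1" by (rule exp_minus_neq_1) (use assms in simp)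
    have "cmod (exp (- Complex s t)) < 1" using True by simp
    with complex_Re_le_cmod have "Re (exp (- Complex s t)) < 1" by (rule le_less_trans)
    then have "Re (1 - exp (- Complex s t)) > 0" by simp
    then have "1 - exp (- Complex s t) \<notin> \<real>\<^sub>\<le>\<^sub>0" using complex_nonpos_Reals_iff by auto
    then have "((\<lambda>z. Ln (1 - exp (- z))) has_field_derivative (exp (- Complex s t) / (1 - exp (- Complex s t)))) (at (Complex s t))"
      using ne by (auto intro!: derivative_eq_intros simp: field_simps)
    from field_vector_diff_chain_at[OF Complex_path_derivs(2) this]
    have "(F has_vector_derivative (\<i> * (exp (- Complex s t) / (1 - exp (- Complex s t))))) (at t)"
      by (simp add: F_def[abs_def] o_def)
    moreover have "exp (- Complex s t) / (1 - exp (- Complex s t)) = ck (Complex s t) - 1"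
      unfolding ck_def using ne by (simp add: field_simps)
    ultimately show "(F has_vector_derivative (\<i> * (ck (Complex s t) - 1))) (at t within {-pi..pi})"
      by (simp only: has_vector_derivative_at_within)
  qed simp
  moreover have "exp (- Complex s pi) = exp (- Complex s (- pi))" by (simp add: complex_eq_iff Re_exp Im_exp)
  then have "F pi = F (-pi)" unfolding F_def by simp
  ultimately have "((\<lambda>t. (1/\<i>) * (\<i> * (ck (Complex s t) - 1)) + 1) has_integral ((1/\<i>) * 0 + of_real (pi - (-pi)))) {-pi..pi}"
    using has_integral_const_real[of "1::complex" "-pi" pi] by (intro has_integral_add has_integral_mult_right) (auto simp: scaleR_conv_of_real)
  then have "((\<lambda>t. ck (Complex s t)) has_integral (2 * of_real pi)) {-pi..pi}" by simp
  then show ?thesis using True by (simp add: integral_unique)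
next
  case False
  then have s: "s < 0" using assms by simp
  define F where "F t = Ln (1 - exp (Complex s t))" for t
  have "((\<lambda>t. \<i> * ck (Complex s t)) has_integral (F pi - F (-pi))) {-pi..pi}"
  proof (rule fundamental_theorem_of_calculus)
    fix t :: real
    have ne: "exp (- Complex s t) \<noteq> 1" by (rule exp_minus_neq_1) (use assms in simp)
    have lt: "cmod (exp (Complex s t)) < 1" using s by simp
    then have ne2: "exp (Complex s t) \<noteq> 1" by (metis norm_one less_irrefl)
    from complex_Re_le_cmod lt have "Re (exp (Complex s t)) < 1" by (rule le_less_trans)
    then have "Re (1 - exp (Complex s t)) > 0" by simp
    then have "1 - exp (Complex s t) \<notin> \<real>\<^sub>\<le>\<^sub>0" using complex_nonpos_Reals_iff by auto
    then have "((\<lambda>z. Ln (1 - exp z)) has_field_derivative (- exp (Complex s t) / (1 - exp (Complex s t)))) (at (Complex s t))"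
      using ne2 by (auto intro!: derivative_eq_intros simp: field_simps)
    from field_vector_diff_chain_at[OF Complex_path_derivs(2) this]
    have "(F has_vector_derivative (\<i> * (- exp (Complex s t) / (1 - exp (Complex s t))))) (at t)"
      by (simp add: F_def[abs_def] o_def)
    moreover have "- exp (Complex s t) / (1 - exp (Complex s t)) = ck (Complex s t)"
      unfolding ck_def using ne ne2 by (simp add: field_simps exp_minus)
    ultimately show "(F has_vector_derivative (\<i> * ck (Complex s t))) (at t within {-pi..pi})"
      by (simp only: has_vector_derivative_at_within)
  qed simp
  moreover have "exp (Complex s pi) = exp (Complex s (- pi))" by (simp add: complex_eq_iff Re_exp Im_exp)
  then have "F pi = F (-pi)" unfolding F_def by simp
  ultimately have "((\<lambda>t. (1/\<i>) * (\<i> * ck (Complex s t))) has_integral ((1/\<i>) * 0)) {-pi..pi}"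
    by (intro has_integral_mult_right) auto
  then have "((\<lambda>t. ck (Complex s t)) has_integral 0) {-pi..pi}" by simp
  then show ?thesis using False by (simp add: integral_unique)
qed


text \<open>\<open>Gs + \<i> * Gt\<close> is twice the antiholomorphic derivative of
  \<open>G\<close>. The integral \<open>g s\<close> of \<open>ck * G\<close> over a circle has
  derivative \<open>q s\<close> for \<open>s \<noteq> 0\<close>. It tends to 0 at minus infinity,
  where \<open>ck\<close> decays, and is 0 beyond \<open>s\<^sub>0\<close>, so the total integral of
  \<open>q\<close> is minus the jump of \<open>g\<close> at 0. By \<open>ck_integral\<close> this
  jump is \<open>2 * pi * G 0 0\<close>.\<close>

lemma cylinder_Pompeiu:
  fixes G Gs Gt :: "real \<Rightarrow> real \<Rightarrow> complex"
  assumes ds: "\<And>s t. ((\<lambda>s. G s t) has_vector_derivative Gs s t) (at s)"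
    and dt: "\<And>s t. ((\<lambda>t. G s t) has_vector_derivative Gt s t) (at t)"
    and cG: "continuous_on UNIV (\<lambda>p. G (fst p) (snd p))"
    and cGs: "continuous_on UNIV (\<lambda>p. Gs (fst p) (snd p))"
    and cGt: "continuous_on UNIV (\<lambda>p. Gt (fst p) (snd p))"
    and per: "\<And>s. G s pi = G s (- pi)"
    and zero: "\<And>s t. s\<^sub>0 \<le> s \<Longrightarrow> G s t = 0"
    and bd: "\<And>s t. cmod (G s t) \<le> B" "\<And>s t. cmod (Gs s t) \<le> B" "\<And>s t. cmod (Gt s t) \<le> B"
  shows "(\<integral>p. cker p * (Gs (fst p) (snd p) + \<i> * Gt (fst p) (snd p)) \<partial>lborel) = - (2 * of_real pi * G 0 0)"
proof -
  have B0: "0 \<le> B" using order_trans[OF norm_ge_zero bd(1)] .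
  define H where "H p = Gs (fst p) (snd p) + \<i> * Gt (fst p) (snd p)" for p
  have cH: "continuous_on S H" for S
    unfolding H_def by (rule continuous_on_subset[of UNIV]) (intro continuous_intros cGs cGt, simp)
  have Hz: "H p = 0" if "s\<^sub>0 < fst p" for p
  proof -
    have "((\<lambda>s. G s (snd p)) has_vector_derivative 0) (at (fst p))"
      by (rule has_vector_derivative_transform_within_open[where f = "\<lambda>_. 0" and S = "{s\<^sub>0<..}"])
         (use that zero in auto)
    then have 1: "Gs (fst p) (snd p) = 0" using ds vector_derivative_unique_at by blast
    have "((\<lambda>t. G (fst p) t) has_vector_derivative 0) (at (snd p))"
      using that zero by simp
    then have 2: "Gt (fst p) (snd p) = 0" using dt vector_derivative_unique_at by blast
    show ?thesis by (simp add: H_def 1 2)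
  qed
  have Hb: "cmod (H p) \<le> 2 * B" for p
    using norm_triangle_ineq[of "Gs (fst p) (snd p)" "\<i> * Gt (fst p) (snd p)"] bd(2)[of "fst p" "snd p"] bd(3)[of "fst p" "snd p"]
    by (simp add: H_def norm_mult)
  have Hm: "H \<in> borel_measurable borel" by (rule borel_measurable_continuous_onI[OF cH])
  have int: "integrable lborel (\<lambda>p. cker p * H p)"
    by (rule cker_mult_integrable[where s = s\<^sub>0 and B = "2 * B"]) (use Hm Hb Hz in auto)
  define q where "q s = (\<integral>t. cker (s, t) * H (s, t) \<partial>lborel)" for s
  have int2: "integrable (lborel \<Otimes>\<^sub>M lborel) (\<lambda>p. cker p * H p)" unfolding lborel_prod by (rule int)
  have qint: "integrable lborel q" unfolding q_def by (rule lborel_pair.integrable_fst'[OF int2])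
  have qL: "(\<integral>s. q s \<partial>lborel) = (\<integral>p. cker p * H p \<partial>lborel)"
    unfolding q_def using lborel_pair.integral_fst'[OF int2] by (simp add: lborel_prod)
  have ckc: "continuous_on S (\<lambda>p. ck (Complex (fst p) (snd p)))" if "\<And>p. p \<in> S \<Longrightarrow> fst p \<noteq> 0" for S :: "(real \<times> real) set"
    by (rule continuous_on_compose2[OF ck_continuous_on continuous_on_Complex, of "{\<zeta>. Re \<zeta> \<noteq> 0}"])
       (use that exp_minus_neq_1 in auto)
  have slice: "continuous_on A (\<lambda>t. F (s, t))" if "continuous_on {p. fst p \<noteq> 0} F" "s \<noteq> 0" for F :: "real \<times> real \<Rightarrow> complex" and s A
    by (rule continuous_on_compose2[OF that(1)]) (use that(2) in \<open>auto intro!: continuous_intros\<close>)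
  have ckt: "continuous_on A (\<lambda>t. ck (Complex s t))" if "s \<noteq> 0" for s A
    using slice[OF ckc that] by simp
  have ct: "continuous_on A (\<lambda>t. F s t)" if "continuous_on UNIV (\<lambda>p. F (fst p) (snd p))" for F :: "real \<Rightarrow> real \<Rightarrow> complex" and s A
  proof -
    have "continuous_on A (\<lambda>t. (s, t))" by (intro continuous_intros)
    from continuous_on_compose2[OF that this] show ?thesis by simp
  qed
  have qH: "q s = integral {-pi..pi} (\<lambda>t. ck (Complex s t) * H (s, t))" if s: "s \<noteq> 0" for s
  proof -
    have c: "continuous_on {-pi..pi} (\<lambda>t. ck (Complex s t) * H (s, t))"
      by (intro continuous_intros ckt s ct[of "\<lambda>s t. H (s, t)"]) (simp add: cH)
    have m: "(\<lambda>t. (s, t)) \<in> borel_measurable borel" for s :: real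
      by (intro borel_measurable_continuous_onI continuous_intros)
    have si: "set_integrable lborel {-pi..pi} (\<lambda>t. ck (Complex s t) * H (s, t))"
      by (rule borel_integrable_atLeastAtMost'[OF c])
    have "q s = (\<integral>t. indicator {-pi..pi} t *\<^sub>R (ck (Complex s t) * H (s, t)) \<partial>lborel)"
      unfolding q_def
    proof (rule integral_cong_AE)
      show "(\<lambda>t. cker (s, t) * H (s, t)) \<in> borel_measurable lborel"
        using measurable_compose[OF m cker_measurable, of s] measurable_compose[OF m Hm, of s] by measurable
      show "(\<lambda>t. indicator {-pi..pi} t *\<^sub>R (ck (Complex s t) * H (s, t))) \<in> borel_measurable lborel"
        using si unfolding set_integrable_def by (rule borel_measurable_integrable)
      show "AE t in lborel. cker (s, t) * H (s, t) = indicator {-pi..pi} t *\<^sub>R (ck (Complex s t) * H (s, t))"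
        using AE_lborel_singleton[of 0] by eventually_elim (use s in \<open>auto simp: cker_def indicator_def abs_le_iff\<close>)
    qed
    also have "\<dots> = integral {-pi..pi} (\<lambda>t. ck (Complex s t) * H (s, t))"
      using set_borel_integral_eq_integral(2)[OF si] by (simp add: set_lebesgue_integral_def)
    finally show ?thesis .
  qed
  define g where "g s = integral {-pi..pi} (\<lambda>t. ck (Complex s t) * G s t)" for s
  define ck' where "ck' \<zeta> = - exp (- \<zeta>) / (1 - exp (- \<zeta>))\<^sup>2" for \<zeta> :: complex
  have ck'c: "continuous_on {p. fst p \<noteq> 0} (\<lambda>p. ck' (Complex (fst p) (snd p)))"
    unfolding ck'_def using exp_minus_neq_1 by (intro continuous_intros continuous_on_Complex) auto
  have dck: "((\<lambda>s. ck (Complex s t)) has_vector_derivative ck' (Complex s t)) (at s)"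
    "((\<lambda>t. ck (Complex s t)) has_vector_derivative (\<i> * ck' (Complex s t))) (at t)" if "s \<noteq> 0" for s t
    using field_vector_diff_chain_at[OF Complex_path_derivs(1) ck_derivative, of s t]
      field_vector_diff_chain_at[OF Complex_path_derivs(2) ck_derivative, of s t] that
    by (simp_all add: o_def ck'_def)
  have gd: "(g has_vector_derivative q s) (at s)" if s: "s \<noteq> 0" for s
  proof -
    define U where "U = {s - \<bar>s\<bar>/2 .. s + \<bar>s\<bar>/2}"
    have U0: "x \<noteq> 0" if "x \<in> U" for x using that s unfolding U_def by (auto simp: abs_if split: if_splits)
    have sU: "s \<in> interior U" unfolding U_def using s by simp
    define fx where "fx x t = ck (Complex x t) * Gs x t + ck' (Complex x t) * G x t" for x t
    have "((\<lambda>x. integral (cbox (-pi) pi) (\<lambda>t. ck (Complex x t) * G x t)) has_vector_derivative integral (cbox (-pi) pi) (fx s)) (at s within U)"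
    proof (rule leibniz_rule_vector_derivative)
      show "((\<lambda>x. ck (Complex x t) * G x t) has_vector_derivative fx x t) (at x within U)" if "x \<in> U" for x t
        unfolding fx_def by (rule has_vector_derivative_at_within, rule has_vector_derivative_mult) (use dck(1) U0 that ds in auto)
      show "(\<lambda>t. ck (Complex x t) * G x t) integrable_on cbox (-pi) pi" if "x \<in> U" for x
        by (rule integrable_continuous) (intro continuous_intros ckt U0 that ct[OF cG])
      have "continuous_on (U \<times> cbox (-pi) pi) (\<lambda>p. ck (Complex (fst p) (snd p)) * Gs (fst p) (snd p) + ck' (Complex (fst p) (snd p)) * G (fst p) (snd p))"
        by (intro continuous_intros ckc continuous_on_subset[OF ck'c] continuous_on_subset[OF cGs] continuous_on_subset[OF cG]) (use U0 in auto)
      then show "continuous_on (U \<times> cbox (-pi) pi) (\<lambda>(x, t). fx x t)"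
        by (simp add: fx_def case_prod_beta)
      show "s \<in> U" using sU interior_subset by blast
      show "convex U" unfolding U_def by simp
    qed
    then have 1: "(g has_vector_derivative integral {-pi..pi} (fx s)) (at s)"
      using at_within_interior[OF sU] by (simp add: g_def[abs_def])
    have ck't: "continuous_on A (\<lambda>t. ck' (Complex s t))" for A using slice[OF ck'c s] by simp
    \<comment> \<open>The total \<open>t\<close>-derivative of \<open>ck * G\<close> integrates to 0
      by periodicity. Adding \<open>\<i>\<close> times it to \<open>fx s\<close> supplies the term
      with \<open>Gt\<close> and cancels the one with \<open>ck'\<close>, because \<open>ck\<close>
      is holomorphic.\<close>
    have "((\<lambda>t. ck (Complex s t) * Gt s t + (\<i> * ck' (Complex s t)) * G s t) has_integral
        (ck (Complex s pi) * G s pi - ck (Complex s (-pi)) * G s (-pi))) {-pi..pi}"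
      by (rule fundamental_theorem_of_calculus, simp, rule has_vector_derivative_at_within, rule has_vector_derivative_mult)
         (use dck(2)[OF s] dt in auto)
    then have "((\<lambda>t. ck (Complex s t) * Gt s t + (\<i> * ck' (Complex s t)) * G s t) has_integral 0) {-pi..pi}"
      by (simp add: ck_period per)
    from has_integral_mult_right[OF this, of \<i>]
    have 2: "((\<lambda>t. \<i> * (ck (Complex s t) * Gt s t + (\<i> * ck' (Complex s t)) * G s t)) has_integral 0) {-pi..pi}" by simp
    have "fx s integrable_on {-pi..pi}"
      unfolding fx_def by (intro integrable_continuous_real continuous_intros ckt s ck't ct[OF cGs] ct[OF cG])
    then have "(fx s has_integral integral {-pi..pi} (fx s)) {-pi..pi}" by (rule integrable_integral)
    from has_integral_add[OF this 2]
    have "((\<lambda>t. ck (Complex s t) * H (s, t)) has_integral integral {-pi..pi} (fx s)) {-pi..pi}"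
      by (simp add: fx_def H_def algebra_simps)
    then have "q s = integral {-pi..pi} (fx s)" unfolding qH[OF s] by (rule integral_unique)
    then show ?thesis using 1 by simp
  qed
  have ftc: "(\<integral>s. indicator {a..b} s *\<^sub>R q s \<partial>lborel) = g b - g a" if "a \<le> b" "0 \<notin> {a..b}" for a b
  proof -
    have "(q has_integral (g b - g a)) {a..b}"
      by (rule fundamental_theorem_of_calculus[OF that(1)], rule has_vector_derivative_at_within, rule gd) (use that(2) in auto)
    moreover have "set_integrable lborel {a..b} q"
      unfolding set_integrable_def by (rule integrable_mult_indicator) (use qint in auto)
    ultimately show ?thesis
      using set_borel_integral_eq_integral(2)[of "{a..b}" q] by (simp add: set_lebesgue_integral_def integral_unique)
  qed
  define S where "S = max s\<^sub>0 1 + 1"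
  define a where "a n = inverse (real (Suc n))" for n
  have a: "a n > 0" "a n \<le> 1" for n unfolding a_def by (auto simp: field_simps)
  have a0: "a \<longlonglongrightarrow> 0" unfolding a_def by (rule LIMSEQ_inverse_real_of_nat)
  \<comment> \<open>Two intervals that avoid \<open>s = 0\<close>, where \<open>g\<close> may jump,
    and exhaust the half-line up to \<open>S\<close> as \<open>n\<close> grows.\<close>
  define A where "A n = {a n..S} \<union> {- real (n + 2) .. - a n}" for n
  have qz: "q s = 0" if "s > s\<^sub>0" for s unfolding q_def using Hz[of "(s, _)"] that by simp
  have gz: "g S = 0" unfolding g_def using zero[of S] by (simp add: S_def)
  have "(\<lambda>n. \<integral>s. indicator (A n) s *\<^sub>R q s \<partial>lborel) \<longlonglongrightarrow> (\<integral>s. q s \<partial>lborel)"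
  proof (rule integral_dominated_convergence[where w = "\<lambda>s. norm (q s)"])
    show "q \<in> borel_measurable lborel" using qint by (rule borel_measurable_integrable)
    then show "(\<lambda>s. indicator (A n) s *\<^sub>R q s) \<in> borel_measurable lborel" for n unfolding A_def by measurable
    show "integrable lborel (\<lambda>s. norm (q s))" using qint by simp
    show "AE s in lborel. norm (indicator (A n) s *\<^sub>R q s) \<le> norm (q s)" for n
      by (rule AE_I2) (auto simp: indicator_def)
    show "AE s in lborel. (\<lambda>n. indicator (A n) s *\<^sub>R q s) \<longlonglongrightarrow> q s"
      using AE_lborel_singleton[of 0]
    proof eventually_elim
      case (elim s)
      show ?case
      proof (cases "s > S")
        case True
        then have "q s = 0" by (intro qz) (auto simp: S_def)
        then show ?thesis by simp
      next
        case False
        have "\<forall>\<^sub>F n in sequentially. a n < \<bar>s\<bar>" using elim by (intro order_tendstoD(2)[OF a0]) auto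
        moreover have "\<forall>\<^sub>F n in sequentially. - s \<le> real n"
          using eventually_ge_at_top[of "nat \<lceil>-s\<rceil>"] by eventually_elim linarith
        ultimately have "\<forall>\<^sub>F n in sequentially. indicator (A n) s *\<^sub>R q s = q s"
        proof eventually_elim
          case (elim n)
          then have "s \<in> A n" using False unfolding A_def by (auto simp: abs_if split: if_splits)
          then show ?case by simp
        qed
        then show ?thesis by (rule tendsto_eventually)
      qed
    qed
  qed
  moreover have "(\<integral>s. indicator (A n) s *\<^sub>R q s \<partial>lborel) = - g (a n) + g (- a n) - g (- real (n + 2))" for n
  proof -
    have ind: "indicator (A n) s *\<^sub>R q s = indicator {a n..S} s *\<^sub>R q s + indicator {- real (n + 2) .. - a n} s *\<^sub>R q s" for s
      using a[of n] by (auto simp: A_def indicator_def)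
    have i: "integrable lborel (\<lambda>s. indicator {x..y} s *\<^sub>R q s)" for x y
      by (rule integrable_mult_indicator) (use qint in auto)
    have "a n \<le> S" using a(2)[of n] by (simp add: S_def)
    moreover have "- real (n + 2) \<le> - a n" using a(2)[of n] by simp
    ultimately show ?thesis unfolding ind
      using a(1)[of n] by (subst Bochner_Integration.integral_add[OF i i]) (simp add: ftc gz)
  qed
  ultimately have L1: "(\<lambda>n. - g (a n) + g (- a n) - g (- real (n + 2))) \<longlonglongrightarrow> (\<integral>s. q s \<partial>lborel)" by simp
  have far: "(\<lambda>n. g (- real (n + 2))) \<longlonglongrightarrow> 0"
  proof (rule Lim_null_comparison)
    show "\<forall>\<^sub>F n in sequentially. norm (g (- real (n + 2))) \<le> 2 * inverse (exp (real n)) * B * (2 * pi)"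
    proof (intro always_eventually allI)
      fix n
      have "norm (g (- real (n + 2))) \<le> (2 * inverse (exp (real n)) * B) * (pi - (-pi))"
        unfolding g_def
      proof (rule integral_bound)
        show "continuous_on {-pi..pi} (\<lambda>t. ck (Complex (- real (n + 2)) t) * G (- real (n + 2)) t)"
          by (intro continuous_intros ckt ct[OF cG]) simp
        fix t
        have "cmod (ck (Complex (- real (n + 2)) t)) \<le> 2 * exp (- real (n + 2))"
          using ck_far_bound[of "Complex (- real (n + 2)) t"] by simp
        also have "\<dots> \<le> 2 * inverse (exp (real n))" by (simp flip: exp_minus)
        finally show "cmod (ck (Complex (- real (n + 2)) t) * G (- real (n + 2)) t) \<le> 2 * inverse (exp (real n)) * B"
          unfolding norm_mult using bd(1) by (intro mult_mono) auto
      qed simp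
      then show "norm (g (- real (n + 2))) \<le> 2 * inverse (exp (real n)) * B * (2 * pi)" by simp
    qed
    have "(\<lambda>n. inverse (exp (real n))) \<longlonglongrightarrow> 0"
      by (rule tendsto_inverse_0_at_top, rule filterlim_compose[OF exp_at_top filterlim_real_sequentially])
    then have "(\<lambda>n. 2 * inverse (exp (real n)) * B * (2 * pi)) \<longlonglongrightarrow> 2 * 0 * B * (2 * pi)" by (intro tendsto_intros)
    then show "(\<lambda>n. 2 * inverse (exp (real n)) * B * (2 * pi)) \<longlonglongrightarrow> 0" by simp
  qed
  define J where "J = {-pi..pi} - {0::real}"
  have negl: "negligible {x \<in> {-pi..pi} - J. f x \<noteq> 0}" "negligible {x \<in> J - {-pi..pi}. f x \<noteq> 0}" for f :: "real \<Rightarrow> 'z::zero"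
    unfolding J_def by (rule negligible_subset[of "{0}"], auto)+
  \<comment> \<open>Subtracting \<open>G 0 0\<close> cancels the singularity: the difference is at
    most a multiple of the distance to 0, so the integrand stays bounded. The limit \<open>I\<close>
    is the same from both sides and drops out, leaving the multiple of \<open>G 0 0\<close> as the
    jump.\<close>
  define I where "I = integral J (\<lambda>t. ck (Complex 0 t) * (G 0 t - G 0 0))"
  have near: "(\<lambda>n. integral {-pi..pi} (\<lambda>t. ck (Complex (\<sigma> n) t) * (G (\<sigma> n) t - G 0 0))) \<longlonglongrightarrow> I"
    if s: "\<sigma> \<longlonglongrightarrow> 0" "\<And>n. \<sigma> n \<noteq> 0" "\<And>n. \<bar>\<sigma> n\<bar> \<le> 1" for \<sigma> :: "nat \<Rightarrow> real"
  proof -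
    obtain C where C: "C > 0" "\<And>\<zeta>. -1 \<le> Re \<zeta> \<Longrightarrow> Re \<zeta> \<le> 1 \<Longrightarrow> \<bar>Im \<zeta>\<bar> \<le> pi \<Longrightarrow> cmod (ck \<zeta>) \<le> C / cmod \<zeta>"
      using ck_near_bound by blast
    let ?f = "\<lambda>n t. ck (Complex (\<sigma> n) t) * (G (\<sigma> n) t - G 0 0)"
    have fi: "?f n integrable_on {-pi..pi}" for n
      by (intro integrable_continuous_real continuous_intros ckt s ct[OF cG])
    have "(\<lambda>n. integral J (?f n)) \<longlonglongrightarrow> I"
      unfolding I_def
    proof (rule dominated_convergence(2)[where h = "\<lambda>_. C * (2 * B)"])
      show "?f n integrable_on J" for n by (rule integrable_spike_set[OF fi negl])
      show "(\<lambda>_. C * (2 * B)) integrable_on J"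
        by (rule integrable_spike_set[OF _ negl]) (rule integrable_const_ivl)
      fix n t assume "t \<in> J"
      then have t: "t \<noteq> 0" "\<bar>t\<bar> \<le> pi" unfolding J_def by auto
      define \<zeta> where "\<zeta> = Complex (\<sigma> n) t"
      have z: "cmod \<zeta> > 0" unfolding \<zeta>_def using t by (simp add: complex_eq_iff)
      have "cmod (G (\<sigma> n) t - G 0 t) \<le> B * \<bar>\<sigma> n\<bar>"
        using lipschitz_onD[OF has_vderiv_lipschitz[of UNIV "\<lambda>s. G s t" "\<lambda>s. Gs s t" B], of "\<sigma> n" 0] ds bd B0
        by (simp add: dist_norm)
      moreover have "cmod (G 0 t - G 0 0) \<le> B * \<bar>t\<bar>"
        using lipschitz_onD[OF has_vderiv_lipschitz[of UNIV "G 0" "Gt 0" B], of t 0] dt bd B0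
        by (simp add: dist_norm)
      moreover have "B * \<bar>\<sigma> n\<bar> \<le> B * cmod \<zeta>" "B * \<bar>t\<bar> \<le> B * cmod \<zeta>"
        using B0 abs_Re_le_cmod[of \<zeta>] abs_Im_le_cmod[of \<zeta>] by (auto simp: \<zeta>_def intro!: mult_left_mono)
      moreover have "cmod (G (\<sigma> n) t - G 0 0) \<le> cmod (G (\<sigma> n) t - G 0 t) + cmod (G 0 t - G 0 0)"
        using norm_triangle_ineq[of "G (\<sigma> n) t - G 0 t" "G 0 t - G 0 0"] by simp
      ultimately have g: "cmod (G (\<sigma> n) t - G 0 0) \<le> 2 * B * cmod \<zeta>" by simp
      have "cmod (ck \<zeta>) \<le> C / cmod \<zeta>" by (rule C(2)) (use s(3)[of n] t in \<open>auto simp: \<zeta>_def abs_le_iff\<close>)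
      then have "cmod (ck \<zeta>) * cmod (G (\<sigma> n) t - G 0 0) \<le> (C / cmod \<zeta>) * (2 * B * cmod \<zeta>)"
        using g C z by (intro mult_mono) auto
      then show "norm (?f n t) \<le> C * (2 * B)" using z by (simp add: norm_mult \<zeta>_def)
    next
      fix t assume "t \<in> J"
      then have t: "t \<noteq> 0" "\<bar>t\<bar> \<le> pi" unfolding J_def by auto
      have "exp (- Complex 0 t) \<noteq> 1" using exp_minus_eq_1_strip[of "Complex 0 t"] t by (auto simp: complex_eq_iff)
      then have "isCont ck (Complex 0 t)" unfolding ck_def[abs_def] by (intro continuous_intros) auto
      moreover have "(\<lambda>n. Complex (\<sigma> n) t) \<longlonglongrightarrow> Complex 0 t" by (intro tendsto_intros s)
      ultimately have 1: "(\<lambda>n. ck (Complex (\<sigma> n) t)) \<longlonglongrightarrow> ck (Complex 0 t)" by (rule isCont_tendsto_compose)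
      have "isCont (\<lambda>s. G s t) 0" using ds[of t 0] by (rule has_vector_derivative_continuous)
      then have 2: "(\<lambda>n. G (\<sigma> n) t) \<longlonglongrightarrow> G 0 t" using s(1) by (rule isCont_tendsto_compose)
      show "(\<lambda>n. ?f n t) \<longlonglongrightarrow> ck (Complex 0 t) * (G 0 t - G 0 0)" by (intro tendsto_intros 1 2)
    qed
    moreover have "integral J (?f n) = integral {-pi..pi} (?f n)" for n
      by (rule integral_spike_set[OF negl(2) negl(1)])
    ultimately show ?thesis by simp
  qed
  have split: "g s = integral {-pi..pi} (\<lambda>t. ck (Complex s t) * (G s t - G 0 0)) + G 0 0 * (if s > 0 then 2 * of_real pi else 0)"
    if s: "s \<noteq> 0" for s
  proof -
    have "integral {-pi..pi} (\<lambda>t. ck (Complex s t) * (G s t - G 0 0)) + integral {-pi..pi} (\<lambda>t. G 0 0 * ck (Complex s t))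
       = integral {-pi..pi} (\<lambda>t. ck (Complex s t) * (G s t - G 0 0) + G 0 0 * ck (Complex s t))"
      by (rule integral_add[symmetric]) (intro integrable_continuous_real continuous_intros ckt s ct[OF cG])+
    also have "\<dots> = g s" unfolding g_def by (simp add: algebra_simps)
    finally show ?thesis using ck_integral[OF s] by (simp add: integral_mult_right)
  qed
  have "(\<lambda>n. g (a n)) \<longlonglongrightarrow> I + G 0 0 * (2 * of_real pi)"
  proof -
    have "(\<lambda>n. integral {-pi..pi} (\<lambda>t. ck (Complex (a n) t) * (G (a n) t - G 0 0)) + G 0 0 * (2 * of_real pi)) \<longlonglongrightarrow> I + G 0 0 * (2 * of_real pi)"
    proof (intro tendsto_add near tendsto_const a0)
      show "a n \<noteq> 0" "\<bar>a n\<bar> \<le> 1" for n using a[of n] by auto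
    qed
    moreover have "g (a n) = integral {-pi..pi} (\<lambda>t. ck (Complex (a n) t) * (G (a n) t - G 0 0)) + G 0 0 * (2 * of_real pi)" for n
      using split[of "a n"] a(1)[of n] by simp
    ultimately show ?thesis by simp
  qed
  moreover have "(\<lambda>n. g (- a n)) \<longlonglongrightarrow> I"
  proof -
    have "(\<lambda>n. - a n) \<longlonglongrightarrow> 0" using tendsto_minus[OF a0] by simp
    moreover have "- a n \<noteq> 0" "\<bar>- a n\<bar> \<le> 1" for n using a[of n] by auto
    ultimately have "(\<lambda>n. integral {-pi..pi} (\<lambda>t. ck (Complex (- a n) t) * (G (- a n) t - G 0 0))) \<longlonglongrightarrow> I"
      by (rule near)
    moreover have "g (- a n) = integral {-pi..pi} (\<lambda>t. ck (Complex (- a n) t) * (G (- a n) t - G 0 0))" for n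
      using split[of "- a n"] a(1)[of n] by simp
    ultimately show ?thesis by simp
  qed
  ultimately have "(\<lambda>n. - g (a n) + g (- a n) - g (- real (n + 2))) \<longlonglongrightarrow> - (I + G 0 0 * (2 * of_real pi)) + I - 0"
    using far by (intro tendsto_intros)
  from LIMSEQ_unique[OF L1 this] show ?thesis unfolding qL H_def by simp
qed

section \<open>Radon measures\<close>

text \<open>True for every finite Borel measure on a metric space, by induction over the
  sigma-algebra. The inner sets are only closed; compactness is supplied by tightness in the next
  lemma.\<close>

lemma open_closed_regular:
  fixes \<mu> :: "'a::metric_space measure"
  assumes "sets \<mu> = sets borel" "finite_measure \<mu>" "B \<in> sets borel"
  shows "\<forall>e>0. \<exists>F Q. closed F \<and> open Q \<and> F \<subseteq> B \<and> B \<subseteq> Q \<and> measure \<mu> (Q - F) < e"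
proof -
  interpret finite_measure \<mu> by fact
  have op: "A \<in> sets \<mu>" if "open A" for A using that assms(1) by simp
  have cl: "A \<in> sets \<mu>" if "closed A" for A using that assms(1) by simp
  have "B \<in> sigma_sets UNIV {S. open S}" using assms(3) by (simp add: borel_def)
  then show ?thesis
  proof (induction rule: sigma_sets.induct)
    case (Basic A)
    then have A: "open A" by simp
    show ?case
    proof (cases "A = UNIV")
      case True
      then show ?thesis by (intro allI impI exI[of _ UNIV]) auto
    next
      case False
      then have ne: "- A \<noteq> {}" by auto
      \<comment> \<open>An open set is the increasing union of the closed sets of points at distance
        at least 1/(n+1) from its complement. The distance is informative only for a nonempty
        complement, hence the case split.\<close>
      define F where "F n = {x. inverse (real (Suc n)) \<le> infdist x (- A)}" for n
      have F: "closed (F n)" for n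
        unfolding F_def by (intro closed_Collect_le continuous_intros)
      have FA: "F n \<subseteq> A" for n
      proof
        fix x assume x: "x \<in> F n"
        show "x \<in> A"
        proof (rule ccontr)
          assume "x \<notin> A"
          then have "infdist x (- A) = 0" by (intro infdist_zero) simp
          then show False using x by (simp add: F_def)
        qed
      qed
      have dec: "decseq (\<lambda>n. A - F n)"
      proof (rule decseq_SucI)
        fix n
        have "inverse (real (Suc (Suc n))) \<le> inverse (real (Suc n))" by (intro le_imp_inverse_le) auto
        then have "F n \<subseteq> F (Suc n)" unfolding F_def using order_trans by blast
        then show "A - F (Suc n) \<subseteq> A - F n" by blast
      qed
      have "(\<lambda>n. measure \<mu> (A - F n)) \<longlonglongrightarrow> measure \<mu> (\<Inter>n. A - F n)"
        by (rule finite_Lim_measure_decseq[OF _ dec]) (use A F op cl in auto)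
      moreover have "(\<Inter>n. A - F n) = {}"
      proof (rule ccontr)
        assume "(\<Inter>n. A - F n) \<noteq> {}"
        then obtain x where x: "x \<in> A" "\<And>n. x \<notin> F n" by auto
        have "infdist x (- A) \<noteq> 0"
          using in_closed_iff_infdist_zero[of "- A" x] A ne x(1) by auto
        then have "infdist x (- A) > 0" using infdist_nonneg[of x "- A"] by linarith
        then obtain n where "inverse (real (Suc n)) < infdist x (- A)" using reals_Archimedean by blast
        then show False using x(2)[of n] unfolding F_def by auto
      qed
      ultimately have lim: "(\<lambda>n. measure \<mu> (A - F n)) \<longlonglongrightarrow> 0" by (simp only: measure_empty)
      show ?thesis
      proof (intro allI impI)
        fix e :: real assume "e > 0"
        from order_tendstoD(2)[OF lim this] obtain n where "measure \<mu> (A - F n) < e"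
          by (auto simp: eventually_sequentially)
        then show "\<exists>F Q. closed F \<and> open Q \<and> F \<subseteq> A \<and> A \<subseteq> Q \<and> measure \<mu> (Q - F) < e"
          using F FA A by - (rule exI[of _ "F n"], rule exI[of _ A], auto)
      qed
    qed
  next
    case Empty
    then show ?case by (intro allI impI exI[of _ "{}"]) auto
  next
    case (Compl A)
    show ?case
    proof (intro allI impI)
      fix e :: real assume "e > 0"
      from Compl.IH[rule_format, OF this] obtain F Q
        where "closed F" "open Q" "F \<subseteq> A" "A \<subseteq> Q" "measure \<mu> (Q - F) < e" by blast
      moreover have "(- F) - (- Q) = Q - F" by auto
      ultimately show "\<exists>F Q. closed F \<and> open Q \<and> F \<subseteq> UNIV - A \<and> UNIV - A \<subseteq> Q \<and> measure \<mu> (Q - F) < e"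
        by - (rule exI[of _ "- Q"], rule exI[of _ "- F"], auto)
    qed
  next
    case (Union A)
    show ?case
    proof (intro allI impI)
      fix e :: real assume e: "e > 0"
      \<comment> \<open>The errors for the single sets sum to \<open>e / 2\<close>. The other half
        pays for cutting the union of the closed sets down to a finite one, which is closed
        again.\<close>
      define d where "d i = e / 2 / 2 ^ Suc i" for i :: nat
      have d: "d i > 0" for i unfolding d_def using e by simp
      have "\<forall>i. \<exists>F Q. closed F \<and> open Q \<and> F \<subseteq> A i \<and> A i \<subseteq> Q \<and> measure \<mu> (Q - F) < d i"
        using Union.IH[rule_format, OF d] by blast
      then obtain F Q where FQ: "\<And>i. closed (F i)" "\<And>i. open (Q i)" "\<And>i. F i \<subseteq> A i" "\<And>i. A i \<subseteq> Q i"
        "\<And>i. measure \<mu> (Q i - F i) < d i" by metis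
      define G where "G n = (\<Union>i<n. F i)" for n
      have G: "closed (G n)" for n unfolding G_def using FQ by auto
      have dec: "decseq (\<lambda>n. (\<Union>i. F i) - G n)"
        by (rule decseq_SucI) (auto simp: G_def lessThan_Suc)
      have UF: "(\<Union>i. F i) \<in> sets \<mu>" using FQ cl by auto
      have "(\<lambda>n. measure \<mu> ((\<Union>i. F i) - G n)) \<longlonglongrightarrow> measure \<mu> (\<Inter>n. (\<Union>i. F i) - G n)"
        by (rule finite_Lim_measure_decseq[OF _ dec]) (use UF G cl in auto)
      moreover have "(\<Inter>n. (\<Union>i. F i) - G n) = {}" unfolding G_def by auto
      ultimately have "(\<lambda>n. measure \<mu> ((\<Union>i. F i) - G n)) \<longlonglongrightarrow> 0" by (simp only: measure_empty)
      from order_tendstoD(2)[OF this, of "e/2"] e obtain n where n: "measure \<mu> ((\<Union>i. F i) - G n) < e / 2"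
        by (auto simp: eventually_sequentially)
      have dsum: "d sums (e / 2)"
      proof -
        have "(\<lambda>i. (e/2) * (1/2) ^ Suc i) sums ((e/2) * 1)" by (intro sums_mult power_half_series)
        then show ?thesis by (simp add: d_def[abs_def] power_one_over field_simps)
      qed
      have sm: "summable (\<lambda>i. measure \<mu> (Q i - F i))"
        by (rule summable_comparison_test'[OF sums_summable[OF dsum], of 0]) (use FQ(5) in \<open>auto simp: less_imp_le\<close>)
      have "measure \<mu> (\<Union>i. Q i - F i) \<le> (\<Sum>i. measure \<mu> (Q i - F i))"
        by (rule finite_measure_subadditive_countably) (use FQ op cl sm in auto)
      also have "\<dots> \<le> (\<Sum>i. d i)" by (rule suminf_le[OF _ sm sums_summable[OF dsum]]) (use FQ(5) in \<open>auto simp: less_imp_le\<close>)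
      also have "\<dots> = e / 2" using dsum by (rule sums_unique[symmetric])
      finally have 1: "measure \<mu> (\<Union>i. Q i - F i) \<le> e / 2" .
      have "measure \<mu> ((\<Union>i. Q i) - G n) \<le> measure \<mu> ((\<Union>i. Q i - F i) \<union> ((\<Union>i. F i) - G n))"
        by (rule finite_measure_mono) (use FQ op cl UF G in auto)
      also have "\<dots> \<le> measure \<mu> (\<Union>i. Q i - F i) + measure \<mu> ((\<Union>i. F i) - G n)"
        by (rule measure_Un_le) (use FQ op cl UF G in auto)
      also have "\<dots> < e" using 1 n by simp
      finally have lt: "measure \<mu> ((\<Union>i. Q i) - G n) < e" .
      have GA: "G n \<subseteq> (\<Union>i. A i)" unfolding G_def using FQ(3) by auto
      have AQ: "(\<Union>i. A i) \<subseteq> (\<Union>i. Q i)" by (intro UN_mono FQ(4) order_refl)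
      have oQ: "open (\<Union>i. Q i)" using FQ(2) by auto
      show "\<exists>F Q. closed F \<and> open Q \<and> F \<subseteq> (\<Union>i. A i) \<and> (\<Union>i. A i) \<subseteq> Q \<and> measure \<mu> (Q - F) < e"
        by (rule exI[of _ "G n"], rule exI[of _ "\<Union>i. Q i"], intro conjI G oQ GA AQ lt)
    qed
  qed
qed

text \<open>Intersecting a closed inner approximation with one compact set carrying almost all of
  the mass gives a compact inner approximation of every Borel set.\<close>

lemma finite_radonI_tight:
  fixes \<mu> :: "'a::metric_space measure"
  assumes s: "sets \<mu> = sets borel" and f: "finite_measure \<mu>"
    and tight: "\<And>e. e > 0 \<Longrightarrow> \<exists>K. compact K \<and> measure \<mu> (- K) < e"
  shows "finite_radon \<mu>"
proof -
  interpret finite_measure \<mu> by fact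
  have "emeasure \<mu> B = (SUP K\<in>{K. compact K \<and> K \<subseteq> B}. emeasure \<mu> K)" if B: "B \<in> sets borel" for B
  proof (rule antisym)
    show "(SUP K\<in>{K. compact K \<and> K \<subseteq> B}. emeasure \<mu> K) \<le> emeasure \<mu> B"
      by (rule SUP_least) (use B s in \<open>auto intro: emeasure_mono\<close>)
    show "emeasure \<mu> B \<le> (SUP K\<in>{K. compact K \<and> K \<subseteq> B}. emeasure \<mu> K)"
    proof (rule ennreal_le_epsilon)
      fix e :: real assume e: "e > 0"
      then have e2: "e / 2 > 0" by simp
      from open_closed_regular[OF s f B, rule_format, OF e2] obtain F Q where FQ: "closed F" "open Q" "F \<subseteq> B" "B \<subseteq> Q" "measure \<mu> (Q - F) < e / 2" by blast
      obtain K where K: "compact K" "measure \<mu> (- K) < e / 2" using tight[OF e2] by blast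
      have sts: "F \<in> sets \<mu>" "Q \<in> sets \<mu>" "K \<in> sets \<mu>" "- K \<in> sets \<mu>" using FQ K s by (auto simp: compact_imp_closed)
      have cFK: "compact (F \<inter> K)" using FQ K by (simp add: closed_Int_compact)
      have "measure \<mu> B \<le> measure \<mu> ((F \<inter> K) \<union> ((Q - F) \<union> - K))"
        by (rule finite_measure_mono) (use FQ sts in auto)
      also have "\<dots> \<le> measure \<mu> (F \<inter> K) + measure \<mu> ((Q - F) \<union> - K)"
        by (rule measure_Un_le) (use sts in auto)
      also have "\<dots> \<le> measure \<mu> (F \<inter> K) + (measure \<mu> (Q - F) + measure \<mu> (- K))"
        by (intro add_left_mono measure_Un_le) (use sts in auto)
      also have "\<dots> \<le> measure \<mu> (F \<inter> K) + e" using FQ(5) K(2) by simp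
      finally have "emeasure \<mu> B \<le> ennreal (measure \<mu> (F \<inter> K) + e)"
        by (simp add: emeasure_eq_measure ennreal_leI)
      also have "\<dots> = emeasure \<mu> (F \<inter> K) + ennreal e" using e by (simp add: emeasure_eq_measure)
      also have "\<dots> \<le> (SUP K\<in>{K. compact K \<and> K \<subseteq> B}. emeasure \<mu> K) + ennreal e"
        using cFK FQ(3) by (intro add_right_mono SUP_upper) auto
      finally show "emeasure \<mu> B \<le> (SUP K\<in>{K. compact K \<and> K \<subseteq> B}. emeasure \<mu> K) + ennreal e" .
    qed
  qed
  then show ?thesis
    unfolding finite_radon_def using s by (auto simp: emeasure_eq_measure)
qed

lemma finite_radon_tight:
  fixes \<mu> :: "'a::metric_space measure"
  assumes r: "finite_radon \<mu>" and e: "e > 0"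
  shows "\<exists>K. compact K \<and> measure \<mu> (- K) < e"
proof -
  interpret finite_measure \<mu> by (rule finite_radon_finite_measure[OF r])
  have s: "sets \<mu> = sets borel" using r by (simp add: finite_radon_def)
  have sp: "space \<mu> = UNIV" using sets_eq_imp_space_eq[OF s] by simp
  show ?thesis
  proof (cases "measure \<mu> UNIV < e")
    case True
    then show ?thesis by (intro exI[of _ "{}"]) simp
  next
    case False
    have "ennreal (measure \<mu> UNIV - e) < emeasure \<mu> UNIV"
      using e False by (simp add: emeasure_eq_measure ennreal_less_iff)
    also have "emeasure \<mu> UNIV = (SUP K\<in>{K. compact K \<and> K \<subseteq> UNIV}. emeasure \<mu> K)"
      using r unfolding finite_radon_def by auto
    finally obtain K where K: "compact K" "ennreal (measure \<mu> UNIV - e) < emeasure \<mu> K"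
      unfolding less_SUP_iff by auto
    then have "measure \<mu> UNIV - e < measure \<mu> K" using False by (simp add: emeasure_eq_measure ennreal_less_iff)
    moreover have "measure \<mu> (- K) = measure \<mu> UNIV - measure \<mu> K"
      using finite_measure_compl[of K] K(1) s sp by (simp add: Compl_eq_Diff_UNIV compact_imp_closed)
    ultimately show ?thesis using K(1) by (intro exI[of _ K]) simp
  qed
qed

text \<open>If both factors are large, the Borel algebra of the product can exceed the product
  algebra. A countable base of one factor suffices: over each basic set \<open>b\<close>,
  \<open>V b\<close> is the largest open set whose box with \<open>b\<close> stays in the preimage,
  and these countably many boxes fill it.\<close>

lemma borel_measurable_pair_continuous:
  fixes h :: "'b::second_countable_topology \<times> 'a::topological_space \<Rightarrow> 'c::topological_space"
  assumes "continuous_on UNIV h"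
  shows "h \<in> borel_measurable (borel \<Otimes>\<^sub>M borel)"
proof (rule borel_measurableI)
  fix S :: "'c set" assume "open S"
  then have W: "open (h -` S)" using assms open_vimage by blast
  obtain \<B> :: "'b set set" where B: "countable \<B>" "topological_basis \<B>" using ex_countable_basis by blast
  define V where "V b = \<Union>{V. open V \<and> b \<times> V \<subseteq> h -` S}" for b
  have "h -` S = (\<Union>b\<in>\<B>. b \<times> V b)"
  proof (intro equalityI subsetI)
    fix p assume "p \<in> h -` S"
    with W obtain A C where AC: "open A" "open C" "p \<in> A \<times> C" "A \<times> C \<subseteq> h -` S"
      by (metis open_prod_elim)
    then have "fst p \<in> A" by auto
    from topological_basisE[OF B(2) AC(1) this] obtain b where b: "b \<in> \<B>" "fst p \<in> b" "b \<subseteq> A" by blast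
    have "C \<in> {V. open V \<and> b \<times> V \<subseteq> h -` S}" using AC b by auto
    then have "C \<subseteq> V b" unfolding V_def by (rule Union_upper)
    then show "p \<in> (\<Union>b\<in>\<B>. b \<times> V b)" using b AC by (intro UN_I[of b]) (auto simp: mem_Times_iff)
  qed (auto simp: V_def)
  moreover have "b \<times> V b \<in> sets (borel \<Otimes>\<^sub>M borel)" if "b \<in> \<B>" for b
  proof -
    have "open b" using B(2) that by (rule topological_basis_open)
    moreover have "open (V b)" unfolding V_def by auto
    ultimately show ?thesis by (intro pair_measureI) auto
  qed
  ultimately have "h -` S \<in> sets (borel \<Otimes>\<^sub>M borel)" using B(1) by auto
  then show "h -` S \<inter> space (borel \<Otimes>\<^sub>M borel) \<in> sets (borel \<Otimes>\<^sub>M borel)" by (simp add: space_pair_measure)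
qed

definition cp :: "real \<times> real \<Rightarrow> complex" where
  "cp p = Complex (fst p) (snd p)"

lemma Re_cp [simp]: "Re (cp p) = fst p" by (simp add: cp_def)

lemma continuous_on_cp: "continuous_on S cp"
  unfolding cp_def[abs_def] by (rule continuous_on_Complex)

text \<open>\<open>\<mu>\<close> is the image of the product of \<open>w\<close> times Lebesgue
  measure with \<open>\<nu>\<close> under the map that dilates a point by a parameter. It is tight
  because a large disc times a compact set has compact image and leaves little mass outside.\<close>

lemma cone_measure:
  fixes \<nu> :: "'a::complex_normed_vector measure" and w :: "real \<times> real \<Rightarrow> real"
  assumes r: "finite_radon \<nu>" and w: "integrable lborel w" and w0: "\<And>p. 0 \<le> w p"
  shows "\<exists>\<mu>. finite_radon \<mu> \<and> (\<forall>f B. is_qlip f \<longrightarrow> (\<forall>x. cmod (f x) \<le> B) \<longrightarrow>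
      integrable lborel (\<lambda>p. w p * (\<integral>x. cmod (dil (cp p) f x) \<partial>\<nu>)) \<and>
      L1norm \<mu> f = (\<integral>p. w p * (\<integral>x. cmod (dil (cp p) f x) \<partial>\<nu>) \<partial>lborel))"
proof -
  interpret nu: finite_measure \<nu> by (rule finite_radon_finite_measure[OF r])
  have snu [measurable_cong]: "sets \<nu> = sets borel" using r by (simp add: finite_radon_def)
  have spnu: "space \<nu> = UNIV" using sets_eq_imp_space_eq[OF snu] by simp
  have wm [measurable]: "w \<in> borel_measurable borel" using w by simp
  define N where "N = density lborel (\<lambda>p. ennreal (w p))"
  have sN [measurable_cong]: "sets N = sets borel" unfolding N_def by simp
  have spN: "space N = UNIV" unfolding N_def by simp
  have fN: "finite_measure N"
  proof (rule finite_measureI)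
    have "emeasure N (space N) = (\<integral>\<^sup>+p. ennreal (w p) \<partial>lborel)"
      unfolding N_def by (simp add: emeasure_density)
    also have "\<dots> < \<infinity>" using nn_integral_eq_integral[OF w] w0 by simp
    finally show "emeasure N (space N) \<noteq> \<infinity>" by simp
  qed
  interpret N: finite_measure N by fact
  interpret P: pair_sigma_finite N \<nu> ..
  interpret PP: finite_measure "N \<Otimes>\<^sub>M \<nu>" by (rule finite_measure_pair_measure) unfold_locales
  define \<Xi> where "\<Xi> = (\<lambda>q::(real \<times> real) \<times> 'a. scaleC (exp (cp (fst q))) (snd q))"
  have c\<Xi>: "continuous_on S \<Xi>" for S
    unfolding \<Xi>_def by (intro continuous_on_scaleC continuous_on_exp continuous_on_compose2[OF continuous_on_cp] continuous_intros) auto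
  have m\<Xi>: "\<Xi> \<in> measurable (N \<Otimes>\<^sub>M \<nu>) borel"
    using borel_measurable_pair_continuous[OF c\<Xi>] measurable_cong_sets[OF sets_pair_measure_cong[OF sN snu] refl] by blast
  define \<mu> where "\<mu> = distr (N \<Otimes>\<^sub>M \<nu>) borel \<Xi>"
  have s\<mu>: "sets \<mu> = sets borel" unfolding \<mu>_def by simp
  have f\<mu>: "finite_measure \<mu>" unfolding \<mu>_def by (rule PP.finite_measure_distr[OF m\<Xi>])
  interpret mu: finite_measure \<mu> by fact
  have "finite_radon \<mu>"
  proof (rule finite_radonI_tight[OF s\<mu> f\<mu>])
    fix e :: real assume e: "e > 0"
    \<comment> \<open>A positive common bound for both total masses; with
      \<open>d = e / (3 * a)\<close> the two outer pieces contribute at most two thirds of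
      \<open>e\<close>.\<close>
    define a where "a = measure N UNIV + measure \<nu> UNIV + 1"
    have a: "a > 0" "measure N UNIV \<le> a" "measure \<nu> UNIV \<le> a" unfolding a_def by (auto simp: add_nonneg_pos add_nonneg_nonneg)
    define d where "d = e / (3 * a)"
    have d: "d > 0" unfolding d_def using e a by simp
    obtain K where K: "compact K" "measure \<nu> (- K) < d" using finite_radon_tight[OF r d] by blast
    have "(\<lambda>n. measure N (- cball 0 (real n))) \<longlonglongrightarrow> measure N (\<Inter>n. - cball 0 (real n))"
    proof (rule N.finite_Lim_measure_decseq)
      show "decseq (\<lambda>n. - cball (0::real \<times> real) (real n))" by (rule decseq_SucI) auto
    qed (auto simp: sN)
    moreover have "(\<Inter>n. - cball (0::real \<times> real) (real n)) = {}"
    proof -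
      have "\<exists>n. x \<in> cball 0 (real n)" for x :: "real \<times> real" using real_arch_simple[of "norm x"] by auto
      then show ?thesis by blast
    qed
    ultimately have "(\<lambda>n. measure N (- cball 0 (real n))) \<longlonglongrightarrow> 0" by (simp only: measure_empty)
    from order_tendstoD(2)[OF this d] obtain n where n: "measure N (- cball 0 (real n)) < d"
      by (auto simp: eventually_sequentially)
    let ?C = "cball (0::real \<times> real) (real n)"
    have cpt: "compact (\<Xi> ` (?C \<times> K))" by (intro compact_continuous_image c\<Xi> compact_Times K) simp
    have stsK: "K \<in> sets \<nu>" "- K \<in> sets \<nu>" "?C \<in> sets N" "- ?C \<in> sets N"
      using K by (auto simp: snu sN compact_imp_closed)
    have sts: "(- ?C) \<times> UNIV \<in> sets (N \<Otimes>\<^sub>M \<nu>)" "UNIV \<times> (- K) \<in> sets (N \<Otimes>\<^sub>M \<nu>)"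
      using stsK by (auto intro!: pair_measureI simp: sN snu)
    have "measure \<mu> (- \<Xi> ` (?C \<times> K)) = measure (N \<Otimes>\<^sub>M \<nu>) (\<Xi> -` (- \<Xi> ` (?C \<times> K)) \<inter> space (N \<Otimes>\<^sub>M \<nu>))"
      unfolding \<mu>_def by (rule measure_distr[OF m\<Xi>]) (use cpt in \<open>auto simp: compact_imp_closed\<close>)
    also have "\<dots> \<le> measure (N \<Otimes>\<^sub>M \<nu>) (((- ?C) \<times> UNIV) \<union> (UNIV \<times> (- K)))"
      by (rule PP.finite_measure_mono) (use sts in auto)
    also have "\<dots> \<le> measure (N \<Otimes>\<^sub>M \<nu>) ((- ?C) \<times> UNIV) + measure (N \<Otimes>\<^sub>M \<nu>) (UNIV \<times> (- K))"
      by (rule measure_Un_le) (use sts in auto)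
    also have "\<dots> = measure N (- ?C) * measure \<nu> UNIV + measure N UNIV * measure \<nu> (- K)"
      using stsK by (simp add: measure_def nu.emeasure_pair_measure_Times enn2real_mult sN snu)
    also have "\<dots> \<le> d * a + a * d"
      using n K(2) a d by (intro add_mono mult_mono) auto
    also have "\<dots> < e" unfolding d_def using e a by (simp add: field_simps)
    finally show "\<exists>K. compact K \<and> measure \<mu> (- K) < e" using cpt by blast
  qed
  moreover have "integrable lborel (\<lambda>p. w p * (\<integral>x. cmod (dil (cp p) f x) \<partial>\<nu>)) \<and>
      L1norm \<mu> f = (\<integral>p. w p * (\<integral>x. cmod (dil (cp p) f x) \<partial>\<nu>) \<partial>lborel)"
    if f: "is_qlip f" and B: "\<And>x. cmod (f x) \<le> B" for f B
  proof -
    have fm [measurable]: "f \<in> borel_measurable borel" by (rule qlip_borel_measurable[OF f refl])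
    have i: "integrable (N \<Otimes>\<^sub>M \<nu>) (\<lambda>q. cmod (f (\<Xi> q)))"
      by (rule PP.integrable_const_bound[where B = B]) (use B m\<Xi> in auto)
    have e: "cmod (f (\<Xi> (p, x))) = cmod (dil (cp p) f x)" for p x by (simp add: \<Xi>_def dil_def)
    have "integrable N (\<lambda>p. \<integral>x. cmod (dil (cp p) f x) \<partial>\<nu>)"
      using P.integrable_fst'[OF i] by (simp add: e)
    then have m: "(\<lambda>p. \<integral>x. cmod (dil (cp p) f x) \<partial>\<nu>) \<in> borel_measurable lborel"
      and i2: "integrable N (\<lambda>p. \<integral>x. cmod (dil (cp p) f x) \<partial>\<nu>)"
      by (auto simp: N_def dest: borel_measurable_integrable)
    have "integrable lborel (\<lambda>p. w p *\<^sub>R (\<integral>x. cmod (dil (cp p) f x) \<partial>\<nu>))"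
      using i2 m w0 unfolding N_def by (subst (asm) integrable_density) auto
    moreover have "L1norm \<mu> f = (\<integral>q. cmod (f (\<Xi> q)) \<partial>(N \<Otimes>\<^sub>M \<nu>))"
      unfolding \<mu>_def by (rule integral_distr[OF m\<Xi>]) simp
    moreover have "\<dots> = (\<integral>p. (\<integral>x. cmod (dil (cp p) f x) \<partial>\<nu>) \<partial>N)"
      using P.integral_fst'[OF i] by (simp add: e)
    moreover have "\<dots> = (\<integral>p. w p *\<^sub>R (\<integral>x. cmod (dil (cp p) f x) \<partial>\<nu>) \<partial>lborel)"
      unfolding N_def by (rule integral_density) (use m w0 in auto)
    ultimately show ?thesis by simp
  qed
  ultimately show ?thesis by (intro exI[of _ \<mu>] conjI allI impI) auto
qed

section \<open>The cone operator on functions differentiable along the flow\<close>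

lemma orbit_eventually_in:
  assumes "open V" "(x::'a::complex_normed_vector) \<in> V"
  shows "\<forall>\<^sub>F t in nhds (0::real). flow a t x \<in> V"
proof -
  have c: "continuous_on UNIV (\<lambda>t::real. flow a t x)"
    by (intro continuous_intros)
  have "open ((\<lambda>t::real. flow a t x) -` V)" using c assms(1) open_vimage by blast
  then show ?thesis using assms(2) by (auto simp: eventually_nhds scaleC_one intro!: exI[of _ "(\<lambda>t::real. flow a t x) -` V"])
qed

lemma ddir_zero_open:
  assumes "open V" "x \<in> V" "\<And>y. y \<in> V \<Longrightarrow> f y = c"
  shows "ddir a f x = 0"
proof (rule ddir_eqI)
  have "\<forall>\<^sub>F t in nhds (0::real). f (flow a t x) = c"
    using orbit_eventually_in[OF assms(1,2)] by eventually_elim (rule assms(3))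
  then obtain N where N: "open N" "0 \<in> N" "\<And>t. t \<in> N \<Longrightarrow> f (flow a t x) = c"
    unfolding eventually_nhds by blast
  show "((\<lambda>t. f (flow a t x)) has_vector_derivative 0) (at 0)"
    by (rule has_vector_derivative_transform_within_open[where f = "\<lambda>_. c" and S = N]) (use N in auto)
qed

lemma dba_zero_open:
  assumes "open V" "x \<in> V" "\<And>y. y \<in> V \<Longrightarrow> f y = c"
  shows "dba f x = 0"
  unfolding dba_def using ddir_zero_open[OF assms] by simp

text \<open>The factor inverts the constant \<open>- (2 * pi)\<close> of
  \<open>cylinder_Pompeiu\<close>; the doubling in \<open>dba\<close> matches the one in
  \<open>Gs + \<i> * Gt\<close>. The formula is intended for \<open>smooth\<close> slots.\<close>

definition Us :: "('a::complex_normed_vector functional) \<Rightarrow>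
    ('a \<Rightarrow> complex) \<Rightarrow> ('a \<Rightarrow> complex) list \<Rightarrow> complex" where
  "Us T f \<pi>s = - (1 / (2 * of_real pi)) * (\<integral>p. cker p * Om T (dil (cp p) f) (map (dil (cp p)) \<pi>s) \<partial>lborel)"

text \<open>The mass bound on one ball, tested on \<open>smooth\<close> slots, where the cone is
  first available; its extension to Lipschitz slots inherits the bound in the limit.\<close>

definition mass_on :: "('a::complex_normed_vector functional) \<Rightarrow> nat \<Rightarrow> real \<Rightarrow> 'a measure \<Rightarrow> bool" where
  "mass_on U n R \<mu> \<longleftrightarrow> finite_radon \<mu> \<and> (\<forall>f \<pi>s. is_qlip f \<and> (\<forall>x. R \<le> norm x \<longrightarrow> f x = 0) \<and> (smooths \<pi>s) \<and> length \<pi>s = n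
    \<longrightarrow> cmod (U f \<pi>s) \<le> lprod R \<pi>s * L1norm \<mu> f)"

lemma mass_onD:
  assumes "mass_on U n R \<mu>"
  shows "finite_radon \<mu>"
    and "\<And>f \<pi>s. \<lbrakk>is_qlip f; \<And>x. R \<le> norm x \<Longrightarrow> f x = 0; smooths \<pi>s; length \<pi>s = n\<rbrakk>
      \<Longrightarrow> cmod (U f \<pi>s) \<le> lprod R \<pi>s * L1norm \<mu> f"
  using assms unfolding mass_on_def by auto

lemma prod_list_rem:
  fixes g :: "'b \<Rightarrow> real"
  assumes "j < length xs"
  shows "prod_list (map g (rem j xs)) * g (xs ! j) = prod_list (map g xs)"
proof -
  have "prod_list (map g xs) = prod_list (map g (take j xs @ xs ! j # drop (Suc j) xs))"
    using id_take_nth_drop[OF assms] by simp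
  also have "\<dots> = prod_list (map g (rem j xs)) * g (xs ! j)" by (simp add: rem_def)
  finally show ?thesis by simp
qed

lemma prod_list_lipc_le:
  assumes "\<forall>\<pi>\<in>set \<pi>s. is_qlip \<pi> \<and> lipc (ball 0 R) \<pi> \<le> B"
  shows "lprod R \<pi>s \<le> B ^ length \<pi>s"
proof -
  have "lprod R \<pi>s \<le> prod_list (map (\<lambda>_. B) \<pi>s)"
    using prod_list_mono[of \<pi>s "lipc (ball 0 R)" "\<lambda>_. B"] assms lipc_nonneg by auto
  then show ?thesis by (simp add: map_replicate_const)
qed

definition cut :: "real \<Rightarrow> 'a::real_normed_vector \<Rightarrow> complex" where
  "cut R x = of_real (max 0 (min 1 (R + 1 - norm x)))"

lemma cut_lip: "1-lipschitz_on UNIV (cut R)"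
proof (rule lipschitz_onI)
  fix x y :: 'a
  have "\<bar>max 0 (min 1 (R + 1 - norm x)) - max 0 (min 1 (R + 1 - norm y))\<bar> \<le> \<bar>norm x - norm y\<bar>" by linarith
  also have "\<dots> \<le> norm (x - y)" by (rule norm_triangle_ineq3)
  finally show "dist (cut R x) (cut R y) \<le> 1 * dist x y"
    by (simp add: cut_def dist_norm flip: of_real_diff)
qed simp

lemma cut_qlip [simp, intro]: "is_qlip (cut R)" by (rule lip_is_qlip[OF cut_lip])

lemma cut_1: "norm x \<le> R \<Longrightarrow> cut R x = 1" and cut_0: "R + 1 \<le> norm x \<Longrightarrow> cut R x = 0"
  and cut_le: "cmod (cut R x) \<le> 1"
  by (auto simp: cut_def)

context shell_current
begin

text \<open>\<open>dba\<close> commutes with dilations, so the dilation can be pulled out of each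
  summand; continuity, bounds and vanishing in \<zeta> then come from the corresponding facts about
  \<open>T\<close>.\<close>

lemma Om_dil:
  assumes "smooths \<pi>s"
  shows "Om T (dil \<zeta> f) (map (dil \<zeta>) \<pi>s) =
    (\<Sum>j<length \<pi>s. (-1) ^ j * T (dil \<zeta> (\<lambda>x. f x * dba (\<pi>s ! j) x)) (map (dil \<zeta>) (rem j \<pi>s)))"
  unfolding Om_def
proof (intro sum.cong)
  fix j assume "j \<in> {..<length \<pi>s}"
  then have j: "j < length \<pi>s" by simp
  then have "smooth (\<pi>s ! j)" using assms by auto
  from smooth_dil(3)[OF this, of \<zeta>] j
  show "(-1) ^ j * T (\<lambda>x. dil \<zeta> f x * dba (map (dil \<zeta>) \<pi>s ! j) x) (rem j (map (dil \<zeta>) \<pi>s))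
      = (-1) ^ j * T (dil \<zeta> (\<lambda>x. f x * dba (\<pi>s ! j) x)) (map (dil \<zeta>) (rem j \<pi>s))"
    by (simp add: map_rem) (simp add: dil_def)
qed simp

lemma qlip_coeff_dba:
  assumes "is_qlip f" "smooths \<pi>s" "j < length \<pi>s"
  shows "is_qlip (\<lambda>x. f x * dba (\<pi>s ! j) x)"
  using assms by (intro is_qlip_mult smooth_dba_qlip) auto

lemma Om_dil_continuous:
  assumes "is_qlip f" "smooths \<pi>s" "length \<pi>s = Suc k"
  shows "continuous_on S (\<lambda>\<zeta>. Om T (dil \<zeta> f) (map (dil \<zeta>) \<pi>s))"
  unfolding Om_dil[OF assms(2)]
proof (rule continuous_on_subset[OF _ subset_UNIV], intro continuous_intros)
  fix j assume "j \<in> {..<length \<pi>s}"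
  then show "continuous_on UNIV (\<lambda>\<zeta>. T (dil \<zeta> (\<lambda>x. f x * dba (\<pi>s ! j) x)) (map (dil \<zeta>) (rem j \<pi>s)))"
    by (intro T_dil_continuous qlip_coeff_dba smooth_rem assms) (use assms in \<open>auto simp: length_rem\<close>)
qed

lemma Om_dil_bounded:
  assumes "is_qlip f" "smooths \<pi>s" "length \<pi>s = Suc k"
  shows "\<exists>B. \<forall>\<zeta>. Re \<zeta> \<le> s \<longrightarrow> cmod (Om T (dil \<zeta> f) (map (dil \<zeta>) \<pi>s)) \<le> B"
proof -
  have "\<forall>j\<in>{..<length \<pi>s}. \<exists>B. \<forall>\<zeta>. Re \<zeta> \<le> s \<longrightarrow>
     cmod (T (dil \<zeta> (\<lambda>x. f x * dba (\<pi>s ! j) x)) (map (dil \<zeta>) (rem j \<pi>s))) \<le> B"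
    by (intro ballI T_dil_bounded qlip_coeff_dba smooth_rem assms) (use assms in \<open>auto simp: length_rem\<close>)
  from bchoice[OF this] obtain B where B: "\<And>j \<zeta>. j < length \<pi>s \<Longrightarrow> Re \<zeta> \<le> s \<Longrightarrow>
     cmod (T (dil \<zeta> (\<lambda>x. f x * dba (\<pi>s ! j) x)) (map (dil \<zeta>) (rem j \<pi>s))) \<le> B j" by auto
  have "cmod (Om T (dil \<zeta> f) (map (dil \<zeta>) \<pi>s)) \<le> (\<Sum>j<length \<pi>s. B j)" if "Re \<zeta> \<le> s" for \<zeta>
    unfolding Om_dil[OF assms(2)] by (rule sum_norm_le) (use B that in \<open>auto simp: norm_mult norm_power\<close>)
  then show ?thesis by blast
qed

lemma Om_dil_zero:
  assumes "is_qlip f" "smooths \<pi>s" "length \<pi>s = Suc k"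
    and "\<And>x. R \<le> norm x \<Longrightarrow> f x = 0" "R \<le> exp (Re \<zeta>) * \<delta>"
  shows "Om T (dil \<zeta> f) (map (dil \<zeta>) \<pi>s) = 0"
  unfolding Om_dil[OF assms(2)]
proof (rule sum.neutral, rule ballI)
  fix j assume "j \<in> {..<length \<pi>s}"
  then have j: "j < length \<pi>s" by simp
  have "T (dil \<zeta> (\<lambda>x. f x * dba (\<pi>s ! j) x)) (map (dil \<zeta>) (rem j \<pi>s)) = 0"
    by (rule T_dil_zero[OF qlip_coeff_dba[OF assms(1,2) j]]) (use assms j smooth_rem[OF assms(2)] in \<open>auto simp: length_rem\<close>)
  then show "(-1) ^ j * T (dil \<zeta> (\<lambda>x. f x * dba (\<pi>s ! j) x)) (map (dil \<zeta>) (rem j \<pi>s)) = 0" by simp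
qed

text \<open>The real part of \<zeta> at which the inner sphere of the shell is carried to radius
  \<open>R\<close>; from there on a coefficient vanishing off that ball pulls back to 0 on the
  shell.\<close>

definition sR :: "real \<Rightarrow> real" where "sR R = ln (R / \<delta>)"

lemma sR: "R > 0 \<Longrightarrow> sR R \<le> s \<Longrightarrow> R \<le> exp s * \<delta>"
  using delta_pos exp_le_cancel_iff[of "ln (R / \<delta>)" s] unfolding sR_def by (simp add: field_simps)

lemma Us_integrable:
  assumes "is_qlip f" "smooths \<pi>s" "length \<pi>s = Suc k" "R > 0" "\<And>x. R \<le> norm x \<Longrightarrow> f x = 0"
  shows "integrable lborel (\<lambda>p. cker p * Om T (dil (cp p) f) (map (dil (cp p)) \<pi>s))"
proof -
  obtain B where B: "\<And>\<zeta>. Re \<zeta> \<le> sR R \<Longrightarrow> cmod (Om T (dil \<zeta> f) (map (dil \<zeta>) \<pi>s)) \<le> B"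
    using Om_dil_bounded[OF assms(1-3)] by blast
  show ?thesis
  proof (rule cker_mult_integrable[where s = "sR R" and B = B])
    show "(\<lambda>p. Om T (dil (cp p) f) (map (dil (cp p)) \<pi>s)) \<in> borel_measurable borel"
      by (rule borel_measurable_continuous_onI, rule continuous_on_compose2[OF Om_dil_continuous[OF assms(1-3)] continuous_on_cp subset_UNIV])
    show "Om T (dil (cp p) f) (map (dil (cp p)) \<pi>s) = 0" if "sR R < fst p" for p
      by (rule Om_dil_zero[OF assms(1-3,5)]) (use sR[OF assms(4), of "fst p"] that in auto)
  qed (use B in auto)
qed

lemma Us_coeff:
  assumes "is_qlip f" "is_qlip g" "smooths \<pi>s" "length \<pi>s = Suc k" "R > 0"
    "\<And>x. R \<le> norm x \<Longrightarrow> f x = 0" "\<And>x. R \<le> norm x \<Longrightarrow> g x = 0"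
  shows "Us T (\<lambda>x. a * f x + b * g x) \<pi>s = a * Us T f \<pi>s + b * Us T g \<pi>s"
proof -
  let ?I = "\<lambda>f p. cker p * Om T (dil (cp p) f) (map (dil (cp p)) \<pi>s)"
  have sm: "smooths (map (dil \<zeta>) \<pi>s)" for \<zeta> using assms(3) smooth_dil(1) by auto
  have "dil \<zeta> (\<lambda>x. a * f x + b * g x) = (\<lambda>x. a * dil \<zeta> f x + b * dil \<zeta> g x)" for \<zeta> by (simp add: dil_def)
  moreover have "Om T (\<lambda>x. a * dil \<zeta> f x + b * dil \<zeta> g x) (map (dil \<zeta>) \<pi>s)
      = a * Om T (dil \<zeta> f) (map (dil \<zeta>) \<pi>s) + b * Om T (dil \<zeta> g) (map (dil \<zeta>) \<pi>s)" for \<zeta>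
    by (rule Om_coeff[OF _ _ sm]) (use assms in auto)
  ultimately have "?I (\<lambda>x. a * f x + b * g x) p = a * ?I f p + b * ?I g p" for p
    by (simp add: algebra_simps)
  moreover have "integrable lborel (?I f)" by (rule Us_integrable[OF assms(1,3,4,5,6)])
  moreover have "integrable lborel (?I g)" by (rule Us_integrable[OF assms(2,3,4,5,7)])
  ultimately have "(\<integral>p. ?I (\<lambda>x. a * f x + b * g x) p \<partial>lborel) = a * (\<integral>p. ?I f p \<partial>lborel) + b * (\<integral>p. ?I g p \<partial>lborel)"
    by simp
  then show ?thesis unfolding Us_def by (simp add: algebra_simps)
qed

lemma Us_slot:
  assumes "is_qlip f" "smooths us" "smooth u" "smooth v" "smooths vs"
    "length us + length vs = k" "R > 0" "\<And>x. R \<le> norm x \<Longrightarrow> f x = 0"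
  shows "Us T f (us @ (\<lambda>x. c * u x + d * v x) # vs) = c * Us T f (us @ u # vs) + d * Us T f (us @ v # vs)"
proof -
  let ?I = "\<lambda>w p. cker p * Om T (dil (cp p) f) (map (dil (cp p)) (us @ w # vs))"
  have sm: "smooths (map (dil \<zeta>) us)" "smooths (map (dil \<zeta>) vs)" for \<zeta>
    using assms(2,5) smooth_dil(1) by auto
  have "dil \<zeta> (\<lambda>x. c * u x + d * v x) = (\<lambda>x. c * dil \<zeta> u x + d * dil \<zeta> v x)" for \<zeta> by (simp add: dil_def)
  moreover have "Om T (dil \<zeta> f) (map (dil \<zeta>) us @ (\<lambda>x. c * dil \<zeta> u x + d * dil \<zeta> v x) # map (dil \<zeta>) vs)
      = c * Om T (dil \<zeta> f) (map (dil \<zeta>) us @ dil \<zeta> u # map (dil \<zeta>) vs)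
      + d * Om T (dil \<zeta> f) (map (dil \<zeta>) us @ dil \<zeta> v # map (dil \<zeta>) vs)" for \<zeta>
    by (rule Om_lin_slot[OF _ sm(1) smooth_dil(1)[OF assms(3)] smooth_dil(1)[OF assms(4)] sm(2)]) (use assms in auto)
  ultimately have "?I (\<lambda>x. c * u x + d * v x) p = c * ?I u p + d * ?I v p" for p
    by (simp add: algebra_simps)
  moreover have "integrable lborel (?I w)" if "smooth w" for w
    by (rule Us_integrable[where R = R]) (use assms that in auto)
  note this[OF assms(3)] this[OF assms(4)]
  ultimately have "(\<integral>p. ?I (\<lambda>x. c * u x + d * v x) p \<partial>lborel) = c * (\<integral>p. ?I u p \<partial>lborel) + d * (\<integral>p. ?I v p \<partial>lborel)"
    by simp
  then show ?thesis unfolding Us_def by (simp add: algebra_simps)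
qed

lemma Us_move:
  assumes "is_qlip f" "smooths us" "smooth g" "smooths vs" "length us + length vs = k"
  shows "Us T f (us @ g # vs) = (-1) ^ length us * Us T f (g # us @ vs)"
proof -
  have sm: "smooths (map (dil \<zeta>) us)" "smooths (map (dil \<zeta>) vs)" for \<zeta>
    using assms(2,4) smooth_dil(1) by auto
  have eq: "cker p * Om T (dil (cp p) f) (map (dil (cp p)) (us @ g # vs))
     = (-1) ^ length us * (cker p * Om T (dil (cp p) f) (map (dil (cp p)) (g # us @ vs)))" for p
  proof -
    have "Om T (dil (cp p) f) (map (dil (cp p)) us @ dil (cp p) g # map (dil (cp p)) vs)
      = (-1) ^ length (map (dil (cp p)) us) * Om T (dil (cp p) f) (dil (cp p) g # map (dil (cp p)) us @ map (dil (cp p)) vs)"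
      by (rule Om_move[OF _ sm(1) smooth_dil(1)[OF assms(3)] sm(2)]) (use assms in auto)
    then show ?thesis by simp
  qed
  show ?thesis unfolding Us_def by (simp only: eq integral_mult_right_zero) (simp only: mult.left_commute)
qed

text \<open>The slot removed by the contraction reappears in the coefficient, where
  \<open>dba_bound\<close> returns its Lipschitz constant times at most \<open>2 * M\<close>; the
  product over all slots is thereby restored.\<close>

lemma Om_bound:
  assumes R: "R > 0" and f: "is_qlip f" and s: "smooths \<pi>s" and l: "length \<pi>s = Suc k"
    and z: "\<And>x. \<delta> \<le> norm x \<Longrightarrow> norm x \<le> M \<Longrightarrow> R \<le> norm x \<Longrightarrow> f x = 0"
  shows "cmod (Om T f \<pi>s) \<le> 2 * M * real (Suc k) * lprod R \<pi>s * L1norm \<nu> f"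
proof -
  let ?I = "\<integral>x. cmod (f x) \<partial>\<nu>" and ?L = "lipc (ball 0 R)"
  have "cmod ((-1) ^ j * T (\<lambda>x. f x * dba (\<pi>s ! j) x) (rem j \<pi>s)) \<le> 2 * M * prod_list (map ?L \<pi>s) * ?I" if j: "j < length \<pi>s" for j
  proof -
    have sj: "smooth (\<pi>s ! j)" using s j by auto
    have L0: "0 \<le> ?L (\<pi>s ! j)" by (rule lipc_nonneg[OF smooth_qlip[OF sj]])
    have p0: "0 \<le> prod_list (map ?L (rem j \<pi>s))" by (rule prod_list_lipc_nonneg[OF smooth_rem[OF s]])
    have "(\<integral>x. cmod (f x * dba (\<pi>s ! j) x) \<partial>\<nu>) \<le> (\<integral>x. 2 * M * ?L (\<pi>s ! j) * cmod (f x) \<partial>\<nu>)"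
    proof (rule integral_mono_AE)
      show "integrable \<nu> (\<lambda>x. cmod (f x * dba (\<pi>s ! j) x))"
        by (intro integrable_norm qlip_integrable qlip_coeff_dba f s j)
      show "integrable \<nu> (\<lambda>x. 2 * M * ?L (\<pi>s ! j) * cmod (f x))"
        by (intro integrable_mult_right integrable_norm qlip_integrable f)
      show "AE x in \<nu>. cmod (f x * dba (\<pi>s ! j) x) \<le> 2 * M * ?L (\<pi>s ! j) * cmod (f x)"
        using conc
      proof eventually_elim
        case (elim x)
        show ?case
        proof (cases "norm x < R")
          case True
          have "cmod (dba (\<pi>s ! j) x) \<le> 2 * (?L (\<pi>s ! j) * norm x)"
            by (rule dba_bound[OF sj is_qlip_lipc[OF smooth_qlip[OF sj]] True])
          also have "\<dots> \<le> 2 * (?L (\<pi>s ! j) * M)" using elim L0 by (intro mult_left_mono) auto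
          finally have "cmod (f x) * cmod (dba (\<pi>s ! j) x) \<le> cmod (f x) * (2 * (?L (\<pi>s ! j) * M))" by (intro mult_left_mono) auto
          then show ?thesis by (simp add: norm_mult mult_ac)
        qed (use z elim in auto)
      qed
    qed
    then have i: "(\<integral>x. cmod (f x * dba (\<pi>s ! j) x) \<partial>\<nu>) \<le> 2 * M * ?L (\<pi>s ! j) * ?I" by simp
    have "cmod (T (\<lambda>x. f x * dba (\<pi>s ! j) x) (rem j \<pi>s)) \<le> prod_list (map ?L (rem j \<pi>s)) * (\<integral>x. cmod (f x * dba (\<pi>s ! j) x) \<partial>\<nu>)"
      by (rule bound[OF R qlip_coeff_dba[OF f s j] _ smooth_rem[OF s]]) (use l j z in \<open>auto simp: length_rem\<close>)
    also have "\<dots> \<le> prod_list (map ?L (rem j \<pi>s)) * (2 * M * ?L (\<pi>s ! j) * ?I)" by (rule mult_left_mono[OF i p0])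
    also have "\<dots> = 2 * M * (prod_list (map ?L (rem j \<pi>s)) * ?L (\<pi>s ! j)) * ?I" by (simp add: mult_ac)
    also have "\<dots> = 2 * M * prod_list (map ?L \<pi>s) * ?I" by (simp only: prod_list_rem[OF j])
    finally show ?thesis by (simp add: norm_mult norm_power)
  qed
  then have "cmod (Om T f \<pi>s) \<le> (\<Sum>j<length \<pi>s. 2 * M * prod_list (map ?L \<pi>s) * ?I)"
    unfolding Om_def by (intro sum_norm_le) auto
  then show ?thesis using l by (simp add: algebra_simps)
qed

lemma Om_dil_bound:
  assumes R: "R > 0" and f: "is_qlip f" and s: "smooths \<pi>s" and l: "length \<pi>s = Suc k"
    and z: "\<And>x. R \<le> norm x \<Longrightarrow> f x = 0"
  shows "cmod (Om T (dil \<zeta> f) (map (dil \<zeta>) \<pi>s)) \<le>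
    2 * M * real (Suc k) * (exp (Re \<zeta>) ^ Suc k * lprod R \<pi>s) * (\<integral>x. cmod (dil \<zeta> f x) \<partial>\<nu>)"
proof -
  \<comment> \<open>The ball of radius \<open>r\<close> is carried onto the ball of radius
    \<open>R\<close>, so Lipschitz constants on the latter suffice even when the ball of radius
    \<open>r\<close> is smaller than the shell.\<close>
  define r where "r = R * exp (- Re \<zeta>)"
  have r: "r > 0" "exp (Re \<zeta>) * r = R" unfolding r_def using R by (auto simp: exp_minus)
  have q: "is_qlip \<pi>" if "\<pi> \<in> set \<pi>s" for \<pi> using s that smooth_qlip by blast
  have "cmod (Om T (dil \<zeta> f) (map (dil \<zeta>) \<pi>s)) \<le>
    2 * M * real (Suc k) * lprod r (map (dil \<zeta>) \<pi>s) * (\<integral>x. cmod (dil \<zeta> f x) \<partial>\<nu>)"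
  proof (rule Om_bound[OF r(1)])
    fix x :: 'a assume "r \<le> norm x"
    then have "exp (Re \<zeta>) * r \<le> exp (Re \<zeta>) * norm x" by simp
    then have "R \<le> norm (scaleC (exp \<zeta>) x)" unfolding r(2) by (simp add: norm_scaleC)
    then show "dil \<zeta> f x = 0" unfolding dil_def by (rule z)
  qed (use f s l smooth_dil(1) in auto)
  also have "\<dots> \<le> 2 * M * real (Suc k) * (exp (Re \<zeta>) ^ Suc k * lprod R \<pi>s) * (\<integral>x. cmod (dil \<zeta> f x) \<partial>\<nu>)"
  proof (intro mult_right_mono mult_left_mono)
    have "prod_list (map (\<lambda>\<pi>. lipc (ball 0 r) (dil \<zeta> \<pi>)) \<pi>s) \<le> prod_list (map (\<lambda>\<pi>. exp (Re \<zeta>) * lipc (ball 0 R) \<pi>) \<pi>s)"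
      using prod_list_mono[of \<pi>s "\<lambda>\<pi>. lipc (ball 0 r) (dil \<zeta> \<pi>)" "\<lambda>\<pi>. exp (Re \<zeta>) * lipc (ball 0 R) \<pi>"]
        lipc_nonneg[OF is_qlip_dil[OF q]] lipc_dil[OF q, of _ \<zeta> r R] r(2) by auto
    also have "\<dots> = exp (Re \<zeta>) ^ length \<pi>s * lprod R \<pi>s"
      by (induction \<pi>s) (auto simp: mult_ac)
    finally show "lprod r (map (dil \<zeta>) \<pi>s) \<le> exp (Re \<zeta>) ^ Suc k * lprod R \<pi>s"
      by (simp add: o_def l)
  qed (use delta_pos delta_le in auto)
  finally show ?thesis .
qed

text \<open>The pointwise bound is integrated against the modulus of the kernel. Since the integrand
  vanishes beyond \<open>sR R\<close>, the growing powers of \<open>exp (Re \<zeta>)\<close> may be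
  replaced by their value there, and \<open>cone_measure\<close> turns the remaining double integral
  into an \<open>L1norm\<close>.\<close>

lemma Us_mass:
  assumes R: "R > 0"
  shows "\<exists>\<mu>. mass_on (Us T) (Suc k) R \<mu>"
proof -
  define D where "D = 1 / (2 * pi) * (2 * M * real (Suc k) * exp (sR R) ^ Suc k)"
  have D0: "0 \<le> D" unfolding D_def using delta_pos delta_le by simp
  define w where "w p = D * norm (indicator {p. fst p \<le> sR R} p *\<^sub>R cker p)" for p
  have w0: "0 \<le> w p" for p unfolding w_def using D0 by simp
  have wi: "integrable lborel w" unfolding w_def by (intro integrable_mult_right integrable_norm cker_integrable)
  obtain \<mu> where \<mu>: "finite_radon \<mu>"
    "\<forall>f B. is_qlip f \<longrightarrow> (\<forall>x. cmod (f x) \<le> B) \<longrightarrow>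
      integrable lborel (\<lambda>p. w p * (\<integral>x. cmod (dil (cp p) f x) \<partial>\<nu>)) \<and>
      L1norm \<mu> f = (\<integral>p. w p * (\<integral>x. cmod (dil (cp p) f x) \<partial>\<nu>) \<partial>lborel)"
    using cone_measure[OF radon wi w0] by (elim exE conjE) (rule that)
  have res: "cmod (Us T f \<pi>s) \<le> lprod R \<pi>s * L1norm \<mu> f"
    if f: "is_qlip f" and z: "\<And>x. R \<le> norm x \<Longrightarrow> f x = 0" and s: "smooths \<pi>s" and l: "length \<pi>s = Suc k" for f \<pi>s
  proof -
    obtain B where B: "B > 0" "\<And>x. x \<in> ball 0 R \<Longrightarrow> cmod (f x) \<le> B" using is_qlip_bounded[OF f] by metis
    have B': "cmod (f x) \<le> B" for x
    proof (cases "norm x < R")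
      case False
      then show ?thesis using z[of x] B(1) by simp
    qed (use B in auto)
    let ?P = "lprod R \<pi>s"
    have P0: "0 \<le> ?P" using s smooth_qlip by (intro prod_list_lipc_nonneg) blast
    note m = \<mu>(2)[rule_format, OF f B']
    let ?\<Theta> = "\<lambda>p. cker p * Om T (dil (cp p) f) (map (dil (cp p)) \<pi>s)"
    have le: "1 / (2 * pi) * cmod (?\<Theta> p) \<le> ?P * (w p * (\<integral>x. cmod (dil (cp p) f x) \<partial>\<nu>))" for p
    proof (cases "fst p \<le> sR R")
      case True
      let ?I = "\<integral>x. cmod (dil (cp p) f x) \<partial>\<nu>"
      have "cmod (Om T (dil (cp p) f) (map (dil (cp p)) \<pi>s)) \<le> 2 * M * real (Suc k) * (exp (fst p) ^ Suc k * ?P) * ?I"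
        using Om_dil_bound[OF R f s l z, of "cp p"] by simp
      also have "\<dots> \<le> 2 * M * real (Suc k) * (exp (sR R) ^ Suc k * ?P) * ?I"
        using True P0 delta_pos delta_le by (intro mult_right_mono mult_left_mono power_mono) auto
      finally have "1 / (2 * pi) * (cmod (cker p) * cmod (Om T (dil (cp p) f) (map (dil (cp p)) \<pi>s)))
         \<le> 1 / (2 * pi) * (cmod (cker p) * (2 * M * real (Suc k) * (exp (sR R) ^ Suc k * ?P) * ?I))"
        by (intro mult_left_mono) auto
      also have "\<dots> = ?P * (w p * ?I)" using True by (simp add: w_def D_def)
      finally show ?thesis by (simp add: norm_mult)
    next
      case False
      then have "Om T (dil (cp p) f) (map (dil (cp p)) \<pi>s) = 0"
        by (intro Om_dil_zero[OF f s l z]) (use sR[OF R, of "fst p"] in auto)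
      then show ?thesis using P0 w0[of p] by simp
    qed
    have "cmod (Us T f \<pi>s) = 1 / (2 * pi) * cmod (\<integral>p. ?\<Theta> p \<partial>lborel)"
      unfolding Us_def by (simp add: norm_mult norm_divide)
    also have "\<dots> \<le> 1 / (2 * pi) * (\<integral>p. cmod (?\<Theta> p) \<partial>lborel)"
      by (intro mult_left_mono integral_norm_bound) auto
    also have "\<dots> = (\<integral>p. 1 / (2 * pi) * cmod (?\<Theta> p) \<partial>lborel)" by simp
    also have "\<dots> \<le> (\<integral>p. ?P * (w p * (\<integral>x. cmod (dil (cp p) f x) \<partial>\<nu>)) \<partial>lborel)"
    proof (rule integral_mono)
      show "integrable lborel (\<lambda>p. 1 / (2 * pi) * cmod (?\<Theta> p))"
        by (intro integrable_mult_right integrable_norm Us_integrable[OF f s l R z])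
      show "integrable lborel (\<lambda>p. ?P * (w p * (\<integral>x. cmod (dil (cp p) f x) \<partial>\<nu>)))"
        using m by (intro integrable_mult_right) blast
    qed (rule le)
    also have "\<dots> = ?P * L1norm \<mu> f" using m by simp
    finally show ?thesis .
  qed
  show ?thesis unfolding mass_on_def by (intro exI[of _ \<mu>] conjI allI impI \<mu>(1) res) auto
qed

text \<open>On \<open>V\<close> both \<open>f\<close> and \<open>dba f\<close> vanish, off
  \<open>V\<close> the coefficient does, so every summand dies by locality or through its
  coefficient. This allows a cutoff to be replaced by 1 if the two differ only where
  \<open>f\<close> is 0.\<close>

lemma Om_coeff_local:
  assumes V: "open V" and u: "is_qlip u" "\<And>x. x \<notin> V \<Longrightarrow> u x = 0" and f: "smooth f" "\<And>x. x \<in> V \<Longrightarrow> f x = 0"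
    and r: "smooths \<rho>" "length \<rho> = k"
  shows "Om T u (f # \<rho>) = 0"
proof (rule Om_vanish[where V = V and m = k and n = 1 and P = "\<lambda>\<pi>. \<forall>x\<in>V. \<pi> x = 0"])
  fix g \<rho>' assume g: "is_qlip g" "\<And>x. x \<notin> V \<Longrightarrow> g x = 0" and q: "qlips \<rho>'" "length \<rho>' = k"
    and c: "1 \<le> length (filter (\<lambda>\<pi>. \<forall>x\<in>V. \<pi> x = 0) \<rho>')"
  then have "filter (\<lambda>\<pi>. \<forall>x\<in>V. \<pi> x = 0) \<rho>' \<noteq> []" by auto
  then obtain \<pi> where p: "\<pi> \<in> set \<rho>'" "\<forall>x\<in>V. \<pi> x = 0" by (auto simp: filter_empty_conv)
  from split_list[OF p(1)] obtain ys zs where e: "\<rho>' = ys @ \<pi> # zs" by (elim exE)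
  show "T g \<rho>' = 0" unfolding e by (rule local[OF V g, where c = 0]) (use q p e in auto)
next
  show "1 \<le> length (filter (\<lambda>\<pi>. \<forall>x\<in>V. \<pi> x = 0) (f # \<rho>)) \<and> (\<forall>\<pi>\<in>set (f # \<rho>). (\<forall>x\<in>V. \<pi> x = 0) \<longrightarrow> (\<forall>x\<in>V. dba \<pi> x = 0)) \<or>
    Suc 1 \<le> length (filter (\<lambda>\<pi>. \<forall>x\<in>V. \<pi> x = 0) (f # \<rho>))"
    using f(2) dba_zero_open[OF V] by (intro disjI1 conjI) auto
qed (use u f r T_zero in auto)

end

section \<open>The boundary of the cone and the normality estimate\<close>

lemma open_norm_scaleC: "open {x::'a::complex_normed_vector. R < norm (scaleC c x)}"
  unfolding norm_scaleC by (intro open_Collect_less continuous_intros)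

lemma mol_lincomb:
  assumes "is_qlip u" "is_qlip v"
  shows "mol h (\<lambda>x. a * u x + b * v x) = (\<lambda>x. a * mol h u x + b * mol h v x)"
proof -
  have av: "Av c (\<lambda>x. a * u x + b * v x) = (\<lambda>x. a * Av c u x + b * Av c v x)"
    if "is_qlip u" "is_qlip v" for c and u v :: "'a \<Rightarrow> complex"
  proof
    fix x
    have "Av c (\<lambda>x. a * u x + b * v x) x = integral {0..1} (\<lambda>t. a * u (flow c t x)) + integral {0..1} (\<lambda>t. b * v (flow c t x))"
      unfolding Av_def by (intro integral_add Av_integrable is_qlip_mult is_qlip_const that)
    then show "Av c (\<lambda>x. a * u x + b * v x) x = a * Av c u x + b * Av c v x"
      unfolding Av_def by (simp add: integral_mult_right)
  qed
  show ?thesis unfolding mol_def by (simp only: av[OF assms] av[OF is_qlip_Av[OF assms(1)] is_qlip_Av[OF assms(2)]])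
qed

lemma exp_half_le_2: "h \<le> 1/2 \<Longrightarrow> exp h \<le> (2::real)"
proof -
  assume h: "h \<le> 1/2"
  have "exp h \<le> exp (1/2)" using h by simp
  moreover have "(exp (1/2))\<^sup>2 = exp (1::real)" by (simp add: power2_eq_square flip: exp_add)
  moreover have "exp (1::real) \<le> 2\<^sup>2" using exp_le by simp
  ultimately have "(exp (1/2))\<^sup>2 \<le> (2::real)\<^sup>2" by simp
  then have "exp (1/2) \<le> (2::real)" by (rule power2_le_imp_le) simp
  then show ?thesis using \<open>exp h \<le> exp (1/2)\<close> by linarith
qed

text \<open>Up to rotation the averages look at \<open>exp (- (u * h))\<close> times
  \<open>x\<close>, so the radius of the support grows by a factor of at most \<open>exp h\<close>,
  which is at most 2 for \<open>h \<le> 1/2\<close>.\<close>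

lemma mol_support:
  assumes z: "\<And>x. R \<le> norm x \<Longrightarrow> f x = 0" and h: "0 \<le> h" "h \<le> 1/2" and x: "2 * R \<le> norm x" and R: "R > 0"
  shows "mol h f x = 0"
proof -
  have e: "R \<le> norm (flow (\<i> * of_real h) v (scaleC (exp (of_real u * of_real (- h))) x))"
    if "u \<in> {0..1}" for u v
  proof -
    have "u * h \<le> 1/2" using that h by (smt (verit) atLeastAtMost_iff mult_left_le_one_le)
    then have e2: "exp (u * h) \<le> 2" by (rule exp_half_le_2)
    have "R * exp (u * h) \<le> R * 2" using e2 R by (intro mult_left_mono) auto
    then have "R * exp (u * h) \<le> norm x" using x by simp
    then have "R \<le> exp (- (u * h)) * norm x" by (simp add: exp_minus field_simps)
    then show ?thesis by (simp add: norm_scaleC)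
  qed
  have inner: "Av (\<i> * of_real h) f (scaleC (exp (of_real u * of_real (- h))) x) = 0" if "u \<in> {0..1}" for u
  proof -
    have "f (flow (\<i> * of_real h) v (scaleC (exp (of_real u * of_real (- h))) x)) = 0" for v
      by (rule z[OF e[OF that]])
    then show ?thesis unfolding Av_def by simp
  qed
  have "mol h f x = integral {0..1} (\<lambda>u::real. 0)"
    unfolding mol_def Av_def[of "of_real (- h)"] by (rule Henstock_Kurzweil_Integration.integral_cong) (rule inner)
  then show ?thesis by simp
qed

lemma mol_bounded:
  assumes f: "is_qlip f" and B: "\<And>x. cmod (f x) \<le> B"
  shows "cmod (mol h f x) \<le> B"
proof -
  have av: "cmod (Av a g x) \<le> B" if "is_qlip g" "\<And>x. cmod (g x) \<le> B" for a g x
    unfolding Av_def by (rule integral_01_bound[OF Av_continuous[OF that(1)] that(2)])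
  show ?thesis unfolding mol_def by (intro av is_qlip_Av f B)
qed

context shell_current
begin

lemma T_dil_bounded_all:
  assumes "is_qlip u" "qlips \<rho>" "length \<rho> = k" "R > 0" "\<And>x. R \<le> norm x \<Longrightarrow> u x = 0"
  shows "\<exists>B. \<forall>\<zeta>. cmod (T (dil \<zeta> u) (map (dil \<zeta>) \<rho>)) \<le> B"
proof -
  obtain B where B: "\<And>\<zeta>. Re \<zeta> \<le> sR R \<Longrightarrow> cmod (T (dil \<zeta> u) (map (dil \<zeta>) \<rho>)) \<le> B"
    using T_dil_bounded[OF assms(1-3)] by blast
  have "cmod (T (dil \<zeta> u) (map (dil \<zeta>) \<rho>)) \<le> \<bar>B\<bar>" for \<zeta>
  proof (cases "Re \<zeta> \<le> sR R")
    case True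
    then show ?thesis using B[of \<zeta>] by simp
  next
    case False
    then have "T (dil \<zeta> u) (map (dil \<zeta>) \<rho>) = 0"
      by (intro T_dil_zero[OF assms(1) _ _ assms(5)]) (use assms sR[OF assms(4), of "Re \<zeta>"] in auto)
    then show ?thesis by simp
  qed
  then show ?thesis by blast
qed

lemma Ld_dil:
  assumes "smooth f" "smooths \<pi>s" "length \<pi>s = k" "a \<in> {1,\<i>}"
  shows "Ld a (dil \<zeta> f) (map (dil \<zeta>) \<pi>s) = T (dil \<zeta> (ddir a f)) (map (dil \<zeta>) \<pi>s) +
     (\<Sum>j<k. T (dil \<zeta> f) (map (dil \<zeta>) (take j \<pi>s @ ddir a (\<pi>s ! j) # drop (Suc j) \<pi>s)))"
proof -
  have "ddir a (map (dil \<zeta>) \<pi>s ! j) = dil \<zeta> (ddir a (\<pi>s ! j))" if "j < k" for j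
    using smooth_dil(2)[of "\<pi>s ! j" a \<zeta>] assms that by auto
  then show ?thesis unfolding Ld_def using smooth_dil(2)[OF assms(1,4), of \<zeta>]
    by (simp add: take_map drop_map)
qed

text \<open>\<open>cylinder_Pompeiu\<close> for the value of \<open>T\<close> on data dilated by
  \<open>exp (Complex s t)\<close>: it takes equal values at \<open>t = pi\<close> and
  \<open>t = - pi\<close>, vanishes for large \<open>s\<close> and equals \<open>T f \<pi>s\<close>
  at 0, while \<open>T_flow_deriv\<close> and \<open>Lie_Ld\<close> identify twice its
  antiholomorphic derivative with the Lie derivative.\<close>

lemma T_Pompeiu:
  assumes f: "smooth f" and s: "smooths \<pi>s" and l: "length \<pi>s = k" and R: "R > 0"
    and z: "\<And>x. R \<le> norm x \<Longrightarrow> f x = 0"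
  shows "(\<integral>p. cker p * Lie (dil (cp p) f) (map (dil (cp p)) \<pi>s) \<partial>lborel) = - (2 * of_real pi * T f \<pi>s)"
proof -
  note qf = smooth_qlip[OF f]
  have qs: "qlips \<pi>s" using s smooth_qlip by blast
  have R1: "R + 1 > 0" using R by simp
  have td: "qlips (take j \<pi>s @ ddir a (\<pi>s ! j) # drop (Suc j) \<pi>s)"
    "length (take j \<pi>s @ ddir a (\<pi>s ! j) # drop (Suc j) \<pi>s) = k" if "j < k" "a \<in> {1,\<i>}" for j a
  proof -
    have "is_qlip (ddir a (\<pi>s ! j))" using s l that by (intro smooth_ddir_qlip) auto
    then show "qlips (take j \<pi>s @ ddir a (\<pi>s ! j) # drop (Suc j) \<pi>s)"
      using qs by (auto dest!: in_set_takeD in_set_dropD)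
    show "length (take j \<pi>s @ ddir a (\<pi>s ! j) # drop (Suc j) \<pi>s) = k" using that l by simp
  qed
  \<comment> \<open>Radius \<open>R + 1\<close> in place of \<open>R\<close>: the derivative is seen
    to vanish where \<open>f\<close> is 0 on a whole neighbourhood.\<close>
  have dz: "ddir a f x = 0" if "R + 1 \<le> norm x" for a x
  proof (rule ddir_zero_open[where V = "{x. R < norm x}" and c = 0])
    show "open {x::'a. R < norm x}" by (intro open_Collect_less continuous_intros)
  qed (use that z in auto)
  have z1: "f x = 0" if "R + 1 \<le> norm x" for x using z[of x] that by simp
  define L where "L a \<zeta> = Ld a (dil \<zeta> f) (map (dil \<zeta>) \<pi>s)" for a \<zeta>
  have Lc: "continuous_on UNIV (L a)" if a: "a \<in> {1,\<i>}" for a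
    unfolding L_def Ld_dil[OF f s l a]
    by (intro continuous_intros T_dil_continuous smooth_ddir_qlip[OF f a] qf qs l td) (use a in auto)
  have Lb: "\<exists>B. \<forall>\<zeta>. cmod (L a \<zeta>) \<le> B" if a: "a \<in> {1,\<i>}" for a
  proof -
    obtain B0 where B0: "\<And>\<zeta>. cmod (T (dil \<zeta> (ddir a f)) (map (dil \<zeta>) \<pi>s)) \<le> B0"
      using T_dil_bounded_all[OF smooth_ddir_qlip[OF f a] qs l R1 dz] by blast
    have "\<forall>j\<in>{..<k}. \<exists>B. \<forall>\<zeta>. cmod (T (dil \<zeta> f) (map (dil \<zeta>) (take j \<pi>s @ ddir a (\<pi>s ! j) # drop (Suc j) \<pi>s))) \<le> B"
      using T_dil_bounded_all[OF qf td R z, OF _ a _ a] by blast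
    from bchoice[OF this] obtain B where B: "\<And>j \<zeta>. j < k \<Longrightarrow>
       cmod (T (dil \<zeta> f) (map (dil \<zeta>) (take j \<pi>s @ ddir a (\<pi>s ! j) # drop (Suc j) \<pi>s))) \<le> B j" by auto
    have "cmod (L a \<zeta>) \<le> B0 + (\<Sum>j<k. B j)" for \<zeta>
      unfolding L_def Ld_dil[OF f s l a] by (intro norm_triangle_le add_mono B0 sum_norm_le) (use B in auto)
    then show ?thesis by blast
  qed
  obtain B1 where B1: "\<And>\<zeta>. cmod (L 1 \<zeta>) \<le> B1" using Lb[of 1] by auto
  obtain B2 where B2: "\<And>\<zeta>. cmod (L \<i> \<zeta>) \<le> B2" using Lb[of \<i>] by auto
  obtain B3 where B3: "\<And>\<zeta>. cmod (T (dil \<zeta> f) (map (dil \<zeta>) \<pi>s)) \<le> B3"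
    using T_dil_bounded_all[OF qf qs l R z] by blast
  define B where "B = max B1 (max B2 B3)"
  have der: "((\<lambda>t. T (dil (\<zeta> + of_real t * a) f) (map (dil (\<zeta> + of_real t * a)) \<pi>s)) has_vector_derivative L a \<zeta>) (at 0)"
    if a: "a \<in> {1,\<i>}" for a \<zeta>
  proof -
    have "smooths (map (dil \<zeta>) \<pi>s)" using s smooth_dil(1) by auto
    from T_flow_deriv[OF smooth_dil(1)[OF f] this _ a, of \<zeta>] l
    show ?thesis unfolding L_def by (simp add: dil_dil add.commute o_def)
  qed
  have shift: "((\<lambda>x::real. x - c) has_vector_derivative 1) (at c)" for c
    by (auto intro!: derivative_eq_intros simp flip: has_real_derivative_iff_has_vector_derivative)
  let ?G = "\<lambda>s t. T (dil (Complex s t) f) (map (dil (Complex s t)) \<pi>s)"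
  have "(\<integral>p. cker p * (L 1 (Complex (fst p) (snd p)) + \<i> * L \<i> (Complex (fst p) (snd p))) \<partial>lborel) = - (2 * of_real pi * ?G 0 0)"
  proof (rule cylinder_Pompeiu[where s\<^sub>0 = "sR R" and B = B and G = ?G and Gs = "\<lambda>s t. L 1 (Complex s t)" and Gt = "\<lambda>s t. L \<i> (Complex s t)"])
    fix s t :: real
    have "((\<lambda>x. T (dil (Complex s t + of_real x * 1) f) (map (dil (Complex s t + of_real x * 1)) \<pi>s)) has_vector_derivative L 1 (Complex s t)) (at (s - s))"
      using der[of 1 "Complex s t"] by simp
    from vector_diff_chain_at[OF shift this]
    show "((\<lambda>s. ?G s t) has_vector_derivative L 1 (Complex s t)) (at s)"
      by (simp add: o_def Complex_eq algebra_simps)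
    have "((\<lambda>x. T (dil (Complex s t + of_real x * \<i>) f) (map (dil (Complex s t + of_real x * \<i>)) \<pi>s)) has_vector_derivative L \<i> (Complex s t)) (at (t - t))"
      using der[of \<i> "Complex s t"] by simp
    from vector_diff_chain_at[OF shift this]
    show "((\<lambda>t. ?G s t) has_vector_derivative L \<i> (Complex s t)) (at t)"
      by (simp add: o_def Complex_eq algebra_simps)
    have "exp (Complex s pi) = exp (Complex s (- pi))" by (simp add: complex_eq_iff Re_exp Im_exp)
    then have "dil (Complex s pi) = (dil (Complex s (- pi)) :: ('a \<Rightarrow> complex) \<Rightarrow> _)" by (intro ext) (simp add: dil_def)
    then show "?G s pi = ?G s (- pi)" by simp
    show "?G s t = 0" if "sR R \<le> s"
      by (rule T_dil_zero[OF qf _ _ z]) (use qs l sR[OF R that] in auto)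
    show "cmod (?G s t) \<le> B" "cmod (L 1 (Complex s t)) \<le> B" "cmod (L \<i> (Complex s t)) \<le> B"
      unfolding B_def using B1[of "Complex s t"] B2[of "Complex s t"] B3[of "Complex s t"] by linarith+
  qed (rule continuous_on_compose2[OF T_dil_continuous[OF qf qs l] continuous_on_Complex subset_UNIV]
       continuous_on_compose2[OF Lc continuous_on_Complex subset_UNIV], simp?)+
  moreover have "Complex 0 0 = 0" by (simp add: complex_eq_iff)
  moreover have "Lie (dil (cp p) f) (map (dil (cp p)) \<pi>s) = L 1 (Complex (fst p) (snd p)) + \<i> * L \<i> (Complex (fst p) (snd p))" for p
    unfolding L_def cp_def by (rule Lie_Ld) (use f s l smooth_dil(1) in auto)
  ultimately show ?thesis by simp
qed

end

text \<open>Normality in shell form: for positive \<open>k\<close> the boundary lives in the same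
  shell with a measure of its own. The coefficient 1 is legitimate because a shell current takes
  coefficients of any support, which spares the cutoff in the quasi-local boundary.\<close>

locale normal_shell = shell_current +
  fixes \<nu>' :: "'a measure"
  assumes bdry: "k = 0 \<or> shell_current (k - 1) (\<lambda>f \<pi>s. T (\<lambda>_. 1) (f # \<pi>s)) \<delta> M \<nu>'"
begin

abbreviation "D \<equiv> \<lambda>f \<pi>s. T (\<lambda>_. 1) (f # \<pi>s)"

lemma Om_D_integrable:
  assumes "is_qlip f" "smooths \<pi>s" "length \<pi>s = k" "R > 0" "\<And>x. R \<le> norm x \<Longrightarrow> f x = 0"
  shows "integrable lborel (\<lambda>p. cker p * Om D (dil (cp p) f) (map (dil (cp p)) \<pi>s))"
proof (cases "k = 0")
  case True
  then show ?thesis using assms(3) by simp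
next
  case False
  then interpret D: shell_current "k - 1" D \<delta> M \<nu>' using bdry by simp
  show ?thesis by (rule D.Us_integrable[OF assms(1,2) _ assms(4,5)]) (use False assms(3) in auto)
qed

text \<open>The cone formula on smooth data: Cartan's formula is integrated against the kernel, and
  \<open>T_Pompeiu\<close> evaluates the Lie derivative. Since \<open>\<sigma>\<close> is 1 wherever
  \<open>f\<close> may be nonzero, it can be replaced by 1 at every dilation.\<close>

lemma Us_boundary:
  assumes f: "smooth f" and s: "smooths \<pi>s" and l: "length \<pi>s = k" and R: "R > 0"
    and z: "\<And>x. R \<le> norm x \<Longrightarrow> f x = 0"
    and \<sigma>: "is_qlip \<sigma>" "\<And>x. norm x \<le> R \<Longrightarrow> \<sigma> x = 1" "\<And>x. R' \<le> norm x \<Longrightarrow> \<sigma> x = 0" and R': "R' > 0"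
  shows "Us T \<sigma> (f # \<pi>s) = T f \<pi>s - Us D f \<pi>s"
proof -
  have eq: "Om T (dil \<zeta> \<sigma>) (map (dil \<zeta>) (f # \<pi>s)) + Om D (dil \<zeta> f) (map (dil \<zeta>) \<pi>s) = Lie (dil \<zeta> f) (map (dil \<zeta>) \<pi>s)" for \<zeta>
  proof -
    have sm: "smooths (map (dil \<zeta>) \<pi>s)" and sf: "smooth (dil \<zeta> f)" using s f smooth_dil(1) by auto
    let ?V = "{x::'a. R < norm (scaleC (exp \<zeta>) x)}"
    have V: "open ?V" by (rule open_norm_scaleC)
    have "Om T (\<lambda>x. dil \<zeta> \<sigma> x - 1) (dil \<zeta> f # map (dil \<zeta>) \<pi>s) = 0"
    proof (rule Om_coeff_local[OF V _ _ sf _ sm])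
      show "is_qlip (\<lambda>x. dil \<zeta> \<sigma> x - 1)" using \<sigma>(1) by auto
      show "dil \<zeta> \<sigma> x - 1 = 0" if "x \<notin> ?V" for x using that \<sigma>(2) by (simp add: dil_def)
      show "dil \<zeta> f x = 0" if "x \<in> ?V" for x using that z by (simp add: dil_def)
    qed (use l in simp)
    moreover have "Om T (\<lambda>x. 1 * 1 + 1 * (dil \<zeta> \<sigma> x - 1)) (dil \<zeta> f # map (dil \<zeta>) \<pi>s)
        = 1 * Om T (\<lambda>_. 1) (dil \<zeta> f # map (dil \<zeta>) \<pi>s) + 1 * Om T (\<lambda>x. dil \<zeta> \<sigma> x - 1) (dil \<zeta> f # map (dil \<zeta>) \<pi>s)"
      by (rule Om_coeff) (use \<sigma> l sm sf in auto)
    ultimately have "Om T (dil \<zeta> \<sigma>) (dil \<zeta> f # map (dil \<zeta>) \<pi>s) = Om T (\<lambda>_. 1) (dil \<zeta> f # map (dil \<zeta>) \<pi>s)" by simp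
    then show ?thesis using Om_Cartan[OF sf sm] l by simp
  qed
  let ?A = "\<lambda>p. cker p * Om T (dil (cp p) \<sigma>) (map (dil (cp p)) (f # \<pi>s))"
  let ?B = "\<lambda>p. cker p * Om D (dil (cp p) f) (map (dil (cp p)) \<pi>s)"
  have "integrable lborel ?A" by (rule Us_integrable[OF \<sigma>(1) _ _ R' \<sigma>(3)]) (use f s l in auto)
  moreover have "integrable lborel ?B" by (rule Om_D_integrable[OF smooth_qlip[OF f] s l R z])
  ultimately have "(\<integral>p. ?A p + ?B p \<partial>lborel) = (\<integral>p. ?A p \<partial>lborel) + (\<integral>p. ?B p \<partial>lborel)"
    by (rule Bochner_Integration.integral_add)
  moreover have "?A p + ?B p = cker p * Lie (dil (cp p) f) (map (dil (cp p)) \<pi>s)" for p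
    unfolding eq[of "cp p", symmetric] by (simp only: distrib_left)
  ultimately have "(\<integral>p. ?A p \<partial>lborel) + (\<integral>p. ?B p \<partial>lborel) = - (2 * of_real pi * T f \<pi>s)"
    using T_Pompeiu[OF f s l R z] by simp
  then have e: "(\<integral>p. ?A p \<partial>lborel) = - (2 * of_real pi * T f \<pi>s) - (\<integral>p. ?B p \<partial>lborel)" by (simp only: eq_diff_eq)
  show ?thesis unfolding Us_def e by (simp add: field_simps)
qed

text \<open>Integration by parts: \<open>Om_leibniz\<close> trades the slot \<open>g\<close> for the
  product in the first slot, and \<open>Us_boundary\<close> evaluates that term. On the right
  \<open>g\<close> enters through coefficients only, so its supremum controls the left side. The
  factor \<open>cut R\<close> gives \<open>g\<close> bounded support and is 1 where \<open>f\<close>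
  is nonzero.\<close>

lemma Us_slot_split:
  assumes f: "smooth f" and g: "smooth g" and r: "smooths \<rho>" "length \<rho> = k" and R: "R > 0"
    and z: "\<And>x. R \<le> norm x \<Longrightarrow> f x = 0"
  shows "Us T f (g # \<rho>) = T (\<lambda>x. f x * g x) \<rho> - Us D (\<lambda>x. f x * g x) \<rho> - Us T (\<lambda>x. cut R x * g x) (f # \<rho>)"
proof -
  have sfg: "smooth (\<lambda>x. f x * g x)" by (rule smooth_mult(1)[OF f g])
  have c0: "cut R x * g x = 0" "cut R x = 0" if "R + 1 \<le> norm x" for x using cut_0[OF that] by auto
  have R1: "R + 1 > 0" using R by simp
  have eq: "Om T (dil \<zeta> f) (map (dil \<zeta>) (g # \<rho>)) + Om T (dil \<zeta> (\<lambda>x. cut R x * g x)) (map (dil \<zeta>) (f # \<rho>))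
      = Om T (dil \<zeta> (cut R)) (map (dil \<zeta>) ((\<lambda>x. f x * g x) # \<rho>))" for \<zeta>
  proof -
    have sm: "smooths (map (dil \<zeta>) \<rho>)" and sf: "smooth (dil \<zeta> f)" and sg: "smooth (dil \<zeta> g)"
      using r f g smooth_dil(1) by auto
    let ?V = "{x::'a. R < norm (scaleC (exp \<zeta>) x)}"
    have V: "open ?V" by (rule open_norm_scaleC)
    have loc: "Om T (\<lambda>x. (dil \<zeta> (cut R) x - 1) * h x) (u # map (dil \<zeta>) \<rho>) = 0"
      if "is_qlip h" "smooth u" "\<And>x. x \<in> ?V \<Longrightarrow> u x = 0" for h u
    proof (rule Om_coeff_local[OF V _ _ that(2,3) sm])
      show "(dil \<zeta> (cut R) x - 1) * h x = 0" if "x \<notin> ?V" for x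
        using that cut_1[of "scaleC (exp \<zeta>) x" R] by (simp add: dil_def)
    qed (use that r in auto)
    have fz: "dil \<zeta> f x = 0" if "x \<in> ?V" for x using that z by (simp add: dil_def)
    have 1: "Om T (dil \<zeta> (\<lambda>x. cut R x * g x)) (dil \<zeta> f # map (dil \<zeta>) \<rho>) = Om T (dil \<zeta> g) (dil \<zeta> f # map (dil \<zeta>) \<rho>)"
    proof -
      have e: "dil \<zeta> (\<lambda>x. cut R x * g x) = (\<lambda>x. 1 * dil \<zeta> g x + 1 * ((dil \<zeta> (cut R) x - 1) * dil \<zeta> g x))"
        by (auto simp: dil_def algebra_simps)
      have "Om T (\<lambda>x. 1 * dil \<zeta> g x + 1 * ((dil \<zeta> (cut R) x - 1) * dil \<zeta> g x)) (dil \<zeta> f # map (dil \<zeta>) \<rho>)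
        = 1 * Om T (dil \<zeta> g) (dil \<zeta> f # map (dil \<zeta>) \<rho>) + 1 * Om T (\<lambda>x. (dil \<zeta> (cut R) x - 1) * dil \<zeta> g x) (dil \<zeta> f # map (dil \<zeta>) \<rho>)"
        by (rule Om_coeff) (use sm sf r smooth_qlip[OF g] in auto)
      then show ?thesis unfolding e using loc[OF is_qlip_dil[OF smooth_qlip[OF g]] sf fz] by simp
    qed
    have 2: "Om T (dil \<zeta> (cut R)) (dil \<zeta> (\<lambda>x. f x * g x) # map (dil \<zeta>) \<rho>) = Om T (\<lambda>_. 1) (dil \<zeta> (\<lambda>x. f x * g x) # map (dil \<zeta>) \<rho>)"
    proof -
      have e: "dil \<zeta> (cut R) = (\<lambda>x. 1 * 1 + 1 * ((dil \<zeta> (cut R) x - 1) * 1))" by auto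
      have "Om T (\<lambda>x. 1 * 1 + 1 * ((dil \<zeta> (cut R) x - 1) * 1)) (dil \<zeta> (\<lambda>x. f x * g x) # map (dil \<zeta>) \<rho>)
        = 1 * Om T (\<lambda>_. 1) (dil \<zeta> (\<lambda>x. f x * g x) # map (dil \<zeta>) \<rho>) + 1 * Om T (\<lambda>x. (dil \<zeta> (cut R) x - 1) * 1) (dil \<zeta> (\<lambda>x. f x * g x) # map (dil \<zeta>) \<rho>)"
        by (rule Om_coeff) (use sm smooth_dil(1)[OF sfg] r in auto)
      moreover have "Om T (\<lambda>x. (dil \<zeta> (cut R) x - 1) * 1) (dil \<zeta> (\<lambda>x. f x * g x) # map (dil \<zeta>) \<rho>) = 0"
        by (rule loc[OF is_qlip_const smooth_dil(1)[OF sfg]]) (use fz in \<open>auto simp: dil_def\<close>)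
      ultimately show ?thesis by (subst e) simp
    qed
    have 3: "dil \<zeta> (\<lambda>x. f x * g x) = (\<lambda>x. dil \<zeta> f x * dil \<zeta> g x)" by (simp add: dil_def)
    show ?thesis using Om_leibniz[OF sf sg sm] 1 2 r(2) by (simp add: 3)
  qed
  let ?A = "\<lambda>p. cker p * Om T (dil (cp p) f) (map (dil (cp p)) (g # \<rho>))"
  let ?B = "\<lambda>p. cker p * Om T (dil (cp p) (\<lambda>x. cut R x * g x)) (map (dil (cp p)) (f # \<rho>))"
  have "integrable lborel ?A" by (rule Us_integrable[OF smooth_qlip[OF f] _ _ R z]) (use g r in auto)
  moreover have "integrable lborel ?B" by (rule Us_integrable[OF _ _ _ R1 c0(1)]) (use f g r smooth_qlip in auto)
  ultimately have "(\<integral>p. ?A p + ?B p \<partial>lborel) = (\<integral>p. ?A p \<partial>lborel) + (\<integral>p. ?B p \<partial>lborel)"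
    by (rule Bochner_Integration.integral_add)
  moreover have "?A p + ?B p = cker p * Om T (dil (cp p) (cut R)) (map (dil (cp p)) ((\<lambda>x. f x * g x) # \<rho>))" for p
    unfolding eq[of "cp p", symmetric] by (simp only: distrib_left)
  ultimately have "Us T f (g # \<rho>) + Us T (\<lambda>x. cut R x * g x) (f # \<rho>) = Us T (cut R) ((\<lambda>x. f x * g x) # \<rho>)"
    unfolding Us_def by (simp only: distrib_left[symmetric])
  moreover have "Us T (cut R) ((\<lambda>x. f x * g x) # \<rho>) = T (\<lambda>x. f x * g x) \<rho> - Us D (\<lambda>x. f x * g x) \<rho>"
    by (rule Us_boundary[OF sfg r R _ _ _ c0(2) R1]) (use z cut_1 in auto)
  ultimately show ?thesis by (simp add: algebra_simps)
qed

lemma Us_D_mass: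
  assumes R: "R > 0"
  shows "\<exists>\<mu>. mass_on (Us D) k R \<mu>"
proof (cases "k = 0")
  case True
  then show ?thesis using radon by (intro exI[of _ \<nu>]) (auto simp: Us_def mass_on_def)
next
  case False
  then interpret D: shell_current "k - 1" D \<delta> M \<nu>' using bdry by simp
  show ?thesis using D.Us_mass[OF R] False by simp
qed

lemma integral_cmod_le:
  fixes \<mu> :: "'a measure"
  assumes "finite_radon \<mu>" "is_qlip f" "\<And>x. cmod (f x) \<le> B"
  shows "L1norm \<mu> f \<le> B * measure \<mu> UNIV"
proof -
  interpret finite_measure \<mu> by (rule finite_radon_finite_measure[OF assms(1)])
  have s: "sets \<mu> = sets borel" using assms(1) by (simp add: finite_radon_def)
  have "integrable \<mu> f" by (rule integrable_const_bound[where B = B]) (use assms qlip_borel_measurable[OF assms(2) s] in auto)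
  then have "L1norm \<mu> f \<le> (\<integral>x. B \<partial>\<mu>)" by (intro integral_mono) (use assms in auto)
  also have "\<dots> = B * measure \<mu> UNIV" using sets_eq_imp_space_eq[OF s] by simp
  finally show ?thesis .
qed

text \<open>A uniform form of the slot estimate: one \<open>B\<close> bounds the coefficient and the
  \<open>k\<close> other slots, which accounts for the power \<open>Suc k\<close>. The ball of
  radius \<open>R + 1\<close> contains all points where \<open>cut R\<close> is nonzero.\<close>

definition slot_const :: "real \<Rightarrow> real \<Rightarrow> bool" where
  "slot_const R C \<longleftrightarrow> 0 \<le> C \<and> (\<forall>B \<eta> f g us vs. 0 \<le> B \<and> 0 \<le> \<eta> \<and> smooth f \<and> (\<forall>x. cmod (f x) \<le> B) \<and> lipc (ball 0 (R+1)) f \<le> B \<and>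
     (\<forall>x. R \<le> norm x \<longrightarrow> f x = 0) \<and> smooth g \<and> (\<forall>x\<in>ball 0 (R+1). cmod (g x) \<le> \<eta>) \<and>
     (\<forall>\<pi>\<in>set (us @ vs). smooth \<pi> \<and> lipc (ball 0 (R+1)) \<pi> \<le> B) \<and> length us + length vs = k
     \<longrightarrow> cmod (Us T f (us @ g # vs)) \<le> C * B ^ Suc k * \<eta>)"

lemma slot_constD:
  assumes "slot_const R C"
  shows "0 \<le> C"
    and "\<lbrakk>0 \<le> B; 0 \<le> \<eta>; smooth f; \<And>x. cmod (f x) \<le> B; lipc (ball 0 (R+1)) f \<le> B; \<And>x. R \<le> norm x \<Longrightarrow> f x = 0;
     smooth g; \<And>x. x \<in> ball 0 (R+1) \<Longrightarrow> cmod (g x) \<le> \<eta>;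
     \<forall>\<pi>\<in>set (us @ vs). smooth \<pi> \<and> lipc (ball 0 (R+1)) \<pi> \<le> B; length us + length vs = k\<rbrakk>
     \<Longrightarrow> cmod (Us T f (us @ g # vs)) \<le> C * B ^ Suc k * \<eta>"
  using assms unfolding slot_const_def by (blast, simp)

lemma Us_slot_bound:
  assumes R: "R > 0"
  shows "\<exists>C. slot_const R C"
proof -
  have R1: "R + 1 > 0" using R by simp
  obtain \<mu>\<^sub>1 where "mass_on (Us T) (Suc k) (R + 1) \<mu>\<^sub>1" using Us_mass[OF R1] by (rule exE)
  note m1 = mass_onD[OF this]
  obtain \<mu>\<^sub>2 where "mass_on (Us D) k (R + 1) \<mu>\<^sub>2" using Us_D_mass[OF R1] by (rule exE)
  note m2 = mass_onD[OF this]
  define C where "C = measure \<nu> UNIV + measure \<mu>\<^sub>2 UNIV + measure \<mu>\<^sub>1 UNIV"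
  have res: "cmod (Us T f (us @ g # vs)) \<le> C * B ^ Suc k * \<eta>"
    if B: "0 \<le> B" and eta: "0 \<le> \<eta>" and f: "smooth f" "\<And>x. cmod (f x) \<le> B" "lipc (ball 0 (R+1)) f \<le> B" and z: "\<And>x. R \<le> norm x \<Longrightarrow> f x = 0"
      and g: "smooth g" "\<And>x. x \<in> ball 0 (R+1) \<Longrightarrow> cmod (g x) \<le> \<eta>"
      and r: "\<forall>\<pi>\<in>set (us @ vs). smooth \<pi> \<and> lipc (ball 0 (R+1)) \<pi> \<le> B" "length us + length vs = k" for B \<eta> f g us vs
  proof -
    define \<rho> where "\<rho> = us @ vs"
    have rs: "smooths \<rho>" "length \<rho> = k" using r by (auto simp: \<rho>_def)
    have rq: "qlips \<rho>" using rs smooth_qlip by blast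
    note qf = smooth_qlip[OF f(1)] and qg = smooth_qlip[OF g(1)]
    have pr: "lprod (R+1) \<rho> \<le> B ^ k"
    proof -
      have "\<forall>\<pi>\<in>set \<rho>. is_qlip \<pi> \<and> lipc (ball 0 (R+1)) \<pi> \<le> B" using r rq by (auto simp: \<rho>_def)
      from prod_list_lipc_le[OF this] rs(2) show ?thesis by simp
    qed
    have pr0: "0 \<le> lprod (R+1) \<rho>" by (rule prod_list_lipc_nonneg[OF rq])
    have pf: "lprod (R+1) (f # \<rho>) \<le> B * B ^ k"
      using pr pr0 f(3) B by (simp add: mult_mono)
    have fg: "cmod (f x * g x) \<le> B * \<eta>" for x
    proof (cases "norm x < R")
      case True
      then show ?thesis unfolding norm_mult using f(2)[of x] g(2)[of x] B by (intro mult_mono) auto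
    qed (use z[of x] B eta in auto)
    have cg: "cmod (cut R x * g x) \<le> \<eta>" for x
    proof (cases "norm x < R + 1")
      case True
      then have "cmod (cut R x) * cmod (g x) \<le> 1 * \<eta>" using cut_le[of R x] g(2)[of x] by (intro mult_mono) auto
      then show ?thesis by (simp add: norm_mult)
    qed (use cut_0[of R x] eta in auto)
    have q1: "is_qlip (\<lambda>x. f x * g x)" "is_qlip (\<lambda>x. cut R x * g x)" using qf qg by auto
    have z1: "f x * g x = 0" "cut R x * g x = 0" if "R + 1 \<le> norm x" for x
      using z[of x] cut_0[OF that] that by auto
    have "cmod (T (\<lambda>x. f x * g x) \<rho>) \<le> lprod (R+1) \<rho> * (\<integral>x. cmod (f x * g x) \<partial>\<nu>)"
      by (rule bound[OF R1 q1(1) rs(2) rq]) (use z1 in auto)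
    also have "\<dots> \<le> B ^ k * (B * \<eta> * measure \<nu> UNIV)"
      by (intro mult_mono pr integral_cmod_le[OF radon q1(1) fg]) (use B in auto)
    finally have 1: "cmod (T (\<lambda>x. f x * g x) \<rho>) \<le> B ^ k * (B * \<eta> * measure \<nu> UNIV)" .
    have "cmod (Us D (\<lambda>x. f x * g x) \<rho>) \<le> lprod (R+1) \<rho> * (\<integral>x. cmod (f x * g x) \<partial>\<mu>\<^sub>2)"
      by (rule m2(2)[OF q1(1) z1(1) rs])
    also have "\<dots> \<le> B ^ k * (B * \<eta> * measure \<mu>\<^sub>2 UNIV)"
      by (intro mult_mono pr integral_cmod_le[OF m2(1) q1(1) fg]) (use B in auto)
    finally have 2: "cmod (Us D (\<lambda>x. f x * g x) \<rho>) \<le> B ^ k * (B * \<eta> * measure \<mu>\<^sub>2 UNIV)" .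
    have "cmod (Us T (\<lambda>x. cut R x * g x) (f # \<rho>)) \<le> lprod (R+1) (f # \<rho>) * (\<integral>x. cmod (cut R x * g x) \<partial>\<mu>\<^sub>1)"
      by (rule m1(2)[OF q1(2) z1(2)]) (use rs f in auto)
    also have "\<dots> \<le> (B * B ^ k) * (\<eta> * measure \<mu>\<^sub>1 UNIV)"
      by (intro mult_mono pf integral_cmod_le[OF m1(1) q1(2) cg]) (use B in auto)
    finally have 3: "cmod (Us T (\<lambda>x. cut R x * g x) (f # \<rho>)) \<le> (B * B ^ k) * (\<eta> * measure \<mu>\<^sub>1 UNIV)" .
    have "cmod (Us T f (us @ g # vs)) = cmod (Us T f (g # \<rho>))"
      using Us_move[of f us g vs] r qf g(1) by (simp add: \<rho>_def norm_mult norm_power)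
    also have "\<dots> = cmod (T (\<lambda>x. f x * g x) \<rho> - Us D (\<lambda>x. f x * g x) \<rho> - Us T (\<lambda>x. cut R x * g x) (f # \<rho>))"
      by (simp only: Us_slot_split[OF f(1) g(1) rs R z])
    also have "\<dots> \<le> cmod (T (\<lambda>x. f x * g x) \<rho>) + cmod (Us D (\<lambda>x. f x * g x) \<rho>) + cmod (Us T (\<lambda>x. cut R x * g x) (f # \<rho>))"
      by (meson norm_triangle_ineq4 order_trans add_right_mono)
    also have "\<dots> \<le> C * B ^ Suc k * \<eta>" using 1 2 3 by (simp add: C_def algebra_simps)
    finally show ?thesis .
  qed
  have C0: "0 \<le> C" unfolding C_def by simp
  show ?thesis unfolding slot_const_def
    by (rule exI[of _ C], intro conjI C0 allI impI, elim conjE, rule res) auto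
qed

text \<open>The further power of \<open>B\<close> comes from the distance between a slot and its
  mollification, which is proportional to the Lipschitz constant. The radius is \<open>2*R+1\<close>
  because mollifying the coefficient may double its support, and the slot estimate adds 1.\<close>

definition mol_const :: "real \<Rightarrow> real \<Rightarrow> bool" where
  "mol_const R C \<longleftrightarrow> 0 \<le> C \<and> (\<forall>B f \<pi>s h h'. 0 \<le> B \<and> is_qlip f \<and> (\<forall>x. cmod (f x) \<le> B) \<and> lipc (ball 0 (2*R+1)) f \<le> B \<and>
     (\<forall>x. R \<le> norm x \<longrightarrow> f x = 0) \<and> (\<forall>\<pi>\<in>set \<pi>s. is_qlip \<pi> \<and> lipc (ball 0 (2*R+1)) \<pi> \<le> B) \<and> length \<pi>s = Suc k \<and> 0 < h \<and> 0 < h'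
     \<longrightarrow> cmod (Us T f (map (mol h) \<pi>s) - Us T f (map (mol h') \<pi>s)) \<le> C * B ^ Suc (Suc k) * (h + h'))"

lemma mol_constD:
  assumes "mol_const R C"
  shows "0 \<le> C"
    and "\<lbrakk>0 \<le> B; is_qlip f; \<And>x. cmod (f x) \<le> B; lipc (ball 0 (2*R+1)) f \<le> B;
     \<And>x. R \<le> norm x \<Longrightarrow> f x = 0; \<forall>\<pi>\<in>set \<pi>s. is_qlip \<pi> \<and> lipc (ball 0 (2*R+1)) \<pi> \<le> B; length \<pi>s = Suc k; 0 < h; 0 < h'\<rbrakk>
     \<Longrightarrow> cmod (Us T f (map (mol h) \<pi>s) - Us T f (map (mol h') \<pi>s)) \<le> C * B ^ Suc (Suc k) * (h + h')"
  using assms unfolding mol_const_def by (blast, simp)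

text \<open>The slots are exchanged one at a time, each at the cost of the sup distance of two
  mollifications. The slot estimate asks for a smooth coefficient, so it is applied to
  mollifications \<open>f' m\<close> of \<open>f\<close>; the mass bound then carries the result
  over to \<open>f\<close>.\<close>

lemma Us_mol_diff:
  assumes R: "R > 0"
  shows "\<exists>C. mol_const R C"
proof -
  have R2: "2 * R > 0" and R3: "2 * R + 1 > 0" using R by auto
  obtain C where "slot_const (2 * R) C" using Us_slot_bound[OF R2] by (rule exE)
  note C = slot_constD[OF this]
  obtain \<mu> where "mass_on (Us T) (Suc k) (2 * R) \<mu>" using Us_mass[OF R2] by (rule exE)
  note m = mass_onD[OF this]
  \<comment> \<open>There are \<open>Suc k\<close> exchanges, each with
    \<open>\<eta> = 2 * B * (2*R+1) * (h + h')\<close> from two uses of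
    \<open>mol_close\<close>.\<close>
  define K where "K = real (Suc k) * C * (2 * (2*R+1))"
  have res: "cmod (Us T f (map (mol h) \<pi>s) - Us T f (map (mol h') \<pi>s)) \<le> K * B ^ Suc (Suc k) * (h + h')"
    if B: "0 \<le> B" and f: "is_qlip f" "\<And>x. cmod (f x) \<le> B" "lipc (ball 0 (2*R+1)) f \<le> B" and z: "\<And>x. R \<le> norm x \<Longrightarrow> f x = 0"
      and p: "\<forall>\<pi>\<in>set \<pi>s. is_qlip \<pi> \<and> lipc (ball 0 (2*R+1)) \<pi> \<le> B" "length \<pi>s = Suc k" and h: "0 < h" "0 < h'" for B f \<pi>s h h'
  proof -
    define \<eta> where "\<eta> = 2 * B * (2*R+1) * (h + h')"
    have eta: "0 \<le> \<eta>" unfolding \<eta>_def using B R h by simp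
    have mp: "\<forall>\<pi>\<in>set (map (mol a) \<pi>s). smooth \<pi> \<and> lipc (ball 0 (2*R+1)) \<pi> \<le> B" if "0 < a" for a
    proof (clarsimp, intro conjI)
      fix \<pi> assume "\<pi> \<in> set \<pi>s"
      then have q: "is_qlip \<pi>" "lipc (ball 0 (2*R+1)) \<pi> \<le> B" using p by auto
      show "smooth (mol a \<pi>)" by (rule smooth_mol(1)[OF q(1) that])
      show "lipc (ball 0 (2*R+1)) (mol a \<pi>) \<le> B" using lipc_mol[OF q(1) _ R3, of a] that q(2) by simp
    qed
    define f' where "f' m = mol (inverse (real (m + 2))) f" for m :: nat
    have hm: "0 < inverse (real (m + 2))" "inverse (real (m + 2)) \<le> 1/2" for m :: nat by (auto simp: field_simps)
    have f's: "smooth (f' m)" for m unfolding f'_def by (rule smooth_mol(1)[OF f(1) hm(1)])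
    have f'z: "f' m x = 0" if "2 * R \<le> norm x" for m x
      unfolding f'_def by (rule mol_support[OF z _ _ that R]) (use hm[of m] in auto)
    have step: "cmod (Us T (f' m) (map (mol h) \<pi>s) - Us T (f' m) (map (mol h') \<pi>s)) \<le> K * B ^ Suc (Suc k) * (h + h')" for m
    proof -
      have "Us T (f' m) (map (mol h) \<pi>s) - Us T (f' m) (map (mol h') \<pi>s)
        = (\<Sum>j<Suc k. Us T (f' m) (take j (map (mol h') \<pi>s) @ (\<lambda>x. (map (mol h) \<pi>s ! j) x - (map (mol h') \<pi>s ! j) x) # drop (Suc j) (map (mol h) \<pi>s)))"
      proof (rule list_telescope[where P = smooth and \<Phi> = "Us T (f' m)"])
        fix us vs :: "('a \<Rightarrow> complex) list" and u v :: "'a \<Rightarrow> complex"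
        assume a: "smooths us" "smooth u" "smooth v" "smooths vs" "Suc (length us + length vs) = Suc k"
        then have l: "length us + length vs = k" by simp
        from Us_slot[OF smooth_qlip[OF f's] a(1-4) l R2 f'z, where c = 1 and d = "-1"]
        show "Us T (f' m) (us @ (\<lambda>x. u x - v x) # vs) = Us T (f' m) (us @ u # vs) - Us T (f' m) (us @ v # vs)" by simp
      qed (use p mp[OF h(1)] mp[OF h(2)] in auto)
      also have "cmod \<dots> \<le> (\<Sum>j<Suc k. C * B ^ Suc k * \<eta>)"
      proof (rule sum_norm_le)
        fix j assume "j \<in> {..<Suc k}"
        then have j: "j < length \<pi>s" using p(2) by simp
        then have q: "is_qlip (\<pi>s ! j)" "lipc (ball 0 (2*R+1)) (\<pi>s ! j) \<le> B" using p(1) by auto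
        have lip: "B-lipschitz_on (ball 0 (2*R+1)) (\<pi>s ! j)" by (rule lipschitz_on_le[OF is_qlip_lipc[OF q(1)] q(2)])
        show "cmod (Us T (f' m) (take j (map (mol h') \<pi>s) @ (\<lambda>x. (map (mol h) \<pi>s ! j) x - (map (mol h') \<pi>s ! j) x) # drop (Suc j) (map (mol h) \<pi>s))) \<le> C * B ^ Suc k * \<eta>"
        proof (rule C(2)[OF B eta f's])
          show "cmod (f' m x) \<le> B" for x unfolding f'_def by (rule mol_bounded[OF f(1,2)])
          show "lipc (ball 0 (2*R+1)) (f' m) \<le> B"
            unfolding f'_def using lipc_mol[OF f(1) less_imp_le[OF hm(1)] R3, of m] f(3) by linarith
          show "f' m x = 0" if "2 * R \<le> norm x" for x using f'z[OF that] .
          have "smooth (\<lambda>x. 1 * mol h (\<pi>s ! j) x + (-1) * mol h' (\<pi>s ! j) x)"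
            by (rule smooth_lincomb(1)) (intro smooth_mol q h)+
          then show "smooth (\<lambda>x. (map (mol h) \<pi>s ! j) x - (map (mol h') \<pi>s ! j) x)" using j by simp
          show "cmod ((map (mol h) \<pi>s ! j) x - (map (mol h') \<pi>s ! j) x) \<le> \<eta>" if "x \<in> ball 0 (2*R+1)" for x
          proof -
            have x: "norm x < 2*R+1" using that by simp
            have "cmod (mol h (\<pi>s ! j) x - (\<pi>s ! j) x) \<le> 2 * B * (2*R+1) * h"
              by (rule mol_close[OF q(1) lip _ x]) (use h in simp)
            moreover have "cmod (mol h' (\<pi>s ! j) x - (\<pi>s ! j) x) \<le> 2 * B * (2*R+1) * h'"
              by (rule mol_close[OF q(1) lip _ x]) (use h in simp)
            ultimately have "cmod (mol h (\<pi>s ! j) x - (\<pi>s ! j) x) + cmod (mol h' (\<pi>s ! j) x - (\<pi>s ! j) x) \<le> \<eta>"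
              unfolding \<eta>_def distrib_left[of "2 * B * (2*R+1)"] by (rule add_mono)
            from order_trans[OF norm_triangle_ineq4 this]
            have "cmod ((mol h (\<pi>s ! j) x - (\<pi>s ! j) x) - (mol h' (\<pi>s ! j) x - (\<pi>s ! j) x)) \<le> \<eta>" .
            then show "cmod ((map (mol h) \<pi>s ! j) x - (map (mol h') \<pi>s ! j) x) \<le> \<eta>" using j by simp
          qed
          show "\<forall>\<pi>\<in>set (take j (map (mol h') \<pi>s) @ drop (Suc j) (map (mol h) \<pi>s)). smooth \<pi> \<and> lipc (ball 0 (2*R+1)) \<pi> \<le> B"
            using mp[OF h(1)] mp[OF h(2)] by (auto simp: take_map drop_map dest!: in_set_takeD in_set_dropD)
          show "length (take j (map (mol h') \<pi>s)) + length (drop (Suc j) (map (mol h) \<pi>s)) = k" using j p(2) by simp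
        qed
      qed
      also have "\<dots> = K * B ^ Suc (Suc k) * (h + h')" by (simp add: K_def \<eta>_def algebra_simps)
      finally show ?thesis .
    qed
    have lim: "(\<lambda>m. Us T (f' m) (map (mol a) \<pi>s)) \<longlonglongrightarrow> Us T f (map (mol a) \<pi>s)" if a: "0 < a" for a
    proof -
      have sp: "smooths (map (mol a) \<pi>s)" and lp: "length (map (mol a) \<pi>s) = Suc k" using mp[OF a] p by auto
      have z2: "f x = 0" if "2 * R \<le> norm x" for x using z[of x] that R by simp
      let ?P = "lprod (2*R) (map (mol a) \<pi>s)"
      have P0: "0 \<le> ?P" using sp smooth_qlip by (intro prod_list_lipc_nonneg) blast
      let ?L = "lipc (ball 0 (2*R)) f"
      have L0: "0 \<le> ?L" by (rule lipc_nonneg[OF f(1)])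
      have le: "norm (Us T (f' m) (map (mol a) \<pi>s) - Us T f (map (mol a) \<pi>s)) \<le> ?P * (2 * ?L * (2 * R) * inverse (real (m + 2)) * measure \<mu> UNIV)" for m
      proof -
        have q: "is_qlip (\<lambda>x. f' m x - f x)" using smooth_qlip[OF f's] f(1) by auto
        have d: "cmod (f' m x - f x) \<le> 2 * ?L * (2 * R) * inverse (real (m + 2))" for x
        proof (cases "norm x < 2 * R")
          case True
          then show ?thesis unfolding f'_def by (intro mol_close[OF f(1) is_qlip_lipc[OF f(1)]]) auto
        next
          case False
          then show ?thesis using f'z[of x m] z2[of x] L0 R by simp
        qed
        have "Us T (f' m) (map (mol a) \<pi>s) - Us T f (map (mol a) \<pi>s) = Us T (\<lambda>x. f' m x - f x) (map (mol a) \<pi>s)"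
          using Us_coeff[OF smooth_qlip[OF f's] f(1) sp lp R2 f'z z2, where a = 1 and b = "-1"] by simp
        also have "norm \<dots> \<le> ?P * (\<integral>x. cmod (f' m x - f x) \<partial>\<mu>)"
          by (rule m(2)[OF q _ sp lp]) (use f'z z2 in auto)
        also have "\<dots> \<le> ?P * (2 * ?L * (2 * R) * inverse (real (m + 2)) * measure \<mu> UNIV)"
          by (rule mult_left_mono[OF integral_cmod_le[OF m(1) q d] P0])
        finally show ?thesis .
      qed
      have "(\<lambda>m. inverse (real (m + 2))) \<longlonglongrightarrow> 0"
        using LIMSEQ_ignore_initial_segment[OF LIMSEQ_inverse_real_of_nat, of 1] by simp
      then have "(\<lambda>m. ?P * (2 * ?L * (2 * R) * inverse (real (m + 2)) * measure \<mu> UNIV)) \<longlonglongrightarrow> ?P * (2 * ?L * (2 * R) * 0 * measure \<mu> UNIV)"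
        by (intro tendsto_intros)
      then have "(\<lambda>m. ?P * (2 * ?L * (2 * R) * inverse (real (m + 2)) * measure \<mu> UNIV)) \<longlonglongrightarrow> 0" by simp
      then have "(\<lambda>m. Us T (f' m) (map (mol a) \<pi>s) - Us T f (map (mol a) \<pi>s)) \<longlonglongrightarrow> 0"
        by (rule Lim_null_comparison[OF always_eventually[OF allI[OF le]]])
      then show ?thesis by (rule LIM_zero_cancel)
    qed
    show ?thesis
      by (rule LIMSEQ_le_const2[OF tendsto_norm[OF tendsto_diff[OF lim[OF h(1)] lim[OF h(2)]]]]) (use step in auto)
  qed
  have K0: "0 \<le> K" unfolding K_def using C(1) R by simp
  show ?thesis unfolding mol_const_def
    by (rule exI[of _ K], intro conjI K0 allI impI, elim conjE, rule res) auto
qed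

end

section \<open>The cone as a quasi-local current\<close>

definition rr :: "real \<Rightarrow> 'a::real_normed_vector \<Rightarrow> 'a" where
  "rr R x = (if norm x \<le> R then x else (R / norm x) *\<^sub>R x)"

lemma norm_rr: "0 \<le> R \<Longrightarrow> norm (rr R x) \<le> R"
  by (auto simp: rr_def)

lemma rr_id: "norm x \<le> R \<Longrightarrow> rr R x = x"
  by (simp add: rr_def)

text \<open>With the longer vector \<open>x\<close> outside the ball and
  \<open>m = max R (norm y)\<close>, the difference splits into a scaled copy of
  \<open>x - y\<close> and a multiple of \<open>y\<close>, each of norm at most
  \<open>norm (x - y)\<close>. This constant is the source of the factors 2 in the extension of
  \<open>T\<close>.\<close>

lemma rr_lipschitz:
  assumes R: "0 < R" shows "2-lipschitz_on UNIV (rr R)"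
proof -
  have le: "norm (rr R x - rr R y) \<le> 2 * norm (x - y)" if xy: "norm y \<le> norm x" for x y :: 'a
  proof (cases "norm x \<le> R")
    case True
    then show ?thesis using xy by (simp add: rr_def)
  next
    case False
    then have nx: "norm x > 0" "R < norm x" using R by auto
    define m where "m = max R (norm y)"
    have m: "m > 0" "m \<le> norm x" "R \<le> m" unfolding m_def using R xy nx by auto
    have ry: "rr R y = (R / m) *\<^sub>R y" using R unfolding m_def rr_def by (cases "norm y \<le> R") (auto simp: max_def)
    have rx: "rr R x = (R / norm x) *\<^sub>R x" using False by (simp add: rr_def)
    have "(R / norm x) *\<^sub>R x - (R / m) *\<^sub>R y = (R / norm x) *\<^sub>R (x - y) + (R / norm x - R / m) *\<^sub>R y"
      by (simp add: algebra_simps)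
    then have "norm (rr R x - rr R y) \<le> norm ((R / norm x) *\<^sub>R (x - y)) + norm ((R / norm x - R / m) *\<^sub>R y)"
      unfolding rx ry using norm_triangle_ineq by metis
    also have "norm ((R / norm x) *\<^sub>R (x - y)) \<le> norm (x - y)"
    proof -
      have "norm ((R / norm x) *\<^sub>R (x - y)) = (R / norm x) * norm (x - y)" using nx R by simp
      also have "\<dots> \<le> 1 * norm (x - y)" using nx by (intro mult_right_mono) auto
      finally show ?thesis by simp
    qed
    also have "norm ((R / norm x - R / m) *\<^sub>R y) \<le> norm (x - y)"
    proof -
      have ge: "R / norm x \<le> R / m" using m R nx by (intro divide_left_mono) auto
      have "norm ((R / norm x - R / m) *\<^sub>R y) = (R / m - R / norm x) * norm y" using ge by simp
      also have "\<dots> \<le> (R / m - R / norm x) * m" using ge unfolding m_def by (intro mult_left_mono) auto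
      also have "\<dots> = R / norm x * (norm x - m)" using m nx by (simp add: field_simps)
      also have "\<dots> \<le> 1 * (norm x - m)" using nx m R by (intro mult_right_mono) auto
      also have "\<dots> \<le> norm x - norm y" unfolding m_def by simp
      also have "\<dots> \<le> norm (x - y)" by (rule norm_triangle_ineq2)
      finally show ?thesis .
    qed
    finally show ?thesis by simp
  qed
  show ?thesis
  proof (rule lipschitz_onI)
    fix x y :: 'a
    show "dist (rr R x) (rr R y) \<le> 2 * dist x y"
      using le[of y x] le[of x y] by (cases "norm y \<le> norm x") (auto simp: dist_norm norm_minus_commute)
  qed simp
qed

text \<open>Soft thresholding. A Lipschitz function vanishing off an open set is changed by at most
  \<open>e\<close> and becomes 0 wherever its modulus is at most \<open>e\<close>, hence near the
  complement of that set.\<close>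

definition soft :: "real \<Rightarrow> complex \<Rightarrow> complex" where
  "soft e w = w - rr e w"

lemma soft_lipschitz: "0 < e \<Longrightarrow> 3-lipschitz_on UNIV (soft e)"
  using lipschitz_on_diff[OF lipschitz_on_id[of UNIV] rr_lipschitz[of e]] unfolding soft_def[abs_def] by simp

lemma soft_zero: "cmod w \<le> e \<Longrightarrow> soft e w = 0"
  by (simp add: soft_def rr_id)

lemma soft_close: "0 \<le> e \<Longrightarrow> cmod (w - soft e w) \<le> e"
  using norm_rr[of e w] by (simp add: soft_def)

lemma filter_map_length:
  assumes "\<And>x. x \<in> set xs \<Longrightarrow> P x \<Longrightarrow> Q (F x)"
  shows "length (filter P xs) \<le> length (filter Q (map F xs))"
  using assms by (induction xs) auto

text \<open>Locality and both bidimension conditions in one scheme: \<open>P V\<close> stands for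
  constant, holomorphic or antiholomorphic on \<open>V\<close>. Counting through
  \<open>filter\<close> keeps track of the number of such slots when one is deleted.\<close>

definition van_prop :: "('a::complex_normed_vector set \<Rightarrow> ('a \<Rightarrow> complex) \<Rightarrow> bool) \<Rightarrow> nat \<Rightarrow> nat \<Rightarrow>
    ('a functional) \<Rightarrow> bool" where
  "van_prop P n k T \<longleftrightarrow> (\<forall>V g \<rho>. open V \<and> is_qlip g \<and> (\<forall>x. x \<notin> V \<longrightarrow> g x = 0) \<and> (qlips \<rho>) \<and> length \<rho> = k
     \<and> n \<le> length (filter (P V) \<rho>) \<longrightarrow> T g \<rho> = 0)"

lemma van_propD:
  "\<lbrakk>van_prop P n k T; open V; is_qlip g; \<And>x. x \<notin> V \<Longrightarrow> g x = 0; qlips \<rho>; length \<rho> = k; n \<le> length (filter (P V) \<rho>)\<rbrakk>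
    \<Longrightarrow> T g \<rho> = 0"
  unfolding van_prop_def by (erule allE[where x = V], erule allE[where x = g], erule allE[where x = \<rho>]) simp

lemma list_all2_rem: "list_all2 P xs ys \<Longrightarrow> list_all2 P (rem j xs) (rem j ys)"
  unfolding rem_def by (intro list_all2_appendI list_all2_takeI list_all2_dropI)

text \<open>The shift by 2 makes all steps at most 1/2, as \<open>mol_support\<close>
  requires.\<close>

definition hn :: "nat \<Rightarrow> real" where "hn n = inverse (real (n + 2))"

lemma hn: "0 < hn n" "hn n \<le> 1/2" by (auto simp: hn_def field_simps)

lemma hn_lim: "hn \<longlonglongrightarrow> 0"
  unfolding hn_def using LIMSEQ_ignore_initial_segment[OF LIMSEQ_inverse_real_of_nat, of 1] by simp

text \<open>The cone on Lipschitz slots. Only the slots are mollified, since the coefficient enters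
  \<open>Us\<close> undifferentiated; on the intended domain the limit exists by
  \<open>Us_rate\<close>.\<close>

definition Uc :: "('a::complex_normed_vector functional) \<Rightarrow>
    ('a \<Rightarrow> complex) \<Rightarrow> ('a \<Rightarrow> complex) list \<Rightarrow> complex" where
  "Uc T f \<pi>s = lim (\<lambda>n. Us T f (map (mol (hn n)) \<pi>s))"

lemma common_bound:
  assumes f: "is_qlip f" and z: "\<forall>x. R \<le> norm x \<longrightarrow> f x = 0" and p: "qlips \<pi>s"
  shows "\<exists>B\<ge>0. (\<forall>x. cmod (f x) \<le> B) \<and> lipc (ball 0 r) f \<le> B \<and> (\<forall>\<pi>\<in>set \<pi>s. is_qlip \<pi> \<and> lipc (ball 0 r) \<pi> \<le> B)"
proof -
  obtain b where b: "b > 0" "\<And>x. x \<in> ball 0 R \<Longrightarrow> cmod (f x) \<le> b" using is_qlip_bounded[OF f] by metis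
  have b': "cmod (f x) \<le> b" for x
  proof (cases "norm x < R")
    case False
    then show ?thesis using z b(1) by simp
  qed (use b in auto)
  define S where "S = sum_list (map (lipc (ball 0 r)) \<pi>s)"
  have S: "0 \<le> S \<and> (\<forall>\<pi>\<in>set \<pi>s. lipc (ball 0 r) \<pi> \<le> S)"
    unfolding S_def using p
  proof (induction \<pi>s)
    case (Cons \<pi> \<pi>s)
    have "0 \<le> lipc (ball 0 r) \<pi>" using Cons.prems lipc_nonneg by auto
    then show ?case using Cons by fastforce
  qed simp
  have L: "0 \<le> lipc (ball 0 r) f" by (rule lipc_nonneg[OF f])
  show ?thesis
  proof (rule exI[of _ "b + lipc (ball 0 r) f + S"], intro conjI allI ballI)
    show "0 \<le> b + lipc (ball 0 r) f + S" using b(1) S L by linarith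
    show "cmod (f x) \<le> b + lipc (ball 0 r) f + S" for x using b'[of x] S L by linarith
    show "lipc (ball 0 r) f \<le> b + lipc (ball 0 r) f + S" using b(1) S by linarith
    fix \<pi> assume \<pi>: "\<pi> \<in> set \<pi>s"
    then show "is_qlip \<pi>" using p by blast
    have "lipc (ball 0 r) \<pi> \<le> S" using S \<pi> by blast
    then show "lipc (ball 0 r) \<pi> \<le> b + lipc (ball 0 r) f + S" using b(1) L by linarith
  qed
qed

context normal_shell
begin

text \<open>\<open>mol_const\<close> makes the values a Cauchy sequence. For fixed \<open>R\<close>
  the rate depends on the data through \<open>B\<close> only, which permits exchanging this limit
  with a limit of the data.\<close>

lemma Us_rate:
  assumes C: "mol_const R C" and B: "0 \<le> B" and f: "is_qlip f" "\<And>x. cmod (f x) \<le> B" "lipc (ball 0 (2*R+1)) f \<le> B"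
    and z: "\<And>x. R \<le> norm x \<Longrightarrow> f x = 0"
    and p: "\<forall>\<pi>\<in>set \<pi>s. is_qlip \<pi> \<and> lipc (ball 0 (2*R+1)) \<pi> \<le> B" "length \<pi>s = Suc k"
  shows "(\<lambda>n. Us T f (map (mol (hn n)) \<pi>s)) \<longlonglongrightarrow> Uc T f \<pi>s"
    and "\<And>n. cmod (Us T f (map (mol (hn n)) \<pi>s) - Uc T f \<pi>s) \<le> C * B ^ Suc (Suc k) * hn n"
proof -
  define K where "K = C * B ^ Suc (Suc k)"
  have K: "0 \<le> K" unfolding K_def using mol_constD(1)[OF C] B by simp
  define X where "X n = Us T f (map (mol (hn n)) \<pi>s)" for n
  have d: "cmod (X n - X m) \<le> K * (hn n + hn m)" for n m
    unfolding X_def K_def by (rule mol_constD(2)[OF C B f z p hn(1) hn(1)])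
  have "Cauchy X"
  proof (rule CauchyI')
    fix e :: real assume e: "e > 0"
    have "(\<lambda>n. K * (2 * hn n)) \<longlonglongrightarrow> K * (2 * 0)" by (intro tendsto_intros hn_lim)
    then have "(\<lambda>n. K * (2 * hn n)) \<longlonglongrightarrow> 0" by simp
    from order_tendstoD(2)[OF this e] obtain N where N: "\<And>n. n \<ge> N \<Longrightarrow> K * (2 * hn n) < e"
      by (auto simp: eventually_sequentially)
    show "\<exists>M. \<forall>m\<ge>M. \<forall>n>m. dist (X m) (X n) < e"
    proof (intro exI[of _ N] allI impI)
      fix m n assume mn: "N \<le> m" "m < n"
      have "hn n \<le> hn m" unfolding hn_def using mn by (intro le_imp_inverse_le) auto
      then have "K * (hn m + hn n) \<le> K * (2 * hn m)" using K by (intro mult_left_mono) auto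
      then show "dist (X m) (X n) < e" using d[of m n] N[OF mn(1)] unfolding dist_norm by linarith
    qed
  qed
  then have "convergent X" by (rule Cauchy_convergent)
  then have lim: "X \<longlonglongrightarrow> Uc T f \<pi>s" unfolding Uc_def X_def[symmetric] by (rule convergent_LIMSEQ_iff[THEN iffD1])
  then show "(\<lambda>n. Us T f (map (mol (hn n)) \<pi>s)) \<longlonglongrightarrow> Uc T f \<pi>s" unfolding X_def .
  fix n
  have "(\<lambda>m. cmod (X n - X m)) \<longlonglongrightarrow> cmod (X n - Uc T f \<pi>s)" by (intro tendsto_intros lim)
  moreover have "(\<lambda>m. K * (hn n + hn m)) \<longlonglongrightarrow> K * (hn n + 0)" by (intro tendsto_intros hn_lim)
  ultimately have "cmod (X n - Uc T f \<pi>s) \<le> K * (hn n + 0)"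
    by (rule LIMSEQ_le) (use d in auto)
  then show "cmod (Us T f (map (mol (hn n)) \<pi>s) - Uc T f \<pi>s) \<le> C * B ^ Suc (Suc k) * hn n"
    by (simp add: X_def K_def)
qed

lemma Uc_tendsto:
  assumes R: "R > 0" and f: "is_qlip f" and z: "\<And>x. R \<le> norm x \<Longrightarrow> f x = 0"
    and p: "qlips \<pi>s" "length \<pi>s = Suc k"
  shows "(\<lambda>n. Us T f (map (mol (hn n)) \<pi>s)) \<longlonglongrightarrow> Uc T f \<pi>s"
proof -
  obtain C where C: "mol_const R C" using Us_mol_diff[OF R] by (rule exE)
  have z': "\<forall>x. R \<le> norm x \<longrightarrow> f x = 0" using z by blast
  from common_bound[where r = "2*R+1", OF f z' p(1)] obtain B where B: "B \<ge> 0" "\<forall>x. cmod (f x) \<le> B" "lipc (ball 0 (2*R+1)) f \<le> B"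
    "\<forall>\<pi>\<in>set \<pi>s. is_qlip \<pi> \<and> lipc (ball 0 (2*R+1)) \<pi> \<le> B" by (elim exE conjE) (rule that)
  show ?thesis by (rule Us_rate(1)[OF C B(1) f _ B(3) z B(4) p(2)]) (use B(2) in auto)
qed

lemma smooth_map_mol: "qlips \<pi>s \<Longrightarrow> h > 0 \<Longrightarrow> smooths (map (mol h) \<pi>s)"
  using smooth_mol(1) by auto

lemma Uc_coeff:
  assumes R: "R > 0" and f: "is_qlip f" "\<And>x. R \<le> norm x \<Longrightarrow> f x = 0" and g: "is_qlip g" "\<And>x. R \<le> norm x \<Longrightarrow> g x = 0"
    and p: "qlips \<pi>s" "length \<pi>s = Suc k"
  shows "Uc T (\<lambda>x. a * f x + b * g x) \<pi>s = a * Uc T f \<pi>s + b * Uc T g \<pi>s"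
proof (rule LIMSEQ_unique)
  show "(\<lambda>n. Us T (\<lambda>x. a * f x + b * g x) (map (mol (hn n)) \<pi>s)) \<longlonglongrightarrow> Uc T (\<lambda>x. a * f x + b * g x) \<pi>s"
    by (rule Uc_tendsto[OF R is_qlip_lincomb[OF f(1) g(1)] _ p]) (use f g in auto)
  have "Us T (\<lambda>x. a * f x + b * g x) (map (mol (hn n)) \<pi>s) = a * Us T f (map (mol (hn n)) \<pi>s) + b * Us T g (map (mol (hn n)) \<pi>s)" for n
    by (rule Us_coeff[OF f(1) g(1) smooth_map_mol[OF p(1) hn(1)] _ R]) (use p f g in auto)
  then show "(\<lambda>n. Us T (\<lambda>x. a * f x + b * g x) (map (mol (hn n)) \<pi>s)) \<longlonglongrightarrow> a * Uc T f \<pi>s + b * Uc T g \<pi>s"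
    by (simp only:) (intro tendsto_add tendsto_mult tendsto_const Uc_tendsto[OF R f p] Uc_tendsto[OF R g p])
qed

lemma Uc_slot:
  assumes R: "R > 0" and f: "is_qlip f" "\<And>x. R \<le> norm x \<Longrightarrow> f x = 0"
    and p: "qlips us" "is_qlip u" "is_qlip v" "qlips vs" "length us + length vs = k"
  shows "Uc T f (us @ (\<lambda>x. a * u x + b * v x) # vs) = a * Uc T f (us @ u # vs) + b * Uc T f (us @ v # vs)"
proof (rule LIMSEQ_unique)
  have t: "(\<lambda>n. Us T f (map (mol (hn n)) (us @ w # vs))) \<longlonglongrightarrow> Uc T f (us @ w # vs)" if "is_qlip w" for w
    by (rule Uc_tendsto[OF R f]) (use p that in auto)
  show "(\<lambda>n. Us T f (map (mol (hn n)) (us @ (\<lambda>x. a * u x + b * v x) # vs))) \<longlonglongrightarrow> Uc T f (us @ (\<lambda>x. a * u x + b * v x) # vs)"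
    by (rule t[OF is_qlip_lincomb[OF p(2,3)]])
  have "Us T f (map (mol (hn n)) (us @ (\<lambda>x. a * u x + b * v x) # vs))
     = a * Us T f (map (mol (hn n)) (us @ u # vs)) + b * Us T f (map (mol (hn n)) (us @ v # vs))" for n
    using Us_slot[OF f(1) smooth_map_mol[OF p(1) hn(1)] smooth_mol(1)[OF p(2) hn(1)] smooth_mol(1)[OF p(3) hn(1)] smooth_map_mol[OF p(4) hn(1)] _ R f(2),
        where c = a and d = b] p(5)
    by (simp add: mol_lincomb[OF p(2,3)])
  then show "(\<lambda>n. Us T f (map (mol (hn n)) (us @ (\<lambda>x. a * u x + b * v x) # vs))) \<longlonglongrightarrow> a * Uc T f (us @ u # vs) + b * Uc T f (us @ v # vs)"
    by (simp only:) (intro tendsto_add tendsto_mult tendsto_const t p)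
qed

lemma Uc_mass:
  assumes R: "R > 0"
  shows "\<exists>\<mu>. finite_radon \<mu> \<and> (\<forall>f \<pi>s. is_qlip f \<and> (\<forall>x. R \<le> norm x \<longrightarrow> f x = 0) \<and> (qlips \<pi>s) \<and> length \<pi>s = Suc k
    \<longrightarrow> cmod (Uc T f \<pi>s) \<le> lprod R \<pi>s * L1norm \<mu> f)"
proof -
  obtain \<mu> where "mass_on (Us T) (Suc k) R \<mu>" using Us_mass[OF R] by (rule exE)
  note m = mass_onD[OF this]
  have res: "cmod (Uc T f \<pi>s) \<le> lprod R \<pi>s * L1norm \<mu> f"
    if f: "is_qlip f" "\<And>x. R \<le> norm x \<Longrightarrow> f x = 0" and p: "qlips \<pi>s" "length \<pi>s = Suc k" for f \<pi>s
  proof -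
    have "cmod (Us T f (map (mol (hn n)) \<pi>s)) \<le> lprod R \<pi>s * L1norm \<mu> f" for n
    proof -
      have "cmod (Us T f (map (mol (hn n)) \<pi>s)) \<le> lprod R (map (mol (hn n)) \<pi>s) * L1norm \<mu> f"
        by (rule m(2)[OF f smooth_map_mol[OF p(1) hn(1)]]) (use p in auto)
      also have "\<dots> \<le> lprod R \<pi>s * L1norm \<mu> f"
      proof (rule mult_right_mono)
        have "prod_list (map (\<lambda>\<pi>. lipc (ball 0 R) (mol (hn n) \<pi>)) \<pi>s) \<le> lprod R \<pi>s"
          by (rule prod_list_mono[THEN conjunct2]) (use p R hn(1)[of n] in \<open>auto intro!: lipc_nonneg lipc_mol\<close>)
        then show "lprod R (map (mol (hn n)) \<pi>s) \<le> lprod R \<pi>s"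
          by (simp add: o_def)
      qed simp
      finally show ?thesis .
    qed
    then show ?thesis by (intro LIMSEQ_le_const2[OF tendsto_norm[OF Uc_tendsto[OF R f p]]]) auto
  qed
  show ?thesis by (rule exI[of _ \<mu>], intro conjI m(1) allI impI, elim conjE, rule res) auto
qed

text \<open>Dominated convergence on the cylinder, with the kernel cut off at \<open>sR R\<close> as
  majorant. The step \<open>h\<close> is fixed because \<open>qconv_dba_mol\<close> gives
  convergence of the derivatives for a fixed step.\<close>

lemma Us_cont:
  assumes R: "R > 0" and F: "qconv F f" and z: "\<And>n x. R \<le> norm x \<Longrightarrow> F n x = 0" "\<And>x. R \<le> norm x \<Longrightarrow> f x = 0"
    and P: "list_all2 qconv Ps \<pi>s" and l: "length \<pi>s = Suc k" and h: "h > 0"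
    and B: "0 \<le> B" "\<And>n x. cmod (F n x) \<le> B" "\<And>n p. p \<in> set Ps \<Longrightarrow> lipc (ball 0 R) (p n) \<le> B"
  shows "(\<lambda>n. Us T (F n) (map (mol h) (map (\<lambda>p. p n) Ps))) \<longlonglongrightarrow> Us T f (map (mol h) \<pi>s)"
proof -
  have lP: "length Ps = Suc k" using list_all2_lengthD[OF P] l by simp
  have qP: "is_qlip (p n)" if "p \<in> set Ps" for p n
  proof -
    obtain j where "j < length Ps" "p = Ps ! j" using \<open>p \<in> set Ps\<close> by (auto simp: in_set_conv_nth)
    then show ?thesis using list_all2_nthD[OF P] qconv_qlip by blast
  qed
  have qF: "is_qlip (F n)" for n by (rule qconv_qlip[OF F])
  have qf: "is_qlip f" by (rule qconv_qlip_lim[OF F])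
  have qp: "qlips \<pi>s"
  proof
    fix \<pi> assume "\<pi> \<in> set \<pi>s"
    then obtain j where "j < length \<pi>s" "\<pi> = \<pi>s ! j" by (auto simp: in_set_conv_nth)
    then show "is_qlip \<pi>" using list_all2_nthD2[OF P] qconv_qlip_lim by blast
  qed
  define Q where "Q n = map (mol h) (map (\<lambda>p. p n) Ps)" for n
  have sQ: "smooths (Q n)" for n unfolding Q_def by (rule smooth_map_mol) (use qP h in auto)
  have lQ: "length (Q n) = Suc k" for n unfolding Q_def using lP by simp
  have sp: "smooths (map (mol h) \<pi>s)" by (rule smooth_map_mol[OF qp h])
  define Qs where "Qs = map (\<lambda>p n. mol h (p n)) Ps"
  have Qs: "list_all2 qconv Qs (map (mol h) \<pi>s)"
    unfolding Qs_def list_all2_map1 list_all2_map2 by (rule list_all2_mono[OF P]) (rule qconv_mol)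
  have Qn: "Q n = map (\<lambda>p. p n) Qs" for n unfolding Q_def Qs_def by simp
  have pw: "(\<lambda>n. Om T (dil \<zeta> (F n)) (map (dil \<zeta>) (Q n))) \<longlonglongrightarrow> Om T (dil \<zeta> f) (map (dil \<zeta>) (map (mol h) \<pi>s))" for \<zeta>
    unfolding Om_dil[OF sQ] Om_dil[OF sp] lQ length_map l
  proof (intro tendsto_sum tendsto_mult tendsto_const)
    fix j assume "j \<in> {..<Suc k}"
    then have j: "j < length Ps" "j < length \<pi>s" using lP l by auto
    have "qconv (\<lambda>n. (Ps ! j) n) (\<pi>s ! j)" using list_all2_nthD[OF P j(1)] by simp
    from qconv_dba_mol[OF this h]
    have c: "qconv (\<lambda>n x. F n x * dba (Q n ! j) x) (\<lambda>x. f x * dba (map (mol h) \<pi>s ! j) x)"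
      using j by (intro qconv_mult F) (simp add: Q_def)
    have "list_all2 qconv (map (\<lambda>p n. dil \<zeta> (p n)) (rem j Qs)) (map (dil \<zeta>) (rem j (map (mol h) \<pi>s)))"
      unfolding list_all2_map1 list_all2_map2 by (rule list_all2_mono[OF list_all2_rem[OF Qs]]) (rule qconv_dil)
    from cont_lists[OF qconv_dil[OF c] this] j l
    show "(\<lambda>n. T (dil \<zeta> (\<lambda>x. F n x * dba (Q n ! j) x)) (map (dil \<zeta>) (rem j (Q n))))
       \<longlonglongrightarrow> T (dil \<zeta> (\<lambda>x. f x * dba (map (mol h) \<pi>s ! j) x)) (map (dil \<zeta>) (rem j (map (mol h) \<pi>s)))"
      by (simp add: o_def Qn map_rem length_rem)
  qed
  define A where "A = 2 * M * real (Suc k) * (exp (sR R) ^ Suc k * B ^ Suc k) * (B * measure \<nu> UNIV)"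
  have A0: "0 \<le> A" unfolding A_def using B(1) delta_pos delta_le by simp
  have dom: "norm (cker p * Om T (dil (cp p) (F n)) (map (dil (cp p)) (Q n))) \<le> A * norm (indicator {p. fst p \<le> sR R} p *\<^sub>R cker p)" for n p
  proof (cases "fst p \<le> sR R")
    case True
    have pr: "lprod R (Q n) \<le> B ^ Suc k"
    proof -
      have "\<forall>\<pi>\<in>set (Q n). is_qlip \<pi> \<and> lipc (ball 0 R) \<pi> \<le> B"
      proof
        fix \<pi> assume "\<pi> \<in> set (Q n)"
        then obtain p where "p \<in> set Ps" "\<pi> = mol h (p n)" unfolding Q_def by auto
        then show "is_qlip \<pi> \<and> lipc (ball 0 R) \<pi> \<le> B"
          using lipc_mol[OF qP less_imp_le[OF h] R, of p n] B(3)[of p n] qP[of p n] by auto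
      qed
      from prod_list_lipc_le[OF this] show ?thesis by (simp add: lQ)
    qed
    have pr0: "0 \<le> lprod R (Q n)" using sQ smooth_qlip by (intro prod_list_lipc_nonneg) blast
    have I: "(\<integral>x. cmod (dil (cp p) (F n) x) \<partial>\<nu>) \<le> B * measure \<nu> UNIV"
      by (rule integral_cmod_le[OF radon is_qlip_dil[OF qF]]) (simp add: dil_def B)
    have "cmod (Om T (dil (cp p) (F n)) (map (dil (cp p)) (Q n)))
      \<le> 2 * M * real (Suc k) * (exp (Re (cp p)) ^ Suc k * lprod R (Q n)) * (\<integral>x. cmod (dil (cp p) (F n) x) \<partial>\<nu>)"
      by (rule Om_dil_bound[OF R qF sQ lQ z(1)])
    also have "\<dots> \<le> A"
      unfolding A_def using True pr pr0 I delta_pos delta_le B(1) by (intro mult_mono power_mono) auto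
    finally have "cmod (cker p) * cmod (Om T (dil (cp p) (F n)) (map (dil (cp p)) (Q n))) \<le> cmod (cker p) * A"
      by (intro mult_left_mono) auto
    then show ?thesis using True by (simp add: norm_mult mult.commute)
  next
    case False
    then have "Om T (dil (cp p) (F n)) (map (dil (cp p)) (Q n)) = 0"
      by (intro Om_dil_zero[OF qF sQ lQ z(1)]) (use sR[OF R, of "fst p"] in auto)
    then show ?thesis using A0 by simp
  qed
  have mn: "(\<lambda>p. cker p * Om T (dil (cp p) (F n)) (map (dil (cp p)) (Q n))) \<in> borel_measurable lborel" for n
    by (rule borel_measurable_integrable[OF Us_integrable[OF qF sQ lQ R z(1)]])
  have m0: "(\<lambda>p. cker p * Om T (dil (cp p) f) (map (dil (cp p)) (map (mol h) \<pi>s))) \<in> borel_measurable lborel"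
    by (rule borel_measurable_integrable[OF Us_integrable[OF qf sp _ R z(2)]]) (simp add: l)
  have "(\<lambda>n. \<integral>p. cker p * Om T (dil (cp p) (F n)) (map (dil (cp p)) (Q n)) \<partial>lborel)
      \<longlonglongrightarrow> (\<integral>p. cker p * Om T (dil (cp p) f) (map (dil (cp p)) (map (mol h) \<pi>s)) \<partial>lborel)"
    by (rule integral_dominated_convergence[OF m0 mn integrable_mult_right[OF integrable_norm[OF cker_integrable[of "sR R"]], of A]])
       (rule AE_I2, rule tendsto_mult[OF tendsto_const pw], rule AE_I2, rule dom)
  then show ?thesis unfolding Us_def Q_def[symmetric] by (intro tendsto_mult tendsto_const)
qed

text \<open>A three-term estimate: both cones are within \<open>K * hn m\<close> of their mollified
  values, uniformly in \<open>n\<close>, and for that fixed \<open>m\<close> the mollified values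
  converge by \<open>Us_cont\<close>.\<close>

lemma Uc_cont:
  assumes R: "R > 0" and F: "qconv F f" and z: "\<And>n x. R \<le> norm x \<Longrightarrow> F n x = 0" "\<And>x. R \<le> norm x \<Longrightarrow> f x = 0"
    and P: "list_all2 qconv Ps \<pi>s" and l: "length \<pi>s = Suc k"
    and B: "0 \<le> B" "\<And>n x. cmod (F n x) \<le> B" "\<And>n. lipc (ball 0 (2*R+1)) (F n) \<le> B"
      "\<And>n p. p \<in> set Ps \<Longrightarrow> is_qlip (p n) \<and> lipc (ball 0 (2*R+1)) (p n) \<le> B"
      "\<And>x. cmod (f x) \<le> B" "lipc (ball 0 (2*R+1)) f \<le> B" "\<forall>\<pi>\<in>set \<pi>s. is_qlip \<pi> \<and> lipc (ball 0 (2*R+1)) \<pi> \<le> B"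
  shows "(\<lambda>n. Uc T (F n) (map (\<lambda>p. p n) Ps)) \<longlonglongrightarrow> Uc T f \<pi>s"
proof (rule LIMSEQ_I)
  fix e :: real assume e: "e > 0"
  obtain C where C: "mol_const R C" using Us_mol_diff[OF R] by (rule exE)
  define K where "K = C * B ^ Suc (Suc k)"
  have lP: "length Ps = Suc k" using list_all2_lengthD[OF P] l by simp
  have "(\<lambda>m. K * hn m) \<longlonglongrightarrow> K * 0" by (intro tendsto_intros hn_lim)
  then have "(\<lambda>m. K * hn m) \<longlonglongrightarrow> 0" by simp
  from order_tendstoD(2)[OF this, of "e/3"] e obtain m where m: "K * hn m < e / 3"
    by (auto simp: eventually_sequentially)
  have Bs: "lipc (ball 0 R) (p n) \<le> B" if "p \<in> set Ps" for n p
    using lipc_mono[of "p n" R "2*R+1"] B(4)[OF that, of n] R by auto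
  have "(\<lambda>n. Us T (F n) (map (mol (hn m)) (map (\<lambda>p. p n) Ps))) \<longlonglongrightarrow> Us T f (map (mol (hn m)) \<pi>s)"
    by (rule Us_cont[where R = R and B = B, OF R F _ _ P l hn(1) B(1)]) (fact z B(2) Bs)+
  from LIMSEQ_D[OF this, of "e/3"] e obtain N where N: "\<forall>n\<ge>N. norm (Us T (F n) (map (mol (hn m)) (map (\<lambda>p. p n) Ps)) - Us T f (map (mol (hn m)) \<pi>s)) < e / 3"
    by (auto simp del: map_map)
  show "\<exists>N. \<forall>n\<ge>N. norm (Uc T (F n) (map (\<lambda>p. p n) Ps) - Uc T f \<pi>s) < e"
  proof (intro exI[of _ N] allI impI)
    fix n assume n: "N \<le> n"
    let ?a = "Us T (F n) (map (mol (hn m)) (map (\<lambda>p. p n) Ps))" and ?b = "Us T f (map (mol (hn m)) \<pi>s)"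
    have 1: "cmod (?a - Uc T (F n) (map (\<lambda>p. p n) Ps)) \<le> K * hn m"
      unfolding K_def by (rule Us_rate(2)[OF C B(1) qconv_qlip[OF F] B(2,3) z(1)]) (use B(4) lP in auto)
    have 2: "cmod (?b - Uc T f \<pi>s) \<le> K * hn m"
      unfolding K_def by (rule Us_rate(2)[OF C B(1) qconv_qlip_lim[OF F] B(5,6) z(2) B(7) l])
    have "Uc T (F n) (map (\<lambda>p. p n) Ps) - Uc T f \<pi>s = - (?a - Uc T (F n) (map (\<lambda>p. p n) Ps)) + (?a - ?b) + (?b - Uc T f \<pi>s)" by simp
    then have "norm (Uc T (F n) (map (\<lambda>p. p n) Ps) - Uc T f \<pi>s)
       \<le> norm (- (?a - Uc T (F n) (map (\<lambda>p. p n) Ps))) + norm (?a - ?b) + norm (?b - Uc T f \<pi>s)"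
      by (simp only:) (intro order_trans[OF norm_triangle_ineq] add_mono norm_triangle_ineq order_refl)
    then show "norm (Uc T (F n) (map (\<lambda>p. p n) Ps) - Uc T f \<pi>s) < e"
      using 1 2 m N[rule_format, OF n] by (simp only: norm_minus_cancel)
  qed
qed

end

subsection \<open>Locality and bidimension\<close>

lemma qtest_bounded_support:
  assumes "is_qtest f"
  shows "is_qlip f" "\<exists>R>0. \<forall>x. R \<le> norm x \<longrightarrow> f x = 0"
proof -
  show "is_qlip f" using assms is_lip_qlip unfolding is_qtest_def by blast
  obtain b where b: "b > 0" "\<And>x. x \<in> fsupp f \<Longrightarrow> norm x \<le> b" using assms unfolding is_qtest_def bounded_pos by blast
  have "f x = 0" if "b + 1 \<le> norm x" for x
  proof (rule ccontr)
    assume "f x \<noteq> 0"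
    then have "x \<in> fsupp f" unfolding fsupp_def using closure_subset by fastforce
    then show False using b(2)[of x] that by simp
  qed
  then show "\<exists>R>0. \<forall>x. R \<le> norm x \<longrightarrow> f x = 0" using b(1) by (intro exI[of _ "b + 1"]) auto
qed

lemma fsupp_subset_off: "fsupp f \<subseteq> V \<Longrightarrow> x \<notin> V \<Longrightarrow> f x = 0"
  using closure_subset[of "{x. f x \<noteq> 0}"] unfolding fsupp_def by auto

context normal_shell
begin

text \<open>Mollification moves points, so a property on \<open>V\<close> is inherited only on a
  smaller open set. After soft thresholding at level \<open>e\<close> the coefficient lives where
  the modulus of \<open>f\<close> exceeds \<open>e\<close>, and short paths from there stay in
  \<open>V\<close> because \<open>f\<close> is Lipschitz. \<open>Om_vanish\<close> treats the
  mollified data there, and \<open>e\<close> tends to 0 under the mass bound.\<close>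

lemma Uc_vanish:
  assumes sub: "\<And>V V' g. P V g \<Longrightarrow> V' \<subseteq> V \<Longrightarrow> open V' \<Longrightarrow> P V' g"
    and dl: "\<And>V g \<zeta>. P V g \<Longrightarrow> P {x. scaleC (exp \<zeta>) x \<in> V} (dil \<zeta> g)"
    and av: "\<And>V V' g a. \<lbrakk>P V g; is_qlip g; open V'; \<And>u x. u \<in> {0..1} \<Longrightarrow> x \<in> V' \<Longrightarrow> flow a u x \<in> V\<rbrakk> \<Longrightarrow> P V' (Av a g)"
    and van: "van_prop P n k T"
    and hol: "n \<le> length (filter (P V) \<pi>s) \<and> (\<forall>V g. open V \<and> smooth g \<and> P V g \<longrightarrow> (\<forall>x\<in>V. dba g x = 0)) \<or> Suc n \<le> length (filter (P V) \<pi>s)"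
    and V: "open V" and f: "is_qtest f" "\<And>x. x \<notin> V \<Longrightarrow> f x = 0"
    and p: "qlips \<pi>s" "length \<pi>s = Suc k"
  shows "Uc T f \<pi>s = 0"
proof -
  note qf = qtest_bounded_support(1)[OF f(1)]
  obtain R where R: "R > 0" "\<forall>x. R \<le> norm x \<longrightarrow> f x = 0" using qtest_bounded_support(2)[OF f(1)] by (elim exE conjE) (rule that)
  obtain L0 where L0: "L0-lipschitz_on UNIV f" using f(1) unfolding is_qtest_def is_lip_def by (elim exE conjE) (rule that)
  define L where "L = L0 + 1"
  have L: "L > 0" "L-lipschitz_on UNIV f" unfolding L_def using lipschitz_on_nonneg[OF L0] lipschitz_on_le[OF L0, of "L0+1"] by auto
  obtain \<mu> where \<mu>: "finite_radon \<mu>" "\<forall>f \<pi>s. is_qlip f \<and> (\<forall>x. R \<le> norm x \<longrightarrow> f x = 0) \<and> (qlips \<pi>s) \<and> length \<pi>s = Suc k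
    \<longrightarrow> cmod (Uc T f \<pi>s) \<le> lprod R \<pi>s * L1norm \<mu> f"
    using Uc_mass[OF R(1)] by (elim exE conjE) (rule that)
  have small: "cmod (Uc T f \<pi>s) \<le> (lprod R \<pi>s * measure \<mu> UNIV) * e" if e: "e > 0" for e
  proof -
    define g where "g x = soft e (f x)" for x
    have qg: "is_qlip g" unfolding g_def by (rule is_qlip_comp_lip[OF qf soft_lipschitz[OF e]])
    have zg: "g x = 0" if "R \<le> norm x" for x using R(2) that soft_zero[of 0 e] e by (simp add: g_def)
    define W where "W c = {x. c < cmod (f x)}" for c
    have W: "open (W c)" for c unfolding W_def by (intro open_Collect_less continuous_intros is_qlip_continuous[OF qf])
    have gW: "g x = 0" if "x \<notin> W e" for x using that soft_zero[of "f x" e] by (simp add: g_def W_def)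
    have WV: "W c \<subseteq> V" if "0 \<le> c" for c using f(2) that by (fastforce simp: W_def)
    have move: "scaleC (exp \<zeta>) x \<in> W (c - L * (cmod \<zeta> * R))" if "x \<in> W c" "Re \<zeta> \<le> 0" "0 \<le> c" for x \<zeta> c
    proof -
      have "f x \<noteq> 0" using that by (auto simp: W_def)
      then have xR: "norm x < R" using R(2) by (meson not_le)
      have "dist (f (scaleC (exp \<zeta>) x)) (f x) \<le> L * dist (scaleC (exp \<zeta>) x) x" by (rule lipschitz_onD[OF L(2)]) auto
      also have "dist (scaleC (exp \<zeta>) x) x = cmod (exp \<zeta> - 1) * norm x"
        using dist_scaleC_left[of "exp \<zeta>" x 1] by (simp add: scaleC_one)
      also have "L * (cmod (exp \<zeta> - 1) * norm x) \<le> L * (cmod \<zeta> * R)"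
        using norm_exp_minus_one_le[OF that(2)] xR L(1) by (intro mult_left_mono mult_mono) auto
      finally have "cmod (f (scaleC (exp \<zeta>) x) - f x) \<le> L * (cmod \<zeta> * R)" by (simp add: dist_norm)
      then have "cmod (f x) - L * (cmod \<zeta> * R) \<le> cmod (f (scaleC (exp \<zeta>) x))"
        using norm_triangle_ineq2[of "f x" "f (scaleC (exp \<zeta>) x)"] by (simp add: norm_minus_commute)
      then show ?thesis using that(1) by (auto simp: W_def)
    qed
    have Us0: "Us T g (map (mol h) \<pi>s) = 0" if h: "0 < h" "L * (h * R) \<le> e / 2" for h
    proof -
      \<comment> \<open>Each of the two averages may lower the level by at most
        \<open>e / 2\<close>: the radial one leads from level \<open>e\<close> to
        \<open>e / 2\<close>, and the rotational one, through \<open>st2\<close>, from there into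
        \<open>V\<close>.\<close>
      have st: "flow a u x \<in> W (c / 2)" if "u \<in> {0..1}" "x \<in> W c" "Re a \<le> 0" "cmod a = h" "e \<le> c" for u a x c
      proof -
        have "Re (of_real u * a) \<le> 0" using that by (simp add: mult_nonneg_nonpos)
        moreover have "cmod (of_real u * a) \<le> h" using that h by (simp add: norm_mult mult_left_le_one_le)
        then have "L * (cmod (of_real u * a) * R) \<le> L * (h * R)" using L(1) R(1) by (intro mult_left_mono mult_right_mono) auto
        then have "c / 2 \<le> c - L * (cmod (of_real u * a) * R)" using h(2) that(5) by simp
        ultimately show ?thesis using move[OF that(2), of "of_real u * a"] that(5) e by (auto simp: W_def)
      qed
      have st2: "flow a u x \<in> V" if "u \<in> {0..1}" "x \<in> W (e/2)" "Re a \<le> 0" "cmod a = h" for u a x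
      proof -
        have neg: "Re (of_real u * a) \<le> 0" using that by (simp add: mult_nonneg_nonpos)
        have "cmod (of_real u * a) \<le> h" using that h by (simp add: norm_mult mult_left_le_one_le)
        then have "L * (cmod (of_real u * a) * R) \<le> L * (h * R)" using L(1) R(1) by (intro mult_left_mono mult_right_mono) auto
        then have pos: "0 \<le> e / 2 - L * (cmod (of_real u * a) * R)" using h(2) by simp
        show ?thesis by (rule subsetD[OF WV[OF pos] move[OF that(2) neg]]) (use e in simp)
      qed
      have Pm: "P (W e) (mol h \<pi>)" if "P V \<pi>" "is_qlip \<pi>" for \<pi>
      proof -
        have "P (W (e/2)) (Av (\<i> * of_real h) \<pi>)"
          by (rule av[OF that W]) (rule st2, use h in \<open>auto simp: norm_mult\<close>)
        then show ?thesis unfolding mol_def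
          by (rule av[OF _ is_qlip_Av[OF that(2)] W]) (rule st[where c = e], use h in \<open>auto\<close>)
      qed
      have Om0: "Om T (dil \<zeta> g) (map (dil \<zeta>) (map (mol h) \<pi>s)) = 0" for \<zeta>
      proof -
        let ?V = "{x. scaleC (exp \<zeta>) x \<in> W e}"
        have oV: "open ?V"
        proof -
          have "continuous_on UNIV (\<lambda>x::'a. scaleC (exp \<zeta>) x)" by (rule continuous_on_scaleC[OF continuous_on_const continuous_on_id])
          from open_vimage[OF W this] show ?thesis by (simp add: vimage_def)
        qed
        have sm: "smooths (map (dil \<zeta>) (map (mol h) \<pi>s))" using smooth_map_mol[OF p(1) h(1)] smooth_dil(1) by auto
        have cnt: "length (filter (P V) \<pi>s) \<le> length (filter (P ?V) (map (dil \<zeta>) (map (mol h) \<pi>s)))"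
          unfolding map_map by (rule filter_map_length) (use p(1) Pm dl in auto)
        show ?thesis
        proof (rule Om_vanish[where V = ?V and m = k and n = n and P = "P ?V"])
          show "T u \<rho> = 0" if "is_qlip u" "\<And>x. x \<notin> ?V \<Longrightarrow> u x = 0" "qlips \<rho>" "length \<rho> = k" "n \<le> length (filter (P ?V) \<rho>)" for u \<rho>
            by (rule van_propD[OF van oV that])
          show "T (\<lambda>x. 0) \<rho> = 0" if "qlips \<rho>" "length \<rho> = k" for \<rho> by (rule T_zero[OF that(2,1)])
          show "dil \<zeta> g x = 0" if "x \<notin> ?V" for x using gW that by (simp add: dil_def)
          show "n \<le> length (filter (P ?V) (map (dil \<zeta>) (map (mol h) \<pi>s))) \<and>
             (\<forall>\<pi>\<in>set (map (dil \<zeta>) (map (mol h) \<pi>s)). P ?V \<pi> \<longrightarrow> (\<forall>x\<in>?V. dba \<pi> x = 0)) \<or>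
             Suc n \<le> length (filter (P ?V) (map (dil \<zeta>) (map (mol h) \<pi>s)))"
            using hol
          proof
            assume a: "n \<le> length (filter (P V) \<pi>s) \<and> (\<forall>V g. open V \<and> smooth g \<and> P V g \<longrightarrow> (\<forall>x\<in>V. dba g x = 0))"
            then have "\<forall>\<pi>\<in>set (map (dil \<zeta>) (map (mol h) \<pi>s)). P ?V \<pi> \<longrightarrow> (\<forall>x\<in>?V. dba \<pi> x = 0)"
              using oV sm by blast
            then show ?thesis using a cnt by (intro disjI1 conjI) auto
          next
            assume "Suc n \<le> length (filter (P V) \<pi>s)"
            then show ?thesis using cnt by (intro disjI2) linarith
          qed
        qed (use qg sm p in auto)
      qed
      then show ?thesis unfolding Us_def by simp
    qed
    have "(\<lambda>n. L * (hn n * R)) \<longlonglongrightarrow> L * (0 * R)" by (intro tendsto_intros hn_lim)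
    then have "(\<lambda>n. L * (hn n * R)) \<longlonglongrightarrow> 0" by simp
    from order_tendstoD(2)[OF this, of "e/2"] e have "\<forall>\<^sub>F n in sequentially. L * (hn n * R) < e / 2" by simp
    then have "\<forall>\<^sub>F n in sequentially. Us T g (map (mol (hn n)) \<pi>s) = 0"
      by eventually_elim (rule Us0[OF hn(1)], simp)
    then have "(\<lambda>n. Us T g (map (mol (hn n)) \<pi>s)) \<longlonglongrightarrow> 0" by (rule tendsto_eventually)
    with Uc_tendsto[OF R(1) qg zg p] have U0: "Uc T g \<pi>s = 0" by (rule LIMSEQ_unique)
    have z: "f x = 0" if "R \<le> norm x" for x using R(2) that by blast
    have qd: "is_qlip (\<lambda>x. f x - g x)" using qf qg by auto
    have "Uc T f \<pi>s = Uc T (\<lambda>x. f x - g x) \<pi>s"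
      using Uc_coeff[where a = 1 and b = "-1", OF R(1) qf z qg zg p] U0 by simp
    also have "cmod \<dots> \<le> lprod R \<pi>s * (\<integral>x. cmod (f x - g x) \<partial>\<mu>)"
      by (rule \<mu>(2)[THEN spec, THEN spec, THEN mp]) (use qd z zg p in auto)
    also have "\<dots> \<le> lprod R \<pi>s * (e * measure \<mu> UNIV)"
      by (intro mult_left_mono integral_cmod_le[OF \<mu>(1) qd] prod_list_lipc_nonneg p) (use soft_close e in \<open>auto simp: g_def\<close>)
    finally show ?thesis by (simp add: mult_ac)
  qed
  show ?thesis by (rule cmod_eq_zero_if_small[OF small])
qed

end

section \<open>Constant and holomorphic functions under dilation and averaging\<close>

lemma Av_const_on:
  assumes "\<And>u. u \<in> {0..1} \<Longrightarrow> g (flow a u x) = c"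
  shows "Av a g x = c"
proof -
  have "Av a g x = integral {0..1} (\<lambda>u::real. c)"
    unfolding Av_def by (rule Henstock_Kurzweil_Integration.integral_cong) (rule assms)
  then show ?thesis by simp
qed

definition constP :: "'a set \<Rightarrow> ('a \<Rightarrow> complex) \<Rightarrow> bool" where "constP V g \<longleftrightarrow> (\<exists>c. \<forall>x\<in>V. g x = c)"

definition aholo :: "'a::complex_normed_vector set \<Rightarrow> ('a \<Rightarrow> complex) \<Rightarrow> bool" where "aholo V g \<longleftrightarrow> holo_on V (\<lambda>x. cnj (g x))"

lemma holo_on_subset: "holo_on V g \<Longrightarrow> V' \<subseteq> V \<Longrightarrow> holo_on V' g"
  unfolding holo_on_def by blast

lemma bounded_linear_scaleC: "bounded_linear (\<lambda>v::'a::complex_normed_vector. scaleC c v)"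
proof (rule bounded_linear_intro[where K = "cmod c"])
  fix r and v :: 'a
  show "scaleC c (r *\<^sub>R v) = r *\<^sub>R scaleC c v" by (simp add: scaleR_scaleC scaleC_scaleC mult.commute)
qed (auto simp: scaleC_add_right norm_scaleC mult.commute)

lemma holo_dil: "holo_on V g \<Longrightarrow> holo_on {x. scaleC (exp \<zeta>) x \<in> V} (dil \<zeta> g)"
  unfolding holo_on_def
proof
  fix x assume g: "\<forall>x\<in>V. \<exists>L. bounded_linear L \<and> (\<forall>c v. L (scaleC c v) = c * L v) \<and> (g has_derivative L) (at x)"
    and x: "x \<in> {x. scaleC (exp \<zeta>) x \<in> V}"
  then obtain L where L: "bounded_linear L" "\<forall>c v. L (scaleC c v) = c * L v" "(g has_derivative L) (at (scaleC (exp \<zeta>) x))" by blast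
  have s: "((\<lambda>x. scaleC (exp \<zeta>) x) has_derivative (\<lambda>v. scaleC (exp \<zeta>) v)) (at x)"
    by (rule bounded_linear.has_derivative[OF bounded_linear_scaleC has_derivative_ident])
  from diff_chain_at[OF s L(3)] have d: "(dil \<zeta> g has_derivative (\<lambda>v. L (scaleC (exp \<zeta>) v))) (at x)"
    by (simp add: o_def dil_def)
  show "\<exists>L. bounded_linear L \<and> (\<forall>c v. L (scaleC c v) = c * L v) \<and> (dil \<zeta> g has_derivative L) (at x)"
    by (rule exI[of _ "\<lambda>v. L (scaleC (exp \<zeta>) v)"]) (use d L(2) has_derivative_bounded_linear[OF d] in auto)
qed

text \<open>The Cauchy-Riemann equation along the orbit: complex linearity gives
  \<open>ddir a g x = a * L x\<close>, and the contributions of 1 and \<open>\<i> * \<i>\<close>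
  cancel.\<close>

lemma holo_dba:
  assumes h: "holo_on V g" and x: "x \<in> V"
  shows "dba g x = 0"
proof -
  obtain L where L: "bounded_linear L" "\<And>c v. L (scaleC c v) = c * L v" "(g has_derivative L) (at x)"
    using h x unfolding holo_on_def by blast
  have e: "((\<lambda>t. flow a t x) has_derivative (\<lambda>t. scaleC (of_real t * a) x)) (at (0::real))" for a
  proof -
    have bl: "bounded_linear (\<lambda>c. scaleC c x)"
      by (rule bounded_linear_intro[where K = "norm x"])
         (auto simp: scaleC_add_left norm_scaleC mult.commute scaleR_scaleC scaleC_scaleC scaleR_conv_of_real)
    have "((\<lambda>z. exp (z * a)) has_field_derivative a) (at (of_real 0))" by (auto intro!: derivative_eq_intros)
    from has_vector_derivative_real_field[OF this]
    have "((\<lambda>t. exp (of_real t * a)) has_derivative (\<lambda>t. of_real t * a)) (at (0::real))"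
      by (simp add: has_vector_derivative_def scaleR_conv_of_real)
    from bounded_linear.has_derivative[OF bl this] show ?thesis .
  qed
  have "ddir a g x = a * L x" for a
  proof (rule ddir_eqI)
    have "(g has_derivative L) (at (flow a 0 x))" using L(3) by (simp add: scaleC_one)
    from diff_chain_at[OF e this]
    have "((\<lambda>t. g (flow a t x)) has_derivative (\<lambda>t. L (scaleC (of_real t * a) x))) (at 0)" by (simp add: o_def)
    then show "((\<lambda>t. g (flow a t x)) has_vector_derivative a * L x) (at 0)"
      by (simp add: has_vector_derivative_def L(2) scaleR_conv_of_real mult.assoc)
  qed
  then show ?thesis unfolding dba_def by simp
qed

text \<open>Differentiation under the integral sign: the difference quotients are dominated by the Lipschitz constant.\<close>

lemma holo_Av:
  assumes h: "holo_on V g" and q: "is_qlip g" and V': "open V'"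
    and mv: "\<And>u x. u \<in> {0..1} \<Longrightarrow> x \<in> V' \<Longrightarrow> flow a u x \<in> V"
  shows "holo_on V' (Av a g)"
  unfolding holo_on_def
proof
  fix x assume x: "x \<in> V'"
  define \<zeta> where "\<zeta> u = complex_of_real u * a" for u
  have "\<forall>u\<in>{0..1}. \<exists>L. bounded_linear L \<and> (\<forall>c v. L (scaleC c v) = c * L v) \<and> (g has_derivative L) (at (scaleC (exp (\<zeta> u)) x))"
    using h mv[OF _ x] unfolding holo_on_def \<zeta>_def by blast
  from bchoice[OF this] obtain L0 where L0: "\<forall>u\<in>{0..1}. bounded_linear (L0 u) \<and> (\<forall>c v. L0 u (scaleC c v) = c * L0 u v) \<and> (g has_derivative L0 u) (at (scaleC (exp (\<zeta> u)) x))"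
    by (rule exE)
  define L where "L u v = L0 u (scaleC (exp (\<zeta> u)) v)" for u v
  have dL: "(dil (\<zeta> u) g has_derivative L u) (at x)" if "u \<in> {0..1}" for u
  proof -
    have s: "((\<lambda>x. scaleC (exp (\<zeta> u)) x) has_derivative (\<lambda>v. scaleC (exp (\<zeta> u)) v)) (at x)"
      by (rule bounded_linear.has_derivative[OF bounded_linear_scaleC has_derivative_ident])
    have "(g has_derivative L0 u) (at (scaleC (exp (\<zeta> u)) x))" using L0 that by blast
    from diff_chain_at[OF s this] show ?thesis by (simp add: o_def dil_def L_def[abs_def])
  qed
  have Lc: "L u (scaleC c v) = c * L u v" if "u \<in> {0..1}" for u c v
  proof -
    have "scaleC (exp (\<zeta> u)) (scaleC c v) = scaleC c (scaleC (exp (\<zeta> u)) v)" by (simp add: scaleC_scaleC mult.commute)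
    then show ?thesis unfolding L_def using L0 that by metis
  qed
  define b where "b = \<bar>Re a\<bar>"
  have Reb: "Re (\<zeta> u) \<le> b" if "u \<in> {0..1}" for u
  proof -
    have "u * Re a \<le> u * \<bar>Re a\<bar>" using that by (intro mult_left_mono) auto
    also have "\<dots> \<le> 1 * \<bar>Re a\<bar>" using that by (intro mult_right_mono) auto
    finally show ?thesis by (simp add: \<zeta>_def b_def)
  qed
  define R where "R = norm x + 1"
  define C where "C = exp b * lipc (ball 0 (exp b * R)) g"
  have C0: "0 \<le> C" unfolding C_def using lipc_nonneg[OF q] by simp
  have R: "R > 0" unfolding R_def by (simp add: add_nonneg_pos)
  have lip: "C-lipschitz_on (ball 0 R) (dil (\<zeta> u) g)" if "u \<in> {0..1}" for u
  proof -
    have "exp (Re (\<zeta> u)) * R \<le> exp b * R" using Reb[OF that] R by simp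
    from dil_lipschitz[OF is_qlip_lipc[OF q] this]
    show ?thesis by (rule lipschitz_on_le) (use Reb[OF that] lipc_nonneg[OF q] in \<open>auto simp: C_def intro!: mult_right_mono\<close>)
  qed
  have xR: "x \<in> ball 0 R" unfolding R_def by simp
  have diff_le: "cmod (dil (\<zeta> u) g (x + v) - dil (\<zeta> u) g x) \<le> C * norm v" if "u \<in> {0..1}" "norm v < 1" for u v
  proof -
    have "norm (x + v) < R" using norm_triangle_ineq[of x v] that(2) unfolding R_def by linarith
    then have "x + v \<in> ball 0 R" by simp
    from lipschitz_onD[OF lip[OF that(1)] this xR] show ?thesis by (simp add: dist_norm)
  qed
  have Lseq: "(\<lambda>n. of_nat (Suc n) * (dil (\<zeta> u) g (x + (1 / real (Suc n)) *\<^sub>R v) - dil (\<zeta> u) g x)) \<longlonglongrightarrow> L u v" if u: "u \<in> {0..1}" for u v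
  proof -
    have "((\<lambda>t. x + t *\<^sub>R v) has_derivative (\<lambda>t. t *\<^sub>R v)) (at 0)" by (auto intro!: derivative_eq_intros)
    from diff_chain_at[OF this] dL[OF u]
    have d: "((\<lambda>t. dil (\<zeta> u) g (x + t *\<^sub>R v)) has_derivative (\<lambda>t. L u (t *\<^sub>R v))) (at 0)" by (simp add: o_def)
    have "L u (t *\<^sub>R v) = t *\<^sub>R L u v" for t using Lc[OF u] by (simp add: scaleR_scaleC scaleR_conv_of_real)
    then have "((\<lambda>t. dil (\<zeta> u) g (x + t *\<^sub>R v)) has_vector_derivative L u v) (at 0)" using d by (simp add: has_vector_derivative_def)
    from vderiv_seq[OF this, of "\<lambda>n. inverse (real (Suc n))"] LIMSEQ_inverse_real_of_nat
    show ?thesis by (simp add: field_simps)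
  qed
  have Lb: "cmod (L u v) \<le> C * norm v" if u: "u \<in> {0..1}" for u v
  proof -
    have "\<forall>\<^sub>F n in sequentially. cmod (of_nat (Suc n) * (dil (\<zeta> u) g (x + (1 / real (Suc n)) *\<^sub>R v) - dil (\<zeta> u) g x)) \<le> C * norm v"
    proof -
      have "(\<lambda>n. inverse (real (Suc n)) * norm v) \<longlonglongrightarrow> 0 * norm v" by (intro tendsto_intros LIMSEQ_inverse_real_of_nat)
      then have "\<forall>\<^sub>F n in sequentially. inverse (real (Suc n)) * norm v < 1" by (intro order_tendstoD(2)) auto
      then show ?thesis
      proof eventually_elim
        case (elim n)
        have "norm ((1 / real (Suc n)) *\<^sub>R v) < 1" using elim by (simp add: inverse_eq_divide del: of_nat_Suc)
        from mult_left_mono[OF diff_le[OF u this], of "real (Suc n)"]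
        show ?case by (simp add: norm_mult del: of_nat_Suc)
      qed
    qed
    then show ?thesis by (rule tendsto_upperbound[OF tendsto_norm[OF Lseq[OF u]]]) simp
  qed
  \<comment> \<open>Integrability in \<open>u\<close> is inherited from continuous difference
    quotients with steps 1/n. The shift \<open>?N\<close> makes the increments shorter than 1, as
    \<open>diff_le\<close> requires.\<close>
  have Li: "(\<lambda>u. L u v) integrable_on {0..1}" for v
  proof (rule dominated_convergence(1)[where h = "\<lambda>_. C * norm v"])
    let ?N = "Suc (nat \<lceil>norm v\<rceil>)"
    let ?f = "\<lambda>n u. of_nat (Suc (n + ?N)) * (dil (\<zeta> u) g (x + (1 / real (Suc (n + ?N))) *\<^sub>R v) - dil (\<zeta> u) g x)"
    have cg: "continuous_on {0..1} (\<lambda>u. dil (\<zeta> u) g y)" for y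
      unfolding dil_def \<zeta>_def by (rule Av_continuous[OF q])
    show "?f n integrable_on {0..1}" for n
      by (intro integrable_continuous_real continuous_intros cg)
    show "(\<lambda>_. C * norm v) integrable_on {0..1::real}" by (rule integrable_const_ivl)
    show "norm (?f n u) \<le> C * norm v" if u: "u \<in> {0..1}" for n u
    proof -
      have "norm v < real (Suc (n + ?N))" by linarith
      then have "norm ((1 / real (Suc (n + ?N))) *\<^sub>R v) < 1" by (simp add: divide_less_eq del: of_nat_Suc)
      from mult_left_mono[OF diff_le[OF u this], of "real (Suc (n + ?N))"]
      show ?thesis by (simp add: norm_mult del: of_nat_Suc)
    qed
    show "(\<lambda>n. ?f n u) \<longlonglongrightarrow> L u v" if u: "u \<in> {0..1}" for u
      using LIMSEQ_ignore_initial_segment[OF Lseq[OF u, of v], of ?N] by simp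
  qed
  define D where "D v = integral {0..1} (\<lambda>u. L u v)" for v
  have Llin: "L u (v + w) = L u v + L u w" if "u \<in> {0..1}" for u v w
    using linear_add[OF has_derivative_linear[OF dL[OF that]]] .
  have Dc: "D (scaleC c v) = c * D v" for c v
  proof -
    have "D (scaleC c v) = integral {0..1} (\<lambda>u. c * L u v)"
      unfolding D_def by (rule Henstock_Kurzweil_Integration.integral_cong) (rule Lc)
    then show ?thesis by (simp add: D_def integral_mult_right)
  qed
  have bl: "bounded_linear D"
  proof (rule bounded_linear_intro[where K = C])
    fix v w :: 'a and r :: real
    have "D (v + w) = integral {0..1} (\<lambda>u. L u v + L u w)"
      unfolding D_def by (rule Henstock_Kurzweil_Integration.integral_cong) (rule Llin)
    then show "D (v + w) = D v + D w" unfolding D_def by (simp add: integral_add Li)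
    show "D (r *\<^sub>R v) = r *\<^sub>R D v" by (simp add: scaleR_scaleC Dc scaleR_conv_of_real)
    have "norm (integral {0..1} (\<lambda>u. L u v)) \<le> integral {0..1} (\<lambda>u::real. C * norm v)"
      by (rule integral_norm_bound_integral[OF Li integrable_const_ivl Lb])
    then show "norm (D v) \<le> norm v * C" by (simp add: D_def mult.commute)
  qed
  have "(Av a g has_derivative D) (at x)"
    unfolding has_derivative_at tendsto_at_iff_sequentially
  proof (intro conjI bl allI impI)
    fix v :: "nat \<Rightarrow> 'a" assume v: "\<forall>i. v i \<in> UNIV - {0}" "v \<longlonglongrightarrow> 0"
    have "\<forall>\<^sub>F n in sequentially. norm (v n) < 1" using tendsto_norm[OF v(2)] by (intro order_tendstoD(2)) auto
    then obtain N where N: "\<And>n. n \<ge> N \<Longrightarrow> norm (v n) < 1" by (auto simp: eventually_sequentially)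
    let ?E = "\<lambda>n u. (dil (\<zeta> u) g (x + v (n + N)) - dil (\<zeta> u) g x - L u (v (n + N))) / of_real (norm (v (n + N)))"
    have gi: "(\<lambda>u. dil (\<zeta> u) g y) integrable_on {0..1}" for y
      unfolding dil_def \<zeta>_def by (rule Av_integrable[OF q])
    have Ei: "?E n integrable_on {0..1}" for n
      by (intro integrable_on_divide integrable_diff gi Li)
    have "(\<lambda>n. integral {0..1} (?E n)) \<longlonglongrightarrow> integral {0..1} (\<lambda>u::real. 0::complex)"
    proof (rule dominated_convergence(2)[OF Ei, where h = "\<lambda>_. 2 * C"])
      show "(\<lambda>_. 2 * C) integrable_on {0..1::real}" by (rule integrable_const_ivl)
      fix n and u :: real assume u: "u \<in> {0..1}"
      have nz: "norm (v (n + N)) > 0" using v(1) by simp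
      have "cmod (dil (\<zeta> u) g (x + v (n + N)) - dil (\<zeta> u) g x - L u (v (n + N))) \<le> C * norm (v (n + N)) + C * norm (v (n + N))"
        by (rule norm_triangle_le_diff, rule add_mono[OF diff_le[OF u N] Lb[OF u]]) simp
      then show "norm (?E n u) \<le> 2 * C" using nz by (simp add: norm_divide divide_le_eq)
    next
      fix u :: real assume u: "u \<in> {0..1}"
      have "((\<lambda>h. norm (dil (\<zeta> u) g (x + h) - dil (\<zeta> u) g x - L u h) / norm h) \<longlongrightarrow> 0) (at 0)"
        using dL[OF u] unfolding has_derivative_at by blast
      then have "(\<lambda>n. norm (dil (\<zeta> u) g (x + v n) - dil (\<zeta> u) g x - L u (v n)) / norm (v n)) \<longlonglongrightarrow> 0"
        using v unfolding tendsto_at_iff_sequentially o_def by blast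
      from LIMSEQ_ignore_initial_segment[OF this, of N]
      have "(\<lambda>n. norm (?E n u)) \<longlonglongrightarrow> 0" by (simp add: norm_divide)
      then show "(\<lambda>n. ?E n u) \<longlonglongrightarrow> 0" by (rule tendsto_norm_zero_cancel)
    qed
    then have "(\<lambda>n. norm (integral {0..1} (?E n))) \<longlonglongrightarrow> 0" by (intro tendsto_norm_zero) simp
    moreover have "norm (integral {0..1} (?E n)) = norm (Av a g (x + v (n + N)) - Av a g x - D (v (n + N))) / norm (v (n + N))" for n
    proof -
      have "integral {0..1} (?E n) = integral {0..1} (\<lambda>u. dil (\<zeta> u) g (x + v (n + N)) - dil (\<zeta> u) g x - L u (v (n + N))) / of_real (norm (v (n + N)))"
        by (rule integral_divide)
      also have "integral {0..1} (\<lambda>u. dil (\<zeta> u) g (x + v (n + N)) - dil (\<zeta> u) g x - L u (v (n + N)))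
         = Av a g (x + v (n + N)) - Av a g x - D (v (n + N))"
        by (simp add: integral_diff gi Li integrable_diff Av_def D_def) (simp add: dil_def \<zeta>_def)
      finally show ?thesis by (simp only: norm_divide norm_of_real abs_norm_cancel)
    qed
    ultimately have "(\<lambda>n. norm (Av a g (x + v (n + N)) - Av a g x - D (v (n + N))) / norm (v (n + N))) \<longlonglongrightarrow> 0" by simp
    then have "(\<lambda>n. norm (Av a g (x + v n) - Av a g x - D (v n)) / norm (v n)) \<longlonglongrightarrow> 0"
      by (rule LIMSEQ_offset[where k = N])
    then show "((\<lambda>h. norm (Av a g (x + h) - Av a g x - D h) / norm h) \<circ> v) \<longlonglongrightarrow> 0" by (simp add: o_def)
  qed
  then show "\<exists>L. bounded_linear L \<and> (\<forall>c v. L (scaleC c v) = c * L v) \<and> (Av a g has_derivative L) (at x)"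
    using bl Dc by blast
qed

lemma Av_cnj: "(\<lambda>x. cnj (Av a g x)) = Av a (\<lambda>x. cnj (g x))"
  unfolding Av_def by (auto simp: integral_cnj)

lemma is_qtestI:
  assumes "is_lip f" "\<And>x. R \<le> norm x \<Longrightarrow> f x = 0"
  shows "is_qtest f"
proof -
  have "{x. f x \<noteq> 0} \<subseteq> cball 0 R" using assms(2) by (auto simp: not_le intro: less_imp_le) (meson assms(2) nle_le)
  then have "fsupp f \<subseteq> cball 0 R" unfolding fsupp_def by (rule closure_minimal) simp
  then show ?thesis unfolding is_qtest_def using assms(1) bounded_subset[OF bounded_cball] by blast
qed

lemma qdomD:
  assumes "qdom n f \<pi>s"
  shows "is_qtest f" "is_qlip f" "\<exists>R>0. \<forall>x. R \<le> norm x \<longrightarrow> f x = 0" "length \<pi>s = n" "qlips \<pi>s"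
  using assms qtest_bounded_support[of f] unfolding qdom_def by auto

lemma card_le_length_filter:
  assumes "J \<subseteq> {..<length \<pi>s}" "\<forall>j\<in>J. P (\<pi>s ! j)"
  shows "card J \<le> length (filter P \<pi>s)"
  unfolding length_filter_conv_card by (rule card_mono) (use assms in auto)

text \<open>Bidimension numbers are written as one less than a natural number of slots, so that -1
  is included and index sets become counts.\<close>

lemma qbidimI:
  assumes h: "\<And>f \<pi>s V. \<lbrakk>qdom k f \<pi>s; open V; \<And>x. x \<notin> V \<Longrightarrow> f x = 0; n \<le> length (filter (holo_on V) \<pi>s)\<rbrakk> \<Longrightarrow> T f \<pi>s = 0"
    and a: "\<And>f \<pi>s V. \<lbrakk>qdom k f \<pi>s; open V; \<And>x. x \<notin> V \<Longrightarrow> f x = 0; m \<le> length (filter (aholo V) \<pi>s)\<rbrakk> \<Longrightarrow> T f \<pi>s = 0"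
  shows "qbidim k (int n - 1) (int m - 1) T"
  unfolding bidim_on_def
proof (intro allI impI, elim conjE exE)
  fix f :: "'a \<Rightarrow> complex" and \<pi>s V
  assume f: "qdom k f \<pi>s" and V: "open V" "fsupp f \<subseteq> V"
    and J: "(\<exists>J\<subseteq>{..<k}. int (card J) = int n - 1 + 1 \<and> (\<forall>j\<in>J. holo_on V (\<pi>s ! j))) \<or>
           (\<exists>J\<subseteq>{..<k}. int (card J) = int m - 1 + 1 \<and> (\<forall>j\<in>J. holo_on V (\<lambda>x. cnj ((\<pi>s ! j) x))))"
  have l: "length \<pi>s = k" by (rule qdomD(4)[OF f])
  from J show "T f \<pi>s = 0"
  proof
    assume "\<exists>J\<subseteq>{..<k}. int (card J) = int n - 1 + 1 \<and> (\<forall>j\<in>J. holo_on V (\<pi>s ! j))"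
    then obtain J where J: "J \<subseteq> {..<k}" "card J = n" "\<forall>j\<in>J. holo_on V (\<pi>s ! j)" by auto
    then have "n \<le> length (filter (holo_on V) \<pi>s)" using card_le_length_filter[of J \<pi>s "holo_on V"] l by simp
    from h[OF f V(1) fsupp_subset_off[OF V(2)] this] show ?thesis .
  next
    assume "\<exists>J\<subseteq>{..<k}. int (card J) = int m - 1 + 1 \<and> (\<forall>j\<in>J. holo_on V (\<lambda>x. cnj ((\<pi>s ! j) x)))"
    then obtain J where J: "J \<subseteq> {..<k}" "card J = m" "\<forall>j\<in>J. aholo V (\<pi>s ! j)" unfolding aholo_def by auto
    then have "m \<le> length (filter (aholo V) \<pi>s)" using card_le_length_filter[of J \<pi>s "aholo V"] l by simp
    from a[OF f V(1) fsupp_subset_off[OF V(2)] this] show ?thesis .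
  qed
qed

lemma qdom_convergence:
  assumes F: "\<And>n. qdom k (F n) (P n)"
    and cF: "\<And>x. (\<lambda>n. F n x) \<longlonglongrightarrow> f x" and cP: "\<And>j x. j < k \<Longrightarrow> (\<lambda>n. (P n ! j) x) \<longlonglongrightarrow> (\<pi>s ! j) x"
    and bF: "\<And>n. lipc UNIV (F n) \<le> C" and bP: "\<And>R. \<exists>C. \<forall>n. \<forall>j<k. lipc (ball 0 R) (P n ! j) \<le> C"
  shows "\<And>n. C-lipschitz_on UNIV (F n)" "qconv F f" "\<And>j. j < k \<Longrightarrow> qconv (\<lambda>n. P n ! j) (\<pi>s ! j)"
proof -
  show lF: "C-lipschitz_on UNIV (F n)" for n
  proof -
    have "is_lip (F n)" using F[of n] unfolding qdom_def is_qtest_def by blast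
    then obtain c where "c-lipschitz_on UNIV (F n)" unfolding is_lip_def by blast
    from lipschitz_on_le[OF lipc_lipschitz[OF this] bF] show ?thesis .
  qed
  show "qconv F f" unfolding qconv_def eqlip_def using cF lipschitz_on_subset[OF lF subset_UNIV] by blast
  show "qconv (\<lambda>n. P n ! j) (\<pi>s ! j)" if j: "j < k" for j
    unfolding qconv_def eqlip_def
  proof (intro conjI allI cP[OF j])
    fix R
    obtain C where C: "\<forall>n. \<forall>j<k. lipc (ball 0 R) (P n ! j) \<le> C" using bP by blast
    have "is_qlip (P n ! j)" for n using qdomD(4,5)[OF F[of n]] j by auto
    then show "\<exists>C. \<forall>n. C-lipschitz_on (ball 0 R) (P n ! j)"
      using lipschitz_on_le[OF is_qlip_lipc] C j by blast
  qed
qed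

context normal_shell
begin

lemma Uc_local:
  assumes V: "open V" and g: "is_qtest g" "\<And>x. x \<notin> V \<Longrightarrow> g x = 0"
    and p: "qlips \<pi>s" "length \<pi>s = Suc k" and c: "u \<in> set \<pi>s" "\<And>x. x \<in> V \<Longrightarrow> u x = c"
  shows "Uc T g \<pi>s = 0"
proof (rule Uc_vanish[where P = constP and n = 1, OF _ _ _ _ _ V g p])
  show "constP V' g" if "constP V g" "V' \<subseteq> V" for V V' :: "'a set" and g
    using that unfolding constP_def by blast
  show "constP {x. scaleC (exp \<zeta>) x \<in> V} (dil \<zeta> g)" if "constP V g" for V :: "'a set" and g \<zeta>
    using that unfolding constP_def dil_def by auto
  show "constP V' (Av a g)" if "constP V g" "\<And>u x. u \<in> {0..1} \<Longrightarrow> x \<in> V' \<Longrightarrow> flow a u x \<in> V" for V V' :: "'a set" and g a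
  proof -
    from that(1) obtain c where c: "\<forall>x\<in>V. g x = c" unfolding constP_def by blast
    have "Av a g x = c" if "x \<in> V'" for x by (rule Av_const_on) (use c \<open>\<And>u x. u \<in> {0..1} \<Longrightarrow> x \<in> V' \<Longrightarrow> flow a u x \<in> V\<close>[OF _ that] in blast)
    then show ?thesis unfolding constP_def by blast
  qed
  show "van_prop constP 1 k T"
    unfolding van_prop_def
  proof (intro allI impI, elim conjE)
    fix V :: "'a set" and g and \<rho> :: "('a \<Rightarrow> complex) list"
    assume a: "open V" "is_qlip g" "\<forall>x. x \<notin> V \<longrightarrow> g x = 0" "qlips \<rho>" "length \<rho> = k" "1 \<le> length (filter (constP V) \<rho>)"
    then have "filter (constP V) \<rho> \<noteq> []" by auto
    then obtain w where w: "w \<in> set \<rho>" "constP V w" unfolding filter_empty_conv by blast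
    obtain c where c: "\<forall>x\<in>V. w x = c" using w(2) unfolding constP_def by blast
    obtain us vs where r: "\<rho> = us @ w # vs" using split_list[OF w(1)] by blast
    show "T g \<rho> = 0" unfolding r by (rule local[OF a(1,2), where c = c]) (use a c r in auto)
  qed
  have "u \<in> set (filter (constP V) \<pi>s)" using c unfolding constP_def by auto
  then have "0 < length (filter (constP V) \<pi>s)" by (rule length_pos_if_in_set)
  then have "1 \<le> length (filter (constP V) \<pi>s)" by linarith
  moreover have "\<forall>V g. open V \<and> smooth g \<and> constP V g \<longrightarrow> (\<forall>x\<in>V. dba g x = 0)"
    using dba_zero_open unfolding constP_def by blast
  ultimately show "1 \<le> length (filter (constP V) \<pi>s) \<and> (\<forall>V g. open V \<and> smooth g \<and> constP V g \<longrightarrow> (\<forall>x\<in>V. dba g x = 0)) \<or> Suc 1 \<le> length (filter (constP V) \<pi>s)"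
    by blast
qed

lemma Uc_qcurrent_cont:
  assumes F: "\<And>n. qdom (Suc k) (F n) (P n)" and f: "qdom (Suc k) f \<pi>s"
    and cF: "\<And>x. (\<lambda>n. F n x) \<longlonglongrightarrow> f x" and cP: "\<And>j x. j < Suc k \<Longrightarrow> (\<lambda>n. (P n ! j) x) \<longlonglongrightarrow> (\<pi>s ! j) x"
    and bF: "\<And>n. fsupp (F n) \<subseteq> ball 0 R0 \<and> lipc UNIV (F n) \<le> C0"
    and bP: "\<And>R. \<exists>C. \<forall>n. \<forall>j<Suc k. lipc (ball 0 R) (P n ! j) \<le> C"
  shows "(\<lambda>n. Uc T (F n) (P n)) \<longlonglongrightarrow> Uc T f \<pi>s"
proof -
  define R where "R = max R0 1"
  have R: "R > 0" unfolding R_def by simp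
  have zF: "F n x = 0" if "R \<le> norm x" for n x
    by (rule fsupp_subset_off[of "F n" "ball 0 R0"]) (use bF that in \<open>auto simp: R_def\<close>)
  have zf: "f x = 0" if "R \<le> norm x" for x
    using cF[of x] zF[OF that] LIMSEQ_unique[OF _ tendsto_const] by (simp add: tendsto_const_iff)
  note cv = qdom_convergence[OF F cF cP bF[THEN conjunct2] bP]
  note lF = cv(1) and qF = cv(2) and qc = cv(3)
  define Ps where "Ps = map (\<lambda>j n. P n ! j) [0..<Suc k]"
  have lP: "length (P n) = Suc k" for n by (rule qdomD(4)[OF F])
  have qPj: "is_qlip (P n ! j)" if "j < Suc k" for n j using qdomD(5)[OF F[of n]] lP[of n] that by auto
  have Pn: "map (\<lambda>p. p n) Ps = P n" for n unfolding Ps_def by (rule nth_equalityI) (auto simp: lP simp del: upt_Suc)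
  have l: "length \<pi>s = Suc k" by (rule qdomD(4)[OF f])
  have Ps: "list_all2 qconv Ps \<pi>s"
    unfolding list_all2_conv_all_nth Ps_def using qc l by (auto simp del: upt_Suc)
  obtain C1 where C1: "\<forall>n. \<forall>j<Suc k. lipc (ball 0 (2*R+1)) (P n ! j) \<le> C1" using bP by blast
  obtain B0 where B0: "B0 > 0" "\<And>n x. x \<in> ball 0 R \<Longrightarrow> cmod (F n x) \<le> B0" using qconv_bounded[OF qF] by metis
  have zf': "\<forall>x. R \<le> norm x \<longrightarrow> f x = 0" using zf by blast
  obtain B2 where B2: "B2 \<ge> 0" "\<forall>x. cmod (f x) \<le> B2" "lipc (ball 0 (2*R+1)) f \<le> B2"
    "\<forall>\<pi>\<in>set \<pi>s. is_qlip \<pi> \<and> lipc (ball 0 (2*R+1)) \<pi> \<le> B2"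
    using common_bound[where r = "2*R+1", OF qdomD(2)[OF f] zf' qdomD(5)[OF f]] by (elim exE conjE) (rule that)
  define B where "B = B0 + \<bar>C0\<bar> + \<bar>C1\<bar> + B2"
  have B: "0 \<le> B" "B0 \<le> B" "C0 \<le> B" "C1 \<le> B" "B2 \<le> B" unfolding B_def using B0(1) B2(1) by auto
  have "(\<lambda>n. Uc T (F n) (map (\<lambda>p. p n) Ps)) \<longlonglongrightarrow> Uc T f \<pi>s"
  proof (rule Uc_cont[OF R qF zF zf Ps l B(1)])
    show "cmod (F n x) \<le> B" for n x
      using B0(2)[of x n] zF[of x n] B by (cases "R \<le> norm x") auto
    show "lipc (ball 0 (2*R+1)) (F n) \<le> B" for n
      using lipc_le[OF lipschitz_on_subset[OF lF subset_UNIV]] B(3) order_trans by blast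
    show "is_qlip (p n) \<and> lipc (ball 0 (2*R+1)) (p n) \<le> B" if "p \<in> set Ps" for n p
    proof -
      obtain j where "j < Suc k" "p = (\<lambda>n. P n ! j)" using \<open>p \<in> set Ps\<close> unfolding Ps_def set_map set_upt by auto
      then show ?thesis using qPj C1 B(4) order_trans by blast
    qed
    show "cmod (f x) \<le> B" for x using B2(2) B(5) order_trans by blast
    show "lipc (ball 0 (2*R+1)) f \<le> B" using B2(3) B(5) by linarith
    show "\<forall>\<pi>\<in>set \<pi>s. is_qlip \<pi> \<and> lipc (ball 0 (2*R+1)) \<pi> \<le> B" using B2(4) B(5) order_trans by blast
  qed
  then show ?thesis by (simp only: Pn)
qed

lemma Uc_qcurrent: "qcurrent (Suc k) (Uc T)"
  unfolding qcurrent_def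
proof (intro conjI)
  show "multilinear_on (qdom (Suc k)) (Suc k) (Uc T)"
    unfolding multilinear_on_def
  proof (intro conjI allI impI; elim conjE)
    fix f g :: "'a \<Rightarrow> complex" and \<pi>s a b
    assume f: "qdom (Suc k) f \<pi>s" and g: "qdom (Suc k) g \<pi>s"
    obtain R1 where R1: "R1 > 0" "\<forall>x. R1 \<le> norm x \<longrightarrow> f x = 0" using qdomD(3)[OF f] by (elim exE conjE) (rule that)
    obtain R2 where R2: "R2 > 0" "\<forall>x. R2 \<le> norm x \<longrightarrow> g x = 0" using qdomD(3)[OF g] by (elim exE conjE) (rule that)
    show "Uc T (\<lambda>x. a * f x + b * g x) \<pi>s = a * Uc T f \<pi>s + b * Uc T g \<pi>s"
      by (rule Uc_coeff[where R = "max R1 R2"]) (use R1 R2 qdomD(2,4,5)[OF f] qdomD(2)[OF g] in auto)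
  next
    fix f u v :: "'a \<Rightarrow> complex" and \<pi>s j a b
    assume j: "j < Suc k" and u: "qdom (Suc k) f (\<pi>s[j := u])" and v: "qdom (Suc k) f (\<pi>s[j := v])"
    obtain R where R: "R > 0" "\<forall>x. R \<le> norm x \<longrightarrow> f x = 0" using qdomD(3)[OF u] by (elim exE conjE) (rule that)
    have l: "length \<pi>s = Suc k" using qdomD(4)[OF u] by simp
    have e: "\<pi>s[j := w] = take j \<pi>s @ w # drop (Suc j) \<pi>s" for w by (rule upd_conv_take_nth_drop) (use j l in simp)
    have q: "qlips (take j \<pi>s)" "is_qlip u" "is_qlip v" "qlips (drop (Suc j) \<pi>s)"
      using qdomD(5)[OF u] qdomD(5)[OF v] unfolding e by (auto simp del: set_take_subset)
    show "Uc T f (\<pi>s[j := \<lambda>x. a * u x + b * v x]) = a * Uc T f (\<pi>s[j := u]) + b * Uc T f (\<pi>s[j := v])"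
      unfolding e by (rule Uc_slot[OF R(1) qdomD(2)[OF u] _ q]) (use R(2) j l in auto)
  qed
  show "local_on (qdom (Suc k)) (Suc k) (Uc T)"
    unfolding local_on_def
  proof (intro allI impI, elim conjE exE)
    fix f :: "'a \<Rightarrow> complex" and \<pi>s j V c
    assume f: "qdom (Suc k) f \<pi>s" and j: "j < Suc k" "open V" "fsupp f \<subseteq> V" "\<forall>x\<in>V. (\<pi>s ! j) x = c"
    show "Uc T f \<pi>s = 0"
      by (rule Uc_local[OF j(2) qdomD(1)[OF f] fsupp_subset_off[OF j(3)] qdomD(5,4)[OF f], where u = "\<pi>s ! j" and c = c])
         (use j qdomD(4)[OF f] in auto)
  qed
  show "\<forall>R>0. \<exists>\<mu>. finite_radon \<mu> \<and> (\<forall>f \<pi>s. qdom (Suc k) f \<pi>s \<and> fsupp f \<subseteq> ball 0 R \<longrightarrow>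
          cmod (Uc T f \<pi>s) \<le> lprod R \<pi>s * (\<integral>x. indicator (ball 0 R) x * cmod (f x) \<partial>\<mu>))"
  proof (intro allI impI)
    fix R :: real assume "R > 0"
    from Uc_mass[OF this] obtain \<mu> where \<mu>: "finite_radon \<mu>" "\<forall>f \<pi>s. is_qlip f \<and> (\<forall>x. R \<le> norm x \<longrightarrow> f x = 0) \<and> (qlips \<pi>s) \<and> length \<pi>s = Suc k
      \<longrightarrow> cmod (Uc T f \<pi>s) \<le> lprod R \<pi>s * L1norm \<mu> f" by (elim exE conjE) (rule that)
    have b: "cmod (Uc T f \<pi>s) \<le> lprod R \<pi>s * (\<integral>x. indicator (ball 0 R) x * cmod (f x) \<partial>\<mu>)"
      if f: "qdom (Suc k) f \<pi>s" and s: "fsupp f \<subseteq> ball 0 R" for f \<pi>s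
    proof -
      have z: "f x = 0" if "R \<le> norm x" for x by (rule fsupp_subset_off[OF s]) (use that in simp)
      have e: "indicator (ball 0 R) x * cmod (f x) = cmod (f x)" for x
        using z[of x] by (cases "norm x < R") (auto simp: indicator_def)
      show ?thesis unfolding e by (rule \<mu>(2)[THEN spec, THEN spec, THEN mp]) (use z qdomD[OF f] in auto)
    qed
    show "\<exists>\<mu>. finite_radon \<mu> \<and> (\<forall>f \<pi>s. qdom (Suc k) f \<pi>s \<and> fsupp f \<subseteq> ball 0 R \<longrightarrow>
          cmod (Uc T f \<pi>s) \<le> lprod R \<pi>s * (\<integral>x. indicator (ball 0 R) x * cmod (f x) \<partial>\<mu>))"
      by (rule exI[of _ \<mu>]) (use \<mu>(1) b in blast)
  qed
  show "\<forall>F P f \<pi>s. (\<forall>n. qdom (Suc k) (F n) (P n)) \<and> qdom (Suc k) f \<pi>s \<and>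
        (\<forall>x. (\<lambda>n. F n x) \<longlonglongrightarrow> f x) \<and> (\<forall>j<Suc k. \<forall>x. (\<lambda>n. (P n ! j) x) \<longlonglongrightarrow> (\<pi>s ! j) x) \<and>
        (\<exists>R C. \<forall>n. fsupp (F n) \<subseteq> ball 0 R \<and> lipc UNIV (F n) \<le> C) \<and>
        (\<forall>R. \<exists>C. \<forall>n. \<forall>j<Suc k. lipc (ball 0 R) (P n ! j) \<le> C)
      \<longrightarrow> (\<lambda>n. Uc T (F n) (P n)) \<longlonglongrightarrow> Uc T f \<pi>s"
    by (intro allI impI, elim conjE exE, rule Uc_qcurrent_cont) (auto simp only:)
qed

text \<open>The two numbers shift differently, by the two alternatives of \<open>Om_vanish\<close>:
  \<open>dba\<close> kills a holomorphic slot, so \<open>n\<close> of them still suffice, while the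
  deleted slot may be antiholomorphic, so one more is asked for.\<close>

lemma Uc_bidim:
  assumes h: "van_prop holo_on n k T" and a: "van_prop aholo m k T"
  shows "qbidim (Suc k) (int n - 1) (int (Suc m) - 1) (Uc T)"
proof (rule qbidimI)
  fix f :: "'a \<Rightarrow> complex" and \<pi>s V
  assume f: "qdom (Suc k) f \<pi>s" and V: "open V" "\<And>x. x \<notin> V \<Longrightarrow> f x = 0"
  show "Uc T f \<pi>s = 0" if c: "n \<le> length (filter (holo_on V) \<pi>s)"
  proof (rule Uc_vanish[where P = holo_on and n = n, OF holo_on_subset holo_dil holo_Av h _ V(1) qdomD(1)[OF f] V(2) qdomD(5,4)[OF f]])
    show "n \<le> length (filter (holo_on V) \<pi>s) \<and> (\<forall>V g. open V \<and> smooth g \<and> holo_on V g \<longrightarrow> (\<forall>x\<in>V. dba g x = 0)) \<or> Suc n \<le> length (filter (holo_on V) \<pi>s)"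
      using c holo_dba by blast
  qed
  show "Uc T f \<pi>s = 0" if c: "Suc m \<le> length (filter (aholo V) \<pi>s)"
  proof (rule Uc_vanish[where P = aholo and n = m, OF _ _ _ a _ V(1) qdomD(1)[OF f] V(2) qdomD(5,4)[OF f]])
    show "aholo V' g" if "aholo V g" "V' \<subseteq> V" for V V' :: "'a set" and g using that holo_on_subset unfolding aholo_def by blast
    show "aholo {x. scaleC (exp \<zeta>) x \<in> V} (dil \<zeta> g)" if "aholo V g" for V :: "'a set" and g \<zeta>
      using holo_dil[OF that[unfolded aholo_def], of \<zeta>] unfolding aholo_def dil_def .
    show "aholo V' (Av a g)" if "aholo V g" "is_qlip g" "open V'" "\<And>u x. u \<in> {0..1} \<Longrightarrow> x \<in> V' \<Longrightarrow> flow a u x \<in> V" for V V' :: "'a set" and g a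
      unfolding aholo_def Av_cnj by (rule holo_Av[OF that(1)[unfolded aholo_def] is_qlip_cnj[OF that(2)] that(3,4)])
  qed (use c in blast)
qed

text \<open>The boundary of the boundary has the constant 1 as a slot, so it is 0 by locality and
  satisfies the locale conditions trivially. The whole construction is thereby available for
  \<open>D\<close>.\<close>

lemma D_normal:
  assumes "k \<noteq> 0" shows "normal_shell (k - 1) D \<delta> M \<nu>' \<nu>'"
proof -
  interpret D: shell_current "k - 1" D \<delta> M \<nu>' using bdry assms by simp
  have zero: "D (\<lambda>_. 1) (f # \<pi>s) = 0" if "k - 1 \<noteq> 0" "is_qlip f" "length \<pi>s = k - 1 - 1" "qlips \<pi>s" for f and \<pi>s :: "('a \<Rightarrow> complex) list"
  proof -
    have "T (\<lambda>_. 1) ([] @ (\<lambda>_. 1) # (f # \<pi>s)) = 0" by (rule local[where V = UNIV and c = 1]) (use that in auto)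
    then show ?thesis by simp
  qed
  show ?thesis
  proof (unfold_locales, rule disj_imp[THEN iffD2], rule impI)
    assume k: "k - 1 \<noteq> 0"
    show "shell_current (k - 1 - 1) (\<lambda>f \<pi>s. D (\<lambda>_. 1) (f # \<pi>s)) \<delta> M \<nu>'"
    proof (rule shell_current.intro[OF delta_pos delta_le D.radon D.conc], goal_cases)
      case (1 f g \<pi>s a b)
      then show ?case by (simp only: zero[OF k] is_qlip_lincomb) simp
    next
      case (2 f u v us vs a b)
      have "D (\<lambda>_. 1) (f # (us @ w # vs)) = 0" if "is_qlip w" for w by (rule zero[OF k]) (use 2 that in auto)
      from this[OF 2(2)] this[OF 2(3)] this[OF is_qlip_lincomb[OF 2(2,3)]] show ?case by simp
    next
      case (3 V f u us vs c)
      show ?case by (rule zero[OF k]) (use 3 in auto)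
    next
      case (4 R f \<pi>s)
      have "0 \<le> lprod R \<pi>s * L1norm \<nu>' f" using prod_list_lipc_nonneg[OF 4(4)] by simp
      then show ?case using zero[OF k] 4 by simp
    next
      case (5 F f P \<pi>s)
      have q: "is_qlip (P n ! j)" "is_qlip (\<pi>s ! j)" if "j < k - 1 - 1" for n j using 5(4)[OF that] qconv_qlip qconv_qlip_lim by blast+
      have "qlips (P n)" "qlips \<pi>s" for n using q 5(2)[of n] 5(3) by (metis in_set_conv_nth)+
      then show ?case using zero[OF k] 5 qconv_qlip[OF 5(1)] qconv_qlip_lim[OF 5(1)] by simp
    qed
  qed
qed

text \<open>In the cone formula \<open>f\<close> is a slot on the left and therefore mollified,
  while on the right it is a coefficient. The mass bound shows that mollifying the coefficient of
  \<open>Us D\<close> leaves the limit unchanged.\<close>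

lemma Us_D_mol_tendsto:
  assumes f: "is_qlip f" "\<And>x. R \<le> norm x \<Longrightarrow> f x = 0" and R: "R > 0" and p: "qlips \<pi>s" "length \<pi>s = k"
  shows "(\<lambda>n. Us D (mol (hn n) f) (map (mol (hn n)) \<pi>s)) \<longlonglongrightarrow> Uc D f \<pi>s"
proof (cases "k = 0")
  case True
  then have "Us D g (map (mol (hn n)) \<pi>s) = 0" for g n using p by (simp add: Us_def Om_def)
  then show ?thesis by (simp add: Uc_def)
next
  case False
  interpret D: normal_shell "k - 1" D \<delta> M \<nu>' \<nu>' by (rule D_normal[OF False])
  have l: "length \<pi>s = Suc (k - 1)" using p False by simp
  have R2: "2 * R > 0" and R20: "2 * R \<ge> 0" using R by auto
  have f2: "f x = 0" if "2 * R \<le> norm x" for x using f(2) that R by simp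
  have m2: "mol (hn n) f x = 0" if "2 * R \<le> norm x" for n x
    by (rule mol_support[OF f(2) less_imp_le[OF hn(1)] hn(2) that R])
  obtain \<mu> where "mass_on (Us D) k (2 * R) \<mu>" using Us_D_mass[OF R2] by (rule exE)
  note m = mass_onD[OF this]
  define K where "K = lprod (2*R) \<pi>s"
  have K: "0 \<le> K" unfolding K_def by (rule prod_list_lipc_nonneg[OF p(1)])
  define E where "E = 2 * lipc (ball 0 (2*R)) f * (2*R)"
  have E: "cmod (mol (hn n) f x - f x) \<le> E * hn n" for n x
  proof (cases "norm x < 2 * R")
    case True
    show ?thesis unfolding E_def by (rule mol_close[OF f(1) is_qlip_lipc[OF f(1)] less_imp_le[OF hn(1)] True])
  next
    case False
    have "0 \<le> E * hn n" unfolding E_def using lipc_nonneg[OF f(1)] R less_imp_le[OF hn(1)[of n]] by simp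
    then show ?thesis using False f2[of x] m2[of x n] by simp
  qed
  have d: "cmod (Us D (mol (hn n) f) (map (mol (hn n)) \<pi>s) - Us D f (map (mol (hn n)) \<pi>s)) \<le> K * (E * measure \<mu> UNIV) * hn n" for n
  proof -
    have sm: "smooths (map (mol (hn n)) \<pi>s)" by (rule smooth_map_mol[OF p(1) hn(1)])
    have qd: "is_qlip (\<lambda>x. mol (hn n) f x - f x)" using f by auto
    have "Us D (mol (hn n) f) (map (mol (hn n)) \<pi>s) - Us D f (map (mol (hn n)) \<pi>s) = Us D (\<lambda>x. mol (hn n) f x - f x) (map (mol (hn n)) \<pi>s)"
      using D.Us_coeff[OF is_qlip_mol[OF f(1), of "hn n"] f(1) sm _ R2 m2 f2, of 1 "-1"] l by simp
    also have "cmod \<dots> \<le> lprod (2*R) (map (mol (hn n)) \<pi>s) * (\<integral>x. cmod (mol (hn n) f x - f x) \<partial>\<mu>)"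
      by (rule m(2)[OF qd _ sm]) (use m2 f2 p in auto)
    also have "\<dots> \<le> K * (E * hn n * measure \<mu> UNIV)"
    proof (rule mult_mono)
      have "prod_list (map (\<lambda>\<pi>. lipc (ball 0 (2*R)) (mol (hn n) \<pi>)) \<pi>s) \<le> lprod (2*R) \<pi>s"
        by (rule prod_list_mono[THEN conjunct2]) (use p R2 hn(1)[of n] in \<open>auto intro!: lipc_nonneg lipc_mol\<close>)
      then show "lprod (2*R) (map (mol (hn n)) \<pi>s) \<le> K" by (simp add: o_def K_def)
      show "(\<integral>x. cmod (mol (hn n) f x - f x) \<partial>\<mu>) \<le> E * hn n * measure \<mu> UNIV" by (rule integral_cmod_le[OF m(1) qd E])
    qed (use K in auto)
    finally show ?thesis by (simp add: mult_ac)
  qed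
  have "(\<lambda>n. K * (E * measure \<mu> UNIV) * hn n) \<longlonglongrightarrow> K * (E * measure \<mu> UNIV) * 0" by (intro tendsto_intros hn_lim)
  then have "(\<lambda>n. K * (E * measure \<mu> UNIV) * hn n) \<longlonglongrightarrow> 0" by simp
  then have "(\<lambda>n. Us D (mol (hn n) f) (map (mol (hn n)) \<pi>s) - Us D f (map (mol (hn n)) \<pi>s)) \<longlonglongrightarrow> 0"
    by (rule Lim_null_comparison[rotated]) (use d in \<open>auto intro!: always_eventually\<close>)
  from tendsto_add[OF this D.Uc_tendsto[OF R f p(1) l]] show ?thesis by simp
qed

text \<open>\<open>\<sigma>\<close> is exchanged for \<open>cut (2*R)\<close>, which is 1 on the
  ball containing all mollifications of \<open>f\<close>; the formula for smooth data then passes to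
  the limit. The exchange uses \<open>Uc_local\<close> on the complement of the support, where the
  slot \<open>f\<close> is constantly 0.\<close>

lemma Uc_boundary:
  assumes f: "qdom k f \<pi>s" and s: "is_qtest \<sigma>" and V: "open V" "fsupp f \<subseteq> V" "\<And>x. x \<in> V \<Longrightarrow> \<sigma> x = 1"
  shows "Uc T \<sigma> (f # \<pi>s) = T f \<pi>s - Uc D f \<pi>s"
proof -
  note q = qdomD(2)[OF f] and l = qdomD(4)[OF f] and p = qdomD(5)[OF f]
  obtain R1 where R1: "R1 > 0" "\<forall>x. R1 \<le> norm x \<longrightarrow> f x = 0" using qdomD(3)[OF f] by (elim exE conjE) (rule that)
  obtain R2 where R2: "R2 > 0" "\<forall>x. R2 \<le> norm x \<longrightarrow> \<sigma> x = 0" using qtest_bounded_support(2)[OF s] by (elim exE conjE) (rule that)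
  define R where "R = max R1 R2"
  have R: "R > 0" "2 * R > 0" "2 * R + 1 > 0" unfolding R_def using R1(1) by auto
  have zf: "f x = 0" if "R \<le> norm x" for x using R1(2) that unfolding R_def by simp
  have zs: "\<sigma> x = 0" if "2 * R + 1 \<le> norm x" for x
  proof -
    have "R2 \<le> norm x" using that R(1) unfolding R_def by linarith
    then show ?thesis using R2(2) by blast
  qed
  have p': "qlips (f # \<pi>s)" "length (f # \<pi>s) = Suc k" using p q l by auto
  have "is_lip \<sigma>" using s unfolding is_qtest_def by blast
  then obtain Ls where "Ls-lipschitz_on UNIV \<sigma>" unfolding is_lip_def by blast
  from lipschitz_on_diff[OF this cut_lip] have "is_lip (\<lambda>x. \<sigma> x - cut (2*R) x)" unfolding is_lip_def by blast
  then have gt: "is_qtest (\<lambda>x. \<sigma> x - cut (2*R) x)" by (rule is_qtestI[where R = "2*R+1"]) (use zs cut_0 in auto)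
  have fs: "fsupp f \<subseteq> cball 0 R" unfolding fsupp_def
    by (rule closure_minimal) (use zf in \<open>auto simp: not_le[symmetric] intro: ccontr\<close>)
  have "Uc T (\<lambda>x. \<sigma> x - cut (2*R) x) (f # \<pi>s) = 0"
  proof (rule Uc_local[OF _ gt _ p', where V = "- fsupp f" and u = f and c = 0])
    show "open (- fsupp f)" unfolding fsupp_def by (rule open_Compl) simp
    show "\<sigma> x - cut (2*R) x = 0" if "x \<notin> - fsupp f" for x
    proof -
      have "x \<in> V" "norm x \<le> 2 * R" using that V(2) fs R by auto
      then show ?thesis using V(3) cut_1 by simp
    qed
    show "f x = 0" if "x \<in> - fsupp f" for x using fsupp_subset_off[of f "fsupp f" x] that by simp
  qed simp
  moreover have "Uc T (\<lambda>x. 1 * \<sigma> x + (-1) * cut (2*R) x) (f # \<pi>s) = 1 * Uc T \<sigma> (f # \<pi>s) + (-1) * Uc T (cut (2*R)) (f # \<pi>s)"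
    by (rule Uc_coeff[OF R(3) qtest_bounded_support(1)[OF s] zs cut_qlip cut_0 p'])
  ultimately have e1: "Uc T \<sigma> (f # \<pi>s) = Uc T (cut (2*R)) (f # \<pi>s)" by simp
  have "Us T (cut (2*R)) (map (mol (hn n)) (f # \<pi>s)) = T (mol (hn n) f) (map (mol (hn n)) \<pi>s) - Us D (mol (hn n) f) (map (mol (hn n)) \<pi>s)" for n
    unfolding list.map
    by (rule Us_boundary[OF smooth_mol(1)[OF q hn(1)] smooth_map_mol[OF p hn(1)] _ R(2) mol_support[OF zf less_imp_le[OF hn(1)] hn(2) _ R(1)] cut_qlip cut_1 cut_0 R(3)])
       (use l in auto)
  moreover have "(\<lambda>n. T (mol (hn n) f) (map (mol (hn n)) \<pi>s)) \<longlonglongrightarrow> T f \<pi>s"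
  proof -
    have mq: "qconv (\<lambda>n. mol (hn n) g) g" if "is_qlip g" for g by (rule qconv_mol_approx[OF that less_imp_le[OF hn(1)] hn_lim])
    have "list_all2 qconv (map (\<lambda>p n. mol (hn n) p) \<pi>s) \<pi>s"
      using p mq by (induction \<pi>s) auto
    from cont_lists[OF mq[OF q] this l] show ?thesis by (simp add: o_def)
  qed
  moreover have "(\<lambda>n. Us D (mol (hn n) f) (map (mol (hn n)) \<pi>s)) \<longlonglongrightarrow> Uc D f \<pi>s"
    by (rule Us_D_mol_tendsto[OF q zf R(1) p l])
  ultimately have "(\<lambda>n. Us T (cut (2*R)) (map (mol (hn n)) (f # \<pi>s))) \<longlonglongrightarrow> T f \<pi>s - Uc D f \<pi>s"
    by (simp only: tendsto_diff)
  moreover have "(\<lambda>n. Us T (cut (2*R)) (map (mol (hn n)) (f # \<pi>s))) \<longlonglongrightarrow> Uc T (cut (2*R)) (f # \<pi>s)"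
    by (rule Uc_tendsto[OF R(3) cut_qlip cut_0 p'])
  ultimately show ?thesis unfolding e1 by (rule LIMSEQ_unique[rotated])
qed

end

section \<open>From metric currents with bounded support to shell currents\<close>

lemma is_lipbI: "C-lipschitz_on UNIV f \<Longrightarrow> (\<And>x. cmod (f x) \<le> B) \<Longrightarrow> is_lipb f"
  unfolding is_lipb_def is_lip_def bounded_iff by auto

lemma is_lipb_bounds:
  assumes "is_lipb f"
  shows "\<exists>C B. C-lipschitz_on UNIV f \<and> (\<forall>x. cmod (f x) \<le> B) \<and> 0 \<le> B"
proof -
  obtain C where C: "C-lipschitz_on UNIV f" using assms unfolding is_lipb_def is_lip_def by blast
  obtain B where B: "\<forall>x. cmod (f x) \<le> B" using assms unfolding is_lipb_def bounded_iff by auto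
  have "0 \<le> B" using B order_trans[OF norm_ge_zero] by blast
  then show ?thesis using C B by blast
qed

lemma is_lipb_mult: 
  assumes "is_lipb f" "is_lipb g" shows "is_lipb (\<lambda>x. f x * g x)"
proof -
  obtain C B where f: "C-lipschitz_on UNIV f" "\<forall>x. cmod (f x) \<le> B" "0 \<le> B" using is_lipb_bounds[OF assms(1)] by (elim exE conjE) (rule that)
  obtain C' B' where g: "C'-lipschitz_on UNIV g" "\<forall>x. cmod (g x) \<le> B'" "0 \<le> B'" using is_lipb_bounds[OF assms(2)] by (elim exE conjE) (rule that)
  show ?thesis
    by (rule is_lipbI[OF lipschitz_on_mult[OF f(1) g(1), where A = B and B = B'], where B = "B * B'"]) (use f g in \<open>auto simp: norm_mult intro: mult_mono\<close>)
qed

lemma is_lip_lincomb: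
  assumes "is_lip f" "is_lip g" shows "is_lip (\<lambda>x. a * f x + b * g x)"
  using assms lipschitz_on_add[OF lipschitz_on_cmul lipschitz_on_cmul] unfolding is_lip_def by blast

lemma is_lipb_lincomb:
  assumes "is_lipb f" "is_lipb g" shows "is_lipb (\<lambda>x. a * f x + b * g x)"
proof -
  obtain C B where f: "C-lipschitz_on UNIV f" "\<forall>x. cmod (f x) \<le> B" "0 \<le> B" using is_lipb_bounds[OF assms(1)] by (elim exE conjE) (rule that)
  obtain C' B' where g: "C'-lipschitz_on UNIV g" "\<forall>x. cmod (g x) \<le> B'" "0 \<le> B'" using is_lipb_bounds[OF assms(2)] by (elim exE conjE) (rule that)
  have "cmod (a * f x + b * g x) \<le> cmod a * B + cmod b * B'" for x
    by (rule norm_triangle_le) (use f g in \<open>auto simp: norm_mult intro!: add_mono mult_left_mono\<close>)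
  then show ?thesis by (rule is_lipbI[OF lipschitz_on_add[OF lipschitz_on_cmul[OF f(1)] lipschitz_on_cmul[OF g(1)]]])
qed

lemma is_lipb_const: "is_lipb (\<lambda>_. c)"
  by (rule is_lipbI[of 0 _ "cmod c"]) (auto simp: lipschitz_on_def)

lemma is_lipb_soft:
  assumes "is_lipb f" "0 < e" shows "is_lipb (\<lambda>x. soft e (f x))"
proof -
  obtain C B where f: "C-lipschitz_on UNIV f" "\<forall>x. cmod (f x) \<le> B" "0 \<le> B" using is_lipb_bounds[OF assms(1)] by (elim exE conjE) (rule that)
  have "cmod (soft e (f x)) \<le> B + e" for x
    using soft_close[of e "f x"] f(2) assms(2) norm_triangle_ineq4[of "f x" "rr e (f x)"] norm_rr[of e "f x"] by (smt (verit) soft_def)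
  then show ?thesis
    by (rule is_lipbI[OF lipschitz_on_compose2[OF f(1) lipschitz_on_subset[OF soft_lipschitz[OF assms(2)] subset_UNIV]]])
qed

lemma lipc_UNIV_nonneg: "is_lip f \<Longrightarrow> 0 \<le> lipc UNIV f"
  unfolding is_lip_def using lipschitz_on_nonneg[OF lipc_lipschitz] by blast

lemma prod_list_lipc_UNIV_nonneg: "\<forall>\<pi>\<in>set \<pi>s. is_lip \<pi> \<Longrightarrow> 0 \<le> prod_list (map (lipc UNIV) \<pi>s)"
  by (induction \<pi>s) (auto simp: lipc_UNIV_nonneg)

lemma integral_cmod_indicator:
  fixes \<mu> :: "'a::metric_space measure"
  assumes r: "finite_radon \<mu>" and S: "S \<in> sets borel" and B: "0 \<le> B" and f: "\<And>x. cmod (f x) \<le> B * indicator S x"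
  shows "L1norm \<mu> f \<le> B * measure \<mu> S"
proof -
  interpret finite_measure \<mu> by (rule finite_radon_finite_measure[OF r])
  have S': "S \<in> sets \<mu>" using r S by (simp add: finite_radon_def)
  have "L1norm \<mu> f \<le> (\<integral>x. B * indicator S x \<partial>\<mu>)"
    by (rule integral_mono') (use S' B f in \<open>auto simp: emeasure_eq_measure\<close>)
  also have "\<dots> = B * measure \<mu> S" using sets.sets_into_space[OF S'] by (simp add: Int_absorb2)
  finally show ?thesis .
qed

lemma mcurrent_lin:
  assumes "mcurrent k T" "mdom k f \<pi>s" "mdom k g \<pi>s"
  shows "T (\<lambda>x. a * f x + b * g x) \<pi>s = a * T f \<pi>s + b * T g \<pi>s"
  using assms unfolding mcurrent_def multilinear_on_def by blast

lemma mcurrent_slot: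
  assumes "mcurrent k T" "j < k" "mdom k f (\<pi>s[j := u])" "mdom k f (\<pi>s[j := v])"
  shows "T f (\<pi>s[j := (\<lambda>x. a * u x + b * v x)]) = a * T f (\<pi>s[j := u]) + b * T f (\<pi>s[j := v])"
  using assms unfolding mcurrent_def multilinear_on_def by blast

lemma mcurrent_mass: "mcurrent k T \<Longrightarrow> \<exists>\<mu>. mass_bound k T \<mu>"
  unfolding mcurrent_def by blast

lemma mass_boundD:
  assumes "mass_bound k T \<mu>"
  shows "finite_radon \<mu>" "mdom k f \<pi>s \<Longrightarrow> cmod (T f \<pi>s) \<le> prod_list (map (lipc UNIV) \<pi>s) * L1norm \<mu> f"
  using assms unfolding mass_bound_def by auto

text \<open>Soft thresholding makes the support of the first entry a closed subset of the set where it does not vanish.\<close>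

lemma mcurrent_soft:
  assumes T: "mcurrent k T" and g: "mdom k g \<rho>"
    and z: "\<And>g'. mdom k g' \<rho> \<Longrightarrow> fsupp g' \<subseteq> {x. g x \<noteq> 0} \<Longrightarrow> T g' \<rho> = 0"
  shows "T g \<rho> = 0"
proof -
  obtain \<mu> where m: "mass_bound k T \<mu>" using mcurrent_mass[OF T] by (rule exE)
  note r = mass_boundD(1)[OF m]
  have gl: "is_lipb g" "length \<rho> = k" "\<forall>\<pi>\<in>set \<rho>. is_lip \<pi>" using g unfolding mdom_def by auto
  obtain C where C: "C-lipschitz_on UNIV g" using gl(1) unfolding is_lipb_def is_lip_def by blast
  have cg: "continuous_on UNIV g" by (rule lipschitz_on_continuous_on[OF C])
  have "cmod (T g \<rho>) \<le> (prod_list (map (lipc UNIV) \<rho>) * measure \<mu> UNIV) * e" if e: "e > 0" for e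
  proof -
    define h where "h x = soft e (g x)" for x
    have h: "mdom k h \<rho>" unfolding mdom_def h_def using is_lipb_soft[OF gl(1) e] gl by auto
    have "closed {x. e \<le> cmod (g x)}" by (intro closed_Collect_le continuous_intros cg)
    moreover have "e \<le> cmod (g x)" if "h x \<noteq> 0" for x
      using soft_zero[of "g x" e] that unfolding h_def by linarith
    then have "{x. h x \<noteq> 0} \<subseteq> {x. e \<le> cmod (g x)}" by blast
    ultimately have "fsupp h \<subseteq> {x. e \<le> cmod (g x)}" unfolding fsupp_def by (intro closure_minimal)
    also have "\<dots> \<subseteq> {x. g x \<noteq> 0}" using e by auto
    finally have "T h \<rho> = 0" by (rule z[OF h])
    then have "T g \<rho> = T (\<lambda>x. 1 * g x + (-1) * h x) \<rho>" using mcurrent_lin[OF T g h, of 1 "-1"] by simp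
    also have "cmod \<dots> \<le> prod_list (map (lipc UNIV) \<rho>) * (\<integral>x. cmod (1 * g x + (-1) * h x) \<partial>\<mu>)"
      by (rule mass_boundD(2)[OF m], unfold mdom_def, intro conjI is_lipb_lincomb gl) (use h in \<open>simp add: mdom_def\<close>)
    also have "\<dots> \<le> prod_list (map (lipc UNIV) \<rho>) * (e * measure \<mu> UNIV)"
      by (intro mult_left_mono integral_cmod_indicator[OF r] prod_list_lipc_UNIV_nonneg gl) (use e soft_close[of e] in \<open>auto simp: h_def\<close>)
    finally show ?thesis by (simp add: mult_ac)
  qed
  then show ?thesis by (rule cmod_eq_zero_if_small)
qed

lemma mcurrent_local:
  assumes T: "mcurrent k T" and V: "open V" and g: "mdom k g \<rho>" "\<And>x. x \<notin> V \<Longrightarrow> g x = 0"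
    and j: "j < k" "\<And>x. x \<in> V \<Longrightarrow> (\<rho> ! j) x = c"
  shows "T g \<rho> = 0"
proof (rule mcurrent_soft[OF T g(1)])
  fix g' assume g': "mdom k g' \<rho>" "fsupp g' \<subseteq> {x. g x \<noteq> 0}"
  have "fsupp g' \<subseteq> V" using g'(2) g(2) by blast
  then have "mdom k g' \<rho> \<and> (\<exists>j<k. \<exists>V c. open V \<and> fsupp g' \<subseteq> V \<and> (\<forall>x\<in>V. (\<rho> ! j) x = c))"
    by (intro conjI g'(1) exI[of _ j] exI[of _ V] exI[of _ c] ballI j V)
  moreover have "local_on (mdom k) k T" using T unfolding mcurrent_def by (elim conjE)
  ultimately show "T g' \<rho> = 0" unfolding local_on_def by (elim allE impE)
qed

text \<open>The slots are exchanged one at a time; by linearity each exchange costs a value with a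
  slot that vanishes on \<open>V\<close>, which is 0 by locality.\<close>

lemma mcurrent_slot_cong:
  assumes T: "mcurrent k T" and V: "open V" and g: "mdom k g \<rho>" "mdom k g \<rho>'" "\<And>x. x \<notin> V \<Longrightarrow> g x = 0"
    and eq: "\<And>j x. j < k \<Longrightarrow> x \<in> V \<Longrightarrow> (\<rho> ! j) x = (\<rho>' ! j) x"
  shows "T g \<rho> = T g \<rho>'"
proof -
  have l: "length \<rho> = k" "length \<rho>' = k" and gl: "is_lipb g" and p: "\<forall>\<pi>\<in>set \<rho>. is_lip \<pi>" "\<forall>\<pi>\<in>set \<rho>'. is_lip \<pi>"
    using g unfolding mdom_def by auto
  have "T g (take i \<rho>' @ drop i \<rho>) = T g \<rho>" if "i \<le> k" for i
    using that
  proof (induction i)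
    case (Suc i)
    let ?s = "take i \<rho>' @ drop i \<rho>"
    have i: "i < k" using Suc.prems by simp
    have ls: "length ?s = k" using l i by simp
    have e1: "?s[i := \<rho>' ! i] = take (Suc i) \<rho>' @ drop (Suc i) \<rho>"
      using l i by (simp add: list_update_append take_Suc_conv_app_nth Cons_nth_drop_Suc[symmetric])
    have e0: "?s[i := \<rho> ! i] = ?s"
      using l i by (simp add: list_update_append Cons_nth_drop_Suc[symmetric])
    have ss: "\<forall>\<pi>\<in>set ?s. is_lip \<pi>" using p set_take_subset[of i \<rho>'] set_drop_subset[of i \<rho>] by auto
    have lip: "is_lip (\<rho>' ! i)" "is_lip (\<rho> ! i)" using p l i by auto
    have dm: "mdom k g (?s[i := w])" if "is_lip w" for w
      unfolding mdom_def using gl ls ss that set_update_subset_insert[of ?s i w] by auto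
    have "T g (?s[i := (\<lambda>x. 1 * (\<rho>' ! i) x + (-1) * (\<rho> ! i) x)]) = 0"
    proof (rule mcurrent_local[OF T V dm g(3) i, where c = 0])
      show "is_lip (\<lambda>x. 1 * (\<rho>' ! i) x + (-1) * (\<rho> ! i) x)" by (rule is_lip_lincomb[OF lip])
      show "(?s[i := (\<lambda>x. 1 * (\<rho>' ! i) x + (-1) * (\<rho> ! i) x)] ! i) x = 0" if "x \<in> V" for x
        using eq[OF i that] i ls by (simp add: nth_list_update_eq)
    qed
    then have "T g (?s[i := \<rho>' ! i]) = T g (?s[i := \<rho> ! i])"
      unfolding mcurrent_slot[OF T i dm[OF lip(1)] dm[OF lip(2)]] by simp
    then show ?case using Suc e0 e1 by simp
  qed simp
  from this[of k] show ?thesis using l by simp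
qed

text \<open>The measure that gives a point outside the support a null ball depends on the point, so
  what is passed on is the vanishing of \<open>T\<close> on functions living in the ball.\<close>

lemma null_ball:
  assumes T: "mcurrent k T" and x: "x \<notin> current_supp k T"
  shows "\<exists>r>0. \<forall>g \<pi>s. mdom k g \<pi>s \<longrightarrow> (\<forall>y. y \<notin> ball x r \<longrightarrow> g y = 0) \<longrightarrow> T g \<pi>s = 0"
proof -
  obtain r \<mu> where r: "r > 0" "mass_bound k T \<mu>" "emeasure \<mu> (ball x r) = 0"
    using x unfolding current_supp_def by (auto simp: not_gr_zero)
  have s: "sets \<mu> = sets borel" using mass_boundD(1)[OF r(2)] by (simp add: finite_radon_def)
  have n: "ball x r \<in> null_sets \<mu>" by (rule null_setsI) (use r s in auto)
  have "T g \<pi>s = 0" if g: "mdom k g \<pi>s" "\<forall>y. y \<notin> ball x r \<longrightarrow> g y = 0" for g \<pi>s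
  proof -
    have "AE y in \<mu>. cmod (g y) = 0" using AE_not_in[OF n] by eventually_elim (use g(2) in auto)
    then have "(\<integral>y. cmod (g y) \<partial>\<mu>) = 0" by (rule integral_eq_zero_AE)
    then show ?thesis using mass_boundD(2)[OF r(2) g(1)] by simp
  qed
  then show ?thesis using r(1) by blast
qed

definition bump :: "'a::metric_space \<Rightarrow> real \<Rightarrow> 'a \<Rightarrow> complex" where
  "bump x r y = of_real (max 0 (min 1 (2 - 2 * dist x y / r)))"

lemma bump:
  assumes r: "r > 0"
  shows "is_lipb (bump x r)" "dist x y \<le> r / 2 \<Longrightarrow> bump x r y = 1" "y \<notin> ball x r \<Longrightarrow> bump x r y = 0" "cmod (1 - bump x r y) \<le> 1"
proof -
  show "is_lipb (bump x r)"
  proof (rule is_lipbI[where B = 1])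
    show "(2 / r)-lipschitz_on UNIV (bump x r)"
    proof (rule lipschitz_onI)
      fix y z :: 'a
      have "\<bar>max 0 (min 1 (2 - 2 * dist x y / r)) - max 0 (min 1 (2 - 2 * dist x z / r))\<bar> \<le> \<bar>2 * dist x y / r - 2 * dist x z / r\<bar>" by linarith
      also have "2 * dist x y / r - 2 * dist x z / r = 2 / r * (dist x y - dist x z)" by (simp add: right_diff_distrib diff_divide_distrib)
      also have "\<bar>2 / r * (dist x y - dist x z)\<bar> = 2 / r * \<bar>dist x y - dist x z\<bar>" unfolding abs_mult using r by simp
      also have "\<dots> \<le> 2 / r * dist y z"
        using r dist_triangle[of x y z] dist_triangle[of x z y] dist_commute[of y z] by (intro mult_left_mono) (auto simp: abs_le_iff)
      finally show "dist (bump x r y) (bump x r z) \<le> 2 / r * dist y z"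
        unfolding bump_def dist_norm by (simp add: norm_of_real flip: of_real_diff)
    qed (use r in simp)
    show "cmod (bump x r y) \<le> 1" for y unfolding bump_def by (simp add: norm_of_real)
  qed
  show "bump x r y = 1" if "dist x y \<le> r / 2"
  proof -
    have "2 * dist x y / r \<le> 1" using that r by (simp add: divide_simps)
    then show ?thesis by (simp add: bump_def)
  qed
  show "bump x r y = 0" if "y \<notin> ball x r"
  proof -
    have "2 \<le> 2 * dist x y / r" using that r by (simp add: divide_simps)
    then show ?thesis by (simp add: bump_def)
  qed
  have "1 - bump x r y = of_real (1 - max 0 (min 1 (2 - 2 * dist x y / r)))" by (simp add: bump_def)
  then show "cmod (1 - bump x r y) \<le> 1" by (simp only: norm_of_real)
qed

text \<open>Multiplying by \<open>1 - bump\<close> removes a part living in a null ball, so the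
  value of \<open>T\<close> is unchanged. One factor per ball clears finitely many half balls and
  never increases the modulus.\<close>

lemma mcurrent_null_cover:
  assumes T: "mcurrent k T" and f: "mdom k f \<pi>s" and X: "finite X"
    and r: "\<And>x. x \<in> X \<Longrightarrow> r x > 0 \<and> (\<forall>g \<pi>s. mdom k g \<pi>s \<longrightarrow> (\<forall>y. y \<notin> ball x (r x) \<longrightarrow> g y = 0) \<longrightarrow> T g \<pi>s = 0)"
  shows "\<exists>g. mdom k g \<pi>s \<and> T g \<pi>s = T f \<pi>s \<and> (\<forall>y. cmod (g y) \<le> cmod (f y)) \<and> (\<forall>x\<in>X. \<forall>y. dist x y \<le> r x / 2 \<longrightarrow> g y = 0)"
  using X r
proof (induction X rule: finite_induct)
  case empty
  then show ?case using f by (intro exI[of _ f]) auto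
next
  case (insert x X)
  have "\<exists>g. mdom k g \<pi>s \<and> T g \<pi>s = T f \<pi>s \<and> (\<forall>y. cmod (g y) \<le> cmod (f y)) \<and> (\<forall>x\<in>X. \<forall>y. dist x y \<le> r x / 2 \<longrightarrow> g y = 0)"
    by (rule insert.IH, rule insert.prems) simp
  then obtain g where g: "mdom k g \<pi>s" "T g \<pi>s = T f \<pi>s" "\<forall>y. cmod (g y) \<le> cmod (f y)" "\<forall>x\<in>X. \<forall>y. dist x y \<le> r x / 2 \<longrightarrow> g y = 0"
    by (elim exE conjE) (rule that)
  have rx: "r x > 0" using insert.prems by blast
  define h where "h y = g y * bump x (r x) y" for y
  have h: "mdom k h \<pi>s" using g(1) is_lipb_mult[OF _ bump(1)[OF rx]] unfolding mdom_def h_def by auto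
  have "\<forall>y. y \<notin> ball x (r x) \<longrightarrow> h y = 0" using bump(3)[OF rx, of _ x] unfolding h_def by simp
  then have "T h \<pi>s = 0" using insert.prems[of x] h by blast
  then have e: "T (\<lambda>y. 1 * g y + (-1) * h y) \<pi>s = T f \<pi>s" using mcurrent_lin[OF T g(1) h, of 1 "-1"] g(2) by simp
  have d: "1 * g y + (-1) * h y = g y * (1 - bump x (r x) y)" for y by (simp add: h_def algebra_simps)
  show ?case
  proof (intro exI[of _ "\<lambda>y. 1 * g y + (-1) * h y"] conjI allI ballI impI e)
    show "mdom k (\<lambda>y. 1 * g y + (-1) * h y) \<pi>s"
      using g(1) h is_lipb_lincomb[of g h 1 "-1"] unfolding mdom_def by blast
    show "cmod (1 * g y + (-1) * h y) \<le> cmod (f y)" for y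
    proof -
      have "cmod (g y) * cmod (1 - bump x (r x) y) \<le> cmod (g y) * 1" by (rule mult_left_mono[OF bump(4)[OF rx]]) simp
      then show ?thesis unfolding d norm_mult using g(3)[rule_format, of y] by linarith
    qed
    show "1 * g y + (-1) * h y = 0" if "z \<in> insert x X" "dist z y \<le> r z / 2" for z y
      unfolding d using that g(4) bump(2)[OF rx] by auto
  qed
qed

text \<open>The complement of \<open>V\<close> is covered by null balls, possibly not by countably
  many. Tightness gives a compact \<open>K\<close> with less than \<open>e\<close> of the mass
  outside; finitely many half balls cover the part of \<open>K\<close> off \<open>V\<close>, and
  after clearing them the function lives off \<open>K\<close>, where the mass bound is
  small.\<close>

lemma mcurrent_support:
  assumes T: "mcurrent k T" and V: "open V" "current_supp k T \<subseteq> V" and f: "mdom k f \<pi>s" "\<And>x. x \<in> V \<Longrightarrow> f x = 0"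
  shows "T f \<pi>s = 0"
proof -
  obtain \<mu> where m: "mass_bound k T \<mu>" using mcurrent_mass[OF T] by (rule exE)
  note rad = mass_boundD(1)[OF m]
  obtain C B where B: "\<forall>x. cmod (f x) \<le> B" "0 \<le> B" using is_lipb_bounds[of f] f(1) unfolding mdom_def by blast
  have "\<forall>x\<in>-V. \<exists>r. r > 0 \<and> (\<forall>g \<pi>s. mdom k g \<pi>s \<longrightarrow> (\<forall>y. y \<notin> ball x r \<longrightarrow> g y = 0) \<longrightarrow> T g \<pi>s = 0)"
    using null_ball[OF T] V(2) by (meson ComplD subsetD)
  from bchoice[OF this] obtain r where r: "\<forall>x\<in>-V. r x > 0 \<and> (\<forall>g \<pi>s. mdom k g \<pi>s \<longrightarrow> (\<forall>y. y \<notin> ball x (r x) \<longrightarrow> g y = 0) \<longrightarrow> T g \<pi>s = 0)"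
    by (rule exE)
  have pr: "0 \<le> prod_list (map (lipc UNIV) \<pi>s)" using f(1) prod_list_lipc_UNIV_nonneg unfolding mdom_def by blast
  have "cmod (T f \<pi>s) \<le> (prod_list (map (lipc UNIV) \<pi>s) * B) * e" if e: "e > 0" for e
  proof -
    obtain K where K: "compact K" "measure \<mu> (- K) < e" using finite_radon_tight[OF rad e] by (elim exE conjE) (rule that)
    have cK: "compact (K \<inter> - V)" by (rule compact_Int_closed[OF K(1)]) (use V(1) in auto)
    have cov: "K \<inter> - V \<subseteq> (\<Union>x\<in>-V. ball x (r x / 2))"
    proof
      fix x assume x: "x \<in> K \<inter> - V"
      then have "x \<in> ball x (r x / 2)" using r by simp
      then show "x \<in> (\<Union>x\<in>-V. ball x (r x / 2))" using x by blast
    qed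
    have op: "\<And>x. x \<in> - V \<Longrightarrow> open (ball x (r x / 2))" by simp
    obtain X where X: "X \<subseteq> - V" "finite X" "K \<inter> - V \<subseteq> (\<Union>x\<in>X. ball x (r x / 2))"
      using compactE_image[OF cK op cov] by blast
    have "\<exists>g. mdom k g \<pi>s \<and> T g \<pi>s = T f \<pi>s \<and> (\<forall>y. cmod (g y) \<le> cmod (f y)) \<and> (\<forall>x\<in>X. \<forall>y. dist x y \<le> r x / 2 \<longrightarrow> g y = 0)"
      by (rule mcurrent_null_cover[OF T f(1) X(2)]) (use r X(1) in blast)
    then obtain g where g: "mdom k g \<pi>s" "T g \<pi>s = T f \<pi>s" "\<forall>y. cmod (g y) \<le> cmod (f y)" "\<forall>x\<in>X. \<forall>y. dist x y \<le> r x / 2 \<longrightarrow> g y = 0"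
      by (elim exE conjE) (rule that)
    have gK: "g y = 0" if "y \<in> K" for y
    proof (cases "y \<in> V")
      case True
      then show ?thesis using g(3)[rule_format, of y] f(2)[of y] by simp
    next
      case False
      then have "y \<in> (\<Union>x\<in>X. ball x (r x / 2))" using X(3) that by blast
      then obtain x where "x \<in> X" "dist x y < r x / 2" by auto
      then show ?thesis using g(4) by (meson less_imp_le)
    qed
    have bK: "- K \<in> sets borel" using compact_imp_closed[OF K(1)] by auto
    have "cmod (T g \<pi>s) \<le> prod_list (map (lipc UNIV) \<pi>s) * L1norm \<mu> g" by (rule mass_boundD(2)[OF m g(1)])
    also have "\<dots> \<le> prod_list (map (lipc UNIV) \<pi>s) * (B * measure \<mu> (- K))"
    proof (intro mult_left_mono integral_cmod_indicator[OF rad bK B(2)] pr)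
      show "cmod (g x) \<le> B * indicator (- K) x" for x
        using gK[of x] g(3)[rule_format, of x] B(1)[rule_format, of x] by (cases "x \<in> K") auto
    qed
    also have "\<dots> \<le> prod_list (map (lipc UNIV) \<pi>s) * (B * e)"
      using pr B(2) K(2) by (intro mult_left_mono) auto
    finally show ?thesis using g(2) by (simp add: mult_ac)
  qed
  then show ?thesis by (rule cmod_eq_zero_if_small)
qed

text \<open>A cutoff to a shell with inner ramp between \<open>d\<close> and \<open>2 * d\<close>
  and outer ramp between \<open>m\<close> and \<open>m + 1\<close>; these ramps are the source of
  the radii in the statements below.\<close>

definition ann :: "real \<Rightarrow> real \<Rightarrow> 'a::real_normed_vector \<Rightarrow> complex" where
  "ann d m x = cut m x * (1 - cut 1 ((1 / d) *\<^sub>R x))"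

lemma ann:
  fixes x :: "'a::real_normed_vector"
  assumes d: "d > 0"
  shows "is_lipb (ann d m :: 'a \<Rightarrow> complex)" "2 * d \<le> norm x \<Longrightarrow> norm x \<le> m \<Longrightarrow> ann d m x = 1"
    "norm x \<le> d \<Longrightarrow> ann d m x = 0" "m + 1 \<le> norm x \<Longrightarrow> ann d m x = 0" "cmod (ann d m x) \<le> 1"
proof -
  have l: "(1 / d)-lipschitz_on UNIV (\<lambda>x::'a. (1 / d) *\<^sub>R x)"
    by (rule lipschitz_onI) (use d in \<open>auto simp: dist_norm simp flip: scaleR_diff_right\<close>)
  have "(1 * (1 / d))-lipschitz_on UNIV (\<lambda>x::'a. cut 1 ((1 / d) *\<^sub>R x))"
    by (rule lipschitz_on_compose2[OF l lipschitz_on_subset[OF cut_lip subset_UNIV]])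
  then have "is_lipb (\<lambda>x::'a. cut 1 ((1 / d) *\<^sub>R x))" by (rule is_lipbI[OF _ cut_le])
  from is_lipb_lincomb[OF is_lipb_const[of 1] this, of 1 "-1"]
  have "is_lipb (\<lambda>x::'a. 1 - cut 1 ((1 / d) *\<^sub>R x))" by simp
  then show "is_lipb (ann d m :: 'a \<Rightarrow> complex)"
    unfolding ann_def[abs_def] by (rule is_lipb_mult[OF is_lipbI[OF cut_lip cut_le]])
  have n: "norm ((1 / d) *\<^sub>R x) = norm x / d" using d by simp
  show "ann d m x = 1" if "2 * d \<le> norm x" "norm x \<le> m"
  proof -
    have "1 + 1 \<le> norm ((1 / d) *\<^sub>R x)" unfolding n using that d by (simp add: pos_le_divide_eq)
    then show ?thesis unfolding ann_def using cut_0[of 1 "(1 / d) *\<^sub>R x"] cut_1[OF that(2)] by simp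
  qed
  show "ann d m x = 0" if "norm x \<le> d"
  proof -
    have "norm ((1 / d) *\<^sub>R x) \<le> 1" unfolding n using that d by (simp add: pos_divide_le_eq)
    then show ?thesis unfolding ann_def using cut_1[of "(1 / d) *\<^sub>R x" 1] by simp
  qed
  show "ann d m x = 0" if "m + 1 \<le> norm x" unfolding ann_def using cut_0[OF that] by simp
  have c: "cmod (1 - cut r y) \<le> 1" for r and y :: 'a
  proof -
    have "1 - cut r y = of_real (1 - max 0 (min 1 (r + 1 - norm y)))" by (simp add: cut_def)
    then show ?thesis by (simp only: norm_of_real)
  qed
  show "cmod (ann d m x) \<le> 1" unfolding ann_def norm_mult by (intro mult_le_one cut_le c norm_ge_zero)
qed

text \<open>Being carried by a closed shell, expressed through test functions, so that it passes to
  the boundary without comparing supports.\<close>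

definition vanishing :: "real \<Rightarrow> real \<Rightarrow> nat \<Rightarrow> ('a::real_normed_vector functional) \<Rightarrow> bool" where
  "vanishing a b k T \<longleftrightarrow> (\<forall>f \<pi>s. mdom k f \<pi>s \<and> (\<forall>x. a \<le> norm x \<and> norm x \<le> b \<longrightarrow> f x = 0) \<longrightarrow> T f \<pi>s = 0)"

lemma vanishingD: "vanishing a b k T \<Longrightarrow> mdom k f \<pi>s \<Longrightarrow> (\<And>x. a \<le> norm x \<Longrightarrow> norm x \<le> b \<Longrightarrow> f x = 0) \<Longrightarrow> T f \<pi>s = 0"
  unfolding vanishing_def by blast

lemma vanishing_mono:
  assumes "vanishing a b k T" "a' \<le> a" "b \<le> b'" shows "vanishing a' b' k T"
  unfolding vanishing_def
proof (intro allI impI, elim conjE)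
  fix f :: "'a \<Rightarrow> complex" and \<pi>s assume "mdom k f \<pi>s" "\<forall>x. a' \<le> norm x \<and> norm x \<le> b' \<longrightarrow> f x = 0"
  then show "T f \<pi>s = 0" by (intro vanishingD[OF assms(1)]) (use assms in auto)
qed

lemma vanishing_support:
  assumes T: "mcurrent k T" and s: "\<And>x. x \<in> current_supp k T \<Longrightarrow> \<delta> \<le> norm x \<and> norm x \<le> M" and d: "\<delta> > 0"
  shows "vanishing (\<delta> / 2) (M + 1) k T"
  unfolding vanishing_def
proof (intro allI impI, elim conjE)
  fix f :: "'a \<Rightarrow> complex" and \<pi>s assume f: "mdom k f \<pi>s" "\<forall>x. \<delta> / 2 \<le> norm x \<and> norm x \<le> M + 1 \<longrightarrow> f x = 0"
  have o: "open {x::'a. \<delta> / 2 < norm x \<and> norm x < M + 1}"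
    by (intro open_Collect_conj open_Collect_less continuous_intros)
  have sub: "current_supp k T \<subseteq> {x. \<delta> / 2 < norm x \<and> norm x < M + 1}" using s d by force
  show "T f \<pi>s = 0" by (rule mcurrent_support[OF T o sub f(1)]) (use f(2) in auto)
qed

lemma mdom_mult: "is_lipb g \<Longrightarrow> mdom k f \<pi>s \<Longrightarrow> mdom k (\<lambda>x. g x * f x) \<pi>s"
  unfolding mdom_def using is_lipb_mult by blast

lemma ann_cut:
  assumes T: "mcurrent k T" and v: "vanishing (2 * d) m k T" and d: "d > 0" and f: "mdom k f \<rho>"
  shows "T (\<lambda>x. ann d m x * f x) \<rho> = T f \<rho>"
proof -
  note g = mdom_mult[OF ann(1)[OF d] f]
  have "T (\<lambda>x. 1 * f x + (-1) * (ann d m x * f x)) \<rho> = 0"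
  proof (rule vanishingD[OF v])
    show "mdom k (\<lambda>x. 1 * f x + (-1) * (ann d m x * f x)) \<rho>" using f g is_lipb_lincomb[of f "\<lambda>x. ann d m x * f x" 1 "-1"] unfolding mdom_def by blast
  qed (use ann(2)[OF d] in auto)
  then show ?thesis using mcurrent_lin[OF T f g, of 1 "-1"] by simp
qed

lemma open_shell: "open {x::'a::real_normed_vector. a < norm x \<and> norm x < b}"
  by (intro open_Collect_conj open_Collect_less continuous_intros)

text \<open>The boundary has coefficient 1, which may be replaced by \<open>ann a b\<close>; if
  \<open>f\<close> vanishes on the shell where this is nonzero, locality applies to the slot
  \<open>f\<close>. The ramps of \<open>ann\<close> cost a factor 2 inside and 1 outside.\<close>

lemma vanishing_bdry:
  assumes T: "mcurrent k T" and k: "k \<noteq> 0" and v: "vanishing (2 * a) b k T" and a: "a > 0"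
  shows "vanishing a (b + 1) (k - 1) (mbdry T)"
  unfolding vanishing_def
proof (intro allI impI, elim conjE)
  fix f :: "'a \<Rightarrow> complex" and \<pi>s assume f: "mdom (k - 1) f \<pi>s" "\<forall>x. a \<le> norm x \<and> norm x \<le> b + 1 \<longrightarrow> f x = 0"
  have one: "mdom k (\<lambda>_. 1) (f # \<pi>s)" using f(1) k unfolding mdom_def by (auto simp: is_lipb_const) (simp add: is_lipb_def)
  have "T (\<lambda>x. ann a b x * 1) (f # \<pi>s) = 0"
    by (rule mcurrent_local[OF T open_shell[of a "b+1"] mdom_mult[OF ann(1)[OF a] one], where j = 0 and c = 0])
       (use f(2) k ann(3,4)[OF a] in \<open>auto simp: not_less\<close>)
  then show "mbdry T f \<pi>s = 0" unfolding mbdry_def using ann_cut[OF T v a one] by simp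
qed

lemma shell_cong:
  assumes T: "mcurrent k T" and v: "vanishing (2 * d) m k T" and d: "d > 0" and f: "mdom k f \<rho>" "mdom k f' \<rho>'"
    and eq: "\<And>x. d < norm x \<Longrightarrow> norm x < m + 1 \<Longrightarrow> f x = f' x"
      "\<And>j x. j < k \<Longrightarrow> d < norm x \<Longrightarrow> norm x < m + 1 \<Longrightarrow> (\<rho> ! j) x = (\<rho>' ! j) x"
  shows "T f \<rho> = T f' \<rho>'"
proof -
  have z: "ann d m x = 0" if "x \<notin> {x. d < norm x \<and> norm x < m + 1}" for x :: 'a using that ann(3,4)[OF d] by (auto simp: not_less)
  have e: "(\<lambda>x. ann d m x * f x) = (\<lambda>x. ann d m x * f' x)" using z eq(1) by fastforce
  have f2: "mdom k f' \<rho>" using f unfolding mdom_def by blast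
  have "T f \<rho> = T (\<lambda>x. ann d m x * f' x) \<rho>" using ann_cut[OF T v d f(1)] e by simp
  also have "\<dots> = T (\<lambda>x. ann d m x * f' x) \<rho>'"
    by (rule mcurrent_slot_cong[OF T open_shell[of d "m+1"] mdom_mult[OF ann(1)[OF d] f2] mdom_mult[OF ann(1)[OF d] f(2)]]) (use z eq(2) in auto)
  also have "\<dots> = T f' \<rho>'" by (rule ann_cut[OF T v d f(2)])
  finally show ?thesis .
qed

section \<open>Extension to locally Lipschitz entries by the radial retraction\<close>

definition tilde :: "real \<Rightarrow> ('a::real_normed_vector functional) \<Rightarrow>
    ('a \<Rightarrow> complex) \<Rightarrow> ('a \<Rightarrow> complex) list \<Rightarrow> complex" where
  "tilde N T f \<pi>s = T (\<lambda>x. f (rr N x)) (map (\<lambda>\<pi> x. \<pi> (rr N x)) \<pi>s)"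

lemma rr_comp_lipschitz:
  assumes f: "is_qlip f" and C: "C-lipschitz_on (ball 0 R) f" and R: "R > 0"
  shows "(C * 2)-lipschitz_on UNIV (\<lambda>x. f (rr R x))"
proof (rule lipschitz_on_compose2[OF rr_lipschitz[OF R]])
  have "C-lipschitz_on (closure (ball 0 R)) f"
    by (rule lipschitz_on_closure[OF C continuous_on_subset[OF is_qlip_continuous[OF f]]]) simp
  then show "C-lipschitz_on (rr R ` UNIV) f"
    by (rule lipschitz_on_subset) (use norm_rr[OF less_imp_le[OF R]] R in auto)
qed

lemma rr_ball: "N > 0 \<Longrightarrow> rr N x \<in> ball 0 (N + 1)"
  using norm_rr[of N x] by simp

lemma rr_lipb:
  assumes f: "is_qlip f" and N: "N > 0" shows "is_lipb (\<lambda>x. f (rr N x))"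
proof -
  obtain B where B: "\<And>x. x \<in> ball 0 (N + 1) \<Longrightarrow> cmod (f x) \<le> B" using is_qlip_bounded[OF f] by metis
  show ?thesis by (rule is_lipbI[OF rr_comp_lipschitz[OF f is_qlip_lipc[OF f] N] B[OF rr_ball[OF N]]])
qed

lemma tilde_mdom:
  assumes "is_qlip f" "N > 0" "length \<pi>s = k" "qlips \<pi>s" "R > 0"
  shows "mdom k (\<lambda>x. f (rr N x)) (map (\<lambda>\<pi> x. \<pi> (rr R x)) \<pi>s)"
  using assms rr_lipb unfolding mdom_def by (auto simp: is_lipb_def)

text \<open>Restriction and scaling are done by a density; being dominated by a multiple of
  \<open>\<mu>\<close>, the new measure inherits tightness. The factor \<open>c\<close> will absorb
  the \<open>2 ^ k\<close> of \<open>tilde_bound\<close>.\<close>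

lemma shell_measure:
  fixes \<mu> :: "'a::real_normed_vector measure"
  assumes r: "finite_radon \<mu>" and c: "0 \<le> c"
  shows "\<exists>\<nu>. finite_radon \<nu> \<and> (AE x in \<nu>. a \<le> norm x \<and> norm x \<le> b) \<and>
    (\<forall>f::'a \<Rightarrow> complex. continuous_on UNIV f \<longrightarrow> L1norm \<nu> f = c * (\<integral>x. indicator {x. a \<le> norm x \<and> norm x \<le> b} x * cmod (f x) \<partial>\<mu>))"
proof -
  define S where "S = {x::'a. a \<le> norm x \<and> norm x \<le> b}"
  interpret mu: finite_measure \<mu> by (rule finite_radon_finite_measure[OF r])
  have s: "sets \<mu> = sets borel" using r by (simp add: finite_radon_def)
  have sp: "space \<mu> = UNIV" using sets_eq_imp_space_eq[OF s] by simp
  have "closed S" unfolding S_def by (intro closed_Collect_conj closed_Collect_le continuous_intros)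
  then have S: "S \<in> sets \<mu>" using s by auto
  define w where "w x = c * indicator S x" for x
  have w: "w \<in> borel_measurable \<mu>" unfolding w_def using S by simp
  define \<nu> where "\<nu> = density \<mu> (\<lambda>x. ennreal (w x))"
  have s\<nu>: "sets \<nu> = sets borel" unfolding \<nu>_def using s by simp
  have le: "emeasure \<nu> A \<le> ennreal c * emeasure \<mu> A" if A: "A \<in> sets \<mu>" for A
  proof -
    have "emeasure \<nu> A = (\<integral>\<^sup>+x. ennreal (w x) * indicator A x \<partial>\<mu>)"
      unfolding \<nu>_def by (rule emeasure_density) (use w A in auto)
    also have "\<dots> \<le> (\<integral>\<^sup>+x. ennreal c * indicator A x \<partial>\<mu>)"
      by (rule nn_integral_mono) (auto simp: w_def indicator_def)
    also have "\<dots> = ennreal c * emeasure \<mu> A" using A by (rule nn_integral_cmult_indicator)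
    finally show ?thesis .
  qed
  have f\<nu>: "finite_measure \<nu>"
  proof (rule finite_measureI)
    have "space \<nu> = space \<mu>" unfolding \<nu>_def by simp
    then have "emeasure \<nu> (space \<nu>) \<le> ennreal c * emeasure \<mu> (space \<mu>)" using le[OF sets.top] by simp
    also have "\<dots> < \<infinity>" using mu.emeasure_finite by (simp add: ennreal_mult_eq_top_iff less_top[symmetric])
    finally show "emeasure \<nu> (space \<nu>) \<noteq> \<infinity>" by simp
  qed
  interpret nu: finite_measure \<nu> by (rule f\<nu>)
  have mle: "measure \<nu> A \<le> c * measure \<mu> A" if A: "A \<in> sets \<mu>" for A
    using le[OF A] c unfolding mu.emeasure_eq_measure nu.emeasure_eq_measure by (simp flip: ennreal_mult')
  have "finite_radon \<nu>"
  proof (rule finite_radonI_tight[OF s\<nu> f\<nu>])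
    fix e :: real assume e: "e > 0"
    have "e / (c + 1) > 0" using e c by simp
    from finite_radon_tight[OF r this] obtain K where K: "compact K" "measure \<mu> (- K) < e / (c + 1)" by (elim exE conjE) (rule that)
    have "- K \<in> sets \<mu>" using compact_imp_closed[OF K(1)] s by auto
    from mle[OF this] have "measure \<nu> (- K) \<le> c * measure \<mu> (- K)" .
    also have "\<dots> \<le> c * (e / (c + 1))" using K(2) c by (intro mult_left_mono) auto
    also have "\<dots> < e" using e c by (simp add: divide_simps)
    finally show "\<exists>K. compact K \<and> measure \<nu> (- K) < e" using K(1) by blast
  qed
  moreover have "AE x in \<nu>. a \<le> norm x \<and> norm x \<le> b"
  proof -
    have "(\<lambda>x. ennreal (w x)) \<in> borel_measurable \<mu>" using w by simp
    then show ?thesis unfolding \<nu>_def by (subst AE_density) (auto simp: w_def S_def indicator_def)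
  qed
  moreover have "L1norm \<nu> f = c * (\<integral>x. indicator {x. a \<le> norm x \<and> norm x \<le> b} x * cmod (f x) \<partial>\<mu>)"
    if f: "continuous_on UNIV f" for f :: "'a \<Rightarrow> complex"
  proof -
    have m: "(\<lambda>x. cmod (f x)) \<in> borel_measurable \<mu>"
      by (subst measurable_cong_sets[OF s refl]) (intro borel_measurable_continuous_onI continuous_intros f)
    have "L1norm \<nu> f = (\<integral>x. w x *\<^sub>R cmod (f x) \<partial>\<mu>)"
      unfolding \<nu>_def by (rule integral_density[OF m w]) (use c in \<open>auto simp: w_def\<close>)
    also have "\<dots> = (\<integral>x. c * (indicator S x * cmod (f x)) \<partial>\<mu>)" by (simp add: w_def mult_ac)
    finally show ?thesis by (simp add: S_def)
  qed
  ultimately show ?thesis by blast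
qed

text \<open>Cut off by \<open>ann\<close>, the coefficient lives where
  \<open>norm x < min (m + 1) R\<close>, so the slots may be composed with the retraction to radius
  \<open>R\<close> in place of \<open>m + 1\<close>. Their Lipschitz constants then involve the ball
  of radius \<open>R\<close> only, at the cost of a factor 2 per slot.\<close>

lemma tilde_bound:
  assumes T: "mcurrent k T" and v: "vanishing (2 * d) m k T" and d: "0 < d" "d \<le> m + 1" and mu: "mass_bound k T \<mu>"
    and R: "R > 0" and f: "is_qlip f" and p: "length \<pi>s = k" "qlips \<pi>s"
    and z: "\<And>x. d \<le> norm x \<Longrightarrow> norm x \<le> m + 1 \<Longrightarrow> R \<le> norm x \<Longrightarrow> f x = 0"
  shows "cmod (tilde (m + 1) T f \<pi>s) \<le> lprod R \<pi>s *
     (2 ^ k * (\<integral>x. indicator {x. d \<le> norm x \<and> norm x \<le> m + 1} x * cmod (f x) \<partial>\<mu>))"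
proof -
  have N: "m + 1 > 0" using d by simp
  define g where "g x = ann d m x * f (rr (m + 1) x)" for x
  define \<rho> where "\<rho> = map (\<lambda>\<pi> x. \<pi> (rr R x)) \<pi>s"
  note m0 = tilde_mdom[OF f N p N]
  have mg: "mdom k g (map (\<lambda>\<pi> x. \<pi> (rr (m + 1) x)) \<pi>s)" unfolding g_def by (rule mdom_mult[OF ann(1)[OF d(1)] m0])
  have mg': "mdom k g \<rho>" unfolding g_def \<rho>_def by (rule mdom_mult[OF ann(1)[OF d(1)] tilde_mdom[OF f N p R]])
  have oV: "open {x::'a. d < norm x \<and> norm x < min (m + 1) R}" by (rule open_shell)
  have gz: "g x = 0" if "x \<notin> {x. d < norm x \<and> norm x < min (m + 1) R}" for x
  proof (cases "norm x \<le> d \<or> m + 1 \<le> norm x")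
    case True
    then show ?thesis using ann(3,4)[OF d(1)] unfolding g_def by auto
  next
    case False
    then have "f x = 0" by (intro z) (use that in auto)
    then show ?thesis using False rr_id[of x "m + 1"] unfolding g_def by simp
  qed
  have "tilde (m + 1) T f \<pi>s = T g (map (\<lambda>\<pi> x. \<pi> (rr (m + 1) x)) \<pi>s)"
    unfolding tilde_def g_def by (rule ann_cut[OF T v d(1) m0, symmetric])
  also have "\<dots> = T g \<rho>"
    by (rule mcurrent_slot_cong[OF T oV mg mg' gz]) (use p in \<open>auto simp: \<rho>_def rr_id\<close>)
  finally have "cmod (tilde (m + 1) T f \<pi>s) \<le> prod_list (map (lipc UNIV) \<rho>) * L1norm \<mu> g"
    using mass_boundD(2)[OF mu mg'] by simp
  also have "\<dots> \<le> (lprod R \<pi>s * 2 ^ k) * (\<integral>x. indicator {x. d \<le> norm x \<and> norm x \<le> m + 1} x * cmod (f x) \<partial>\<mu>)"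
  proof (rule mult_mono)
    have "prod_list (map (\<lambda>\<pi>. lipc UNIV (\<lambda>x. \<pi> (rr R x))) \<pi>s) \<le> prod_list (map (\<lambda>\<pi>. lipc (ball 0 R) \<pi> * 2) \<pi>s)"
    proof (rule prod_list_mono[THEN conjunct2])
      fix \<pi> assume "\<pi> \<in> set \<pi>s"
      then have q: "is_qlip \<pi>" using p by blast
      have "is_lip (\<lambda>x. \<pi> (rr R x))" using rr_lipb[OF q R] by (simp add: is_lipb_def)
      then show "0 \<le> lipc UNIV (\<lambda>x. \<pi> (rr R x))" by (rule lipc_UNIV_nonneg)
      show "lipc UNIV (\<lambda>x. \<pi> (rr R x)) \<le> lipc (ball 0 R) \<pi> * 2"
        by (rule lipc_le[OF rr_comp_lipschitz[OF q is_qlip_lipc[OF q] R]])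
    qed
    moreover have "prod_list (map (\<lambda>\<pi>. h \<pi> * 2) xs) = prod_list (map h xs) * 2 ^ length xs" for h :: "('a \<Rightarrow> complex) \<Rightarrow> real" and xs
      by (induction xs) auto
    ultimately show "prod_list (map (lipc UNIV) \<rho>) \<le> lprod R \<pi>s * 2 ^ k" using p by (simp add: \<rho>_def o_def)
    interpret finite_measure \<mu> by (rule finite_radon_finite_measure[OF mass_boundD(1)[OF mu]])
    have s: "sets \<mu> = sets borel" using mass_boundD(1)[OF mu] by (simp add: finite_radon_def)
    obtain B where B: "B > 0" "\<And>x. x \<in> ball 0 (m + 2) \<Longrightarrow> cmod (f x) \<le> B" using is_qlip_bounded[OF f] by metis
    let ?S = "{x::'a. d \<le> norm x \<and> norm x \<le> m + 1}"
    have "closed ?S" by (intro closed_Collect_conj closed_Collect_le continuous_intros)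
    then have S: "?S \<in> sets \<mu>" using s by auto
    have fm: "(\<lambda>x. cmod (f x)) \<in> borel_measurable \<mu>" using qlip_borel_measurable[OF f s] by simp
    have int: "integrable \<mu> (\<lambda>x. indicator ?S x * cmod (f x))"
    proof (rule integrable_const_bound[where B = B])
      show "AE x in \<mu>. norm (indicator ?S x * cmod (f x)) \<le> B" using B by (intro AE_I2) (auto simp: indicator_def less_imp_le)
      show "(\<lambda>x. indicator ?S x * cmod (f x)) \<in> borel_measurable \<mu>" by (rule borel_measurable_times[OF borel_measurable_indicator[OF S] fm])
    qed
    show "L1norm \<mu> g \<le> (\<integral>x. indicator ?S x * cmod (f x) \<partial>\<mu>)"
    proof (rule integral_mono'[OF int])
      fix x
      show "0 \<le> indicator ?S x * cmod (f x)" by simp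
      show "cmod (g x) \<le> indicator ?S x * cmod (f x)"
      proof (cases "d < norm x \<and> norm x < m + 1")
        case True
        have "cmod (ann d m x) * cmod (f x) \<le> 1 * cmod (f x)" by (intro mult_right_mono ann(5)[OF d(1)]) simp
        then show ?thesis using True rr_id[of x "m + 1"] by (simp add: g_def norm_mult indicator_def)
      next
        case False
        then show ?thesis using gz[of x] by auto
      qed
    qed
    show "0 \<le> lprod R \<pi>s * 2 ^ k" using prod_list_lipc_nonneg[OF p(2)] by simp
  qed simp
  finally show ?thesis by (simp add: mult_ac)
qed

lemma tilde_cont:
  assumes T: "mcurrent k T" and N: "N > 0" and F: "qconv F f" and lP: "\<And>n. length (P n) = k" "length \<pi>s = k"
    and P: "\<And>j. j < k \<Longrightarrow> qconv (\<lambda>n. P n ! j) (\<pi>s ! j)"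
  shows "(\<lambda>n. tilde N T (F n) (P n)) \<longlonglongrightarrow> tilde N T f \<pi>s"
proof -
  have q: "is_qlip (P n ! j)" "is_qlip (\<pi>s ! j)" if "j < k" for n j using P[OF that] qconv_qlip qconv_qlip_lim by blast+
  have qP: "qlips (P n)" and qp: "qlips \<pi>s" for n
    using q lP(1)[of n] lP(2) by (metis in_set_conv_nth)+
  obtain B where B: "\<And>n x. x \<in> ball 0 (N + 1) \<Longrightarrow> cmod (F n x) \<le> B" using qconv_bounded[OF F] by metis
  obtain C0 where C0: "\<forall>n. C0-lipschitz_on (ball 0 N) (F n)" using F unfolding qconv_def eqlip_def by blast
  have "\<forall>j\<in>{..<k}. \<exists>C. \<forall>n. C-lipschitz_on (ball 0 N) (P n ! j)" using P unfolding qconv_def eqlip_def by blast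
  from bchoice[OF this] obtain c :: "nat \<Rightarrow> real" where c: "\<forall>j\<in>{..<k}. \<forall>n. (c j)-lipschitz_on (ball 0 N) (P n ! j)" by (rule exE)
  define C where "C = \<bar>B\<bar> + \<bar>C0\<bar> * 2 + (\<Sum>j<k. \<bar>c j\<bar>) * 2"
  have S0: "0 \<le> (\<Sum>j<k. \<bar>c j\<bar>)" by (intro sum_nonneg) auto
  have b1: "cmod (F n (rr N x)) \<le> C" for n x
    using B[where n = n and x = "rr N x", OF rr_ball[OF N]] S0 unfolding C_def by linarith
  have b2: "lipc UNIV (\<lambda>x. F n (rr N x)) \<le> C" for n
    using lipc_le[OF rr_comp_lipschitz[OF qconv_qlip[OF F] C0[rule_format] N], of n] S0 unfolding C_def by linarith
  have b3: "lipc UNIV (map (\<lambda>\<pi> x. \<pi> (rr N x)) (P n) ! j) \<le> C" if j: "j < k" for n j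
  proof -
    have "\<bar>c j\<bar> \<le> (\<Sum>j<k. \<bar>c j\<bar>)" using j by (intro member_le_sum) auto
    moreover have "(c j)-lipschitz_on (ball 0 N) (P n ! j)" using c j by blast
    from lipc_le[OF rr_comp_lipschitz[OF q(1)[OF j] this N]]
    have "lipc UNIV (\<lambda>x. (P n ! j) (rr N x)) \<le> c j * 2" .
    ultimately show ?thesis using j lP(1)[of n] unfolding C_def by simp
  qed
  have cl: "\<forall>F P f \<pi>s. (\<forall>n. mdom k (F n) (P n)) \<and> mdom k f \<pi>s \<and>
        (\<forall>x. (\<lambda>n. F n x) \<longlonglongrightarrow> f x) \<and> (\<forall>j<k. \<forall>x. (\<lambda>n. (P n ! j) x) \<longlonglongrightarrow> (\<pi>s ! j) x) \<and>
        (\<exists>C. \<forall>n. (\<forall>x. cmod (F n x) \<le> C) \<and> lipc UNIV (F n) \<le> C \<and> (\<forall>j<k. lipc UNIV (P n ! j) \<le> C))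
      \<longrightarrow> (\<lambda>n. T (F n) (P n)) \<longlonglongrightarrow> T f \<pi>s" using T unfolding mcurrent_def by (elim conjE)
  show ?thesis
    unfolding tilde_def
  proof (rule cl[THEN spec, THEN spec, THEN spec, THEN spec, THEN mp], intro conjI allI impI)
    show "mdom k (\<lambda>x. F n (rr N x)) (map (\<lambda>\<pi> x. \<pi> (rr N x)) (P n))" for n by (rule tilde_mdom[OF qconv_qlip[OF F] N lP(1) qP N])
    show "mdom k (\<lambda>x. f (rr N x)) (map (\<lambda>\<pi> x. \<pi> (rr N x)) \<pi>s)" by (rule tilde_mdom[OF qconv_qlip_lim[OF F] N lP(2) qp N])
    show "(\<lambda>n. F n (rr N x)) \<longlonglongrightarrow> f (rr N x)" for x by (rule qconv_tendsto[OF F])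
    show "(\<lambda>n. (map (\<lambda>\<pi> x. \<pi> (rr N x)) (P n) ! j) x) \<longlonglongrightarrow> (map (\<lambda>\<pi> x. \<pi> (rr N x)) \<pi>s ! j) x" if "j < k" for j x
      using qconv_tendsto[OF P[OF that], of "rr N x"] that lP by simp
    show "\<exists>C. \<forall>n. (\<forall>x. cmod (F n (rr N x)) \<le> C) \<and> lipc UNIV (\<lambda>x. F n (rr N x)) \<le> C \<and> (\<forall>j<k. lipc UNIV (map (\<lambda>\<pi> x. \<pi> (rr N x)) (P n) ! j) \<le> C)"
      using b1 b2 b3 by blast
  qed
qed

lemma tilde_shell:
  fixes T :: "'a::complex_normed_vector functional"
  assumes T: "mcurrent k T" and v: "vanishing (2 * d) m k T" and d: "0 < d" "d \<le> m + 1"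
  shows "\<exists>\<nu>. shell_current k (tilde (m + 1) T) d (m + 1) \<nu>"
proof -
  have N: "m + 1 > 0" using d by simp
  obtain \<mu> where mu: "mass_bound k T \<mu>" using mcurrent_mass[OF T] by (rule exE)
  have "\<exists>\<nu>. finite_radon \<nu> \<and> (AE x in \<nu>. d \<le> norm x \<and> norm x \<le> m + 1) \<and>
    (\<forall>f::'a \<Rightarrow> complex. continuous_on UNIV f \<longrightarrow> L1norm \<nu> f = 2 ^ k * (\<integral>x. indicator {x. d \<le> norm x \<and> norm x \<le> m + 1} x * cmod (f x) \<partial>\<mu>))"
    by (rule shell_measure[OF mass_boundD(1)[OF mu]]) simp
  then obtain \<nu> where nu: "finite_radon \<nu>" "AE x in \<nu>. d \<le> norm x \<and> norm x \<le> m + 1"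
    "\<forall>f::'a \<Rightarrow> complex. continuous_on UNIV f \<longrightarrow> L1norm \<nu> f = 2 ^ k * (\<integral>x. indicator {x. d \<le> norm x \<and> norm x \<le> m + 1} x * cmod (f x) \<partial>\<mu>)"
    by (elim exE conjE) (rule that)
  have "shell_current k (tilde (m + 1) T) d (m + 1) \<nu>"
  proof (rule shell_current.intro[OF d nu(1,2)], goal_cases)
    case (1 f g \<pi>s a b)
    show ?case unfolding tilde_def by (rule mcurrent_lin[OF T tilde_mdom[OF 1(1) N 1(3,4) N] tilde_mdom[OF 1(2) N 1(3,4) N]])
  next
    case (2 f u v us vs a b)
    have md: "mdom k (\<lambda>x. f (rr (m + 1) x)) (map (\<lambda>\<pi> x. \<pi> (rr (m + 1) x)) (us @ w # vs))" if "is_qlip w" for w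
      by (rule tilde_mdom[OF 2(1) N _ _ N]) (use 2 that in auto)
    let ?r = "map (\<lambda>\<pi> x. \<pi> (rr (m + 1) x)) us" and ?s = "map (\<lambda>\<pi> x. \<pi> (rr (m + 1) x)) vs"
    have up: "(?r @ w # ?s)[length us := w'] = ?r @ w' # ?s" for w w' using list_update_length[of ?r w ?s w'] by simp
    from mcurrent_slot[OF T, of "length us" "\<lambda>x. f (rr (m + 1) x)" "?r @ u # ?s" "\<lambda>x. u (rr (m + 1) x)" "\<lambda>x. v (rr (m + 1) x)" a b]
    show ?case using md[OF 2(2)] md[OF 2(3)] 2(4) unfolding tilde_def up by simp
  next
    case (3 V f u us vs c)
    have cr: "continuous_on UNIV (rr (m + 1) :: 'a \<Rightarrow> 'a)" by (rule lipschitz_on_continuous_on[OF rr_lipschitz[OF N]])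
    have oV: "open (rr (m + 1) -` V)" by (rule open_vimage[OF 3(1) cr])
    show ?case unfolding tilde_def
    proof (rule mcurrent_local[OF T oV tilde_mdom[OF 3(2) N _ _ N], where j = "length us" and c = c])
      show "(map (\<lambda>\<pi> x. \<pi> (rr (m + 1) x)) (us @ u # vs) ! length us) x = c" if "x \<in> rr (m + 1) -` V" for x
        using 3(8)[of "rr (m + 1) x"] that by (simp add: nth_append)
    qed (use 3 in auto)
  next
    case (4 R f \<pi>s)
    have "L1norm \<nu> f = 2 ^ k * (\<integral>x. indicator {x. d \<le> norm x \<and> norm x \<le> m + 1} x * cmod (f x) \<partial>\<mu>)"
      using nu(3) is_qlip_continuous[OF 4(2)] by blast
    then show ?case using tilde_bound[OF T v d mu 4(1-4)] 4(5) by simp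
  next
    case (5 F f P \<pi>s)
    show ?case by (rule tilde_cont[OF T N 5(1-4)])
  qed
  then show ?thesis by blast
qed

section \<open>Bidimension of the extension\<close>

definition mvan :: "('a::complex_normed_vector set \<Rightarrow> ('a \<Rightarrow> complex) \<Rightarrow> bool) \<Rightarrow> nat \<Rightarrow> nat \<Rightarrow>
    ('a functional) \<Rightarrow> bool" where
  "mvan P n k T \<longleftrightarrow> (\<forall>f \<pi>s V. mdom k f \<pi>s \<and> open V \<and> fsupp f \<subseteq> V \<and> n \<le> length (filter (P V) \<pi>s) \<longrightarrow> T f \<pi>s = 0)"

lemma length_filter_obtain:
  assumes "n \<le> length (filter Q \<pi>s)"
  shows "\<exists>J\<subseteq>{..<length \<pi>s}. card J = n \<and> (\<forall>j\<in>J. Q (\<pi>s ! j))"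
proof -
  obtain J where "J \<subseteq> {i. i < length \<pi>s \<and> Q (\<pi>s ! i)}" "card J = n"
    using obtain_subset_with_card_n[OF assms[unfolded length_filter_conv_card]] by blast
  then show ?thesis by (intro exI[of _ J]) auto
qed

lemma mbidim_mvan:
  assumes b: "mbidim k (int p - 1) (int q - 1) T"
  shows "mvan holo_on p k T" "mvan aholo q k T"
proof -
  have "T f \<pi>s = 0" if f: "mdom k f \<pi>s" "open V" "fsupp f \<subseteq> V" "p \<le> length (filter (holo_on V) \<pi>s)" for f \<pi>s V
  proof -
    have l: "length \<pi>s = k" using f(1) unfolding mdom_def by blast
    obtain J where "J \<subseteq> {..<k}" "int (card J) = int p - 1 + 1" "\<forall>j\<in>J. holo_on V (\<pi>s ! j)"
      using length_filter_obtain[OF f(4)] l by auto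
    then show ?thesis using b f(1-3) unfolding bidim_on_def by blast
  qed
  then show "mvan holo_on p k T" unfolding mvan_def by blast
  have "T f \<pi>s = 0" if f: "mdom k f \<pi>s" "open V" "fsupp f \<subseteq> V" "q \<le> length (filter (aholo V) \<pi>s)" for f \<pi>s V
  proof -
    have l: "length \<pi>s = k" using f(1) unfolding mdom_def by blast
    obtain J where "J \<subseteq> {..<k}" "int (card J) = int q - 1 + 1" "\<forall>j\<in>J. holo_on V (\<lambda>x. cnj ((\<pi>s ! j) x))"
      using length_filter_obtain[OF f(4)] l unfolding aholo_def by auto
    then show ?thesis using b f(1-3) unfolding bidim_on_def by blast
  qed
  then show "mvan aholo q k T" unfolding mvan_def by blast
qed

lemma holo_on_cong:
  assumes h: "holo_on V g" and V': "open V'" "V' \<subseteq> V" and eq: "\<And>x. x \<in> V' \<Longrightarrow> g x = g' x"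
  shows "holo_on V' g'"
  unfolding holo_on_def
proof
  fix x assume x: "x \<in> V'"
  then obtain L where L: "bounded_linear L" "\<forall>c v. L (scaleC c v) = c * L v" "(g has_derivative L) (at x)"
    using h V'(2) unfolding holo_on_def by blast
  have "(g' has_derivative L) (at x)" by (rule has_derivative_transform_within_open[OF L(3) V'(1) x eq])
  then show "\<exists>L. bounded_linear L \<and> (\<forall>c v. L (scaleC c v) = c * L v) \<and> (g' has_derivative L) (at x)" using L by blast
qed

text \<open>The retraction can destroy holomorphy outside its ball. Cutting off by
  \<open>ann\<close> and thresholding through \<open>mcurrent_soft\<close> places the support in the
  intersection of \<open>V\<close> with the open shell, where the retraction is the identity and
  \<open>cong\<close> transfers \<open>P\<close>.\<close>

lemma tilde_van:
  assumes T: "mcurrent k T" and v: "vanishing (2 * d) m k T" and d: "0 < d" "d \<le> m + 1" and mv: "mvan P n k T"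
    and cong: "\<And>V V' g g'. \<lbrakk>P V g; open V'; V' \<subseteq> V; \<And>x. x \<in> V' \<Longrightarrow> g x = g' x\<rbrakk> \<Longrightarrow> P V' g'"
  shows "van_prop P n k (tilde (m + 1) T)"
  unfolding van_prop_def
proof (intro allI impI, elim conjE)
  fix V :: "'a set" and g and \<rho> :: "('a \<Rightarrow> complex) list"
  assume V: "open V" and g: "is_qlip g" "\<forall>x. x \<notin> V \<longrightarrow> g x = 0" and r: "qlips \<rho>" "length \<rho> = k" "n \<le> length (filter (P V) \<rho>)"
  have N: "m + 1 > 0" using d by simp
  note m0 = tilde_mdom[OF g(1) N r(2,1) N]
  let ?\<rho> = "map (\<lambda>\<pi> x. \<pi> (rr (m + 1) x)) \<rho>"
  let ?V = "V \<inter> {x. d < norm x \<and> norm x < m + 1}"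
  have oV: "open ?V" using V open_shell by (rule open_Int)
  have "T (\<lambda>x. ann d m x * g (rr (m + 1) x)) ?\<rho> = 0"
  proof (rule mcurrent_soft[OF T mdom_mult[OF ann(1)[OF d(1)] m0]])
    fix g' assume g': "mdom k g' ?\<rho>" "fsupp g' \<subseteq> {x. ann d m x * g (rr (m + 1) x) \<noteq> 0}"
    have "x \<in> ?V" if "ann d m x * g (rr (m + 1) x) \<noteq> 0" for x
    proof -
      have a: "d < norm x" "norm x < m + 1" using that ann(3,4)[OF d(1), where x = x and m = m] by (auto simp: not_le[symmetric])
      then have "g x \<noteq> 0" using that rr_id[of x "m + 1"] by auto
      then show ?thesis using a g(2) by auto
    qed
    then have s: "fsupp g' \<subseteq> ?V" using g'(2) by blast
    have "length (filter (P V) \<rho>) \<le> length (filter (P ?V) ?\<rho>)"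
      by (rule filter_map_length, rule cong[OF _ oV]) (auto simp: rr_id)
    then have "n \<le> length (filter (P ?V) ?\<rho>)" using r(3) by linarith
    then show "T g' ?\<rho> = 0" using mv g'(1) oV s unfolding mvan_def by blast
  qed
  then show "tilde (m + 1) T g \<rho> = 0" unfolding tilde_def using ann_cut[OF T v d(1) m0] by simp
qed

lemma tilde_van_holo:
  assumes "mcurrent k T" "vanishing (2 * d) m k T" "0 < d" "d \<le> m + 1" "mbidim k (int p - 1) (int q - 1) T"
  shows "van_prop holo_on p k (tilde (m + 1) T)" "van_prop aholo q k (tilde (m + 1) T)"
proof -
  show "van_prop holo_on p k (tilde (m + 1) T)"
    by (rule tilde_van[OF assms(1-4) mbidim_mvan(1)[OF assms(5)]]) (rule holo_on_cong)
  have c: "aholo V' g'" if "aholo V g" "open V'" "V' \<subseteq> V" "\<And>x. x \<in> V' \<Longrightarrow> g x = g' x" for V V' :: "'a set" and g g'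
    unfolding aholo_def by (rule holo_on_cong[OF that(1)[unfolded aholo_def] that(2,3)]) (simp add: that(4))
  show "van_prop aholo q k (tilde (m + 1) T)"
    by (rule tilde_van[OF assms(1-4) mbidim_mvan(2)[OF assms(5)]]) (rule c)
qed

lemma tilde_agree:
  assumes T: "mcurrent k T" and v: "vanishing (2 * d) m k T" and d: "0 < d" "d \<le> m + 1"
    and f: "is_qtest f" and p: "length \<pi>s = k" "\<forall>\<pi>\<in>set \<pi>s. is_lip \<pi>"
  shows "tilde (m + 1) T f \<pi>s = T f \<pi>s"
proof -
  have N: "m + 1 > 0" using d by simp
  obtain R where R: "R > 0" "\<forall>x. R \<le> norm x \<longrightarrow> f x = 0" using qtest_bounded_support(2)[OF f] by (elim exE conjE) (rule that)
  have "\<exists>B\<ge>0. (\<forall>x. cmod (f x) \<le> B) \<and> lipc (ball 0 R) f \<le> B \<and> (\<forall>\<pi>\<in>set []. is_qlip \<pi> \<and> lipc (ball 0 R) \<pi> \<le> B)"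
    by (rule common_bound[OF qtest_bounded_support(1)[OF f] R(2)]) simp
  then have "is_lipb f" using f unfolding is_lipb_def is_qtest_def bounded_iff by auto
  then have md: "mdom k f \<pi>s" using p unfolding mdom_def by blast
  have q: "qlips \<pi>s" using p is_lip_qlip by blast
  show ?thesis unfolding tilde_def
    by (rule shell_cong[OF T v d(1) tilde_mdom[OF qtest_bounded_support(1)[OF f] N p(1) q N] md]) (use p in \<open>auto simp: rr_id\<close>)
qed

lemma (in shell_current) shell_qcurrent: "qcurrent k T"
  unfolding qcurrent_def
proof (intro conjI)
  show "multilinear_on (qdom k) k T"
    unfolding multilinear_on_def
  proof (intro conjI allI impI; elim conjE)
    fix f g :: "'a \<Rightarrow> complex" and \<pi>s a b
    assume f: "qdom k f \<pi>s" and g: "qdom k g \<pi>s"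
    show "T (\<lambda>x. a * f x + b * g x) \<pi>s = a * T f \<pi>s + b * T g \<pi>s"
      by (rule lin_coeff[OF qdomD(2)[OF f] qdomD(2)[OF g] qdomD(4,5)[OF f]])
  next
    fix f u v :: "'a \<Rightarrow> complex" and \<pi>s j a b
    assume j: "j < k" and u: "qdom k f (\<pi>s[j := u])" and v: "qdom k f (\<pi>s[j := v])"
    have l: "length \<pi>s = k" using qdomD(4)[OF u] by simp
    have e: "\<pi>s[j := w] = take j \<pi>s @ w # drop (Suc j) \<pi>s" for w by (rule upd_conv_take_nth_drop) (use j l in simp)
    have q: "qlips (take j \<pi>s)" "is_qlip u" "is_qlip v" "qlips (drop (Suc j) \<pi>s)"
      using qdomD(5)[OF u] qdomD(5)[OF v] unfolding e by auto
    show "T f (\<pi>s[j := \<lambda>x. a * u x + b * v x]) = a * T f (\<pi>s[j := u]) + b * T f (\<pi>s[j := v])"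
      unfolding e by (rule lin_slot[OF qdomD(2)[OF u] q(2,3) _ q(1,4)]) (use j l in auto)
  qed
  show "local_on (qdom k) k T"
    unfolding local_on_def
  proof (intro allI impI, elim conjE exE)
    fix f :: "'a \<Rightarrow> complex" and \<pi>s j V c
    assume f: "qdom k f \<pi>s" and j: "j < k" "open V" "fsupp f \<subseteq> V" "\<forall>x\<in>V. (\<pi>s ! j) x = c"
    have l: "length \<pi>s = k" by (rule qdomD(4)[OF f])
    have e: "\<pi>s = take j \<pi>s @ (\<pi>s ! j) # drop (Suc j) \<pi>s" by (rule id_take_nth_drop) (use j l in simp)
    have q: "qlips (take j \<pi>s)" "qlips (drop (Suc j) \<pi>s)"
      using qdomD(5)[OF f] set_take_subset[of j \<pi>s] set_drop_subset[of "Suc j" \<pi>s] by auto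
    show "T f \<pi>s = 0"
      by (subst e, rule local[OF j(2) qdomD(2)[OF f] fsupp_subset_off[OF j(3)] _ _ q, where c = c])
         (use j l qdomD(5)[OF f] in auto)
  qed
  show "\<forall>R>0. \<exists>\<mu>. finite_radon \<mu> \<and> (\<forall>f \<pi>s. qdom k f \<pi>s \<and> fsupp f \<subseteq> ball 0 R \<longrightarrow>
          cmod (T f \<pi>s) \<le> lprod R \<pi>s * (\<integral>x. indicator (ball 0 R) x * cmod (f x) \<partial>\<mu>))"
  proof (intro allI impI exI[of _ \<nu>] conjI radon, elim conjE)
    fix R :: real and f :: "'a \<Rightarrow> complex" and \<pi>s assume R: "R > 0" and f: "qdom k f \<pi>s" and s: "fsupp f \<subseteq> ball 0 R"
    have z: "f x = 0" if "R \<le> norm x" for x by (rule fsupp_subset_off[OF s]) (use that in simp)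
    have e: "indicator (ball 0 R) x * cmod (f x) = cmod (f x)" for x
      using z[of x] by (cases "norm x < R") (auto simp: indicator_def)
    show "cmod (T f \<pi>s) \<le> lprod R \<pi>s * (\<integral>x. indicator (ball 0 R) x * cmod (f x) \<partial>\<nu>)"
      unfolding e by (rule bound[OF R qdomD(2)[OF f] qdomD(4,5)[OF f] z])
  qed
  show "\<forall>F P f \<pi>s. (\<forall>n. qdom k (F n) (P n)) \<and> qdom k f \<pi>s \<and>
        (\<forall>x. (\<lambda>n. F n x) \<longlonglongrightarrow> f x) \<and> (\<forall>j<k. \<forall>x. (\<lambda>n. (P n ! j) x) \<longlonglongrightarrow> (\<pi>s ! j) x) \<and>
        (\<exists>R C. \<forall>n. fsupp (F n) \<subseteq> ball 0 R \<and> lipc UNIV (F n) \<le> C) \<and>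
        (\<forall>R. \<exists>C. \<forall>n. \<forall>j<k. lipc (ball 0 R) (P n ! j) \<le> C)
      \<longrightarrow> (\<lambda>n. T (F n) (P n)) \<longlonglongrightarrow> T f \<pi>s"
  proof (intro allI impI, elim conjE exE)
    fix F :: "nat \<Rightarrow> 'a \<Rightarrow> complex" and P f \<pi>s R0 C0
    assume F: "\<forall>n. qdom k (F n) (P n)" and f: "qdom k f \<pi>s"
      and cF: "\<forall>x. (\<lambda>n. F n x) \<longlonglongrightarrow> f x" and cP: "\<forall>j<k. \<forall>x. (\<lambda>n. (P n ! j) x) \<longlonglongrightarrow> (\<pi>s ! j) x"
      and bF: "\<forall>n. fsupp (F n) \<subseteq> ball 0 R0 \<and> lipc UNIV (F n) \<le> C0"
      and bP: "\<forall>R. \<exists>C. \<forall>n. \<forall>j<k. lipc (ball 0 R) (P n ! j) \<le> C"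
    have lP: "length (P n) = k" for n using F qdomD(4) by blast
    note cv = qdom_convergence[OF F[rule_format] cF[rule_format] cP[rule_format] bF[rule_format, THEN conjunct2] bP[rule_format]]
    show "(\<lambda>n. T (F n) (P n)) \<longlonglongrightarrow> T f \<pi>s" by (rule cont[OF cv(2) lP qdomD(4)[OF f] cv(3)])
  qed
qed

lemma van_prop_qbidim:
  assumes "van_prop holo_on n k T" "van_prop aholo m k T"
  shows "qbidim k (int n - 1) (int m - 1) T"
  by (rule qbidimI; rule van_propD[OF assms(1)] van_propD[OF assms(2)]) (auto dest: qdomD)

lemma qcurrent_uminus:
  assumes T: "qcurrent k T" shows "qcurrent k (\<lambda>f \<pi>s. - T f \<pi>s)"
proof -
  have "multilinear_on (qdom k) k (\<lambda>f \<pi>s. - T f \<pi>s)"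
    using T unfolding qcurrent_def multilinear_on_def by (auto simp del: list_update_beyond)
  moreover have "local_on (qdom k) k (\<lambda>f \<pi>s. - T f \<pi>s)"
    using T unfolding qcurrent_def local_on_def by (elim conjE) (simp only: neg_equal_0_iff_equal)
  moreover have "((\<lambda>n. - X n) \<longlonglongrightarrow> - y) = (X \<longlonglongrightarrow> y)" for X :: "nat \<Rightarrow> complex" and y
    using tendsto_minus[of X y] tendsto_minus_cancel[of X y] by blast
  ultimately show ?thesis using T unfolding qcurrent_def by (simp only: norm_minus_cancel simp_thms) (elim conjE, intro conjI)
qed

lemma qcurrent_zero: "qcurrent k (\<lambda>f \<pi>s. 0)"
proof -
  have "finite_radon (null_measure borel :: 'a measure)"
    by (rule finite_radonI_tight) (auto intro!: finite_measureI exI[of _ "{}"] simp: measure_def)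
  moreover have "qdom k f \<pi>s \<Longrightarrow> 0 \<le> lprod R \<pi>s * (\<integral>x. indicator (ball 0 R) x * cmod (f x) \<partial>(null_measure borel))" for f :: "'a \<Rightarrow> complex" and \<pi>s R
    using prod_list_lipc_nonneg[OF qdomD(5)] by (simp add: integral_nonneg_AE)
  ultimately show ?thesis unfolding qcurrent_def multilinear_on_def local_on_def by auto
qed

theorem theorem7p7:
  fixes T :: "('a::complex_banach \<Rightarrow> complex) \<Rightarrow> ('a \<Rightarrow> complex) list \<Rightarrow> complex"
    and p q k :: nat
  assumes "k = p + q"
    and "normal_current k T"
    and "mbidim k (int p) (int q) T"
    and "dbar_zero k p q T"
    and "bounded (current_supp k T)"
    and "\<exists>\<delta>>0. \<forall>x\<in>current_supp k T. \<delta> \<le> norm x"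
  shows "\<exists>U. qcurrent (k + 1) U \<and> qbidim (k + 1) (int p) (int q + 1) U \<and> qdbar_is k p q U T"
proof -
  have T: "mcurrent k T" using assms(2) unfolding normal_current_def by blast
  obtain \<delta> where \<delta>: "\<delta> > 0" "\<forall>x\<in>current_supp k T. \<delta> \<le> norm x" using assms(6) by blast
  obtain M where M: "M > 0" "\<forall>x\<in>current_supp k T. norm x \<le> M" using assms(5) unfolding bounded_pos by blast
  \<comment> \<open>The support gives vanishing for the radii \<open>\<delta> / 2\<close> and
    \<open>M + 1\<close>. Passing to the boundary halves the inner radius and adds 1 outside, and
    the extension needs a further factor 2: hence \<open>4 * d \<le> \<delta> / 2\<close> and
    \<open>m = M + 2\<close>. The minimum with 1 ensures \<open>d \<le> m + 1\<close>.\<close>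
  define d m where "d = min (\<delta> / 8) 1" and "m = M + 2"
  have d: "0 < d" "d \<le> m + 1" unfolding d_def m_def using \<delta>(1) M(1) by auto
  have v0: "vanishing (\<delta> / 2) (M + 1) k T" by (rule vanishing_support[OF T _ \<delta>(1)]) (use \<delta> M in blast)
  have v1: "vanishing (2 * (2 * d)) (M + 1) k T" by (rule vanishing_mono[OF v0]) (auto simp: d_def)
  have v: "vanishing (2 * d) m k T" by (rule vanishing_mono[OF v0]) (use \<delta>(1) in \<open>auto simp: d_def m_def\<close>)
  define S where "S = tilde (m + 1) T"
  define D where "D = (\<lambda>f \<pi>s. S (\<lambda>_. 1) (f # \<pi>s))"
  have DT: "D = tilde (m + 1) (mbdry T)" by (intro ext) (simp add: D_def S_def tilde_def mbdry_def)
  have bT: "mbidim k (int (Suc p) - 1) (int (Suc q) - 1) T" using assms(3) by simp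
  note vanT = tilde_van_holo[OF T v d bT, folded S_def]
  obtain \<nu> where "shell_current k S d (m + 1) \<nu>" using tilde_shell[OF T v d] unfolding S_def by (rule exE)
  then interpret S: shell_current k S d "m + 1" \<nu> .
  have bd: "\<exists>\<nu>'. k = 0 \<or> shell_current (k - 1) D d (m + 1) \<nu>'"
    and vanD: "k \<noteq> 0 \<Longrightarrow> van_prop holo_on p (k - 1) D \<and> van_prop aholo (Suc q) (k - 1) D"
  proof -
    have *: "(\<exists>\<nu>'. shell_current (k - 1) D d (m + 1) \<nu>') \<and> van_prop holo_on p (k - 1) D \<and> van_prop aholo (Suc q) (k - 1) D" if k: "k \<noteq> 0"
    proof -
      have T': "mcurrent (k - 1) (mbdry T)" using assms(2) k unfolding normal_current_def by blast
      have "0 < 2 * d" using d by simp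
      from vanishing_bdry[OF T k v1 this] have v': "vanishing (2 * d) m (k - 1) (mbdry T)" by (simp add: m_def add.commute)
      \<comment> \<open>The part of bidimension \<open>(p,q-1)\<close> being 0, the boundary equals
        its part \<open>B\<close> of bidimension \<open>(p-1,q)\<close>; this is where
        \<open>dbar_zero\<close> enters.\<close>
      obtain B where B: "mbidim (k - 1) (int p - 1) (int q) B" "\<forall>f \<pi>s. mdom (k - 1) f \<pi>s \<longrightarrow> mbdry T f \<pi>s = 0 + B f \<pi>s"
        using assms(4) k unfolding dbar_zero_def dbar_is_def by blast
      have "mbidim (k - 1) (int p - 1) (int (Suc q) - 1) (mbdry T)"
        using B unfolding bidim_on_def by simp
      from tilde_van_holo[OF T' v' d this, folded DT] tilde_shell[OF T' v' d, folded DT] show ?thesis by blast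
    qed
    show "\<exists>\<nu>'. k = 0 \<or> shell_current (k - 1) D d (m + 1) \<nu>'"
    proof (cases "k = 0")
      case False
      from *[OF False, THEN conjunct1] show ?thesis by (elim exE) (intro exI disjI2)
    qed simp
    show "k \<noteq> 0 \<Longrightarrow> van_prop holo_on p (k - 1) D \<and> van_prop aholo (Suc q) (k - 1) D" by (rule *[THEN conjunct2])
  qed
  obtain \<nu>' where bd': "k = 0 \<or> shell_current (k - 1) D d (m + 1) \<nu>'" using bd by (rule exE)
  interpret S: normal_shell k S d "m + 1" \<nu> \<nu>' by unfold_locales (use bd' in \<open>simp add: D_def\<close>)
  \<comment> \<open>The cone formula leaves the negative cone of the boundary as the part of
    bidimension \<open>(p-1,q+1)\<close>. For \<open>k = 0\<close> there is no boundary to take the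
    cone of, and this part is 0.\<close>
  define B where "B = (if k = 0 then (\<lambda>f \<pi>s. 0) else (\<lambda>f \<pi>s. - Uc D f \<pi>s))"
  have B: "qcurrent k B \<and> qbidim k (int p - 1) (int q + 1) B"
  proof (cases "k = 0")
    case True
    then show ?thesis using qcurrent_zero unfolding B_def bidim_on_def by simp
  next
    case False
    interpret D: normal_shell "k - 1" D d "m + 1" \<nu>' \<nu>' using S.D_normal[OF False] unfolding D_def .
    have "qbidim (Suc (k - 1)) (int p - 1) (int (Suc (Suc q)) - 1) (Uc D)" using D.Uc_bidim vanD[OF False] by blast
    then have "qbidim k (int p - 1) (int q + 1) (Uc D)" using False by (simp add: add.commute)
    then have "qbidim k (int p - 1) (int q + 1) (\<lambda>f \<pi>s. - Uc D f \<pi>s)" unfolding bidim_on_def by (simp only: neg_equal_0_iff_equal)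
    moreover have "qcurrent k (\<lambda>f \<pi>s. - Uc D f \<pi>s)" using qcurrent_uminus[OF D.Uc_qcurrent] False by simp
    ultimately show ?thesis unfolding B_def using False by simp
  qed
  have bdry: "Uc S \<sigma> (f # \<pi>s) = S f \<pi>s + B f \<pi>s"
    if "qdom k f \<pi>s" "is_qtest \<sigma>" "open V" "fsupp f \<subseteq> V" "\<forall>x\<in>V. \<sigma> x = 1" for \<sigma> f \<pi>s V
  proof -
    have "Uc S \<sigma> (f # \<pi>s) = S f \<pi>s - Uc D f \<pi>s"
      unfolding D_def by (rule S.Uc_boundary[OF that(1-4)]) (use that(5) in blast)
    moreover have "Uc D f \<pi>s = 0" if "k = 0"
      using qdomD(4)[OF \<open>qdom k f \<pi>s\<close>] that by (simp add: Uc_def Us_def Om_def)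
    ultimately show ?thesis unfolding B_def by simp
  qed
  have U: "qcurrent (k + 1) (Uc S)" using S.Uc_qcurrent by simp
  have Ub: "qbidim (k + 1) (int p) (int q + 1) (Uc S)" using S.Uc_bidim[OF vanT] by (simp add: add.commute)
  have "qdbar_is k p q (Uc S) T"
    unfolding qdbar_is_def
  proof (rule exI[of _ S], rule exI[of _ B], intro conjI allI impI)
    show "qcurrent k S" by (rule S.shell_qcurrent)
    show "qcurrent k B" "qbidim k (int p - 1) (int q + 1) B" using B by auto
    show "qbidim k (int p) (int q) S" using van_prop_qbidim[OF vanT] by simp
    show "Uc S \<sigma> (f # \<pi>s) = S f \<pi>s + B f \<pi>s" if "qdom k f \<pi>s \<and> is_qtest \<sigma> \<and> (\<exists>V. open V \<and> fsupp f \<subseteq> V \<and> (\<forall>x\<in>V. \<sigma> x = 1))" for \<sigma> f \<pi>s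
      using that bdry by blast
    show "S f \<pi>s = T f \<pi>s" if "is_qtest f \<and> length \<pi>s = k \<and> (\<forall>\<pi>\<in>set \<pi>s. is_lip \<pi>)" for f \<pi>s
      unfolding S_def by (rule tilde_agree[OF T v d]) (use that in auto)
  qed
  then show ?thesis using U Ub by blast
qed

end
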